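(* Let $\mathbb F$ be a field that is complete with respect to a nontrivial absolute value $|\cdot|$, let $A\in\mathbb F^{n\times n}$, and let $\mathcal D$ be an $n\times n$ matrix consisting of $0$'s and $*$'s such that $$\mathbb F^{n\times n}=T(A)\oplus\mathcal D(\mathbb F).\qquad (1)$$ Let matrices $F_{ij}\in\mathbb F^{n\times n}$ $(i,j=1,\dots,n)$ be fixed such that $E_{ij}+F_{ij}A-AF_{ij}\in\mathcal D(\mathbb F)$ for all $i,j$, and $F_{ij}=0_n$ whenever $E_{ij}\in\mathcal D(\mathbb F)$. Put $$a:=\|A\|,\qquad f:=\max\Bigl\{\sum_{i,j}\|F_{ij}\|,\ \tfrac13\Bigr\},\qquad U:=\Bigl\{X\in\mathbb F^{n\times n}\ \Big|\ \|X\|<\frac{1}{48\sqrt n\,(a+1)f^2}\Bigr\}.$$ For $X\in U$ define the sequences $M_1,M_2,\dots$ and $C_1,C_2,\dots$ of $n\times n$ matrices by $M_1:=X$ and, for $M_k=[m^{(k)}_{ij}]$, $$C_k:=\sum_{i,j}m^{(k)}_{ij}F_{ij},\qquad A+M_{k+1}:=(I_n-C_k)^{-1}(A+M_k)(I_n-C_k).$$ Then the following statements hold. (a) For each $X\in U$ the infinite product $$\mathcal S(X):=(I_n-C_1)(I_n-C_2)(I_n-C_3)\cdots$$ is convergent and nonsingular (in particular, the matrices $I_n-C_k$ are nonsingular, so that the sequences are well defined). The resulting matrix function $\mathcal S:U\to\mathbb F^{n\times n}$ is continuous and $\mathcal S(0_n)=I_n$; this function is analytic if $\mathbb F=\mathbb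 C$ (with the usual absolute value). (b) If $X\in U$, then $$D(X):=\mathcal S(X)^{-1}(A+X)\mathcal S(X)-A\in\mathcal D(\mathbb F).$$ That is, all matrices $A+X$ with $X\in U$ are reduced by the similarity transformation $\mathcal S(X)^{-1}(A+X)\mathcal S(X)$ to the form $A+\mathcal D$, in which the stars of $\mathcal D$ represent entries that depend continuously on the entries of $X$. The number of stars in $\mathcal D$ is equal to the codimension $n^2-\dim_{\mathbb F}T(A)$ of the similarity class of $A$. In particular, for each real $\varepsilon$ with $0<\varepsilon\le 1/2$ and each $X\in 2\varepsilon U$, we have $$\|\mathcal S(X)-I_n\|<-1+(1+\varepsilon)(1+\varepsilon^2)(1+\varepsilon^3)\cdots,\qquad \|D(X)\|\le \frac{\varepsilon}{2f}.$$ (c) Let one of the following conditions hold: (i) $A$ is a Frobenius canonical matrix $$\bigoplus_{i=1}^t\bigl(\Phi_{m_{i1}}(p_i)\oplus\Phi_{m_{i2}}(p_i)\oplus\dots\oplus\Phi_{m_{ik_i}}(p_i)\bigr),\qquad m_{i1}\ge\dots\ge m_{ik_i}\ \text{for all } i,$$ in which $p_1,\dots,p_t$ are distinct irreducible polynomials over $\mathbb F$; (ii) $\mathbb F=\mathbb C$ and $A$ is a Jordan canonical matrix $$\bigoplus_{i=1}^t\bigl(J_{m_{i1}}(\lambda_i)\oplus J_{m_{i2}}(\lambda_i)\oplus\dots\oplus J_{m_{ik_i}}(\lambda_i)\bigr),\qquad m_{i1}\ge\dots\ge m_{ik_i}\ \text{for all } i,$$ in which $\lambda_1,\dots,\lambda_t$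 are distinct complex numbers; (iii) $\mathbb F=\mathbb R$ and $A$ is a real Jordan canonical matrix $$\Bigl[\bigoplus_{i=1}^{t'}\bigl(J_{m_{i1}}(\lambda_i)\oplus\dots\oplus J_{m_{ik_i}}(\lambda_i)\bigr)\Bigr]\oplus\Bigl[\bigoplus_{i=t'+1}^{t}\bigl(C_{m_{i1}}(a_i,b_i)\oplus\dots\oplus C_{m_{ik_i}}(a_i,b_i)\bigr)\Bigr],\qquad m_{i1}\ge\dots\ge m_{ik_i}\ \text{for all } i,$$ in which $\lambda_i,a_i,b_i\in\mathbb R$, $b_i>0$, the numbers $\lambda_1,\dots,\lambda_{t'}$ are distinct, and the pairs $(a_{t'+1},b_{t'+1}),\dots,(a_t,b_t)$ are distinct. Then the matrix $\mathcal D$ satisfying (1) can be taken as follows: $$\mathcal D:=\bigoplus_{i=1}^t\begin{bmatrix}0^{\downarrow}_{m_{i1}}&0^{\downarrow}&\dots&0^{\downarrow}\\ 0^{\leftarrow}&0^{\downarrow}_{m_{i2}}&\ddots&\vdots\\ \vdots&\ddots&\ddots&0^{\downarrow}\\ 0^{\leftarrow}&\dots&0^{\leftarrow}&0^{\downarrow}_{m_{ik_i}}\end{bmatrix},$$ where, in the $i$-th summand, the $(j,l)$ block has size $m_{ij}\times m_{il}$, it is of the form $0^{\downarrow}$ if $j\le l$ and of the form $0^{\leftarrow}$ if $j>l$.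
   Context: An absolute value on a field $\mathbb F$ is a function $|\cdot|:\mathbb F\to\mathbb R$ with $|x|\ge 0$, $|x|=0\Leftrightarrow x=0$, $|xy|=|x||y|$ and $|x+y|\le|x|+|y|$; it is trivial if $|x|=1$ for all $x\ne0$. The field is complete if every Cauchy sequence converges (for the metric $|x-y|$). It may be Archimedean or non-Archimedean. For $M=[m_{ij}]$ with entries in $\mathbb F$, $\|M\|:=\sqrt{\sum_{i,j}|m_{ij}|^2}$. Convergence of an infinite product of matrices means convergence of its sequence of partial products in this norm. $I_n$ and $0_n$ are the $n\times n$ identity and zero matrices, and $E_{ij}$ are the $n\times n$ matrix units. $T(A):=\{XA-AX\mid X\in\mathbb F^{n\times n}\}$ is the tangent space to the similarity class of $A$; the codimension of the similarity class of $A$ is by definition $n^2-\dim_{\mathbb F}T(A)$. For a matrix $\mathcal D$ whose entries are symbols $0$ and $*$, $\mathcal D(\mathbb F)$ is the vector space of all matrices obtained from $\mathcal D$ by replacing its stars by (independent) elements of $\mathbb F$. Matrices $F_{ij}$ as in the claim exist because of the decomposition (1). For a real $\varepsilon>0$, $2\varepsilon U$ denotes the ball $U$ with radius multiplied by $2\varepsilon$: $2\varepsilon U=\{X\in\mathbb F^{n\times n}\mid \|X\|<2\varepsilon/(48\sqrt n(a+1)f^2)\}$. $0^{\downarrow}$ denotes a (rectangular) matrix all of whose entries are $0$ except for the last row, which consists of stars; $0^{\leftarrow}$ denotes a matrix all of whose entries are $0$ except for the first column, which consists of stars; $0^{\downarrow}_m$ is $0^{\downarrow}$ of size $m\times m$.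 A direct sum of matrices is the block diagonal matrix. $J_m(\lambda)$ is the $m\times m$ upper Jordan block ($\lambda$ on the diagonal, $1$ on the first superdiagonal, $0$ elsewhere). For $a,b\in\mathbb R$ and even $m\ge2$, $C_m(a,b)$ is the $m\times m$ matrix partitioned into $2\times2$ blocks with diagonal blocks $\begin{bmatrix}a&b\\-b&a\end{bmatrix}$, first block superdiagonal consisting of $I_2$, and all other blocks zero. $\Phi_m(p)$, for $p\in\mathbb F[x]$ irreducible over $\mathbb F$, is the $m\times m$ matrix $$\begin{bmatrix}0&1&&0\\ &\ddots&\ddots&\\ 0&&0&1\\ -c_m&\dots&-c_2&-c_1\end{bmatrix}$$ whose characteristic polynomial $x^m+c_1x^{m-1}+\dots+c_m$ is an integer power of $p$ (polynomials $p$ taken monic). *)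

theory Defs
  imports
    "HOL-Analysis.Infinite_Sum"
    "HOL-Analysis.Infinite_Products"
    "Jordan_Normal_Form.Jordan_Normal_Form_Existence"
begin

no_notation Finite_Cartesian_Product.vec_nth (infixl \<open>$\<close> 90)
hide_const (open) Finite_Cartesian_Product.mat Finite_Cartesian_Product.vec

section \<open>Complete fields and the Frobenius norm\<close>

definition absolute_value :: "('a::field \<Rightarrow> real) \<Rightarrow> bool" where
  "absolute_value av \<longleftrightarrow>
     (\<forall>x. 0 \<le> av x) \<and> (\<forall>x. av x = 0 \<longleftrightarrow> x = 0) \<and>
     (\<forall>x y. av (x * y) = av x * av y) \<and> (\<forall>x y. av (x + y) \<le> av x + av y)"

definition nontrivial_absolute_value :: "('a::field \<Rightarrow> real) \<Rightarrow> bool" where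
  "nontrivial_absolute_value av \<longleftrightarrow> absolute_value av \<and> (\<exists>x. x \<noteq> 0 \<and> av x \<noteq> 1)"

definition complete_wrt :: "('a::field \<Rightarrow> real) \<Rightarrow> bool" where
  "complete_wrt av \<longleftrightarrow>
     (\<forall>s :: nat \<Rightarrow> 'a.
        (\<forall>e>0. \<exists>N. \<forall>k\<ge>N. \<forall>l\<ge>N. av (s k - s l) < e) \<longrightarrow>
        (\<exists>x. (\<lambda>k. av (s k - x)) \<longlonglongrightarrow> 0))"

definition mat_norm :: "('a \<Rightarrow> real) \<Rightarrow> 'a mat \<Rightarrow> real" where
  "mat_norm av M = sqrt (\<Sum>i<dim_row M. \<Sum>j<dim_col M. (av (M $$ (i, j)))\<^sup>2)"

definition mat_tendsto :: "('a::field \<Rightarrow> real) \<Rightarrow> (nat \<Rightarrow> 'a mat) \<Rightarrow> 'a mat \<Rightarrow> bool" where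
  "mat_tendsto av P L \<longleftrightarrow> (\<lambda>k. mat_norm av (P k - L)) \<longlonglongrightarrow> 0"

definition mat_continuous_on ::
  "('a::field \<Rightarrow> real) \<Rightarrow> 'a mat set \<Rightarrow> ('a mat \<Rightarrow> 'a mat) \<Rightarrow> bool" where
  "mat_continuous_on av V G \<longleftrightarrow>
     (\<forall>X\<in>V. \<forall>e>0. \<exists>d>0. \<forall>Y\<in>V. mat_norm av (Y - X) < d \<longrightarrow> mat_norm av (G Y - G X) < e)"

text \<open>
  Every entry of \<open>G\<close> is, near every point \<open>X0\<close> of \<open>V\<close>, the sum of a power series in the \<open>n\<^sup>2\<close>
  entries of \<open>X - X0\<close>. A multi-index is a function \<open>\<alpha>\<close> on positions vanishing outside the
  \<open>n \<times> n\<close> square; \<open>has_sum\<close> is unordered (hence absolute) convergence.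
\<close>
definition mat_analytic_on ::
  "nat \<Rightarrow> complex mat set \<Rightarrow> (complex mat \<Rightarrow> complex mat) \<Rightarrow> bool" where
  "mat_analytic_on n V G \<longleftrightarrow>
     (\<forall>X0\<in>V. \<forall>i<n. \<forall>j<n. \<exists>r>0. \<exists>c :: (nat \<times> nat \<Rightarrow> nat) \<Rightarrow> complex.
        \<forall>X\<in>V. mat_norm cmod (X - X0) < r \<longrightarrow>
          ((\<lambda>\<alpha>. c \<alpha> * (\<Prod>p\<in>{..<n} \<times> {..<n}. ((X - X0) $$ p) ^ \<alpha> p))
             has_sum (G X $$ (i, j)))
          {\<alpha>. \<forall>p. p \<notin> {..<n} \<times> {..<n} \<longrightarrow> \<alpha> p = 0})"

section \<open>Tangent space and the decomposition\<close>

definition mat_unit :: "nat \<Rightarrow> nat \<Rightarrow> nat \<Rightarrow> 'a::zero_neq_one mat" where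
  "mat_unit n i j = mat n n (\<lambda>p. if p = (i, j) then 1 else 0)"

definition tangent_space :: "nat \<Rightarrow> 'a::field mat \<Rightarrow> 'a mat set" where
  "tangent_space n A = {X * A - A * X | X. X \<in> carrier_mat n n}"

definition similarity_class_codim :: "nat \<Rightarrow> 'a::field mat \<Rightarrow> int" where
  "similarity_class_codim n A =
     int (n\<^sup>2) - int (vectorspace.dim class_ring
                      (module_mat TYPE('a) n n \<lparr>carrier := tangent_space n A\<rparr>))"

datatype sym = Nul | Star

text \<open>The zero is only needed to form block diagonal matrices of symbols.\<close>
instantiation sym :: zero
begin
definition zero_sym :: sym where "zero_sym = Nul"
instance ..
end

definition form_space :: "nat \<Rightarrow> sym mat \<Rightarrow> 'a::field mat set" where
  "form_space n D = {M \<in> carrier_mat n n. \<forall>i<n. \<forall>j<n. D $$ (i, j) = Nul \<longrightarrow> M $$ (i, j) = 0}"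

definition star_positions :: "nat \<Rightarrow> sym mat \<Rightarrow> (nat \<times> nat) set" where
  "star_positions n D = {(i, j). i < n \<and> j < n \<and> D $$ (i, j) = Star}"

definition tangent_decomposition :: "nat \<Rightarrow> 'a::field mat \<Rightarrow> sym mat \<Rightarrow> bool" where
  "tangent_decomposition n A D \<longleftrightarrow>
     D \<in> carrier_mat n n \<and>
     carrier_mat n n = {P + Q | P Q. P \<in> tangent_space n A \<and> Q \<in> form_space n D} \<and>
     tangent_space n A \<inter> form_space n D = {0\<^sub>m n n}"

definition reduction_data ::
  "nat \<Rightarrow> 'a::field mat \<Rightarrow> sym mat \<Rightarrow> (nat \<Rightarrow> nat \<Rightarrow> 'a mat) \<Rightarrow> bool" where
  "reduction_data n A D F \<longleftrightarrow>
     0 < n \<and> A \<in> carrier_mat n n \<and> tangent_decomposition n A D \<and>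
     (\<forall>i<n. \<forall>j<n. F i j \<in> carrier_mat n n \<and>
        mat_unit n i j + F i j * A - A * F i j \<in> form_space n D \<and>
        (mat_unit n i j \<in> (form_space n D :: 'a mat set) \<longrightarrow> F i j = 0\<^sub>m n n))"

section \<open>The reducing transformation\<close>

definition F_const :: "('a::field \<Rightarrow> real) \<Rightarrow> nat \<Rightarrow> (nat \<Rightarrow> nat \<Rightarrow> 'a mat) \<Rightarrow> real" where
  "F_const av n F = max (\<Sum>i<n. \<Sum>j<n. mat_norm av (F i j)) (1/3)"

text \<open>\<open>nbhd av n A F \<delta>\<close> is the ball \<open>\<delta> U\<close>.\<close>
definition nbhd ::
  "('a::field \<Rightarrow> real) \<Rightarrow> nat \<Rightarrow> 'a mat \<Rightarrow> (nat \<Rightarrow> nat \<Rightarrow> 'a mat) \<Rightarrow> real \<Rightarrow> 'a mat set" where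
  "nbhd av n A F \<delta> =
     {X \<in> carrier_mat n n.
        mat_norm av X < \<delta> / (48 * sqrt (real n) * (mat_norm av A + 1) * (F_const av n F)\<^sup>2)}"

abbreviation mat_inv :: "'a::field mat \<Rightarrow> 'a mat" where
  "mat_inv M \<equiv> the (mat_inverse M)"

definition C_of :: "nat \<Rightarrow> (nat \<Rightarrow> nat \<Rightarrow> 'a::field mat) \<Rightarrow> 'a mat \<Rightarrow> 'a mat" where
  "C_of n F M = mat n n (\<lambda>p. \<Sum>i<n. \<Sum>j<n. M $$ (i, j) * (F i j $$ p))"

text \<open>Indices start at 0: \<open>M_seq n A F X k\<close> is $M_{k+1}$ and \<open>C_seq n A F X k\<close> is $C_{k+1}$.\<close>
primrec M_seq ::
  "nat \<Rightarrow> 'a::field mat \<Rightarrow> (nat \<Rightarrow> nat \<Rightarrow> 'a mat) \<Rightarrow> 'a mat \<Rightarrow> nat \<Rightarrow> 'a mat" where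
  "M_seq n A F X 0 = X"
| "M_seq n A F X (Suc k) =
     mat_inv (1\<^sub>m n - C_of n F (M_seq n A F X k)) * (A + M_seq n A F X k)
       * (1\<^sub>m n - C_of n F (M_seq n A F X k)) - A"

definition C_seq ::
  "nat \<Rightarrow> 'a::field mat \<Rightarrow> (nat \<Rightarrow> nat \<Rightarrow> 'a mat) \<Rightarrow> 'a mat \<Rightarrow> nat \<Rightarrow> 'a mat" where
  "C_seq n A F X k = C_of n F (M_seq n A F X k)"

primrec partial_prod ::
  "nat \<Rightarrow> 'a::field mat \<Rightarrow> (nat \<Rightarrow> nat \<Rightarrow> 'a mat) \<Rightarrow> 'a mat \<Rightarrow> nat \<Rightarrow> 'a mat" where
  "partial_prod n A F X 0 = 1\<^sub>m n"
| "partial_prod n A F X (Suc k) = partial_prod n A F X k * (1\<^sub>m n - C_seq n A F X k)"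

definition S_map ::
  "('a::field \<Rightarrow> real) \<Rightarrow> nat \<Rightarrow> 'a mat \<Rightarrow> (nat \<Rightarrow> nat \<Rightarrow> 'a mat) \<Rightarrow> 'a mat \<Rightarrow> 'a mat" where
  "S_map av n A F X =
     (THE L. L \<in> carrier_mat n n \<and> mat_tendsto av (partial_prod n A F X) L)"

definition D_map ::
  "('a::field \<Rightarrow> real) \<Rightarrow> nat \<Rightarrow> 'a mat \<Rightarrow> (nat \<Rightarrow> nat \<Rightarrow> 'a mat) \<Rightarrow> 'a mat \<Rightarrow> 'a mat" where
  "D_map av n A F X = mat_inv (S_map av n A F X) * (A + X) * S_map av n A F X - A"

section \<open>Canonical matrices and the associated forms\<close>

definition block_sizes :: "nat list \<Rightarrow> bool" where
  "block_sizes ms \<longleftrightarrow> ms \<noteq> [] \<and> (\<forall>m\<in>set ms. 0 < m) \<and> sorted_wrt (\<ge>) ms"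

text \<open>Last row $-c_m, \dots, -c_1$.\<close>
definition companion :: "nat \<Rightarrow> (nat \<Rightarrow> 'a::field) \<Rightarrow> 'a mat" where
  "companion m c =
     mat m m (\<lambda>(i, j). if i + 1 = m then - c (m - j) else if j = i + 1 then 1 else 0)"

text \<open>\<open>frobenius_block p m B\<close> says that \<open>B\<close> is $\Phi_m(p)$.\<close>
definition frobenius_block :: "'a::field poly \<Rightarrow> nat \<Rightarrow> 'a mat \<Rightarrow> bool" where
  "frobenius_block p m B \<longleftrightarrow> (\<exists>c. B = companion m c) \<and> (\<exists>s. char_poly B = p ^ s)"

text \<open>
  In the following, \<open>pms\<close> lists the pairs of $p_i$ (or the eigenvalue data) and
  $[m_{i1}, \dots, m_{ik_i}]$.
\<close>
definition frobenius_canonical :: "('a::field poly \<times> nat list) list \<Rightarrow> 'a mat \<Rightarrow> bool" where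
  "frobenius_canonical pms A \<longleftrightarrow>
     distinct (map fst pms) \<and>
     (\<forall>(p, ms)\<in>set pms. irreducible p \<and> monic p \<and> block_sizes ms) \<and>
     (\<exists>Bss. list_all2 (\<lambda>(p, ms) Bs. list_all2 (frobenius_block p) ms Bs) pms Bss \<and>
        A = diag_block_mat (concat Bss))"

definition jordan_canonical :: "('a::field \<times> nat list) list \<Rightarrow> 'a mat \<Rightarrow> bool" where
  "jordan_canonical lms A \<longleftrightarrow>
     distinct (map fst lms) \<and> (\<forall>(l, ms)\<in>set lms. block_sizes ms) \<and>
     A = diag_block_mat (concat (map (\<lambda>(l, ms). map (\<lambda>m. jordan_block m l) ms) lms))"

definition real_jordan_block :: "nat \<Rightarrow> real \<times> real \<Rightarrow> real mat" where
  "real_jordan_block m ab =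
     mat m m (\<lambda>(i, j).
       if i div 2 = j div 2 then
         (if i = j then fst ab else if i < j then snd ab else - snd ab)
       else if j = i + 2 then 1 else 0)"

definition real_jordan_canonical ::
  "(real \<times> nat list) list \<Rightarrow> ((real \<times> real) \<times> nat list) list \<Rightarrow> real mat \<Rightarrow> bool" where
  "real_jordan_canonical lms cms A \<longleftrightarrow>
     distinct (map fst lms) \<and> (\<forall>(l, ms)\<in>set lms. block_sizes ms) \<and>
     distinct (map fst cms) \<and>
     (\<forall>((a, b), ms)\<in>set cms. 0 < b \<and> block_sizes ms \<and> (\<forall>m\<in>set ms. even m)) \<and>
     A = diag_block_mat
           (concat (map (\<lambda>(l, ms). map (\<lambda>m. jordan_block m l) ms) lms) @
            concat (map (\<lambda>(ab, ms). map (\<lambda>m. real_jordan_block m ab) ms) cms))"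

definition stars_down :: "nat \<Rightarrow> nat \<Rightarrow> sym mat" where
  "stars_down r c = mat r c (\<lambda>(i, j). if i + 1 = r then Star else Nul)"

definition stars_left :: "nat \<Rightarrow> nat \<Rightarrow> sym mat" where
  "stars_left r c = mat r c (\<lambda>(i, j). if j = 0 then Star else Nul)"

text \<open>Row (or column) \<open>r\<close> lies in block \<open>block_of ms r\<close>, at position \<open>offset_of ms r\<close>.\<close>
definition block_of :: "nat list \<Rightarrow> nat \<Rightarrow> nat" where
  "block_of ms r = (LEAST j. r < sum_list (take (Suc j) ms))"

definition offset_of :: "nat list \<Rightarrow> nat \<Rightarrow> nat" where
  "offset_of ms r = r - sum_list (take (block_of ms r) ms)"

definition form_summand :: "nat list \<Rightarrow> sym mat" where
  "form_summand ms =
     mat (sum_list ms) (sum_list ms) (\<lambda>(r, c).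
       let j = block_of ms r; l = block_of ms c;
           B = (if j \<le> l then stars_down (ms ! j) (ms ! l) else stars_left (ms ! j) (ms ! l))
       in B $$ (offset_of ms r, offset_of ms c))"

definition canonical_form :: "nat list list \<Rightarrow> sym mat" where
  "canonical_form mss = diag_block_mat (map form_summand mss)"

end

theory Submission
  imports Defs
begin

text \<open>
  \<^bold>\<open>The iteration.\<close> Put \<open>M = M\<^sub>k\<close>, \<open>C = C\<^sub>k\<close>, \<open>M' = M\<^sub>k\<^sub>+\<^sub>1\<close>. Multiplying out the conjugation gives
  \<open>M' = M + (CA - AC) + (CM' - MC)\<close>. The matrices \<open>F\<^sub>i\<^sub>j\<close> are chosen such that the linear part
  \<open>M + CA - AC\<close> has the form \<open>\<D>\<close>, so that outside the stars only \<open>CM' - MC\<close> is left; and \<open>C\<close> is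
  computed from the entries outside the stars alone, because \<open>F\<^sub>i\<^sub>j = 0\<close> at a star. Hence \<open>\<parallel>C\<^sub>k\<^sub>+\<^sub>1\<parallel>\<close> is
  at most \<open>f (\<parallel>M\<parallel> + \<parallel>M'\<parallel>) c\<close> if \<open>\<parallel>C\<^sub>k\<parallel> \<le> c\<close>, and as long as all \<open>\<parallel>M\<^sub>k\<parallel>\<close> stay below \<open>\<epsilon>/(4f)\<close>, the
  \<open>C\<^sub>k\<close> decrease geometrically with ratio \<open>\<epsilon>/2\<close>. Both facts are proved together in
  \<open>reduction_step_bound\<close>, by an invariant that pays for the growth of \<open>M\<^sub>k\<close> out of the decrease of
  \<open>C\<^sub>k\<close>. It follows that the product converges at a geometric rate, that \<open>\<S>(X)\<close> stays within distance
  \<open>1/2\<close> of the identity and is therefore invertible, and that \<open>M\<^sub>k\<close> converges to \<open>D(X)\<close>, whose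
  entries outside the stars vanish. The rates do not depend on \<open>X\<close>, so continuity passes from the
  partial products and the \<open>M\<^sub>k\<close>, which are Lipschitz in \<open>X\<close>, to their limits.

  \<^bold>\<open>Analyticity.\<close> For power series in the entries of \<open>X - X\<^sub>0\<close> the norm \<open>\<Sum> \<bar>c\<^sub>\<alpha>\<bar> r\<^bsup>\<bar>\<alpha>\<bar>\<^esup>\<close> is
  submultiplicative and complete, just as the absolute value is for numbers. If \<open>r\<close> is small, then
  the function \<open>X \<mapsto> X\<close>, read as a matrix of power series, is so small in this norm that the
  estimates of the iteration apply to it word for word (\<open>series_Ms\<close>). The only new point is that
  \<open>M'\<close> has to be produced as a power series; it is the Neumann series of
  \<open>M' = (M + CA - AC - MC) + CM'\<close> (\<open>mat_series_bound_fixpoint\<close>).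

  \<^bold>\<open>The canonical forms.\<close> The operator \<open>X \<mapsto> XA - AX\<close> acts on the blocks of \<open>X\<close> as
  \<open>X \<mapsto> X\<Psi> - \<Phi>X\<close> with diagonal blocks \<open>\<Phi>\<close> and \<open>\<Psi>\<close> of \<open>A\<close>, so that the complement can be found
  block by block. Modulo the range of this operator one has \<open>p(\<Phi>)X = Xp(\<Psi>)\<close> for all polynomials
  \<open>p\<close>. If \<open>\<Phi>\<close> and \<open>\<Psi>\<close> are annihilated by coprime polynomials, this makes the operator surjective
  (\<open>sylvester_range_full\<close>), and no stars are needed. If \<open>\<Phi>\<close> has a cyclic vector \<open>e\<^sub>v\<close> and its
  annihilating polynomial also annihilates \<open>\<Psi>\<close>, every row can be moved into row \<open>v\<close>, and nothing
  more can be removed (\<open>cyclic_row_split\<close>): this yields the blocks \<open>0\<^sup>\<down>\<close>, and \<open>0\<^sup>\<leftarrow>\<close> by transposition.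
  For companion matrices and Jordan blocks the last unit vector is visibly cyclic. For real Jordan
  blocks this requires that the rotation part of the block is a polynomial in the block, which
  Newton's iteration for the square root of \<open>-1\<close> provides (\<open>rotation_polynomial_step\<close>).
\<close>


section \<open>Polynomials of a matrix\<close>

definition mat_poly :: "nat \<Rightarrow> 'a::field mat \<Rightarrow> 'a poly \<Rightarrow> 'a mat" where
  "mat_poly n A p = fold_coeffs (\<lambda>a P. a \<cdot>\<^sub>m 1\<^sub>m n + A * P) p (0\<^sub>m n n)"

lemma mat_poly_0 [simp]: "mat_poly n A 0 = 0\<^sub>m n n"
  by (simp add: mat_poly_def)

lemma mat_poly_pCons [simp]:
  assumes "A \<in> carrier_mat n n"
  shows "mat_poly n A (pCons a p) = a \<cdot>\<^sub>m 1\<^sub>m n + A * mat_poly n A p"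
proof (cases "p = 0 \<and> a = 0")
  case True
  then show ?thesis using assms by (auto simp: mat_poly_def)
next
  case False
  then show ?thesis by (auto simp: mat_poly_def)
qed

lemma mat_poly_closed [simp]:
  assumes A: "A \<in> carrier_mat n n"
  shows "mat_poly n A p \<in> carrier_mat n n"
proof (induction p)
  case (pCons a p)
  then show ?case using A by (simp add: add_carrier_mat mult_carrier_mat)
qed simp

lemma mat_poly_dim [simp]:
  assumes A: "A \<in> carrier_mat n n"
  shows "dim_row (mat_poly n A p) = n" "dim_col (mat_poly n A p) = n"
  using mat_poly_closed[OF A, of p] by auto

lemma mat_poly_1 [simp]:
  assumes A: "A \<in> carrier_mat n n"
  shows "mat_poly n A 1 = 1\<^sub>m n"
  using A by (subst one_pCons) (simp, intro eq_matI, auto)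

lemma mat_poly_x [simp]:
  assumes A: "A \<in> carrier_mat n n"
  shows "mat_poly n A [:0, 1:] = A"
proof -
  have "1 \<cdot>\<^sub>m 1\<^sub>m n + A * 0\<^sub>m n n = 1\<^sub>m n" using A by (intro eq_matI) auto
  then have "mat_poly n A [:0, 1:] = 0 \<cdot>\<^sub>m 1\<^sub>m n + A * 1\<^sub>m n" using A by simp
  also have "\<dots> = A" using A right_mult_one_mat[OF A] by (intro eq_matI) auto
  finally show ?thesis .
qed

lemma mat_poly_add:
  assumes A: "A \<in> carrier_mat n n"
  shows "mat_poly n A (p + q) = mat_poly n A p + mat_poly n A q"
proof (induction p q rule: poly_induct2)
  case (pCons a p b q)
  let ?P = "mat_poly n A p" and ?Q = "mat_poly n A q"
  have c: "?P \<in> carrier_mat n n" "?Q \<in> carrier_mat n n" using A by auto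
  have "A * (?P + ?Q) = A * ?P + A * ?Q" using A c by (rule mult_add_distrib_mat)
  moreover have "(a + b) \<cdot>\<^sub>m 1\<^sub>m n + (X + Y) = (a \<cdot>\<^sub>m 1\<^sub>m n + X) + (b \<cdot>\<^sub>m 1\<^sub>m n + Y)"
    if "X \<in> carrier_mat n n" "Y \<in> carrier_mat n n" for X Y
    using that by (intro eq_matI) (auto simp: algebra_simps)
  ultimately show ?case using A c pCons by simp
qed simp

lemma mat_poly_smult:
  assumes A: "A \<in> carrier_mat n n"
  shows "mat_poly n A (Polynomial.smult c p) = c \<cdot>\<^sub>m mat_poly n A p"
proof (induction p)
  case (pCons a p)
  let ?P = "mat_poly n A p"
  have c: "?P \<in> carrier_mat n n" using A by auto
  have "A * (c \<cdot>\<^sub>m ?P) = c \<cdot>\<^sub>m (A * ?P)" using A c by (rule mult_smult_distrib)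
  moreover have "(c * a) \<cdot>\<^sub>m 1\<^sub>m n + c \<cdot>\<^sub>m X = c \<cdot>\<^sub>m (a \<cdot>\<^sub>m 1\<^sub>m n + X)"
    if "X \<in> carrier_mat n n" for X
    using that by (intro eq_matI) (auto simp: algebra_simps)
  ultimately show ?case using A c pCons by simp
qed auto

lemma mat_poly_mult:
  assumes A: "A \<in> carrier_mat n n"
  shows "mat_poly n A (p * q) = mat_poly n A p * mat_poly n A q"
proof (induction p)
  case 0
  have "mat_poly n A q \<in> carrier_mat n n" using A by simp
  then show ?case by simp
next
  case (pCons a p)
  let ?P = "mat_poly n A p" and ?Q = "mat_poly n A q"
  have c: "?P \<in> carrier_mat n n" "?Q \<in> carrier_mat n n" using A by auto
  have "(a \<cdot>\<^sub>m 1\<^sub>m n + A * ?P) * ?Q = (a \<cdot>\<^sub>m 1\<^sub>m n) * ?Q + (A * ?P) * ?Q"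
    by (rule add_mult_distrib_mat[of _ n n]) (use A c in auto)
  also have "(a \<cdot>\<^sub>m 1\<^sub>m n) * ?Q = a \<cdot>\<^sub>m ?Q"
    using mult_smult_assoc_mat[of "1\<^sub>m n" n n ?Q n a] c by simp
  also have "(A * ?P) * ?Q = A * (?P * ?Q)"
    using A c by (intro assoc_mult_mat) auto
  finally have "(a \<cdot>\<^sub>m 1\<^sub>m n + A * ?P) * ?Q = a \<cdot>\<^sub>m ?Q + A * (?P * ?Q)" .
  moreover have "pCons a p * q = Polynomial.smult a q + pCons 0 (p * q)" by simp
  moreover have "0 \<cdot>\<^sub>m 1\<^sub>m n + A * (?P * ?Q) = A * (?P * ?Q)"
    using A c by (intro eq_matI) auto
  ultimately show ?case using A c pCons
    by (simp add: A mat_poly_add[OF A] mat_poly_smult[OF A])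
qed

lemma mat_poly_minus:
  assumes A: "A \<in> carrier_mat n n"
  shows "mat_poly n A (p - q) = mat_poly n A p - mat_poly n A q"
proof -
  have "mat_poly n A (p + Polynomial.smult (-1) q) = mat_poly n A p + (-1) \<cdot>\<^sub>m mat_poly n A q"
    by (simp only: mat_poly_add[OF A] mat_poly_smult[OF A])
  then show ?thesis using A
    by (intro eq_matI) (simp_all)
qed

lemma mat_poly_linear:
  assumes A: "A \<in> carrier_mat n n"
  shows "mat_poly n A [:a, b:] = a \<cdot>\<^sub>m 1\<^sub>m n + b \<cdot>\<^sub>m A"
proof -
  have "b \<cdot>\<^sub>m 1\<^sub>m n + A * 0\<^sub>m n n = b \<cdot>\<^sub>m 1\<^sub>m n" using A by (intro eq_matI) auto
  moreover have "A * (b \<cdot>\<^sub>m 1\<^sub>m n) = b \<cdot>\<^sub>m A"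
    using mult_smult_distrib[of A n n "1\<^sub>m n" n b] A by simp
  ultimately show ?thesis using A by simp
qed

lemma mat_poly_dvd_zero:
  assumes A: "A \<in> carrier_mat n n" and "p dvd q" "mat_poly n A p = 0\<^sub>m n n"
  shows "mat_poly n A q = 0\<^sub>m n n"
proof -
  obtain r where "q = p * r" using assms(2) by (elim dvdE)
  moreover have "mat_poly n A r \<in> carrier_mat n n" using A by simp
  ultimately show ?thesis using assms(3) by (simp add: mat_poly_mult[OF A])
qed

lemma mat_poly_commute:
  assumes A: "A \<in> carrier_mat n n" and B: "B \<in> carrier_mat n n" and AB: "A * B = B * A"
  shows "mat_poly n A p * B = B * mat_poly n A p"
proof (induction p)
  case 0
  then show ?case using B by simp
next
  case (pCons a p)
  let ?P = "mat_poly n A p"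
  have c: "?P \<in> carrier_mat n n" using A by auto
  have "(a \<cdot>\<^sub>m 1\<^sub>m n + A * ?P) * B = (a \<cdot>\<^sub>m 1\<^sub>m n) * B + (A * ?P) * B"
    by (rule add_mult_distrib_mat[of _ n n]) (use A c B in auto)
  also have "(a \<cdot>\<^sub>m 1\<^sub>m n) * B = a \<cdot>\<^sub>m B"
    using mult_smult_assoc_mat[of "1\<^sub>m n" n n B n a] B by simp
  also have "(A * ?P) * B = A * (?P * B)"
    using A c B by (intro assoc_mult_mat) auto
  also have "\<dots> = A * (B * ?P)" using pCons by simp
  also have "\<dots> = (A * B) * ?P" using assoc_mult_mat[OF A B c] by simp
  also have "\<dots> = B * (A * ?P)" unfolding AB using assoc_mult_mat[OF B A c] by simp
  finally have 1: "(a \<cdot>\<^sub>m 1\<^sub>m n + A * ?P) * B = a \<cdot>\<^sub>m B + B * (A * ?P)" .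
  have "B * (a \<cdot>\<^sub>m 1\<^sub>m n + A * ?P) = B * (a \<cdot>\<^sub>m 1\<^sub>m n) + B * (A * ?P)"
    by (rule mult_add_distrib_mat[of _ n n]) (use A c B in auto)
  also have "B * (a \<cdot>\<^sub>m 1\<^sub>m n) = a \<cdot>\<^sub>m B"
    using mult_smult_distrib[of B n n "1\<^sub>m n" n a] B by simp
  finally show ?case using 1 A by (simp add: A)
qed

lemma mat_poly_transpose:
  assumes A: "A \<in> carrier_mat n n"
  shows "mat_poly n (transpose_mat A) p = transpose_mat (mat_poly n A p)"
proof (induction p)
  case (pCons a p)
  let ?P = "mat_poly n A p"
  have At: "transpose_mat A \<in> carrier_mat n n" using A by simp
  have c: "?P \<in> carrier_mat n n" using A by auto
  have "mat_poly n A p * A = A * mat_poly n A p" by (rule mat_poly_commute[OF A A refl])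
  then have "transpose_mat (A * ?P) = transpose_mat A * transpose_mat ?P"
    using transpose_mult[OF c A] by simp
  moreover have "transpose_mat (a \<cdot>\<^sub>m 1\<^sub>m n + X) = a \<cdot>\<^sub>m 1\<^sub>m n + transpose_mat X"
    if "X \<in> carrier_mat n n" for X
    using that by (intro eq_matI) auto
  ultimately show ?case using pCons A c At by simp
qed auto

lemma mat_poly_four_block:
  assumes A: "A \<in> carrier_mat n1 n1" and B: "B \<in> carrier_mat n2 n2"
  shows "mat_poly (n1 + n2) (four_block_mat A (0\<^sub>m n1 n2) (0\<^sub>m n2 n1) B) p =
    four_block_mat (mat_poly n1 A p) (0\<^sub>m n1 n2) (0\<^sub>m n2 n1) (mat_poly n2 B p)"
proof (induction p)
  case (pCons a p)
  let ?F = "four_block_mat A (0\<^sub>m n1 n2) (0\<^sub>m n2 n1) B"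
  let ?P = "mat_poly n1 A p" and ?Q = "mat_poly n2 B p"
  have F: "?F \<in> carrier_mat (n1 + n2) (n1 + n2)" using A B by simp
  have c: "?P \<in> carrier_mat n1 n1" "?Q \<in> carrier_mat n2 n2" using A B by auto
  have "?F * four_block_mat ?P (0\<^sub>m n1 n2) (0\<^sub>m n2 n1) ?Q
      = four_block_mat (A * ?P) (0\<^sub>m n1 n2) (0\<^sub>m n2 n1) (B * ?Q)"
    by (subst mult_four_block_mat[OF A _ _ B c(1) _ _ c(2)]) (use A B c in auto)
  then have "mat_poly (n1 + n2) ?F (pCons a p) = a \<cdot>\<^sub>m 1\<^sub>m (n1 + n2) +
      four_block_mat (A * ?P) (0\<^sub>m n1 n2) (0\<^sub>m n2 n1) (B * ?Q)"
    using pCons by (simp add: F)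
  also have "\<dots> = four_block_mat (a \<cdot>\<^sub>m 1\<^sub>m n1 + A * ?P) (0\<^sub>m n1 n2) (0\<^sub>m n2 n1)
      (a \<cdot>\<^sub>m 1\<^sub>m n2 + B * ?Q)"
    using carrier_matD[OF A] carrier_matD[OF B] carrier_matD[OF c(1)] carrier_matD[OF c(2)]
    by (intro eq_matI) auto
  finally show ?case using A B by simp
qed auto

section \<open>The Sylvester operator\<close>

definition sylvester_range :: "nat \<Rightarrow> nat \<Rightarrow> 'a::field mat \<Rightarrow> 'a mat \<Rightarrow> 'a mat set" where
  "sylvester_range m l A B = {X * B - A * X | X. X \<in> carrier_mat m l}"

lemma tangent_space_sylvester: "tangent_space n A = sylvester_range n n A A"
  by (simp add: tangent_space_def sylvester_range_def)

lemma sylvester_rangeI: "X \<in> carrier_mat m l \<Longrightarrow> X * B - A * X \<in> sylvester_range m l A B"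
  unfolding sylvester_range_def by blast

lemma sylvester_rangeE:
  assumes "M \<in> sylvester_range m l A B"
  obtains X where "X \<in> carrier_mat m l" "M = X * B - A * X"
  using assms unfolding sylvester_range_def by blast

lemma sylvester_range_carrier:
  assumes "A \<in> carrier_mat m m" "B \<in> carrier_mat l l" "M \<in> sylvester_range m l A B"
  shows "M \<in> carrier_mat m l"
  using assms by (auto simp: sylvester_range_def)

lemma sylvester_range_zero:
  assumes "A \<in> carrier_mat m m" "B \<in> carrier_mat l l"
  shows "0\<^sub>m m l \<in> sylvester_range m l A B"
  unfolding sylvester_range_def
  by (rule CollectI, rule exI[of _ "0\<^sub>m m l"]) (use assms in auto)

lemma sylvester_range_add:
  assumes A: "A \<in> carrier_mat m m" and B: "B \<in> carrier_mat l l"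
    and "M \<in> sylvester_range m l A B" "N \<in> sylvester_range m l A B"
  shows "M + N \<in> sylvester_range m l A B"
proof -
  obtain X Y where X: "X \<in> carrier_mat m l" "M = X * B - A * X"
    and Y: "Y \<in> carrier_mat m l" "N = Y * B - A * Y"
    using assms(3,4) by (auto simp: sylvester_range_def)
  have "(X + Y) * B = X * B + Y * B" using X Y B by (intro add_mult_distrib_mat) auto
  moreover have "A * (X + Y) = A * X + A * Y" using X Y A by (intro mult_add_distrib_mat) auto
  moreover have "P + Q - (R + S) = (P - R) + (Q - S)"
    if "P \<in> carrier_mat m l" "Q \<in> carrier_mat m l" "R \<in> carrier_mat m l" "S \<in> carrier_mat m l"
    for P Q R S :: "'a mat"
    using that by (intro eq_matI) auto
  ultimately have "M + N = (X + Y) * B - A * (X + Y)"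
    using X Y A B by simp
  then show ?thesis using sylvester_rangeI[of "X + Y" m l B A] X(1) Y(1) by simp
qed

lemma sylvester_range_smult:
  assumes A: "A \<in> carrier_mat m m" and B: "B \<in> carrier_mat l l"
    and "M \<in> sylvester_range m l A B"
  shows "c \<cdot>\<^sub>m M \<in> sylvester_range m l A B"
proof -
  obtain X where X: "X \<in> carrier_mat m l" "M = X * B - A * X"
    using assms(3) by (auto simp: sylvester_range_def)
  have "(c \<cdot>\<^sub>m X) * B = c \<cdot>\<^sub>m (X * B)" using X B by (intro mult_smult_assoc_mat) auto
  moreover have "A * (c \<cdot>\<^sub>m X) = c \<cdot>\<^sub>m (A * X)" using X A by (intro mult_smult_distrib) auto
  moreover have "c \<cdot>\<^sub>m (P - Q) = c \<cdot>\<^sub>m P - c \<cdot>\<^sub>m Q"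
    if "P \<in> carrier_mat m l" "Q \<in> carrier_mat m l" for P Q :: "'a mat"
    using that by (intro eq_matI) (auto simp: algebra_simps)
  ultimately have "c \<cdot>\<^sub>m M = (c \<cdot>\<^sub>m X) * B - A * (c \<cdot>\<^sub>m X)"
    using X A B by simp
  then show ?thesis using sylvester_rangeI[of "c \<cdot>\<^sub>m X" m l B A] X(1) by simp
qed

lemma sylvester_range_minus:
  assumes A: "A \<in> carrier_mat m m" and B: "B \<in> carrier_mat l l"
    and "M \<in> sylvester_range m l A B" "N \<in> sylvester_range m l A B"
  shows "M - N \<in> sylvester_range m l A B"
proof -
  have "M \<in> carrier_mat m l" "N \<in> carrier_mat m l"
    using assms sylvester_range_carrier by blast+
  then have "M - N = M + (-1) \<cdot>\<^sub>m N" by (intro eq_matI) auto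
  then show ?thesis
    using sylvester_range_add[OF A B assms(3) sylvester_range_smult[OF A B assms(4), of "-1"]] by simp
qed

text \<open>
  Modulo the range of \<open>X \<mapsto> XB - AX\<close>, multiplying by \<open>A\<close> on the left is the same as multiplying by
  \<open>B\<close> on the right; hence the same holds for every polynomial in \<open>A\<close> and \<open>B\<close>.
\<close>
lemma poly_commutator_in_sylvester_range:
  assumes A: "A \<in> carrier_mat m m" and B: "B \<in> carrier_mat l l" and X: "X \<in> carrier_mat m l"
  shows "mat_poly m A p * X - X * mat_poly l B p \<in> sylvester_range m l A B"
proof (induction p)
  case 0
  have z: "0\<^sub>m m l - 0\<^sub>m m l = (0\<^sub>m m l :: 'a mat)" by (intro eq_matI) auto
  have "mat_poly m A 0 * X - X * mat_poly l B 0 = 0\<^sub>m m l - 0\<^sub>m m l" using X by simp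
  then show ?case using sylvester_range_zero[OF A B] unfolding z by metis
next
  case (pCons a p)
  define P Q where "P = mat_poly m A p" and "Q = mat_poly l B p"
  have c: "P \<in> carrier_mat m m" "Q \<in> carrier_mat l l" using A B by (auto simp: P_def Q_def)
  obtain Y where Y: "Y \<in> carrier_mat m l" and PX: "P * X - X * Q = Y * B - A * Y"
    using pCons.IH by (auto simp: sylvester_range_def P_def Q_def)
  have QB: "Q * B = B * Q" unfolding Q_def by (rule mat_poly_commute[OF B B refl])
  have PX': "P * X = X * Q + (Y * B - A * Y)"
  proof -
    have "U = V + W" if "U - V = W" "U \<in> carrier_mat m l" "V \<in> carrier_mat m l" for U V W :: "'a mat"
      using that by (intro eq_matI) auto
    from this[OF PX] show ?thesis using c X by auto
  qed
  have 1: "(a \<cdot>\<^sub>m 1\<^sub>m m + A * P) * X = a \<cdot>\<^sub>m X + A * (P * X)"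
  proof -
    have "(a \<cdot>\<^sub>m 1\<^sub>m m + A * P) * X = (a \<cdot>\<^sub>m 1\<^sub>m m) * X + (A * P) * X"
      by (rule add_mult_distrib_mat[of _ m m]) (use A c X in auto)
    moreover have "(a \<cdot>\<^sub>m 1\<^sub>m m) * X = a \<cdot>\<^sub>m X"
      using mult_smult_assoc_mat[of "1\<^sub>m m" m m X l a] X by simp
    ultimately show ?thesis using assoc_mult_mat[OF A c(1) X] by simp
  qed
  have 2: "X * (a \<cdot>\<^sub>m 1\<^sub>m l + B * Q) = a \<cdot>\<^sub>m X + (X * Q) * B"
  proof -
    have "X * (a \<cdot>\<^sub>m 1\<^sub>m l + B * Q) = X * (a \<cdot>\<^sub>m 1\<^sub>m l) + X * (B * Q)"
      by (rule mult_add_distrib_mat[of _ m l]) (use B c X in auto)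
    moreover have "X * (a \<cdot>\<^sub>m 1\<^sub>m l) = a \<cdot>\<^sub>m X"
      using mult_smult_distrib[of X m l "1\<^sub>m l" l a] X by simp
    moreover have "X * (B * Q) = (X * Q) * B" using assoc_mult_mat[OF X c(2) B] QB by simp
    ultimately show ?thesis by simp
  qed
  have 3: "A * (P * X) = A * (X * Q) + (A * Y * B - A * (A * Y))"
  proof -
    have "A * (P * X) = A * (X * Q) + A * (Y * B - A * Y)"
      unfolding PX' by (rule mult_add_distrib_mat) (use A B c X Y in auto)
    moreover have "A * (Y * B - A * Y) = A * (Y * B) - A * (A * Y)"
      by (rule mult_minus_distrib_mat) (use A B c X Y in auto)
    ultimately show ?thesis using assoc_mult_mat[OF A Y B] by simp
  qed
  have 4: "(A * Y - X * Q) * B = A * Y * B - X * Q * B"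
    by (rule minus_mult_distrib_mat) (use A B c X Y in auto)
  have 5: "A * (A * Y - X * Q) = A * (A * Y) - A * (X * Q)"
    by (rule mult_minus_distrib_mat) (use A B c X Y in auto)
  have "(a \<cdot>\<^sub>m X + (R + (S - T))) - (a \<cdot>\<^sub>m X + V) = (S - V) - (T - R)"
    if "R \<in> carrier_mat m l" "S \<in> carrier_mat m l" "T \<in> carrier_mat m l" "V \<in> carrier_mat m l"
    for R S T V :: "'a mat"
    using that X by (intro eq_matI) (auto simp: algebra_simps)
  then have "mat_poly m A (pCons a p) * X - X * mat_poly l B (pCons a p)
      = (A * Y - X * Q) * B - A * (A * Y - X * Q)"
    using A B c X Y by (simp add: 1 2 3 4 5 P_def[symmetric] Q_def[symmetric])
  moreover have "A * Y - X * Q \<in> carrier_mat m l" using A c X Y by auto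
  ultimately show ?case using sylvester_rangeI[of "A * Y - X * Q" m l B A] by simp
qed

definition bezout :: "'a::field poly \<Rightarrow> 'a poly \<Rightarrow> bool" where
  "bezout p q \<longleftrightarrow> (\<exists>u v. u * p + v * q = 1)"

lemma bezout_commute: "bezout p q \<Longrightarrow> bezout q p"
  unfolding bezout_def by (metis add.commute)

lemma bezout_mult:
  assumes "bezout p r" "bezout q r"
  shows "bezout (p * q) r"
proof -
  obtain u v u' v' where "u * p + v * r = 1" "u' * q + v' * r = 1"
    using assms by (auto simp: bezout_def)
  then have "(u * p + v * r) * (u' * q + v' * r) = 1" by simp
  then have "(u * u') * (p * q) + (u * p * v' + v * u' * q + v * r * v') * r = 1"
    by (simp add: algebra_simps)
  then show ?thesis unfolding bezout_def by blast
qed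

lemma bezout_1 [simp]: "bezout 1 r"
  unfolding bezout_def by (intro exI[of _ 1] exI[of _ 0]) simp

lemma bezout_power: "bezout p q \<Longrightarrow> bezout (p ^ k) q"
  by (induction k) (auto intro: bezout_mult)

lemma bezout_powers: "bezout p q \<Longrightarrow> bezout (p ^ k) (q ^ j)"
  using bezout_power bezout_commute by blast

lemma bezout_prod_list: "(\<And>p. p \<in> set ps \<Longrightarrow> bezout p q) \<Longrightarrow> bezout (prod_list ps) q"
  by (induction ps) (auto intro: bezout_mult)

text \<open>
  Sylvester's theorem: as \<open>f(A) = 0\<close>, the matrix \<open>M f(B)\<close> is in the range for every \<open>M\<close>; and
  \<open>f(B)\<close> is invertible, because \<open>g(B) = 0\<close> and \<open>f\<close>, \<open>g\<close> are coprime.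
\<close>
lemma sylvester_range_full:
  assumes A: "A \<in> carrier_mat m m" and B: "B \<in> carrier_mat l l"
    and f: "mat_poly m A f = 0\<^sub>m m m" and g: "mat_poly l B g = 0\<^sub>m l l" and fg: "bezout f g"
  shows "sylvester_range m l A B = carrier_mat m l"
proof
  show "sylvester_range m l A B \<subseteq> carrier_mat m l"
    using sylvester_range_carrier[OF A B] by blast
  show "carrier_mat m l \<subseteq> sylvester_range m l A B"
  proof
    fix M :: "'a mat" assume M: "M \<in> carrier_mat m l"
    obtain u v where uv: "u * f + v * g = 1" using fg by (auto simp: bezout_def)
    have c: "mat_poly l B u \<in> carrier_mat l l" "mat_poly l B v \<in> carrier_mat l l"
      "mat_poly l B f \<in> carrier_mat l l"
      using B by auto
    have "mat_poly l B u * mat_poly l B f + mat_poly l B v * 0\<^sub>m l l = 1\<^sub>m l"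
      using arg_cong[OF uv, of "mat_poly l B"] B
      by (simp add: mat_poly_add mat_poly_mult g)
    then have one: "mat_poly l B u * mat_poly l B f = 1\<^sub>m l"
      using c by simp
    define N where "N = (-1) \<cdot>\<^sub>m (M * mat_poly l B u)"
    have N: "N \<in> carrier_mat m l" using M c by (simp add: N_def)
    have "M * mat_poly l B u * mat_poly l B f = M"
      using assoc_mult_mat[OF M c(1) c(3)] one M by simp
    then have "N * mat_poly l B f = (-1) \<cdot>\<^sub>m M"
      using mult_smult_assoc_mat[of "M * mat_poly l B u" m l "mat_poly l B f" l "-1"] M c
      by (simp add: N_def)
    moreover have "mat_poly m A f * N = 0\<^sub>m m l" using N f by simp
    moreover have "0\<^sub>m m l - (-1) \<cdot>\<^sub>m M = M" using M by (intro eq_matI) auto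
    ultimately show "M \<in> sylvester_range m l A B"
      using poly_commutator_in_sylvester_range[OF A B N, of f] by simp
  qed
qed

section \<open>Complements of the Sylvester range spanned by matrix units\<close>

definition rect_form :: "nat \<Rightarrow> nat \<Rightarrow> sym mat \<Rightarrow> 'a::field mat set" where
  "rect_form m l D = {M \<in> carrier_mat m l. \<forall>i<m. \<forall>j<l. D $$ (i, j) = Nul \<longrightarrow> M $$ (i, j) = 0}"

text \<open>
  The decomposition into tangent space and form, for a pair of matrices of different sizes: on a
  block matrix \<open>X\<close> the operator \<open>X \<mapsto> XA - AX\<close> with block diagonal \<open>A\<close> acts in this way on each block.
\<close>
definition sylvester_split :: "nat \<Rightarrow> nat \<Rightarrow> 'a::field mat \<Rightarrow> 'a mat \<Rightarrow> sym mat \<Rightarrow> bool" where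
  "sylvester_split m l A B D \<longleftrightarrow> D \<in> carrier_mat m l \<and>
     (\<forall>M\<in>carrier_mat m l. \<exists>Q\<in>rect_form m l D. M - Q \<in> sylvester_range m l A B) \<and>
     (\<forall>M\<in>sylvester_range m l A B \<inter> rect_form m l D. M = 0\<^sub>m m l)"

lemma rect_form_carrier: "M \<in> rect_form m l D \<Longrightarrow> M \<in> carrier_mat m l"
  by (simp add: rect_form_def)

lemma sylvester_split_zero:
  assumes "sylvester_split m l A B D" "X \<in> carrier_mat m l" "X * B - A * X \<in> rect_form m l D"
  shows "X * B - A * X = 0\<^sub>m m l"
  using assms(1,3) sylvester_rangeI[OF assms(2), of B A] unfolding sylvester_split_def by (meson IntI)

lemma tangent_decomposition_if_split:
  assumes A: "A \<in> carrier_mat n n" and s: "sylvester_split n n A A D"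
  shows "tangent_decomposition n A D"
proof -
  have form: "form_space n D = (rect_form n n D :: 'a mat set)"
    by (simp add: form_space_def rect_form_def)
  have "M \<in> {P + Q | P Q. P \<in> tangent_space n A \<and> Q \<in> form_space n D}"
    if M: "M \<in> carrier_mat n n" for M
  proof -
    obtain Q where Q: "Q \<in> rect_form n n D" "M - Q \<in> sylvester_range n n A A"
      using s M by (auto simp: sylvester_split_def)
    have "M = (M - Q) + Q" using M rect_form_carrier[OF Q(1)] by (intro eq_matI) auto
    then show ?thesis using Q by (auto simp: form tangent_space_sylvester)
  qed
  moreover have "M \<in> carrier_mat n n"
    if "M \<in> {P + Q | P Q. P \<in> tangent_space n A \<and> Q \<in> form_space n D}" for M
    using that rect_form_carrier sylvester_range_carrier[OF A A]
    by (fastforce simp: form tangent_space_sylvester intro: add_carrier_mat)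
  moreover have "0\<^sub>m n n \<in> tangent_space n A \<inter> form_space n D"
    using sylvester_range_zero[OF A A] by (auto simp: tangent_space_sylvester form_space_def)
  ultimately show ?thesis
    using s unfolding tangent_decomposition_def sylvester_split_def form[symmetric]
      tangent_space_sylvester[symmetric]
    by blast
qed

lemma sylvester_split_full:
  assumes "sylvester_range m l A B = carrier_mat m l"
  shows "sylvester_split m l A B (0\<^sub>m m l)"
  unfolding sylvester_split_def
proof (intro conjI ballI)
  fix M :: "'a mat" assume M: "M \<in> carrier_mat m l"
  show "\<exists>Q\<in>rect_form m l (0\<^sub>m m l). M - Q \<in> sylvester_range m l A B"
  proof (rule bexI)
    have "M - 0\<^sub>m m l = M" using M by (intro eq_matI) auto
    then show "M - 0\<^sub>m m l \<in> sylvester_range m l A B" using M unfolding assms by simp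
    show "0\<^sub>m m l \<in> rect_form m l (0\<^sub>m m l)" by (simp add: rect_form_def)
  qed
next
  fix M :: "'a mat" assume "M \<in> sylvester_range m l A B \<inter> rect_form m l (0\<^sub>m m l)"
  then show "M = 0\<^sub>m m l"
    by (intro eq_matI) (auto simp: rect_form_def zero_sym_def)
qed auto

subsection \<open>Block matrices\<close>

lemma four_block_exhaust:
  assumes M: "M \<in> carrier_mat (m1 + m2) (l1 + l2)"
  obtains M11 M12 M21 M22 where "M = four_block_mat M11 M12 M21 M22"
    "M11 \<in> carrier_mat m1 l1" "M12 \<in> carrier_mat m1 l2"
    "M21 \<in> carrier_mat m2 l1" "M22 \<in> carrier_mat m2 l2"
proof -
  obtain A1 A2 A3 A4 where sb: "split_block M m1 l1 = (A1, A2, A3, A4)"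
    by (metis prod_cases4)
  show ?thesis
    by (rule that[of A1 A2 A3 A4]) (use split_block[OF sb, of m2 l2] M in auto)
qed

lemma minus_four_block_mat:
  assumes "A1 \<in> carrier_mat m1 l1" "B1 \<in> carrier_mat m1 l2"
    "C1 \<in> carrier_mat m2 l1" "D1 \<in> carrier_mat m2 l2"
    "A2 \<in> carrier_mat m1 l1" "B2 \<in> carrier_mat m1 l2"
    "C2 \<in> carrier_mat m2 l1" "D2 \<in> carrier_mat m2 l2"
  shows "four_block_mat A1 B1 C1 D1 - four_block_mat A2 B2 C2 D2 =
    four_block_mat (A1 - A2) (B1 - B2) (C1 - C2) (D1 - D2)"
  using assms by (intro eq_matI) auto

lemma sylvester_four_block:
  assumes A: "A1 \<in> carrier_mat m1 m1" "A2 \<in> carrier_mat m2 m2"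
    and B: "B1 \<in> carrier_mat l1 l1" "B2 \<in> carrier_mat l2 l2"
    and X: "X11 \<in> carrier_mat m1 l1" "X12 \<in> carrier_mat m1 l2"
      "X21 \<in> carrier_mat m2 l1" "X22 \<in> carrier_mat m2 l2"
  shows "four_block_mat X11 X12 X21 X22 * four_block_mat B1 (0\<^sub>m l1 l2) (0\<^sub>m l2 l1) B2
      - four_block_mat A1 (0\<^sub>m m1 m2) (0\<^sub>m m2 m1) A2 * four_block_mat X11 X12 X21 X22
    = four_block_mat (X11 * B1 - A1 * X11) (X12 * B2 - A1 * X12)
        (X21 * B1 - A2 * X21) (X22 * B2 - A2 * X22)"
proof -
  have "four_block_mat X11 X12 X21 X22 * four_block_mat B1 (0\<^sub>m l1 l2) (0\<^sub>m l2 l1) B2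
      = four_block_mat (X11 * B1) (X12 * B2) (X21 * B1) (X22 * B2)"
    by (subst mult_four_block_mat[OF X B(1) _ _ B(2)]) (use X B in auto)
  moreover have "four_block_mat A1 (0\<^sub>m m1 m2) (0\<^sub>m m2 m1) A2 * four_block_mat X11 X12 X21 X22
      = four_block_mat (A1 * X11) (A1 * X12) (A2 * X21) (A2 * X22)"
    by (subst mult_four_block_mat[OF A(1) _ _ A(2) X]) (use X A in auto)
  ultimately show ?thesis
    by (simp, subst minus_four_block_mat[of _ m1 l1 _ l2 _ m2]) (use A B X in auto)
qed

lemma four_block_rect_form_iff:
  assumes M: "M11 \<in> carrier_mat m1 l1" "M12 \<in> carrier_mat m1 l2"
      "M21 \<in> carrier_mat m2 l1" "M22 \<in> carrier_mat m2 l2"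
    and D: "D11 \<in> carrier_mat m1 l1" "D12 \<in> carrier_mat m1 l2"
      "D21 \<in> carrier_mat m2 l1" "D22 \<in> carrier_mat m2 l2"
  shows "four_block_mat M11 M12 M21 M22
        \<in> rect_form (m1 + m2) (l1 + l2) (four_block_mat D11 D12 D21 D22) \<longleftrightarrow>
    M11 \<in> rect_form m1 l1 D11 \<and> M12 \<in> rect_form m1 l2 D12 \<and>
    M21 \<in> rect_form m2 l1 D21 \<and> M22 \<in> rect_form m2 l2 D22" (is "?M \<in> ?F \<longleftrightarrow> ?R")
proof
  assume ?R
  then show "?M \<in> ?F" using M D by (auto simp: rect_form_def)
next
  assume L: "?M \<in> ?F"
  have e: "?M $$ (i, j) = 0"
    if "four_block_mat D11 D12 D21 D22 $$ (i, j) = Nul" "i < m1 + m2" "j < l1 + l2" for i j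
    using L that by (auto simp: rect_form_def)
  have "M11 $$ (i, j) = 0" if "i < m1" "j < l1" "D11 $$ (i, j) = Nul" for i j
    using e[of i j] that M D by auto
  moreover have "M12 $$ (i, j) = 0" if "i < m1" "j < l2" "D12 $$ (i, j) = Nul" for i j
    using e[of i "l1 + j"] that M D by auto
  moreover have "M21 $$ (i, j) = 0" if "i < m2" "j < l1" "D21 $$ (i, j) = Nul" for i j
    using e[of "m1 + i" "j"] that M D by auto
  moreover have "M22 $$ (i, j) = 0" if "i < m2" "j < l2" "D22 $$ (i, j) = Nul" for i j
    using e[of "m1 + i" "l1 + j"] that M D by auto
  ultimately show ?R using M by (auto simp: rect_form_def)
qed

lemma sylvester_split_four_block:
  assumes A: "A1 \<in> carrier_mat m1 m1" "A2 \<in> carrier_mat m2 m2"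
    and B: "B1 \<in> carrier_mat l1 l1" "B2 \<in> carrier_mat l2 l2"
    and S: "sylvester_split m1 l1 A1 B1 D11" "sylvester_split m1 l2 A1 B2 D12"
      "sylvester_split m2 l1 A2 B1 D21" "sylvester_split m2 l2 A2 B2 D22"
  shows "sylvester_split (m1 + m2) (l1 + l2)
    (four_block_mat A1 (0\<^sub>m m1 m2) (0\<^sub>m m2 m1) A2)
    (four_block_mat B1 (0\<^sub>m l1 l2) (0\<^sub>m l2 l1) B2) (four_block_mat D11 D12 D21 D22)"
    (is "sylvester_split ?m ?l ?A ?B ?D")
proof -
  have D: "D11 \<in> carrier_mat m1 l1" "D12 \<in> carrier_mat m1 l2"
      "D21 \<in> carrier_mat m2 l1" "D22 \<in> carrier_mat m2 l2"
    using S by (auto simp: sylvester_split_def)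
  show ?thesis unfolding sylvester_split_def
  proof (intro conjI ballI)
    show "?D \<in> carrier_mat ?m ?l" using D by auto
  next
    fix M :: "'a mat" assume "M \<in> carrier_mat ?m ?l"
    then obtain M11 M12 M21 M22 where M: "M = four_block_mat M11 M12 M21 M22"
      and Mc: "M11 \<in> carrier_mat m1 l1" "M12 \<in> carrier_mat m1 l2"
        "M21 \<in> carrier_mat m2 l1" "M22 \<in> carrier_mat m2 l2"
      by (rule four_block_exhaust)
    obtain Q11 where Q11: "Q11 \<in> rect_form m1 l1 D11" "M11 - Q11 \<in> sylvester_range m1 l1 A1 B1"
      using S(1) Mc by (auto simp: sylvester_split_def)
    obtain Q12 where Q12: "Q12 \<in> rect_form m1 l2 D12" "M12 - Q12 \<in> sylvester_range m1 l2 A1 B2"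
      using S(2) Mc by (auto simp: sylvester_split_def)
    obtain Q21 where Q21: "Q21 \<in> rect_form m2 l1 D21" "M21 - Q21 \<in> sylvester_range m2 l1 A2 B1"
      using S(3) Mc by (auto simp: sylvester_split_def)
    obtain Q22 where Q22: "Q22 \<in> rect_form m2 l2 D22" "M22 - Q22 \<in> sylvester_range m2 l2 A2 B2"
      using S(4) Mc by (auto simp: sylvester_split_def)
    note Qc = Q11(1)[THEN rect_form_carrier] Q12(1)[THEN rect_form_carrier]
      Q21(1)[THEN rect_form_carrier] Q22(1)[THEN rect_form_carrier]
    obtain X11 where X11: "X11 \<in> carrier_mat m1 l1" "M11 - Q11 = X11 * B1 - A1 * X11"
      using Q11(2) by (rule sylvester_rangeE)
    obtain X12 where X12: "X12 \<in> carrier_mat m1 l2" "M12 - Q12 = X12 * B2 - A1 * X12"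
      using Q12(2) by (rule sylvester_rangeE)
    obtain X21 where X21: "X21 \<in> carrier_mat m2 l1" "M21 - Q21 = X21 * B1 - A2 * X21"
      using Q21(2) by (rule sylvester_rangeE)
    obtain X22 where X22: "X22 \<in> carrier_mat m2 l2" "M22 - Q22 = X22 * B2 - A2 * X22"
      using Q22(2) by (rule sylvester_rangeE)
    note X = X11(1) X12(1) X21(1) X22(1) and eqs = X11(2) X12(2) X21(2) X22(2)
    let ?Q = "four_block_mat Q11 Q12 Q21 Q22" and ?X = "four_block_mat X11 X12 X21 X22"
    have "M - ?Q = ?X * ?B - ?A * ?X"
      unfolding M minus_four_block_mat[OF Mc Qc] eqs sylvester_four_block[OF A B X] ..
    moreover have "?X \<in> carrier_mat ?m ?l" using X by auto
    ultimately have "M - ?Q \<in> sylvester_range ?m ?l ?A ?B" by (simp add: sylvester_rangeI)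
    moreover have "?Q \<in> rect_form ?m ?l ?D"
      using four_block_rect_form_iff[OF Qc D] Q11 Q12 Q21 Q22 by auto
    ultimately show "\<exists>Q\<in>rect_form ?m ?l ?D. M - Q \<in> sylvester_range ?m ?l ?A ?B" by blast
  next
    fix M :: "'a mat" assume "M \<in> sylvester_range ?m ?l ?A ?B \<inter> rect_form ?m ?l ?D"
    then obtain X where X: "X \<in> carrier_mat ?m ?l" and MX: "M = X * ?B - ?A * X"
      and MF: "M \<in> rect_form ?m ?l ?D"
      by (auto simp: sylvester_range_def)
    obtain X11 X12 X21 X22 where Xb: "X = four_block_mat X11 X12 X21 X22"
      and Xc: "X11 \<in> carrier_mat m1 l1" "X12 \<in> carrier_mat m1 l2"
        "X21 \<in> carrier_mat m2 l1" "X22 \<in> carrier_mat m2 l2"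
      using X by (rule four_block_exhaust)
    let ?M11 = "X11 * B1 - A1 * X11" and ?M12 = "X12 * B2 - A1 * X12"
      and ?M21 = "X21 * B1 - A2 * X21" and ?M22 = "X22 * B2 - A2 * X22"
    have M: "M = four_block_mat ?M11 ?M12 ?M21 ?M22"
      unfolding MX Xb sylvester_four_block[OF A B Xc] ..
    have Mc: "?M11 \<in> carrier_mat m1 l1" "?M12 \<in> carrier_mat m1 l2"
        "?M21 \<in> carrier_mat m2 l1" "?M22 \<in> carrier_mat m2 l2"
      using A B Xc by auto
    note forms = MF[unfolded M four_block_rect_form_iff[OF Mc D]]
    have "?M11 = 0\<^sub>m m1 l1" using S(1) Xc(1) forms by (auto intro: sylvester_split_zero)
    moreover have "?M12 = 0\<^sub>m m1 l2" using S(2) Xc(2) forms by (auto intro: sylvester_split_zero)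
    moreover have "?M21 = 0\<^sub>m m2 l1" using S(3) Xc(3) forms by (auto intro: sylvester_split_zero)
    moreover have "?M22 = 0\<^sub>m m2 l2" using S(4) Xc(4) forms by (auto intro: sylvester_split_zero)
    ultimately show "M = 0\<^sub>m ?m ?l" unfolding M by simp
  qed
qed

subsection \<open>Cyclic vectors\<close>

lemma index_mult_mat_sum:
  assumes "A \<in> carrier_mat a b" "B \<in> carrier_mat b c" "i < a" "j < c"
  shows "(A * B) $$ (i, j) = (\<Sum>k<b. A $$ (i, k) * B $$ (k, j))"
  using assms by (simp add: scalar_prod_def lessThan_atLeast0)

lemma mat_poly_sum_index:
  assumes A: "A \<in> carrier_mat n n" and "r < n" "c < n"
  shows "mat_poly n A (\<Sum>i\<in>I. f i) $$ (r, c) = (\<Sum>i\<in>I. mat_poly n A (f i) $$ (r, c))"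
proof (induction I rule: infinite_finite_induct)
  case (insert i I)
  have "mat_poly n A (f i) \<in> carrier_mat n n" "mat_poly n A (sum f I) \<in> carrier_mat n n"
    using A by auto
  then show ?case using insert assms by (simp add: mat_poly_add[OF A])
qed (use assms in auto)

text \<open>
  Let \<open>e\<^sub>v\<close> be a cyclic vector of \<open>\<Phi>\<close>, with \<open>e\<^sub>i = p\<^sub>i(\<Phi>) e\<^sub>v\<close>. A matrix with rows \<open>w\<^sub>i\<close> is
  \<open>\<Sum> p\<^sub>i(\<Phi>) e\<^sub>v w\<^sub>i\<close>, which is congruent to \<open>\<Sum> e\<^sub>v w\<^sub>i p\<^sub>i(\<Psi>)\<close> modulo the range; so the matrices
  supported in row \<open>v\<close> span a complement. They meet the range only in \<open>0\<close>: the functional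
  \<open>M \<mapsto> \<Sum> w\<^sub>i p\<^sub>i(\<Psi>)\<close> vanishes on the range and recovers row \<open>v\<close> of a matrix supported there.
\<close>
lemma cyclic_row_split:
  fixes \<Phi> \<Psi> :: "'a::field mat" and p :: "nat \<Rightarrow> 'a poly"
  assumes Phi: "\<Phi> \<in> carrier_mat m m" and Psi: "\<Psi> \<in> carrier_mat l l" and v: "v < m"
    and pv: "p v = 1"
    and rel: "\<And>k. k < m \<Longrightarrow>
      mat_poly l \<Psi> ((\<Sum>i<m. Polynomial.smult (\<Phi> $$ (i, k)) (p i)) - pCons 0 (p k)) = 0\<^sub>m l l"
    and cyc: "\<And>i r. i < m \<Longrightarrow> r < m \<Longrightarrow>
      mat_poly m \<Phi> (p i) $$ (r, v) = (if r = i then 1 else 0)"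
    and D: "D \<in> carrier_mat m l"
    and star: "\<And>i j. i < m \<Longrightarrow> j < l \<Longrightarrow> D $$ (i, j) = (if i = v then Star else Nul)"
  shows "sylvester_split m l \<Phi> \<Psi> D"
proof -
  define P where "P i = mat_poly l \<Psi> (p i)" for i
  have P [simp]: "P i \<in> carrier_mat l l" for i using Psi by (simp add: P_def)
  have form: "M \<in> rect_form m l D \<longleftrightarrow>
      M \<in> carrier_mat m l \<and> (\<forall>i<m. \<forall>j<l. i \<noteq> v \<longrightarrow> M $$ (i, j) = 0)" for M :: "'a mat"
    using star by (auto simp: rect_form_def)
  have rel': "(\<Sum>i<m. \<Phi> $$ (i, k) * P i $$ (d, c)) = (\<Psi> * P k) $$ (d, c)"
    if "k < m" "d < l" "c < l" for k d c
  proof -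
    have "mat_poly l \<Psi> (\<Sum>i<m. Polynomial.smult (\<Phi> $$ (i, k)) (p i)) - mat_poly l \<Psi> (pCons 0 (p k))
        = 0\<^sub>m l l"
      using rel[OF that(1)] by (simp only: mat_poly_minus[OF Psi])
    moreover have "mat_poly l \<Psi> (pCons 0 (p k)) = \<Psi> * P k"
      using Psi P[of k] by (simp add: P_def) (intro eq_matI, auto)
    ultimately have "mat_poly l \<Psi> (\<Sum>i<m. Polynomial.smult (\<Phi> $$ (i, k)) (p i)) - \<Psi> * P k = 0\<^sub>m l l"
      by simp
    then have "(mat_poly l \<Psi> (\<Sum>i<m. Polynomial.smult (\<Phi> $$ (i, k)) (p i)) - \<Psi> * P k) $$ (d, c) = 0"
      using that by simp
    then have "mat_poly l \<Psi> (\<Sum>i<m. Polynomial.smult (\<Phi> $$ (i, k)) (p i)) $$ (d, c)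
        = (\<Psi> * P k) $$ (d, c)"
      using that Psi P[of k] by (simp del: index_mult_mat(1))
    moreover have "mat_poly l \<Psi> (Polynomial.smult (\<Phi> $$ (i, k)) (p i)) $$ (d, c)
        = \<Phi> $$ (i, k) * P i $$ (d, c)" for i
      using that P[of i] by (simp add: mat_poly_smult[OF Psi] P_def)
    ultimately show ?thesis by (simp add: mat_poly_sum_index[OF Psi that(2,3)])
  qed
  have exists: "\<exists>Q\<in>rect_form m l D. M - Q \<in> sylvester_range m l \<Phi> \<Psi>"
    if M: "M \<in> carrier_mat m l" for M
  proof -
    define R where "R k = mat m l (\<lambda>(i, j). if i < k then M $$ (i, j) else 0)" for k
    have R [simp]: "R k \<in> carrier_mat m l" for k by (simp add: R_def)
    have "\<exists>Q\<in>rect_form m l D. R k - Q \<in> sylvester_range m l \<Phi> \<Psi>" if "k \<le> m" for k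
      using that
    proof (induction k)
      case 0
      have "R 0 - 0\<^sub>m m l = 0\<^sub>m m l" by (intro eq_matI) (auto simp: R_def)
      moreover have "(0\<^sub>m m l :: 'a mat) \<in> rect_form m l D" by (auto simp: form)
      ultimately show ?case using sylvester_range_zero[OF Phi Psi] by metis
    next
      case (Suc k)
      then obtain Q where Q: "Q \<in> rect_form m l D" "R k - Q \<in> sylvester_range m l \<Phi> \<Psi>" by auto
      define W where "W = mat m l (\<lambda>(i, j). if i = v then M $$ (k, j) else 0)"
      have W: "W \<in> carrier_mat m l" by (simp add: W_def)
      have PW: "mat_poly m \<Phi> (p k) \<in> carrier_mat m m" using Phi by simp
      have "(mat_poly m \<Phi> (p k) * W) $$ (i, j) = (if i = k then M $$ (k, j) else 0)"
        if "i < m" "j < l" for i j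
      proof -
        have "(mat_poly m \<Phi> (p k) * W) $$ (i, j)
            = (\<Sum>s<m. mat_poly m \<Phi> (p k) $$ (i, s) * W $$ (s, j))"
          using that by (intro index_mult_mat_sum[OF PW W])
        also have "\<dots> = (\<Sum>s<m. if s = v then mat_poly m \<Phi> (p k) $$ (i, v) * M $$ (k, j) else 0)"
          using that by (intro sum.cong) (auto simp: W_def)
        also have "\<dots> = mat_poly m \<Phi> (p k) $$ (i, v) * M $$ (k, j)" using v by simp
        finally show ?thesis using cyc[of k i] that Suc.prems by simp
      qed
      note PWi = this
      have "(W * P k) $$ (i, j) = 0" if "i < m" "j < l" "i \<noteq> v" for i j
        using that by (subst index_mult_mat_sum[OF W P]) (auto simp: W_def)
      then have "Q + W * P k \<in> rect_form m l D"
      proof -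
        have "U + V \<in> rect_form m l D"
          if "U \<in> rect_form m l D" "V \<in> carrier_mat m l"
            "\<And>i j. i < m \<Longrightarrow> j < l \<Longrightarrow> i \<noteq> v \<Longrightarrow> V $$ (i, j) = 0" for U V :: "'a mat"
          using that by (auto simp: form)
        from this[OF Q(1) mult_carrier_mat[OF W P]] show ?thesis
          using \<open>\<And>i j. i < m \<Longrightarrow> j < l \<Longrightarrow> i \<noteq> v \<Longrightarrow> (W * P k) $$ (i, j) = 0\<close> by blast
      qed
      moreover have "R (Suc k) - (Q + W * P k) = (R k - Q) + (mat_poly m \<Phi> (p k) * W - W * P k)"
      proof -
        have "R (Suc k) = R k + mat_poly m \<Phi> (p k) * W"
          using PW W PWi by (intro eq_matI) (auto simp: R_def less_Suc_eq simp del: index_mult_mat(1))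
        moreover have "R k + U - (Q + V) = (R k - Q) + (U - V)"
          if "U \<in> carrier_mat m l" "V \<in> carrier_mat m l" for U V
          using that rect_form_carrier[OF Q(1)] R[of k] by (intro eq_matI) auto
        ultimately show ?thesis using PW W P[of k] by simp
      qed
      ultimately show ?case
        using sylvester_range_add[OF Phi Psi Q(2) poly_commutator_in_sylvester_range[OF Phi Psi W, of "p k"]]
        unfolding P_def by metis
    qed
    moreover have "R m = M" using M by (intro eq_matI) (auto simp: R_def)
    ultimately show ?thesis by (metis order_refl)
  qed
  have unique: "M = 0\<^sub>m m l" if MM: "M \<in> sylvester_range m l \<Phi> \<Psi> \<inter> rect_form m l D" for M
  proof -
    obtain X where X: "X \<in> carrier_mat m l" and MX: "M = X * \<Psi> - \<Phi> * X"
      using MM by (auto simp: sylvester_range_def)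
    have M: "M \<in> carrier_mat m l" and M0: "\<And>i j. i < m \<Longrightarrow> j < l \<Longrightarrow> i \<noteq> v \<Longrightarrow> M $$ (i, j) = 0"
      using MM form by auto
    have "M $$ (v, c) = 0" if c: "c < l" for c
    proof -
      have Pv: "P v = 1\<^sub>m l" using Psi by (simp add: P_def pv)
      have "(\<Sum>i<m. \<Sum>d<l. M $$ (i, d) * P i $$ (d, c))
          = (\<Sum>i<m. if i = v then M $$ (v, c) else 0)"
      proof (rule sum.cong)
        fix i assume i: "i \<in> {..<m}"
        have "(\<Sum>d<l. M $$ (v, d) * P v $$ (d, c)) = (M * P v) $$ (v, c)"
          using index_mult_mat_sum[OF M P v c] by simp
        also have "\<dots> = M $$ (v, c)" using M by (simp add: Pv)
        finally show "(\<Sum>d<l. M $$ (i, d) * P i $$ (d, c)) = (if i = v then M $$ (v, c) else 0)"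
          using i M0 by (cases "i = v") simp_all
      qed simp
      then have 1: "(\<Sum>i<m. \<Sum>d<l. M $$ (i, d) * P i $$ (d, c)) = M $$ (v, c)"
        using v by simp
      have PsP: "\<Psi> * P k \<in> carrier_mat l l" for k using Psi P by (rule mult_carrier_mat)
      have XP: "X * \<Psi> \<in> carrier_mat m l" and PX: "\<Phi> * X \<in> carrier_mat m l"
        using X Phi Psi by auto
      have "(\<Sum>i<m. \<Sum>d<l. (X * \<Psi>) $$ (i, d) * P i $$ (d, c))
          = (\<Sum>i<m. \<Sum>d<l. X $$ (i, d) * (\<Psi> * P i) $$ (d, c))"
      proof (rule sum.cong)
        fix i assume "i \<in> {..<m}"
        then have i: "i < m" by simp
        have "(\<Sum>d<l. (X * \<Psi>) $$ (i, d) * P i $$ (d, c)) = (X * \<Psi> * P i) $$ (i, c)"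
          using index_mult_mat_sum[OF XP P i c] by simp
        also have "\<dots> = (X * (\<Psi> * P i)) $$ (i, c)" using assoc_mult_mat[OF X Psi P] by simp
        also have "\<dots> = (\<Sum>d<l. X $$ (i, d) * (\<Psi> * P i) $$ (d, c))"
          by (rule index_mult_mat_sum[OF X PsP i c])
        finally show "(\<Sum>d<l. (X * \<Psi>) $$ (i, d) * P i $$ (d, c))
          = (\<Sum>d<l. X $$ (i, d) * (\<Psi> * P i) $$ (d, c))" .
      qed simp
      moreover have "(\<Sum>i<m. \<Sum>d<l. (\<Phi> * X) $$ (i, d) * P i $$ (d, c))
          = (\<Sum>k<m. \<Sum>d<l. X $$ (k, d) * (\<Psi> * P k) $$ (d, c))"
      proof -
        have "(\<Sum>i<m. \<Sum>d<l. (\<Phi> * X) $$ (i, d) * P i $$ (d, c))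
            = (\<Sum>i<m. \<Sum>d<l. \<Sum>k<m. X $$ (k, d) * (\<Phi> $$ (i, k) * P i $$ (d, c)))"
          by (intro sum.cong refl) (simp add: index_mult_mat_sum[OF Phi X] sum_distrib_left
              sum_distrib_right mult_ac del: index_mult_mat(1))
        also have "\<dots> = (\<Sum>d<l. \<Sum>i<m. \<Sum>k<m. X $$ (k, d) * (\<Phi> $$ (i, k) * P i $$ (d, c)))"
          by (rule sum.swap)
        also have "\<dots> = (\<Sum>d<l. \<Sum>k<m. \<Sum>i<m. X $$ (k, d) * (\<Phi> $$ (i, k) * P i $$ (d, c)))"
          by (intro sum.cong refl sum.swap)
        also have "\<dots> = (\<Sum>d<l. \<Sum>k<m. X $$ (k, d) * (\<Psi> * P k) $$ (d, c))"
          using c by (intro sum.cong refl) (simp add: rel'[symmetric] sum_distrib_left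
              del: index_mult_mat(1))
        also have "\<dots> = (\<Sum>k<m. \<Sum>d<l. X $$ (k, d) * (\<Psi> * P k) $$ (d, c))"
          by (rule sum.swap)
        finally show ?thesis .
      qed
      moreover have "(\<Sum>i<m. \<Sum>d<l. M $$ (i, d) * P i $$ (d, c))
          = (\<Sum>i<m. \<Sum>d<l. (X * \<Psi>) $$ (i, d) * P i $$ (d, c))
            - (\<Sum>i<m. \<Sum>d<l. (\<Phi> * X) $$ (i, d) * P i $$ (d, c))"
      proof -
        have "M $$ (i, d) = (X * \<Psi>) $$ (i, d) - (\<Phi> * X) $$ (i, d)" if "i < m" "d < l" for i d
          unfolding MX by (rule index_minus_mat(1)) (use that carrier_matD[OF PX] in simp_all)
        then show ?thesis
          by (simp add: sum_subtractf[symmetric] left_diff_distrib del: index_mult_mat(1))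
      qed
      ultimately show ?thesis using 1 by simp
    qed
    then have "M $$ (i, j) = 0" if "i < m" "j < l" for i j
      using M0 that by (cases "i = v") auto
    then show ?thesis using M by (intro eq_matI) auto
  qed
  show ?thesis using D exists unique by (auto simp: sylvester_split_def)
qed

lemma sylvester_range_transpose:
  assumes A: "A \<in> carrier_mat m m" and B: "B \<in> carrier_mat l l"
    and "M \<in> sylvester_range m l A B"
  shows "transpose_mat M \<in> sylvester_range l m (transpose_mat B) (transpose_mat A)"
proof -
  obtain X where X: "X \<in> carrier_mat m l" "M = X * B - A * X"
    using assms(3) by (auto simp: sylvester_range_def)
  define Y where "Y = (-1) \<cdot>\<^sub>m transpose_mat X"
  have Y: "Y \<in> carrier_mat l m" using X by (simp add: Y_def)
  have Xt: "transpose_mat X \<in> carrier_mat l m" using X by simp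
  have t1: "transpose_mat (X * B) = transpose_mat B * transpose_mat X"
    by (rule transpose_mult[OF X(1) B])
  have t2: "transpose_mat (A * X) = transpose_mat X * transpose_mat A"
    by (rule transpose_mult[OF A X(1)])
  have "Y * transpose_mat A = (-1) \<cdot>\<^sub>m (transpose_mat X * transpose_mat A)"
    unfolding Y_def using mult_smult_assoc_mat[OF Xt, of "transpose_mat A" m "-1"] A by simp
  moreover have "transpose_mat B * Y = (-1) \<cdot>\<^sub>m (transpose_mat B * transpose_mat X)"
    unfolding Y_def using mult_smult_distrib[of "transpose_mat B" l l _ m "-1", OF _ Xt] B by simp
  moreover have "transpose_mat (U - V) = (-1) \<cdot>\<^sub>m transpose_mat V - (-1) \<cdot>\<^sub>m transpose_mat U"
    if "U \<in> carrier_mat m l" "V \<in> carrier_mat m l" for U V :: "'a mat"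
    using that by (intro eq_matI) auto
  ultimately have "transpose_mat M = Y * transpose_mat A - transpose_mat B * Y"
    using X A B t1 t2 by simp
  then show ?thesis using sylvester_rangeI[OF Y] by simp
qed

lemma rect_form_transpose:
  assumes "D \<in> carrier_mat m l" "M \<in> rect_form m l D"
  shows "transpose_mat M \<in> rect_form l m (transpose_mat D)"
  using assms by (auto simp: rect_form_def)

text \<open>By transposition the form \<open>0\<^sup>\<leftarrow>\<close> becomes the form with stars in row \<open>0\<close>, the case \<open>v = 0\<close> of \<open>cyclic_row_split\<close>.\<close>
lemma sylvester_split_transpose:
  assumes A: "A \<in> carrier_mat m m" and B: "B \<in> carrier_mat l l"
    and s: "sylvester_split l m (transpose_mat B) (transpose_mat A) (transpose_mat D)"
  shows "sylvester_split m l A B D"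
proof -
  have At: "transpose_mat A \<in> carrier_mat m m" and Bt: "transpose_mat B \<in> carrier_mat l l"
    using A B by auto
  have Dt: "transpose_mat D \<in> carrier_mat l m" using s by (simp add: sylvester_split_def)
  then have D: "D \<in> carrier_mat m l" by simp
  show ?thesis unfolding sylvester_split_def
  proof (intro conjI ballI)
    show "D \<in> carrier_mat m l" by (rule D)
  next
    fix M :: "'a mat" assume M: "M \<in> carrier_mat m l"
    then have "transpose_mat M \<in> carrier_mat l m" by simp
    then obtain Q where Q: "Q \<in> rect_form l m (transpose_mat D)"
      "transpose_mat M - Q \<in> sylvester_range l m (transpose_mat B) (transpose_mat A)"
      using s unfolding sylvester_split_def by blast
    have "transpose_mat (transpose_mat M - Q) = M - transpose_mat Q"
      using M rect_form_carrier[OF Q(1)] by (intro eq_matI) auto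
    then have "M - transpose_mat Q \<in> sylvester_range m l A B"
      using sylvester_range_transpose[OF Bt At Q(2)] by simp
    then show "\<exists>Q\<in>rect_form m l D. M - Q \<in> sylvester_range m l A B"
      using rect_form_transpose[OF Dt Q(1)] by auto
  next
    fix M :: "'a mat" assume M: "M \<in> sylvester_range m l A B \<inter> rect_form m l D"
    then have "transpose_mat M \<in> sylvester_range l m (transpose_mat B) (transpose_mat A)
        \<inter> rect_form l m (transpose_mat D)"
      using sylvester_range_transpose[OF A B] rect_form_transpose[OF D] by blast
    then have "transpose_mat M = 0\<^sub>m l m" using s unfolding sylvester_split_def by blast
    then have "transpose_mat (transpose_mat M) = 0\<^sub>m m l" by simp
    then show "M = 0\<^sub>m m l" by simp
  qed
qed

section \<open>Cyclic blocks\<close>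

text \<open>
  Which matrices \<open>\<Psi>\<close> can stand opposite to \<open>\<Phi>\<close> depends only on whether \<open>g\<close> annihilates them. So
  \<open>\<Psi>\<close> may be \<open>\<Phi>\<close> itself, or the direct sum of all blocks whose polynomials divide \<open>g\<close>.
\<close>
definition cyclic_block :: "'a::field mat \<Rightarrow> 'a poly \<Rightarrow> bool" where
  "cyclic_block \<Phi> g \<longleftrightarrow> (let m = dim_row \<Phi> in
     0 < m \<and> \<Phi> \<in> carrier_mat m m \<and> mat_poly m \<Phi> g = 0\<^sub>m m m \<and>
     (\<forall>l \<Psi>. \<Psi> \<in> carrier_mat l l \<longrightarrow> mat_poly l \<Psi> g = 0\<^sub>m l l \<longrightarrow>
        sylvester_split m l \<Phi> \<Psi> (stars_down m l) \<and> sylvester_split l m \<Psi> \<Phi> (stars_left l m)))"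

lemma cyclic_block_annihilated:
  assumes "cyclic_block \<Phi> g" "dim_row \<Phi> = m"
  shows "0 < m" "\<Phi> \<in> carrier_mat m m" "mat_poly m \<Phi> g = 0\<^sub>m m m"
  using assms by (auto simp: cyclic_block_def Let_def)

lemma cyclic_block_split:
  assumes "cyclic_block \<Phi> g" "dim_row \<Phi> = m" "\<Psi> \<in> carrier_mat l l" "mat_poly l \<Psi> g = 0\<^sub>m l l"
  shows "sylvester_split m l \<Phi> \<Psi> (stars_down m l)" "sylvester_split l m \<Psi> \<Phi> (stars_left l m)"
  using assms by (auto simp: cyclic_block_def Let_def)

text \<open>
  The polynomials \<open>p\<^sub>i\<close> produce the unit vectors from the last one, and the \<open>q\<^sub>i\<close> produce the unit row
  vectors from the first one; this is where the position of the stars comes from.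
\<close>
lemma cyclic_blockI:
  fixes \<Phi> :: "'a::field mat"
  assumes Phi: "\<Phi> \<in> carrier_mat m m" and m: "0 < m" and g: "mat_poly m \<Phi> g = 0\<^sub>m m m"
    and p: "p (m - 1) = 1"
      "\<And>k. k < m \<Longrightarrow> g dvd (\<Sum>i<m. Polynomial.smult (\<Phi> $$ (i, k)) (p i)) - pCons 0 (p k)"
      "\<And>i r. i < m \<Longrightarrow> r < m \<Longrightarrow> mat_poly m \<Phi> (p i) $$ (r, m - 1) = (if r = i then 1 else 0)"
    and q: "q 0 = 1"
      "\<And>k. k < m \<Longrightarrow> g dvd (\<Sum>i<m. Polynomial.smult (\<Phi> $$ (k, i)) (q i)) - pCons 0 (q k)"
      "\<And>i r. i < m \<Longrightarrow> r < m \<Longrightarrow> mat_poly m \<Phi> (q i) $$ (0, r) = (if r = i then 1 else 0)"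
  shows "cyclic_block \<Phi> g"
proof -
  have dim: "dim_row \<Phi> = m" using Phi by simp
  have "sylvester_split m l \<Phi> \<Psi> (stars_down m l) \<and> sylvester_split l m \<Psi> \<Phi> (stars_left l m)"
    if Psi: "\<Psi> \<in> carrier_mat l l" and gPsi: "mat_poly l \<Psi> g = 0\<^sub>m l l" for l \<Psi>
  proof
    show "sylvester_split m l \<Phi> \<Psi> (stars_down m l)"
      by (rule cyclic_row_split[OF Phi Psi _ p(1) _ p(3)])
        (use m mat_poly_dvd_zero[OF Psi p(2) gPsi] in \<open>auto simp: stars_down_def\<close>)
    have Phit: "transpose_mat \<Phi> \<in> carrier_mat m m" and Psit: "transpose_mat \<Psi> \<in> carrier_mat l l"
      using Phi Psi by auto
    have gt: "mat_poly l (transpose_mat \<Psi>) g = 0\<^sub>m l l"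
      using mat_poly_transpose[OF Psi, of g] gPsi by simp
    have sum: "(\<Sum>i<m. Polynomial.smult (transpose_mat \<Phi> $$ (i, k)) (q i))
        = (\<Sum>i<m. Polynomial.smult (\<Phi> $$ (k, i)) (q i))" if "k < m" for k
      using that Phi by (intro sum.cong) auto
    show "sylvester_split l m \<Psi> \<Phi> (stars_left l m)"
    proof (rule sylvester_split_transpose[OF Psi Phi],
        rule cyclic_row_split[OF Phit Psit, of 0 q])
      show "mat_poly l \<Psi>\<^sup>T ((\<Sum>i<m. Polynomial.smult (\<Phi>\<^sup>T $$ (i, k)) (q i)) - pCons 0 (q k)) = 0\<^sub>m l l"
        if "k < m" for k
        unfolding sum[OF that] by (rule mat_poly_dvd_zero[OF Psit q(2)[OF that] gt])
      show "mat_poly m \<Phi>\<^sup>T (q i) $$ (r, 0) = (if r = i then 1 else 0)" if "i < m" "r < m" for i r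
        using that q(3)[OF that] m Phi by (simp add: mat_poly_transpose[OF Phi])
    qed (use m q in \<open>auto simp: stars_left_def\<close>)
  qed
  then show ?thesis using m Phi g by (simp add: cyclic_block_def dim)
qed

text \<open>
  A relation between the \<open>p\<^sub>i\<close> holds on the cyclic vector because it says \<open>\<Phi>e\<^sub>k = \<Sum> \<Phi>\<^sub>i\<^sub>k e\<^sub>i\<close>; being a
  polynomial in \<open>\<Phi>\<close>, it then holds on everything. For companion matrices this is the
  Cayley--Hamilton theorem.
\<close>
lemma cyclic_relation_annihilates:
  fixes \<Phi> :: "'a::field mat"
  assumes Phi: "\<Phi> \<in> carrier_mat m m" and v: "v < m" and k: "k < m"
    and cyc: "\<And>i r. i < m \<Longrightarrow> r < m \<Longrightarrow> mat_poly m \<Phi> (p i) $$ (r, v) = (if r = i then 1 else 0)"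
  shows "mat_poly m \<Phi> ((\<Sum>i<m. Polynomial.smult (\<Phi> $$ (i, k)) (p i)) - pCons 0 (p k)) = 0\<^sub>m m m"
    (is "mat_poly m \<Phi> ?h = _")
proof -
  let ?H = "mat_poly m \<Phi> ?h"
  have H: "?H \<in> carrier_mat m m" using Phi by simp
  have pk: "mat_poly m \<Phi> (p i) \<in> carrier_mat m m" for i using Phi by simp
  have Hv: "?H $$ (r, v) = 0" if r: "r < m" for r
  proof -
    have "mat_poly m \<Phi> (\<Sum>i<m. Polynomial.smult (\<Phi> $$ (i, k)) (p i)) $$ (r, v)
        = (\<Sum>i<m. if i = r then \<Phi> $$ (r, k) else 0)"
      unfolding mat_poly_sum_index[OF Phi r v]
      by (intro sum.cong refl) (use r v cyc Phi in \<open>simp add: mat_poly_smult\<close>)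
    also have "\<dots> = \<Phi> $$ (r, k)" using r by simp
    finally have 1: "mat_poly m \<Phi> (\<Sum>i<m. Polynomial.smult (\<Phi> $$ (i, k)) (p i)) $$ (r, v) = \<Phi> $$ (r, k)" .
    have "mat_poly m \<Phi> (pCons 0 (p k)) = \<Phi> * mat_poly m \<Phi> (p k)"
      using Phi pk[of k] by simp (intro eq_matI, auto)
    then have "mat_poly m \<Phi> (pCons 0 (p k)) $$ (r, v)
        = (\<Sum>s<m. \<Phi> $$ (r, s) * mat_poly m \<Phi> (p k) $$ (s, v))"
      using index_mult_mat_sum[OF Phi pk r v] by simp
    also have "\<dots> = (\<Sum>s<m. if s = k then \<Phi> $$ (r, k) else 0)"
      by (intro sum.cong) (use k cyc in auto)
    also have "\<dots> = \<Phi> $$ (r, k)" using k by simp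
    finally show ?thesis
      using 1 r v Phi by (simp only: mat_poly_minus[OF Phi]) (simp del: mat_poly_pCons)
  qed
  have "?H $$ (r, i) = 0" if r: "r < m" and i: "i < m" for r i
  proof -
    have "?H * mat_poly m \<Phi> (p i) = mat_poly m \<Phi> (p i) * ?H"
      by (simp only: mat_poly_mult[OF Phi, symmetric] mult.commute)
    then have "(\<Sum>s<m. ?H $$ (r, s) * mat_poly m \<Phi> (p i) $$ (s, v))
        = (\<Sum>s<m. mat_poly m \<Phi> (p i) $$ (r, s) * ?H $$ (s, v))"
      using index_mult_mat_sum[OF H pk r v, of i] index_mult_mat_sum[OF pk H r v, of i] by simp
    also have "\<dots> = 0" using Hv by simp
    finally have "(\<Sum>s<m. if s = i then ?H $$ (r, i) else 0) = 0"
      using cyc[OF i] by (smt (verit) lessThan_iff mult.right_neutral mult_zero_right sum.cong)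
    then show ?thesis using i by simp
  qed
  then show ?thesis using H by (intro eq_matI) auto
qed

subsection \<open>Companion matrices\<close>

text \<open>
  \<open>companion_poly c j\<close> is \<open>x\<^sup>j + c\<^sub>1 x\<^sup>j\<^sup>-\<^sup>1 + \<dots> + c\<^sub>j\<close>, built by Horner's rule; the intermediate
  values express the unit vectors through the last one.
\<close>
primrec companion_poly :: "(nat \<Rightarrow> 'a::field) \<Rightarrow> nat \<Rightarrow> 'a poly" where
  "companion_poly c 0 = 1"
| "companion_poly c (Suc j) = pCons (c (Suc j)) (companion_poly c j)"

lemma companion_poly_expand:
  "companion_poly c j = [:0, 1:] ^ j + (\<Sum>i<j. Polynomial.smult (c (j - i)) ([:0, 1:] ^ i))"
proof (induction j)
  case (Suc j)
  have "pCons a p = [:a:] + [:0, 1:] * p" for a :: 'a and p by simp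
  then have "companion_poly c (Suc j) = [:c (Suc j):] + [:0, 1:] * companion_poly c j"
    by (metis companion_poly.simps(2))
  also have "[:0, 1:] * companion_poly c j = [:0, 1:] ^ Suc j
      + (\<Sum>i<j. Polynomial.smult (c (j - i)) ([:0, 1:] ^ Suc i))"
    unfolding Suc by (simp only: distrib_left sum_distrib_left mult_smult_right power_Suc)
  also have "[:c (Suc j):] + ([:0, 1:] ^ Suc j
      + (\<Sum>i<j. Polynomial.smult (c (j - i)) ([:0, 1:] ^ Suc i))) = [:0, 1:] ^ Suc j
      + (\<Sum>i<Suc j. Polynomial.smult (c (Suc j - i)) ([:0, 1:] ^ i))"
    by (subst sum.lessThan_Suc_shift) (simp add: algebra_simps)
  finally show ?case .
qed simp

lemma companion_poly_degree: "degree (companion_poly c j) = j" "monic (companion_poly c j)"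
proof -
  have "companion_poly c j \<noteq> 0 \<and> degree (companion_poly c j) = j \<and> monic (companion_poly c j)"
    by (induction j) auto
  then show "degree (companion_poly c j) = j" "monic (companion_poly c j)" by auto
qed

lemma companion_closed [simp]: "companion m c \<in> carrier_mat m m"
  by (simp add: companion_def)

lemma companion_last_column:
  assumes "j < m" "r < m"
  shows "mat_poly m (companion m c) (companion_poly c j) $$ (r, m - 1) = (if r + j = m - 1 then 1 else 0)"
  using assms
proof (induction j arbitrary: r)
  case 0
  then show ?case by auto
next
  case (Suc j)
  let ?C = "companion m c"
  have P: "mat_poly m ?C (companion_poly c j) \<in> carrier_mat m m" by simp
  have "(?C * mat_poly m ?C (companion_poly c j)) $$ (r, m - 1)
      = (\<Sum>s<m. ?C $$ (r, s) * mat_poly m ?C (companion_poly c j) $$ (s, m - 1))"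
    by (rule index_mult_mat_sum[OF _ P]) (use Suc.prems in auto)
  also have "\<dots> = (\<Sum>s<m. if s = m - 1 - j then ?C $$ (r, m - 1 - j) else 0)"
    using Suc by (intro sum.cong) auto
  also have "\<dots> = ?C $$ (r, m - 1 - j)" using Suc.prems by simp
  also have "\<dots> = (if r + 1 = m then - c (Suc j) else if r + Suc j = m - 1 then 1 else 0)"
    using Suc.prems by (auto simp: companion_def)
  finally have "(?C * mat_poly m ?C (companion_poly c j)) $$ (r, m - 1)
      = (if r + 1 = m then - c (Suc j) else if r + Suc j = m - 1 then 1 else 0)" .
  moreover have add: "(a \<cdot>\<^sub>m 1\<^sub>m m + X) $$ (r, m - 1) = (if r + 1 = m then a else 0) + X $$ (r, m - 1)"
    if "X \<in> carrier_mat m m" for a :: 'a and X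
    using that Suc.prems by auto
  moreover have "mat_poly m ?C (companion_poly c (Suc j))
      = c (Suc j) \<cdot>\<^sub>m 1\<^sub>m m + ?C * mat_poly m ?C (companion_poly c j)"
    by simp
  ultimately show ?case
    using Suc.prems by (simp only: add[OF mult_carrier_mat[OF companion_closed P]]) auto
qed

lemma companion_first_row:
  assumes "j < m" "r < m"
  shows "mat_poly m (companion m c) ([:0, 1:] ^ j) $$ (0, r) = (if r = j then 1 else 0)"
  using assms
proof (induction j arbitrary: r)
  case 0
  then show ?case by auto
next
  case (Suc j)
  let ?C = "companion m c"
  have P: "mat_poly m ?C ([:0, 1:] ^ j) \<in> carrier_mat m m" by simp
  have "mat_poly m ?C ([:0, 1:] ^ Suc j) = mat_poly m ?C ([:0, 1:] ^ j) * ?C"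
    by (simp only: power_Suc2 mat_poly_mult[OF companion_closed] mat_poly_x[OF companion_closed])
  moreover have "(mat_poly m ?C ([:0, 1:] ^ j) * ?C) $$ (0, r)
      = (\<Sum>s<m. mat_poly m ?C ([:0, 1:] ^ j) $$ (0, s) * ?C $$ (s, r))"
    by (rule index_mult_mat_sum[OF P]) (use Suc.prems in auto)
  moreover have "\<dots> = (\<Sum>s<m. if s = j then ?C $$ (j, r) else 0)"
    using Suc by (intro sum.cong) auto
  moreover have "\<dots> = ?C $$ (j, r)" using Suc.prems by simp
  moreover have "\<dots> = (if r = Suc j then 1 else 0)"
    using Suc.prems by (auto simp: companion_def)
  ultimately show ?case by (simp only:)
qed

lemma companion_column_relation:
  assumes "k < m"
  shows "(\<Sum>i<m. Polynomial.smult (companion m c $$ (i, k)) (companion_poly c (m - 1 - i)))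
      - pCons 0 (companion_poly c (m - 1 - k)) = (if k = 0 then - companion_poly c m else 0)"
proof -
  obtain m' where m: "m = Suc m'" using assms by (cases m) auto
  have "(\<Sum>i<m. Polynomial.smult (companion m c $$ (i, k)) (companion_poly c (m - 1 - i)))
      = Polynomial.smult (- c (m - k)) 1
        + (\<Sum>i<m'. if i + 1 = k then companion_poly c (m - k) else 0)"
    unfolding m using assms m
    by (subst sum.lessThan_Suc, subst add.commute)
      (auto intro!: arg_cong2[of _ _ _ _ "(+)"] sum.cong simp: companion_def)
  also have "(\<Sum>i<m'. if i + 1 = k then companion_poly c (m - k) else 0)
      = (if k = 0 then 0 else companion_poly c (m - k))"
  proof (cases k)
    case (Suc k')
    then have "k' < m'" using assms m by simp
    then show ?thesis using Suc by simp
  qed simp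
  moreover have "companion_poly c (m - k) = pCons (c (m - k)) (companion_poly c (m - 1 - k))"
    using assms m by (simp add: Suc_diff_le less_Suc_eq_le)
  ultimately show ?thesis using m by auto
qed

lemma companion_row_relation:
  assumes "k < m"
  shows "(\<Sum>i<m. Polynomial.smult (companion m c $$ (k, i)) ([:0, 1:] ^ i)) - pCons 0 ([:0, 1:] ^ k)
    = (if k = m - 1 then - companion_poly c m else 0)"
proof (cases "k = m - 1")
  case True
  have "(\<Sum>i<m. Polynomial.smult (companion m c $$ (k, i)) ([:0, 1:] ^ i))
      = (\<Sum>i<m. - Polynomial.smult (c (m - i)) ([:0, 1:] ^ i))"
    using True assms by (intro sum.cong) (auto simp: companion_def)
  moreover have "pCons 0 ([:0, 1:] ^ k) = ([:0, 1:] :: 'a poly) ^ m"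
    using True assms by (cases m) auto
  moreover have "(\<Sum>i<m. - Polynomial.smult (c (m - i)) ([:0, 1:] ^ i))
      = - (\<Sum>i<m. Polynomial.smult (c (m - i)) ([:0, 1:] ^ i))"
    by (rule sum_negf)
  ultimately have "(\<Sum>i<m. Polynomial.smult (companion m c $$ (k, i)) ([:0, 1:] ^ i)) - pCons 0 ([:0, 1:] ^ k)
      = - (\<Sum>i<m. Polynomial.smult (c (m - i)) ([:0, 1:] ^ i)) - [:0, 1:] ^ m"
    by (simp only:)
  then show ?thesis using True unfolding companion_poly_expand[of c m] by simp
next
  case False
  have "(\<Sum>i<m. Polynomial.smult (companion m c $$ (k, i)) ([:0, 1:] ^ i))
      = (\<Sum>i<m. if i = Suc k then [:0, 1:] ^ Suc k else 0)"
    using False assms by (intro sum.cong) (auto simp: companion_def)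
  also have "\<dots> = [:0, 1:] ^ Suc k" using False assms by simp
  finally show ?thesis using False by simp
qed

lemma companion_annihilated:
  assumes "0 < m"
  shows "mat_poly m (companion m c) (companion_poly c m) = 0\<^sub>m m m"
proof -
  have "mat_poly m (companion m c) (companion_poly c (m - 1 - i)) $$ (r, m - 1) = (if r = i then 1 else 0)"
    if "i < m" "r < m" for i r
    using that by (subst companion_last_column) auto
  then have "mat_poly m (companion m c)
      ((\<Sum>i<m. Polynomial.smult (companion m c $$ (i, 0)) (companion_poly c (m - 1 - i)))
        - pCons 0 (companion_poly c (m - 1 - 0))) = 0\<^sub>m m m"
    using assms by (intro cyclic_relation_annihilates[OF companion_closed, of "m - 1"]) auto
  then have "mat_poly m (companion m c) (- companion_poly c m) = 0\<^sub>m m m"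
    unfolding companion_column_relation[OF assms] by simp
  then show ?thesis
    using mat_poly_dvd_zero[OF companion_closed, of "- companion_poly c m" "companion_poly c m"] by simp
qed

lemma cyclic_block_companion:
  assumes "0 < m"
  shows "cyclic_block (companion m c) (companion_poly c m)"
proof (rule cyclic_blockI[where p = "\<lambda>i. companion_poly c (m - 1 - i)" and q = "\<lambda>i. [:0, 1:] ^ i",
      OF companion_closed assms companion_annihilated[OF assms]])
  show "companion_poly c (m - 1 - (m - 1)) = 1" by simp
  show "companion_poly c m dvd (\<Sum>i<m. Polynomial.smult (companion m c $$ (i, k)) (companion_poly c (m - 1 - i)))
      - pCons 0 (companion_poly c (m - 1 - k))" if "k < m" for k
    unfolding companion_column_relation[OF that] by simp
  show "mat_poly m (companion m c) (companion_poly c (m - 1 - i)) $$ (r, m - 1) = (if r = i then 1 else 0)"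
    if "i < m" "r < m" for i r
    using that by (subst companion_last_column) auto
  show "[:0, 1:] ^ 0 = 1" by simp
  show "companion_poly c m dvd (\<Sum>i<m. Polynomial.smult (companion m c $$ (k, i)) ([:0, 1:] ^ i))
      - pCons 0 ([:0, 1:] ^ k)" if "k < m" for k
    unfolding companion_row_relation[OF that] by simp
  show "mat_poly m (companion m c) ([:0, 1:] ^ i) $$ (0, r) = (if r = i then 1 else 0)"
    if "i < m" "r < m" for i r
    using that by (rule companion_first_row)
qed

text \<open>
  The matrix \<open>xI - C\<close> maps \<open>(1, x, \<dots>, x\<^sup>m\<^sup>-\<^sup>1)\<close> to \<open>(0, \<dots>, 0, g)\<close>, so multiplying by the adjugate
  shows that \<open>g\<close> divides the characteristic polynomial; both are monic of degree \<open>m\<close>.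
\<close>
lemma char_poly_companion:
  assumes m: "0 < m"
  shows "char_poly (companion m c) = companion_poly c m"
proof -
  let ?C = "companion m c" and ?g = "companion_poly c m"
  let ?x = "[:0, 1:] :: 'a poly"
  define K where "K = char_poly_matrix ?C"
  have K: "K \<in> carrier_mat m m" by (simp add: K_def)
  have adj: "adj_mat K \<in> carrier_mat m m" "adj_mat K * K = det K \<cdot>\<^sub>m 1\<^sub>m m"
    using adj_mat(1,3)[OF K] by auto
  have Kij: "K $$ (k, i) = (if k = i then ?x else 0) - [:?C $$ (k, i):]" if "k < m" "i < m" for k i
    using that by (simp add: K_def char_poly_matrix_def companion_def)
  have Kv: "(\<Sum>i<m. K $$ (k, i) * ?x ^ i) = (if k = m - 1 then ?g else 0)" if k: "k < m" for k
  proof -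
    have "(\<Sum>i<m. K $$ (k, i) * ?x ^ i)
        = (\<Sum>i<m. (if i = k then ?x * ?x ^ k else 0) - Polynomial.smult (?C $$ (k, i)) (?x ^ i))"
      using k by (intro sum.cong) (auto simp: Kij algebra_simps)
    also have "\<dots> = ?x * ?x ^ k - (\<Sum>i<m. Polynomial.smult (?C $$ (k, i)) (?x ^ i))"
      using k by (simp add: sum_subtractf)
    also have "\<dots> = - ((\<Sum>i<m. Polynomial.smult (?C $$ (k, i)) (?x ^ i)) - pCons 0 (?x ^ k))"
      by simp
    finally show ?thesis unfolding companion_row_relation[OF k] by simp
  qed
  have "det K = (\<Sum>i<m. (adj_mat K * K) $$ (0, i) * ?x ^ i)"
  proof -
    have "(\<Sum>i<m. (adj_mat K * K) $$ (0, i) * ?x ^ i) = (\<Sum>i<m. if i = 0 then det K else 0)"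
      unfolding adj(2) using m by (intro sum.cong) auto
    then show ?thesis using m by simp
  qed
  also have "\<dots> = (\<Sum>i<m. \<Sum>k<m. adj_mat K $$ (0, k) * (K $$ (k, i) * ?x ^ i))"
    using m by (intro sum.cong refl)
      (simp add: index_mult_mat_sum[OF adj(1) K] sum_distrib_right mult.assoc del: index_mult_mat(1))
  also have "\<dots> = (\<Sum>k<m. \<Sum>i<m. adj_mat K $$ (0, k) * (K $$ (k, i) * ?x ^ i))"
    by (rule sum.swap)
  also have "\<dots> = (\<Sum>k<m. adj_mat K $$ (0, k) * (if k = m - 1 then ?g else 0))"
    by (intro sum.cong refl) (simp add: sum_distrib_left[symmetric] Kv)
  also have "\<dots> = (\<Sum>k<m. if k = m - 1 then adj_mat K $$ (0, m - 1) * ?g else 0)"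
    by (intro sum.cong) auto
  also have "\<dots> = adj_mat K $$ (0, m - 1) * ?g" using m by simp
  finally have det: "char_poly ?C = adj_mat K $$ (0, m - 1) * ?g"
    by (simp add: char_poly_def K_def)
  let ?a = "adj_mat K $$ (0, m - 1)"
  have cp: "degree (char_poly ?C) = m" "monic (char_poly ?C)"
    using degree_monic_char_poly[of ?C m] by auto
  have "?a \<noteq> 0" "?g \<noteq> 0" using cp(2) det by auto
  then have "degree ?a = 0"
    using cp(1) companion_poly_degree(1)[of c m] det by (simp add: degree_mult_eq)
  then obtain b where b: "?a = [:b:]" by (metis degree_eq_zeroE)
  have "lead_coeff (char_poly ?C) = lead_coeff [:b:] * lead_coeff ?g"
    by (simp only: det b lead_coeff_mult)
  then have "b = 1" using cp(2) companion_poly_degree(2)[of c m] by simp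
  then show ?thesis using det b by (simp add: one_pCons)
qed

subsection \<open>Jordan blocks\<close>

lemma jordan_block_shift:
  "mat_poly m (jordan_block m a) [:- a, 1:] = jordan_block m 0"
  by (subst mat_poly_linear[of _ m]) (auto intro!: eq_matI)

lemma jordan_last_column:
  assumes "j < m" "r < m"
  shows "mat_poly m (jordan_block m a) ([:- a, 1:] ^ j) $$ (r, m - 1) = (if r + j = m - 1 then 1 else 0)"
  using assms
proof (induction j arbitrary: r)
  case 0
  then show ?case by auto
next
  case (Suc j)
  let ?J = "jordan_block m a" and ?N = "jordan_block m (0 :: 'a)"
  have P: "mat_poly m ?J ([:- a, 1:] ^ j) \<in> carrier_mat m m" by simp
  have "mat_poly m ?J ([:- a, 1:] ^ Suc j) = ?N * mat_poly m ?J ([:- a, 1:] ^ j)"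
    by (simp only: power_Suc mat_poly_mult[OF jordan_block_carrier] jordan_block_shift)
  moreover have "(?N * mat_poly m ?J ([:- a, 1:] ^ j)) $$ (r, m - 1)
      = (\<Sum>s<m. ?N $$ (r, s) * mat_poly m ?J ([:- a, 1:] ^ j) $$ (s, m - 1))"
    by (rule index_mult_mat_sum[OF _ P]) (use Suc.prems in auto)
  moreover have "\<dots> = (\<Sum>s<m. if s = m - 1 - j then ?N $$ (r, m - 1 - j) else 0)"
    using Suc by (intro sum.cong) (auto simp del: jordan_block_index(1))
  moreover have "\<dots> = ?N $$ (r, m - 1 - j)" using Suc.prems by simp
  moreover have "\<dots> = (if r + Suc j = m - 1 then 1 else 0)" using Suc.prems by auto
  ultimately show ?case by (simp only:)
qed

lemma jordan_first_row:
  assumes "j < m" "r < m"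
  shows "mat_poly m (jordan_block m a) ([:- a, 1:] ^ j) $$ (0, r) = (if r = j then 1 else 0)"
  using assms
proof (induction j arbitrary: r)
  case 0
  then show ?case by auto
next
  case (Suc j)
  let ?J = "jordan_block m a" and ?N = "jordan_block m (0 :: 'a)"
  have P: "mat_poly m ?J ([:- a, 1:] ^ j) \<in> carrier_mat m m" by simp
  have "mat_poly m ?J ([:- a, 1:] ^ Suc j) = mat_poly m ?J ([:- a, 1:] ^ j) * ?N"
    by (simp only: power_Suc2 mat_poly_mult[OF jordan_block_carrier] jordan_block_shift)
  moreover have "(mat_poly m ?J ([:- a, 1:] ^ j) * ?N) $$ (0, r)
      = (\<Sum>s<m. mat_poly m ?J ([:- a, 1:] ^ j) $$ (0, s) * ?N $$ (s, r))"
    by (rule index_mult_mat_sum[OF P]) (use Suc.prems in auto)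
  moreover have "\<dots> = (\<Sum>s<m. if s = j then ?N $$ (j, r) else 0)"
    using Suc by (intro sum.cong) (auto simp del: jordan_block_index(1))
  moreover have "\<dots> = ?N $$ (j, r)" using Suc.prems by simp
  moreover have "\<dots> = (if r = Suc j then 1 else 0)" using Suc.prems by auto
  ultimately show ?case by (simp only:)
qed

lemma pCons_0_linear: "pCons 0 p = Polynomial.smult a p + [:- a, 1:] * p" for a :: "'a::field"
  by simp

lemma jordan_column_relation:
  fixes a :: "'a::field"
  assumes "k < m"
  shows "(\<Sum>i<m. Polynomial.smult (jordan_block m a $$ (i, k)) ([:- a, 1:] ^ (m - 1 - i)))
      - pCons 0 ([:- a, 1:] ^ (m - 1 - k)) = (if k = 0 then - ([:- a, 1:] ^ m) else 0)"
proof -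
  let ?y = "[:- a, 1:] :: 'a poly"
  have "(\<Sum>i<m. Polynomial.smult (jordan_block m a $$ (i, k)) (?y ^ (m - 1 - i)))
      = (\<Sum>i<m. (if i = k then Polynomial.smult a (?y ^ (m - 1 - k)) else 0)
          + (if Suc i = k then ?y ^ (m - k) else 0))"
    using assms by (intro sum.cong) auto
  also have "\<dots> = Polynomial.smult a (?y ^ (m - 1 - k)) + (if k = 0 then 0 else ?y ^ (m - k))"
    using assms by (cases k) (auto simp: sum.distrib)
  finally have S: "(\<Sum>i<m. Polynomial.smult (jordan_block m a $$ (i, k)) (?y ^ (m - 1 - i)))
      = Polynomial.smult a (?y ^ (m - 1 - k)) + (if k = 0 then 0 else ?y ^ (m - k))" .
  have "m - k = Suc (m - 1 - k)" using assms by simp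
  then have Y: "pCons 0 (?y ^ (m - 1 - k)) = Polynomial.smult a (?y ^ (m - 1 - k)) + ?y ^ (m - k)"
    using pCons_0_linear[where p = "?y ^ (m - 1 - k)" and a = a] by (simp only: power_Suc)
  show ?thesis unfolding S Y by simp
qed

lemma jordan_row_relation:
  fixes a :: "'a::field"
  assumes "k < m"
  shows "(\<Sum>i<m. Polynomial.smult (jordan_block m a $$ (k, i)) ([:- a, 1:] ^ i))
      - pCons 0 ([:- a, 1:] ^ k) = (if k = m - 1 then - ([:- a, 1:] ^ m) else 0)"
proof -
  let ?y = "[:- a, 1:] :: 'a poly"
  have "(\<Sum>i<m. Polynomial.smult (jordan_block m a $$ (k, i)) (?y ^ i))
      = (\<Sum>i<m. (if i = k then Polynomial.smult a (?y ^ k) else 0)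
          + (if i = Suc k then ?y ^ Suc k else 0))"
    using assms by (intro sum.cong) auto
  also have "\<dots> = Polynomial.smult a (?y ^ k) + (if k = m - 1 then 0 else ?y ^ Suc k)"
    using assms by (auto simp: sum.distrib)
  finally have S: "(\<Sum>i<m. Polynomial.smult (jordan_block m a $$ (k, i)) (?y ^ i))
      = Polynomial.smult a (?y ^ k) + (if k = m - 1 then 0 else ?y ^ Suc k)" .
  have Y: "pCons 0 (?y ^ k) = Polynomial.smult a (?y ^ k) + ?y ^ Suc k"
    using pCons_0_linear[where p = "?y ^ k" and a = a] by (simp only: power_Suc)
  have "k = m - 1 \<Longrightarrow> Suc k = m" using assms by simp
  then show ?thesis unfolding S Y by (cases "k = m - 1") (simp_all del: power_Suc)
qed

lemma cyclic_block_jordan: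
  assumes m: "0 < m"
  shows "cyclic_block (jordan_block m a) ([:- a, 1:] ^ m)"
proof (rule cyclic_blockI[where p = "\<lambda>i. [:- a, 1:] ^ (m - 1 - i)" and q = "\<lambda>i. [:- a, 1:] ^ i",
      OF jordan_block_carrier m])
  let ?y = "[:- a, 1:] :: 'a poly"
  have col: "mat_poly m (jordan_block m a) (?y ^ (m - 1 - i)) $$ (r, m - 1) = (if r = i then 1 else 0)"
    if "i < m" "r < m" for i r
    using that by (subst jordan_last_column) auto
  then have "mat_poly m (jordan_block m a) ((\<Sum>i<m. Polynomial.smult (jordan_block m a $$ (i, 0)) (?y ^ (m - 1 - i)))
      - pCons 0 (?y ^ (m - 1 - 0))) = 0\<^sub>m m m"
    using m by (intro cyclic_relation_annihilates[OF jordan_block_carrier, of "m - 1"]) auto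
  then have "mat_poly m (jordan_block m a) (- (?y ^ m)) = 0\<^sub>m m m"
    unfolding jordan_column_relation[OF m] by simp
  then show "mat_poly m (jordan_block m a) (?y ^ m) = 0\<^sub>m m m"
    using mat_poly_dvd_zero[OF jordan_block_carrier, of "- (?y ^ m)" "?y ^ m"] by simp
  show "?y ^ (m - 1 - (m - 1)) = 1" by simp
  show "?y ^ m dvd (\<Sum>i<m. Polynomial.smult (jordan_block m a $$ (i, k)) (?y ^ (m - 1 - i)))
      - pCons 0 (?y ^ (m - 1 - k))" if "k < m" for k
    unfolding jordan_column_relation[OF that] by simp
  show "mat_poly m (jordan_block m a) (?y ^ (m - 1 - i)) $$ (r, m - 1) = (if r = i then 1 else 0)"
    if "i < m" "r < m" for i r
    using that by (rule col)
  show "?y ^ 0 = 1" by simp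
  show "?y ^ m dvd (\<Sum>i<m. Polynomial.smult (jordan_block m a $$ (k, i)) (?y ^ i))
      - pCons 0 (?y ^ k)" if "k < m" for k
    unfolding jordan_row_relation[OF that] by simp
  show "mat_poly m (jordan_block m a) (?y ^ i) $$ (0, r) = (if r = i then 1 else 0)"
    if "i < m" "r < m" for i r
    using that by (rule jordan_first_row)
qed

section \<open>Direct sums of cyclic blocks\<close>

subsection \<open>The form of one summand\<close>

lemma block_of_Cons_less [simp]: "r < m \<Longrightarrow> block_of (m # ms) r = 0"
  unfolding block_of_def by (intro Least_equality) auto

lemma block_of_Cons_ge:
  assumes "m \<le> r" "r < m + sum_list ms"
  shows "block_of (m # ms) r = Suc (block_of ms (r - m))"
proof -
  have "(LEAST j. r < sum_list (take (Suc j) (m # ms)))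
      = Suc (LEAST j. r < sum_list (take (Suc (Suc j)) (m # ms)))"
    by (rule Least_Suc[of _ "length ms"]) (use assms in auto)
  moreover have "r < sum_list (take (Suc (Suc j)) (m # ms)) \<longleftrightarrow> r - m < sum_list (take (Suc j) ms)" for j
    using assms by auto
  ultimately show ?thesis unfolding block_of_def by simp
qed

lemma offset_of_Cons_less [simp]: "r < m \<Longrightarrow> offset_of (m # ms) r = r"
  by (simp add: offset_of_def)

lemma offset_of_Cons_ge:
  assumes "m \<le> r" "r < m + sum_list ms"
  shows "offset_of (m # ms) r = offset_of ms (r - m)"
  by (simp add: offset_of_def block_of_Cons_ge[OF assms])

lemma block_offset_bounds:
  assumes "r < sum_list ms"
  shows "block_of ms r < length ms" "offset_of ms r < ms ! block_of ms r"
proof -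
  have "block_of ms r < length ms \<and> offset_of ms r < ms ! block_of ms r"
    using assms
  proof (induction ms arbitrary: r)
    case (Cons m ms)
    show ?case
    proof (cases "r < m")
      case False
      then have "m \<le> r" "r < m + sum_list ms" "r - m < sum_list ms" using Cons.prems by auto
      then show ?thesis using Cons.IH[of "r - m"] by (simp add: block_of_Cons_ge offset_of_Cons_ge)
    qed simp
  qed simp
  then show "block_of ms r < length ms" "offset_of ms r < ms ! block_of ms r" by auto
qed

lemma form_summand_index:
  assumes "r < sum_list ms" "c < sum_list ms"
  shows "form_summand ms $$ (r, c) =
    (if block_of ms r \<le> block_of ms c then
       (if offset_of ms r + 1 = ms ! block_of ms r then Star else Nul)
     else (if offset_of ms c = 0 then Star else Nul))"
  using assms block_offset_bounds[OF assms(1)] block_offset_bounds[OF assms(2)]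
  by (simp add: form_summand_def stars_down_def stars_left_def Let_def)

lemma form_summand_closed [simp]: "form_summand ms \<in> carrier_mat (sum_list ms) (sum_list ms)"
  by (simp add: form_summand_def)

lemma form_summand_Cons:
  "form_summand (m # ms) = four_block_mat (stars_down m m) (stars_down m (sum_list ms))
     (stars_left (sum_list ms) m) (form_summand ms)" (is "_ = ?R")
proof (rule eq_matI)
  fix r c assume "r < dim_row ?R" "c < dim_col ?R"
  then have rc: "r < m + sum_list ms" "c < m + sum_list ms"
    by (auto simp: stars_down_def form_summand_def)
  note dims = carrier_matD[OF form_summand_closed[of ms]]
  have R: "?R $$ (r, c) = (if r < m then if c < m then stars_down m m $$ (r, c)
      else stars_down m (sum_list ms) $$ (r, c - m)
      else if c < m then stars_left (sum_list ms) m $$ (r - m, c) else form_summand ms $$ (r - m, c - m))"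
    using rc by (subst index_mat_four_block(1)) (auto simp: dims stars_down_def)
  have L: "form_summand (m # ms) $$ (r, c) = (if block_of (m # ms) r \<le> block_of (m # ms) c then
       (if offset_of (m # ms) r + 1 = (m # ms) ! block_of (m # ms) r then Star else Nul)
     else (if offset_of (m # ms) c = 0 then Star else Nul))"
    using rc by (intro form_summand_index) auto
  show "form_summand (m # ms) $$ (r, c) = ?R $$ (r, c)"
    unfolding L R using rc
    by (auto simp: stars_down_def stars_left_def block_of_Cons_ge offset_of_Cons_ge form_summand_index)
qed (auto simp: form_summand_def stars_down_def)

subsection \<open>One summand\<close>

lemma carrier_diag_block_mat:
  assumes "\<And>B. B \<in> set Bs \<Longrightarrow> square_mat B"
  shows "diag_block_mat Bs \<in> carrier_mat (sum_list (map dim_row Bs)) (sum_list (map dim_row Bs))"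
proof -
  have "map dim_col Bs = map dim_row Bs" using assms by (intro map_cong) auto
  then show ?thesis by (intro carrier_matI) (simp_all only: dim_diag_block_mat)
qed

lemma diag_block_mat_Cons_square:
  assumes "square_mat B" "\<And>B. B \<in> set Bs \<Longrightarrow> square_mat B"
  defines "N \<equiv> sum_list (map dim_row Bs)" and "m \<equiv> dim_row B"
  shows "diag_block_mat (B # Bs) =
    four_block_mat B (0\<^sub>m m N) (0\<^sub>m N m) (diag_block_mat Bs)"
proof -
  have "diag_block_mat Bs \<in> carrier_mat N N"
    unfolding N_def using assms(2) by (rule carrier_diag_block_mat)
  from carrier_matD[OF this] show ?thesis using assms(1) by (simp add: Let_def m_def)
qed

lemma sylvester_split_empty:
  assumes "D \<in> carrier_mat 0 0"
  shows "sylvester_split 0 0 (0\<^sub>m 0 0 :: 'a::field mat) (0\<^sub>m 0 0) D"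
proof -
  have z: "(0\<^sub>m 0 0 :: 'a mat) \<in> carrier_mat 0 0" by simp
  have "sylvester_range 0 0 (0\<^sub>m 0 0) (0\<^sub>m 0 0 :: 'a mat) = carrier_mat 0 0"
  proof (intro equalityI subsetI)
    fix M :: "'a mat" assume "M \<in> carrier_mat 0 0"
    then have "M = 0\<^sub>m 0 0" by (intro eq_matI) auto
    then show "M \<in> sylvester_range 0 0 (0\<^sub>m 0 0) (0\<^sub>m 0 0 :: 'a mat)"
      using sylvester_range_zero[OF z z] by simp
  qed (rule sylvester_range_carrier[OF z z])
  moreover have "D = 0\<^sub>m 0 0" using assms by (intro eq_matI) auto
  ultimately show ?thesis using sylvester_split_full[of 0 0 "0\<^sub>m 0 0 :: 'a mat" "0\<^sub>m 0 0"] by simp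
qed

lemma cyclic_blocks_square:
  assumes "list_all2 cyclic_block Bs gs" "B \<in> set Bs"
  shows "square_mat B"
  using assms
proof (induction Bs gs rule: list_all2_induct)
  case (Cons A Bs g gs)
  have "A \<in> carrier_mat (dim_row A) (dim_row A)"
    by (rule cyclic_block_annihilated(2)[OF Cons.hyps(1) refl])
  from carrier_matD(2)[OF this] have "square_mat A" by simp
  then show ?case using Cons.IH Cons.prems by (cases "B = A") simp_all
qed simp

text \<open>
  The blocks are in order of divisibility, so the polynomial of the first block also annihilates all
  later ones. Hence the first block splits against the sum of the later ones in one piece: a row of
  blocks \<open>0\<^sup>\<down>\<close> is a single wide \<open>0\<^sup>\<down>\<close>, and a column of blocks \<open>0\<^sup>\<leftarrow>\<close> a single tall \<open>0\<^sup>\<leftarrow>\<close>.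
\<close>
lemma cyclic_chain_split:
  fixes Bs :: "'a::field mat list"
  assumes "list_all2 cyclic_block Bs gs" "sorted_wrt (\<lambda>g g'. g' dvd g) gs"
  defines "N \<equiv> sum_list (map dim_row Bs)"
  shows "sylvester_split N N (diag_block_mat Bs) (diag_block_mat Bs) (form_summand (map dim_row Bs))
    \<and> (\<forall>f. (\<forall>g\<in>set gs. g dvd f) \<longrightarrow> mat_poly N (diag_block_mat Bs) f = 0\<^sub>m N N)"
  using assms(1,2) unfolding N_def
proof (induction Bs gs rule: list_all2_induct)
  case Nil
  have "mat_poly 0 (0\<^sub>m 0 0 :: 'a mat) f = 0\<^sub>m 0 0" for f
    using mat_poly_dim[of "0\<^sub>m 0 0 :: 'a mat" 0 f] by (intro eq_matI) auto
  then show ?case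
    using sylvester_split_empty[of "form_summand []", where 'a = 'a]
      form_summand_closed[of "[]"] by auto
next
  case (Cons B Bs g gs)
  let ?m = "dim_row B" and ?A = "diag_block_mat Bs" and ?N = "sum_list (map dim_row Bs)"
  note B = cyclic_block_annihilated[OF Cons.hyps(1) refl]
  have sq: "square_mat B'" if "B' \<in> set Bs" for B'
    using cyclic_blocks_square[OF Cons.hyps(2) that] .
  have A: "?A \<in> carrier_mat ?N ?N" by (rule carrier_diag_block_mat[OF sq])
  have A': "diag_block_mat (B # Bs) = four_block_mat B (0\<^sub>m ?m ?N) (0\<^sub>m ?N ?m) ?A"
    using carrier_matD(2)[OF B(2)] sq by (intro diag_block_mat_Cons_square) simp_all
  have IH: "sylvester_split ?N ?N ?A ?A (form_summand (map dim_row Bs))"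
    "\<And>f. (\<forall>g\<in>set gs. g dvd f) \<Longrightarrow> mat_poly ?N ?A f = 0\<^sub>m ?N ?N"
    using Cons.IH Cons.prems by auto
  have gA: "mat_poly ?N ?A g = 0\<^sub>m ?N ?N" using Cons.prems by (intro IH(2)) auto
  have "sylvester_split (?m + ?N) (?m + ?N) (diag_block_mat (B # Bs)) (diag_block_mat (B # Bs))
      (form_summand (?m # map dim_row Bs))"
    unfolding A' form_summand_Cons
    by (intro sylvester_split_four_block[OF B(2) A B(2) A] IH(1)
        cyclic_block_split[OF Cons.hyps(1) refl] B A gA)
  moreover have "mat_poly (?m + ?N) (diag_block_mat (B # Bs)) f = 0\<^sub>m (?m + ?N) (?m + ?N)"
    if "\<forall>g\<in>set (g # gs). g dvd f" for f
  proof -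
    have "mat_poly ?m B f = 0\<^sub>m ?m ?m" using mat_poly_dvd_zero[OF B(2) _ B(3)] that by simp
    moreover have "mat_poly ?N ?A f = 0\<^sub>m ?N ?N" using IH(2) that by simp
    ultimately show ?thesis unfolding A' mat_poly_four_block[OF B(2) A] by simp
  qed
  ultimately show ?case by simp
qed

subsection \<open>All summands\<close>

lemma diag_block_mat_concat:
  "diag_block_mat (concat Bss) = diag_block_mat (map diag_block_mat Bss)"
  by (induction Bss) (simp_all add: diag_block_mat_append Let_def)

lemma canonical_form_Cons:
  "canonical_form (ms # mss) = (let N = sum_list (map sum_list mss) in
    four_block_mat (form_summand ms) (0\<^sub>m (sum_list ms) N) (0\<^sub>m N (sum_list ms)) (canonical_form mss))"
  and canonical_form_closed:
  "canonical_form mss \<in> carrier_mat (sum_list (map sum_list mss)) (sum_list (map sum_list mss))"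
proof -
  have dims: "map (dim_row \<circ> form_summand) mss = map sum_list mss"
    "map (dim_col \<circ> form_summand) mss = map sum_list mss" for mss
    by (auto simp: form_summand_def)
  show c: "canonical_form mss \<in> carrier_mat (sum_list (map sum_list mss)) (sum_list (map sum_list mss))" for mss
    unfolding canonical_form_def by (rule carrier_matI) (simp_all only: dim_diag_block_mat map_map dims)
  have f: "dim_row (form_summand ms) = sum_list ms" "dim_col (form_summand ms) = sum_list ms"
    by (simp_all add: form_summand_def)
  show "canonical_form (ms # mss) = (let N = sum_list (map sum_list mss) in
    four_block_mat (form_summand ms) (0\<^sub>m (sum_list ms) N) (0\<^sub>m N (sum_list ms)) (canonical_form mss))"
    unfolding canonical_form_def list.map diag_block_mat.simps Let_def
      carrier_matD[OF c[of mss, unfolded canonical_form_def]] f ..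
qed

lemma dvd_prod_list: "x \<in> set xs \<Longrightarrow> x dvd prod_list (xs :: 'a::comm_monoid_mult list)"
  by (induction xs) auto

definition cyclic_chain :: "'a::field mat list \<Rightarrow> 'a poly list \<Rightarrow> bool" where
  "cyclic_chain Bs gs \<longleftrightarrow> list_all2 cyclic_block Bs gs \<and> sorted_wrt (\<lambda>g g'. g' dvd g) gs"

lemma cyclic_chain_square: "cyclic_chain Bs gs \<Longrightarrow> B \<in> set Bs \<Longrightarrow> square_mat B"
  unfolding cyclic_chain_def by (elim conjE) (rule cyclic_blocks_square)

definition bezout_lists :: "'a::field poly list \<Rightarrow> 'a poly list \<Rightarrow> bool" where
  "bezout_lists gs hs \<longleftrightarrow> (\<forall>g\<in>set gs. \<forall>h\<in>set hs. bezout g h)"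

text \<open>
  Summands belonging to coprime polynomials do not interact: by Sylvester's theorem the
  off-diagonal blocks lie entirely in the range.
\<close>
lemma direct_sum_split:
  fixes Gs :: "('a::field mat list \<times> 'a poly list) list"
  assumes "\<And>Bs gs. (Bs, gs) \<in> set Gs \<Longrightarrow> cyclic_chain Bs gs"
    and "sorted_wrt (\<lambda>(_, gs) (_, hs). bezout_lists gs hs) Gs"
  defines "mss \<equiv> map (map dim_row \<circ> fst) Gs"
  defines "N \<equiv> sum_list (map sum_list mss)" and "A \<equiv> diag_block_mat (map (diag_block_mat \<circ> fst) Gs)"
  shows "A \<in> carrier_mat N N \<and> sylvester_split N N A A (canonical_form mss) \<and>
    mat_poly N A (prod_list (concat (map snd Gs))) = 0\<^sub>m N N"
  using assms(1,2) unfolding A_def N_def mss_def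
proof (induction Gs)
  case Nil
  have "mat_poly 0 (0\<^sub>m 0 0 :: 'a mat) f = 0\<^sub>m 0 0" for f
    using mat_poly_dim[of "0\<^sub>m 0 0 :: 'a mat" 0 f] by (intro eq_matI) auto
  then show ?case
    using sylvester_split_empty[of "canonical_form []", where 'a = 'a]
      canonical_form_closed[of "[]"] by auto
next
  case (Cons G Gs)
  obtain Bs gs where G: "G = (Bs, gs)" by (cases G)
  let ?B = "diag_block_mat Bs" and ?m = "sum_list (map dim_row Bs)"
  let ?A = "diag_block_mat (map (diag_block_mat \<circ> fst) Gs)"
    and ?mss = "map (map dim_row \<circ> fst) Gs"
  let ?N = "sum_list (map sum_list ?mss)" and ?f = "prod_list gs" and ?h = "prod_list (concat (map snd Gs))"
  have chain: "cyclic_chain Bs gs" using Cons.prems(1) G by simp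
  have B: "?B \<in> carrier_mat ?m ?m"
    using cyclic_chain_square[OF chain] by (rule carrier_diag_block_mat)
  have sB: "sylvester_split ?m ?m ?B ?B (form_summand (map dim_row Bs))"
    and fB: "mat_poly ?m ?B ?f = 0\<^sub>m ?m ?m"
    using cyclic_chain_split[of Bs gs] chain dvd_prod_list[of _ gs] by (auto simp: cyclic_chain_def)
  have "?A \<in> carrier_mat ?N ?N \<and> sylvester_split ?N ?N ?A ?A (canonical_form ?mss) \<and>
    mat_poly ?N ?A ?h = 0\<^sub>m ?N ?N"
    by (rule Cons.IH) (use Cons.prems in auto)
  then have IH: "?A \<in> carrier_mat ?N ?N" "sylvester_split ?N ?N ?A ?A (canonical_form ?mss)"
    "mat_poly ?N ?A ?h = 0\<^sub>m ?N ?N"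
    by blast+
  have "bezout g h" if "g \<in> set gs" "h \<in> set (concat (map snd Gs))" for g h
    using that Cons.prems(2) G by (fastforce simp: bezout_lists_def)
  then have bz: "bezout ?f ?h"
    by (intro bezout_prod_list bezout_commute[OF bezout_prod_list]) (auto intro: bezout_commute)
  have A': "diag_block_mat (map (diag_block_mat \<circ> fst) (G # Gs))
      = four_block_mat ?B (0\<^sub>m ?m ?N) (0\<^sub>m ?N ?m) ?A"
    using carrier_matD[OF B] carrier_matD[OF IH(1)] by (simp add: G Let_def)
  have D': "canonical_form (map (map dim_row \<circ> fst) (G # Gs))
      = four_block_mat (form_summand (map dim_row Bs)) (0\<^sub>m ?m ?N) (0\<^sub>m ?N ?m) (canonical_form ?mss)"
    by (simp add: G canonical_form_Cons Let_def)
  have "sylvester_split (?m + ?N) (?m + ?N) (diag_block_mat (map (diag_block_mat \<circ> fst) (G # Gs)))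
      (diag_block_mat (map (diag_block_mat \<circ> fst) (G # Gs)))
      (canonical_form (map (map dim_row \<circ> fst) (G # Gs)))"
    unfolding A' D'
    by (intro sylvester_split_four_block[OF B IH(1) B IH(1)] sB IH(2) sylvester_split_full
        sylvester_range_full[OF B IH(1) fB IH(3) bz]
        sylvester_range_full[OF IH(1) B IH(3) fB bezout_commute[OF bz]])
  moreover have "four_block_mat ?B (0\<^sub>m ?m ?N) (0\<^sub>m ?N ?m) ?A \<in> carrier_mat (?m + ?N) (?m + ?N)"
    using B IH(1) by auto
  moreover have "mat_poly (?m + ?N) (four_block_mat ?B (0\<^sub>m ?m ?N) (0\<^sub>m ?N ?m) ?A) (?f * ?h)
      = 0\<^sub>m (?m + ?N) (?m + ?N)"
  proof -
    have "mat_poly ?m ?B (?f * ?h) = 0\<^sub>m ?m ?m" using mat_poly_dvd_zero[OF B _ fB] by simp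
    moreover have "mat_poly ?N ?A (?f * ?h) = 0\<^sub>m ?N ?N" using mat_poly_dvd_zero[OF IH(1) _ IH(3)] by simp
    ultimately show ?thesis unfolding mat_poly_four_block[OF B IH(1)] by simp
  qed
  moreover have "sum_list (map sum_list (map (map dim_row \<circ> fst) (G # Gs))) = ?m + ?N"
    "prod_list (concat (map snd (G # Gs))) = ?f * ?h"
    by (simp_all add: G)
  ultimately show ?case unfolding A' by (simp only:)
qed

lemma direct_sum_tangent_decomposition:
  fixes Gs :: "('a::field mat list \<times> 'a poly list) list"
  assumes "\<And>Bs gs. (Bs, gs) \<in> set Gs \<Longrightarrow> cyclic_chain Bs gs"
    and "sorted_wrt (\<lambda>(_, gs) (_, hs). bezout_lists gs hs) Gs"
    and A: "A = diag_block_mat (concat (map fst Gs))" "A \<in> carrier_mat n n"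
  shows "tangent_decomposition n A (canonical_form (map (map dim_row \<circ> fst) Gs))"
proof -
  have A': "A = diag_block_mat (map (diag_block_mat \<circ> fst) Gs)"
    unfolding A(1) diag_block_mat_concat by simp
  let ?N = "sum_list (map sum_list (map (map dim_row \<circ> fst) Gs))"
  have "A \<in> carrier_mat ?N ?N" "sylvester_split ?N ?N A A (canonical_form (map (map dim_row \<circ> fst) Gs))"
    using direct_sum_split[of Gs] assms(1,2) unfolding A' by auto
  note s = this
  have "n = ?N" using carrier_matD(1)[OF s(1)] carrier_matD(1)[OF A(2)] by simp
  then show ?thesis using tangent_decomposition_if_split[OF s] by simp
qed

subsection \<open>Coprime polynomials\<close>

lemma bezout_linear:
  assumes "poly q a \<noteq> 0"
  shows "bezout [:- a, 1:] (q :: 'a::field poly)"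
proof -
  have "[:- a, 1:] dvd q - [:poly q a:]" by (simp add: poly_eq_0_iff_dvd[symmetric])
  then obtain r where r: "q - [:poly q a:] = [:- a, 1:] * r" by (elim dvdE)
  let ?c = "[:inverse (poly q a):]"
  have "(- c * r) * y + c * q = c * (q - y * r)" for c y :: "'a poly" by (simp add: algebra_simps)
  then have "(- ?c * r) * [:- a, 1:] + ?c * q = ?c * (q - [:- a, 1:] * r)" .
  also have "q - [:- a, 1:] * r = [:poly q a:]" using r by (simp add: algebra_simps)
  also have "?c * [:poly q a:] = 1" using assms by (simp add: one_pCons)
  finally show ?thesis unfolding bezout_def by blast
qed

text \<open>
  A combination \<open>w\<close> of \<open>p\<close> and \<open>q\<close> of least degree divides both; it is a unit, as otherwise both
  would be associated to \<open>w\<close>.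
\<close>
lemma bezout_irreducible:
  fixes p q :: "'a::field poly"
  assumes p: "irreducible p" "monic p" and q: "irreducible q" "monic q" and neq: "p \<noteq> q"
  shows "bezout p q"
proof -
  define I where "I = {u * p + v * q | u v. True}"
  have pI: "p \<in> I" unfolding I_def by (rule CollectI, rule exI[of _ 1], rule exI[of _ 0]) simp
  have qI: "q \<in> I" unfolding I_def by (rule CollectI, rule exI[of _ 0], rule exI[of _ 1]) simp
  have p0: "p \<noteq> 0" using p(1) by auto
  obtain w where w: "w \<in> I" "w \<noteq> 0" "\<And>x. x \<in> I \<Longrightarrow> x \<noteq> 0 \<Longrightarrow> degree w \<le> degree x"
    using ex_has_least_nat[of "\<lambda>x. x \<in> I \<and> x \<noteq> 0" p degree] pI p0 by blast
  obtain u v where uv: "w = u * p + v * q" using w(1) by (auto simp: I_def)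
  have dvdI: "w dvd x" if x: "x \<in> I" for x
  proof -
    obtain u' v' where x': "x = u' * p + v' * q" using x by (auto simp: I_def)
    have "x mod w = x - x div w * w" by (simp add: minus_div_mult_eq_mod)
    also have "\<dots> = (u' - x div w * u) * p + (v' - x div w * v) * q"
      unfolding x' by (subst (2) uv) (simp add: algebra_simps)
    finally have "x mod w \<in> I" unfolding I_def by blast
    then have "x mod w = 0"
      using w(3) degree_mod_less[OF w(2), of x] by (meson not_le)
    then show ?thesis by (simp add: mod_eq_0_iff_dvd)
  qed
  have "is_unit w"
  proof (rule ccontr)
    assume nu: "\<not> is_unit w"
    obtain a b where a: "p = w * a" and b: "q = w * b"
      using dvdI[OF pI] dvdI[OF qI] by (meson dvdE)
    have "is_unit a" "is_unit b" using irreducibleD[OF p(1) a] irreducibleD[OF q(1) b] nu by auto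
    then obtain \<alpha> \<beta> where ab: "a = [:\<alpha>:]" "b = [:\<beta>:]" by (meson is_unit_polyE)
    have "lead_coeff w * lead_coeff a = 1" using p(2) unfolding a lead_coeff_mult .
    moreover have "lead_coeff w * lead_coeff b = 1" using q(2) unfolding b lead_coeff_mult .
    ultimately have "\<alpha> * lead_coeff w = 1" "\<beta> * lead_coeff w = 1"
      by (simp_all add: ab mult.commute)
    then have "\<alpha> = \<beta>" by (metis mult_right_cancel mult_zero_right zero_neq_one)
    then show False using neq a b ab by simp
  qed
  then obtain c where "c * w = 1" by (metis dvdE mult.commute)
  then have "(c * u) * p + (c * v) * q = 1" unfolding uv by (simp add: algebra_simps)
  then show ?thesis unfolding bezout_def by blast
qed

section \<open>Real Jordan blocks\<close>

definition rotation_part :: "nat \<Rightarrow> real mat" where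
  "rotation_part m = mat m m (\<lambda>(i, j).
     if even i \<and> j = i + 1 then 1 else if odd i \<and> i = j + 1 then - 1 else 0)"

definition double_shift :: "nat \<Rightarrow> real mat" where
  "double_shift m = mat m m (\<lambda>(i, j). if j = i + 2 then 1 else 0)"

lemma real_jordan_closed [simp]:
  "real_jordan_block m ab \<in> carrier_mat m m" "rotation_part m \<in> carrier_mat m m"
  "double_shift m \<in> carrier_mat m m"
  by (simp_all add: real_jordan_block_def rotation_part_def double_shift_def)

lemma rotation_row:
  assumes "i < m" "k < m"
  shows "rotation_part m $$ (i, k)
    = (if k = (if even i then i + 1 else i - 1) then if even i then 1 else - 1 else 0)"
  using assms by (cases "even i"; cases i) (auto simp: rotation_part_def)

lemma rotation_column:
  assumes "k < m" "j < m"
  shows "rotation_part m $$ (k, j)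
    = (if k = (if even j then j + 1 else j - 1) then if even j then - 1 else 1 else 0)"
  using assms by (cases "even j"; cases j) (auto simp: rotation_part_def)

lemma real_jordan_index:
  assumes "i < m" "j < m"
  shows "real_jordan_block m (a, b) $$ (i, j) = (if i = j then a else 0)
    + b * rotation_part m $$ (i, j) + double_shift m $$ (i, j)"
proof -
  have same: "k div 2 = l div 2 \<and> k < l \<longleftrightarrow> even k \<and> l = k + 1" for k l :: nat
  proof -
    have "k = 2 * (k div 2) + k mod 2" "l = 2 * (l div 2) + l mod 2" "k mod 2 < 2" "l mod 2 < 2"
      by auto
    then show ?thesis unfolding even_iff_mod_2_eq_zero by linarith
  qed
  have up: "i div 2 = j div 2 \<and> i < j \<longleftrightarrow> even i \<and> j = i + 1"
    and down: "j div 2 = i div 2 \<and> j < i \<longleftrightarrow> even j \<and> i = j + 1"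
    by (rule same)+
  consider "i = j" | "even i \<and> j = i + 1" | "even j \<and> i = j + 1"
    | "i \<noteq> j" "\<not> (even i \<and> j = i + 1)" "\<not> (even j \<and> i = j + 1)"
    by blast
  then show ?thesis
  proof cases
    case 1
    then show ?thesis using assms
      by (simp add: real_jordan_block_def rotation_part_def double_shift_def)
  next
    case 2
    then have "i div 2 = j div 2" using up by blast
    with 2 show ?thesis using assms
      by (simp add: real_jordan_block_def rotation_part_def double_shift_def)
  next
    case 3
    then have "j div 2 = i div 2" using down by blast
    with 3 show ?thesis using assms
      by (simp add: real_jordan_block_def rotation_part_def double_shift_def)
  next
    case 4
    then have "i div 2 \<noteq> j div 2" using up down by (metis linorder_neqE_nat)
    moreover have "\<not> (odd i \<and> i = j + 1)" using 4(3) by (metis even_Suc Suc_eq_plus1)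
    ultimately show ?thesis using assms 4(1,2)
      by (auto simp: real_jordan_block_def rotation_part_def double_shift_def)
  qed
qed

lemma real_jordan_column:
  assumes "i < m" "k < m"
  shows "real_jordan_block m (a, b) $$ (i, k) = (if i = k then a else 0)
    + (if i = (if even k then k + 1 else k - 1) then if even k then - b else b else 0)
    + (if i = k - 2 then if 2 \<le> k then 1 else 0 else 0)"
proof -
  have "b * rotation_part m $$ (i, k)
      = (if i = (if even k then k + 1 else k - 1) then if even k then - b else b else 0)"
    using assms by (simp add: rotation_column)
  moreover have "double_shift m $$ (i, k) = (if i = k - 2 then if 2 \<le> k then 1 else 0 else 0)"
    using assms by (auto simp: double_shift_def)
  ultimately show ?thesis by (simp only: real_jordan_index[OF assms])
qed

lemma real_jordan_row:
  assumes "k < m" "i < m"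
  shows "real_jordan_block m (a, b) $$ (k, i) = (if i = k then a else 0)
    + (if i = (if even k then k + 1 else k - 1) then if even k then b else - b else 0)
    + (if i = k + 2 then 1 else 0)"
proof -
  have "b * rotation_part m $$ (k, i)
      = (if i = (if even k then k + 1 else k - 1) then if even k then b else - b else 0)"
    using assms by (simp add: rotation_row)
  moreover have "double_shift m $$ (k, i) = (if i = k + 2 then 1 else 0)"
    using assms by (simp add: double_shift_def)
  ultimately show ?thesis by (simp only: real_jordan_index[OF assms] eq_commute[of k i])
qed

lemma real_jordan_decompose:
  "real_jordan_block m (a, b) = a \<cdot>\<^sub>m 1\<^sub>m m + b \<cdot>\<^sub>m rotation_part m + double_shift m"
  using carrier_matD[OF real_jordan_closed(1)[of m "(a, b)"]]
    carrier_matD[OF real_jordan_closed(2)[of m]] carrier_matD[OF real_jordan_closed(3)[of m]]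
  by (intro eq_matI) (auto simp: real_jordan_index)

lemma rotation_mult_index:
  assumes m: "even m" and M: "M \<in> carrier_mat m l" and i: "i < m" and j: "j < l"
  shows "(rotation_part m * M) $$ (i, j) = (if even i then M $$ (i + 1, j) else - M $$ (i - 1, j))"
proof -
  let ?i = "if even i then i + 1 else i - 1"
  have "?i < m" using m i by (auto elim!: evenE)
  have "(rotation_part m * M) $$ (i, j) = (\<Sum>k<m. rotation_part m $$ (i, k) * M $$ (k, j))"
    by (rule index_mult_mat_sum[OF real_jordan_closed(2) M i j])
  also have "\<dots> = (\<Sum>k<m. if k = ?i then (if even i then 1 else - 1) * M $$ (?i, j) else 0)"
    by (rule sum.cong) (use i in \<open>simp_all add: rotation_row\<close>)
  also have "\<dots> = (if even i then M $$ (i + 1, j) else - M $$ (i - 1, j))"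
    using \<open>?i < m\<close> by auto
  finally show ?thesis .
qed

lemma mult_rotation_index:
  assumes m: "even m" and M: "M \<in> carrier_mat l m" and i: "i < l" and j: "j < m"
  shows "(M * rotation_part m) $$ (i, j) = (if even j then - M $$ (i, j + 1) else M $$ (i, j - 1))"
proof -
  let ?j = "if even j then j + 1 else j - 1"
  have "?j < m" using m j by (auto elim!: evenE)
  have "(M * rotation_part m) $$ (i, j) = (\<Sum>k<m. M $$ (i, k) * rotation_part m $$ (k, j))"
    by (rule index_mult_mat_sum[OF M real_jordan_closed(2) i j])
  also have "\<dots> = (\<Sum>k<m. if k = ?j then (if even j then - 1 else 1) * M $$ (i, ?j) else 0)"
    by (rule sum.cong) (use j in \<open>simp_all add: rotation_column\<close>)
  also have "\<dots> = (if even j then - M $$ (i, j + 1) else M $$ (i, j - 1))"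
    using \<open>?j < m\<close> by auto
  finally show ?thesis .
qed

lemma double_shift_mult_index:
  assumes M: "M \<in> carrier_mat m l" and i: "i < m" and j: "j < l"
  shows "(double_shift m * M) $$ (i, j) = (if i + 2 < m then M $$ (i + 2, j) else 0)"
proof -
  have "(double_shift m * M) $$ (i, j) = (\<Sum>k<m. double_shift m $$ (i, k) * M $$ (k, j))"
    by (rule index_mult_mat_sum[OF real_jordan_closed(3) M i j])
  also have "\<dots> = (\<Sum>k<m. if k = i + 2 then M $$ (i + 2, j) else 0)"
    using i by (intro sum.cong) (auto simp: double_shift_def)
  finally show ?thesis by simp
qed

lemma mult_double_shift_index:
  assumes M: "M \<in> carrier_mat l m" and i: "i < l" and j: "j < m"
  shows "(M * double_shift m) $$ (i, j) = (if 2 \<le> j then M $$ (i, j - 2) else 0)"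
proof -
  have "(M * double_shift m) $$ (i, j) = (\<Sum>k<m. M $$ (i, k) * double_shift m $$ (k, j))"
    by (rule index_mult_mat_sum[OF M real_jordan_closed(3) i j])
  also have "\<dots> = (\<Sum>k<m. if k = j - 2 then (if 2 \<le> j then M $$ (i, j - 2) else 0) else 0)"
    using j by (intro sum.cong) (auto simp: double_shift_def)
  also have "\<dots> = (if 2 \<le> j then M $$ (i, j - 2) else 0)" using j by auto
  finally show ?thesis .
qed

lemma rotation_square:
  assumes "even m"
  shows "rotation_part m * rotation_part m = - 1 \<cdot>\<^sub>m 1\<^sub>m m"
proof (rule eq_matI)
  fix i j assume "i < dim_row (- 1 \<cdot>\<^sub>m 1\<^sub>m m :: real mat)" "j < dim_col (- 1 \<cdot>\<^sub>m 1\<^sub>m m :: real mat)"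
  then have ij: "i < m" "j < m" by auto
  have "even i \<Longrightarrow> i + 1 < m" using assms ij by presburger
  then show "(rotation_part m * rotation_part m) $$ (i, j) = (- 1 \<cdot>\<^sub>m 1\<^sub>m m) $$ (i, j)"
    unfolding rotation_mult_index[OF assms real_jordan_closed(2) ij] using ij
    by (auto simp: rotation_part_def elim!: oddE)
qed (auto simp: rotation_part_def)

lemma rotation_double_shift_commute:
  assumes "even m"
  shows "double_shift m * rotation_part m = rotation_part m * double_shift m"
proof (rule eq_matI)
  let ?J = "rotation_part m" and ?N = "double_shift m"
  fix i j assume "i < dim_row (?J * ?N)" "j < dim_col (?J * ?N)"
  then have ij: "i < m" "j < m" by (auto simp: rotation_part_def double_shift_def)
  have i1: "even i \<Longrightarrow> i + 1 < m" "odd i \<Longrightarrow> i + 1 < m \<Longrightarrow> i + 2 < m"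
    using assms ij by presburger+
  have "(?N * ?J) $$ (i, j) = (if i + 2 < m then ?J $$ (i + 2, j) else 0)"
    by (rule double_shift_mult_index[OF real_jordan_closed(2) ij])
  also have "\<dots> = (if even i then if j = i + 3 then 1 else 0 else if j = i + 1 then - 1 else 0)"
    using ij i1 by (auto simp: rotation_part_def)
  also have "\<dots> = (if even i then ?N $$ (i + 1, j) else - ?N $$ (i - 1, j))"
    using ij i1 by (auto simp: double_shift_def elim!: oddE)
  also have "\<dots> = (?J * ?N) $$ (i, j)"
    by (rule rotation_mult_index[OF assms real_jordan_closed(3) ij, symmetric])
  finally show "(?N * ?J) $$ (i, j) = (?J * ?N) $$ (i, j)" .
qed (auto simp: rotation_part_def double_shift_def)

lemma rotation_commutes:
  assumes "even m"
  shows "real_jordan_block m (a, b) * rotation_part m = rotation_part m * real_jordan_block m (a, b)"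
proof -
  let ?J = "rotation_part m" and ?N = "double_shift m"
  have J: "?J \<in> carrier_mat m m" and N: "?N \<in> carrier_mat m m" by simp_all
  have aJ: "a \<cdot>\<^sub>m 1\<^sub>m m \<in> carrier_mat m m" "b \<cdot>\<^sub>m ?J \<in> carrier_mat m m"
    "a \<cdot>\<^sub>m 1\<^sub>m m + b \<cdot>\<^sub>m ?J \<in> carrier_mat m m"
    by simp_all
  have "(a \<cdot>\<^sub>m 1\<^sub>m m) * ?J = ?J * (a \<cdot>\<^sub>m 1\<^sub>m m)"
    using mult_smult_assoc_mat[OF one_carrier_mat J, of a] mult_smult_distrib[OF J one_carrier_mat, of a]
      left_mult_one_mat[OF J] right_mult_one_mat[OF J] by simp
  moreover have "(b \<cdot>\<^sub>m ?J) * ?J = ?J * (b \<cdot>\<^sub>m ?J)"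
    using mult_smult_assoc_mat[OF J J, of b] mult_smult_distrib[OF J J, of b] by simp
  ultimately show ?thesis
    unfolding real_jordan_decompose add_mult_distrib_mat[OF aJ(3) N J] mult_add_distrib_mat[OF J aJ(3) N]
      add_mult_distrib_mat[OF aJ(1,2) J] mult_add_distrib_mat[OF J aJ(1,2)]
      rotation_double_shift_commute[OF assms]
    by simp
qed

text \<open>
  Block upper triangular matrices with blocks of size two whose nonzero blocks begin at the \<open>k\<close>-th
  block superdiagonal. The numbers \<open>k\<close> add up under multiplication.
\<close>
definition block_band :: "nat \<Rightarrow> nat \<Rightarrow> real mat \<Rightarrow> bool" where
  "block_band m k M \<longleftrightarrow> M \<in> carrier_mat m m \<and>
     (\<forall>i<m. \<forall>j<m. j div 2 < i div 2 + k \<longrightarrow> M $$ (i, j) = 0)"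

lemma block_band_mult:
  assumes "block_band m k M" "block_band m l N"
  shows "block_band m (k + l) (M * N)"
proof -
  have c: "M \<in> carrier_mat m m" "N \<in> carrier_mat m m" using assms by (auto simp: block_band_def)
  have "(M * N) $$ (i, j) = 0" if ij: "i < m" "j < m" "j div 2 < i div 2 + (k + l)" for i j
  proof -
    have "M $$ (i, s) * N $$ (s, j) = 0" if "s < m" for s
    proof (cases "s div 2 < i div 2 + k")
      case True
      then show ?thesis using assms(1) that ij by (simp add: block_band_def)
    next
      case False
      then have "j div 2 < s div 2 + l" using ij by simp
      then show ?thesis using assms(2) that ij by (simp add: block_band_def)
    qed
    then show ?thesis unfolding index_mult_mat_sum[OF c ij(1,2)] by (intro sum.neutral) auto
  qed
  then show ?thesis using c by (auto simp: block_band_def)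
qed

lemma block_band_mono: "block_band m k M \<Longrightarrow> l \<le> k \<Longrightarrow> block_band m l M"
  by (auto simp: block_band_def)

lemma block_band_add: "block_band m k M \<Longrightarrow> block_band m k N \<Longrightarrow> block_band m k (M + N)"
  by (auto simp: block_band_def)

lemma block_band_smult: "block_band m k M \<Longrightarrow> block_band m k (c \<cdot>\<^sub>m M)"
  by (auto simp: block_band_def)

lemma block_band_parts: "block_band m 0 (rotation_part m)" "block_band m 1 (double_shift m)"
proof -
  have "even i \<and> j = i + 1 \<Longrightarrow> \<not> j div 2 < i div 2" "odd i \<and> i = j + 1 \<Longrightarrow> \<not> j div 2 < i div 2" for i j :: nat
    by presburger+
  then show "block_band m 0 (rotation_part m)" by (auto simp: block_band_def rotation_part_def)
  show "block_band m 1 (double_shift m)" by (auto simp: block_band_def double_shift_def)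
qed

lemma block_band_zero:
  assumes "block_band m k M" "m \<le> 2 * k"
  shows "M = 0\<^sub>m m m"
proof (rule eq_matI)
  fix i j assume "i < dim_row (0\<^sub>m m m :: real mat)" "j < dim_col (0\<^sub>m m m :: real mat)"
  then have ij: "i < m" "j < m" by auto
  then have "j div 2 < i div 2 + k" using assms(2) by linarith
  then show "M $$ (i, j) = (0\<^sub>m m m) $$ (i, j)" using assms(1) ij by (auto simp: block_band_def)
qed (use assms in \<open>auto simp: block_band_def\<close>)

text \<open>
  Replacing \<open>X\<^sup>-\<^sup>1\<close> by \<open>-X\<close> in the Newton step for \<open>X\<^sup>2 = -1\<close> gives \<open>E \<mapsto> (E\<^sup>3 + 3E)/2\<close>. The error
  with respect to a root \<open>J\<close> that commutes with \<open>E\<close> is squared, up to a factor.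
\<close>
lemma newton_error:
  fixes E J :: "real mat"
  assumes E: "E \<in> carrier_mat m m" and J: "J \<in> carrier_mat m m"
    and EJ: "E * J = J * E" and JJ: "J * J = - 1 \<cdot>\<^sub>m 1\<^sub>m m"
  shows "(E - J) * (E - J) * (E + 2 \<cdot>\<^sub>m J) = E * E * E + 3 \<cdot>\<^sub>m E - 2 \<cdot>\<^sub>m J"
proof -
  have c: "E * E \<in> carrier_mat m m" "E * J \<in> carrier_mat m m" "E * E * E \<in> carrier_mat m m"
    "E * E * J \<in> carrier_mat m m" using E J by auto
  let ?D = "E * E - 2 \<cdot>\<^sub>m (E * J) - 1\<^sub>m m"
  have D: "?D \<in> carrier_mat m m" using c by auto
  have "(E - J) * (E - J) = (E - J) * E - (E - J) * J"
    using E J by (intro mult_minus_distrib_mat) auto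
  also have "(E - J) * E = E * E - E * J"
    using minus_mult_distrib_mat[OF E J E] EJ by simp
  also have "(E - J) * J = E * J - - 1 \<cdot>\<^sub>m 1\<^sub>m m"
    using minus_mult_distrib_mat[OF E J J] JJ by simp
  finally have "(E - J) * (E - J) = E * E - E * J - (E * J - - 1 \<cdot>\<^sub>m 1\<^sub>m m)" .
  also have "\<dots> = ?D"
  proof -
    have "U - V - (V - - 1 \<cdot>\<^sub>m 1\<^sub>m m) = U - 2 \<cdot>\<^sub>m V - 1\<^sub>m m"
      if "U \<in> carrier_mat m m" "V \<in> carrier_mat m m" for U V :: "real mat"
      using that by (intro eq_matI) auto
    then show ?thesis using c by simp
  qed
  finally have 1: "(E - J) * (E - J) = ?D" .
  have EJE: "E * J * E = E * E * J"
    using assoc_mult_mat[OF E J E] assoc_mult_mat[OF E E J] EJ by simp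
  have EJJ: "E * J * J = - 1 \<cdot>\<^sub>m E"
    using assoc_mult_mat[OF E J J] JJ mult_smult_distrib[OF E, of "1\<^sub>m m" m "- 1"] E by simp
  have DX: "?D * X = E * E * X - 2 \<cdot>\<^sub>m (E * J * X) - X" if X: "X \<in> carrier_mat m m" for X
  proof -
    have "?D * X = (E * E - 2 \<cdot>\<^sub>m (E * J)) * X - 1\<^sub>m m * X"
      by (intro minus_mult_distrib_mat[of _ m m] minus_carrier_mat) (use c X in simp_all)
    also have "(E * E - 2 \<cdot>\<^sub>m (E * J)) * X = E * E * X - (2 \<cdot>\<^sub>m (E * J)) * X"
      using c X by (intro minus_mult_distrib_mat) auto
    also have "(2 \<cdot>\<^sub>m (E * J)) * X = 2 \<cdot>\<^sub>m (E * J * X)"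
      using c X by (intro mult_smult_assoc_mat) auto
    finally show ?thesis using X by simp
  qed
  have "?D * (E + 2 \<cdot>\<^sub>m J) = ?D * E + ?D * (2 \<cdot>\<^sub>m J)"
    using D E J by (intro mult_add_distrib_mat) auto
  also have "?D * (2 \<cdot>\<^sub>m J) = 2 \<cdot>\<^sub>m (?D * J)" by (rule mult_smult_distrib[OF D J])
  also have "?D * E + 2 \<cdot>\<^sub>m (?D * J) = (E * E * E - 2 \<cdot>\<^sub>m (E * E * J) - E)
      + 2 \<cdot>\<^sub>m (E * E * J - 2 \<cdot>\<^sub>m (- 1 \<cdot>\<^sub>m E) - J)"
    unfolding DX[OF E] DX[OF J] EJE EJJ ..
  also have "\<dots> = E * E * E + 3 \<cdot>\<^sub>m E - 2 \<cdot>\<^sub>m J"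
  proof -
    have "(U - 2 \<cdot>\<^sub>m V - E) + 2 \<cdot>\<^sub>m (V - 2 \<cdot>\<^sub>m (- 1 \<cdot>\<^sub>m E) - J) = U + 3 \<cdot>\<^sub>m E - 2 \<cdot>\<^sub>m J"
      if "U \<in> carrier_mat m m" "V \<in> carrier_mat m m" for U V :: "real mat"
      using that E J by (intro eq_matI) auto
    then show ?thesis using c by simp
  qed
  finally show ?thesis unfolding 1 .
qed

text \<open>The characteristic polynomial of the 2-by-2 block with \<open>a\<close> on the diagonal and \<open>b\<close>, \<open>-b\<close> off it.\<close>
definition pair_poly :: "real \<times> real \<Rightarrow> real poly" where
  "pair_poly ab = [:- fst ab, 1:]\<^sup>2 + [:(snd ab)\<^sup>2:]"

text \<open>
  Newton's iteration for \<open>X\<^sup>2 = -1\<close>, started at \<open>(x - a)/b\<close>, produces polynomials \<open>u\<close> that are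
  square roots of \<open>-1\<close> modulo ever higher powers of \<open>(x - a)\<^sup>2 + b\<^sup>2\<close>, and such that \<open>u(C)\<close> agrees
  with the rotation part of \<open>C\<close> on more and more block superdiagonals. So the rotation part is a
  polynomial in \<open>C\<close>.
\<close>
lemma rotation_polynomial_step:
  assumes b: "b \<noteq> 0"
  shows "\<exists>u. pair_poly (a, b) ^ Suc k dvd u\<^sup>2 + 1 \<and>
    pair_poly (a, b) dvd [:- a, 1:] - Polynomial.smult b u \<and>
    (\<forall>m. even m \<longrightarrow> block_band m (Suc k) (mat_poly m (real_jordan_block m (a, b)) u - rotation_part m))"
proof (induction k)
  case 0
  let ?u = "Polynomial.smult (1 / b) [:- a, 1:]" and ?q = "pair_poly (a, b)"
  have "?q = Polynomial.smult (b\<^sup>2) (?u\<^sup>2 + 1)"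
    using b by (simp add: pair_poly_def smult_power[symmetric] power_divide smult_add_right)
  then have "?q dvd ?u\<^sup>2 + 1" using b by (metis dvd_smult_cancel dvd_refl smult_dvd_iff power2_eq_square no_zero_divisors)
  moreover have "[:- a, 1:] - Polynomial.smult b ?u = 0" using b by simp
  moreover have "block_band m (Suc 0) (mat_poly m (real_jordan_block m (a, b)) ?u - rotation_part m)" for m
  proof -
    let ?C = "real_jordan_block m (a, b)"
    have "(1 / b) \<cdot>\<^sub>m (- a \<cdot>\<^sub>m 1\<^sub>m m + 1 \<cdot>\<^sub>m (a \<cdot>\<^sub>m 1\<^sub>m m + b \<cdot>\<^sub>m J + N)) - J = (1 / b) \<cdot>\<^sub>m N"
      if "J \<in> carrier_mat m m" "N \<in> carrier_mat m m" for J N :: "real mat"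
      using that b by (intro eq_matI) (auto simp: field_simps)
    then have e: "mat_poly m ?C ?u - rotation_part m = (1 / b) \<cdot>\<^sub>m double_shift m"
      unfolding mat_poly_smult[OF real_jordan_closed(1)] mat_poly_linear[OF real_jordan_closed(1)]
      unfolding real_jordan_decompose by simp
    show ?thesis unfolding e by (rule block_band_smult[OF block_band_parts(2)[unfolded One_nat_def]])
  qed
  ultimately show ?case unfolding power_Suc0_right by (intro exI[of _ ?u]) simp
next
  case (Suc k)
  let ?q = "pair_poly (a, b)"
  obtain u where u: "?q ^ Suc k dvd u\<^sup>2 + 1" "?q dvd [:- a, 1:] - Polynomial.smult b u"
    "\<And>m. even m \<Longrightarrow> block_band m (Suc k) (mat_poly m (real_jordan_block m (a, b)) u - rotation_part m)"
    using Suc by blast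
  define u' where "u' = Polynomial.smult (1/2) (u * (u\<^sup>2 + 3))"
  have u2: "2 * u' = u * (u\<^sup>2 + 3)"
    by (simp add: u'_def numeral_poly)
  have "(2 * u')\<^sup>2 + 4 = (u\<^sup>2 + 1)\<^sup>2 * (u\<^sup>2 + 4)"
    unfolding u2 by (simp add: power2_eq_square algebra_simps)
  moreover have "(2 * u')\<^sup>2 + 4 = 4 * (u'\<^sup>2 + 1)" by (simp add: power2_eq_square algebra_simps)
  moreover have "4 * v = Polynomial.smult 4 v" for v :: "real poly" by (simp add: numeral_poly)
  ultimately have e4: "Polynomial.smult 4 (u'\<^sup>2 + 1) = (u\<^sup>2 + 1)\<^sup>2 * (u\<^sup>2 + 4)"
    by metis
  have "?q ^ Suc (Suc k) dvd (?q ^ Suc k)\<^sup>2"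
    unfolding power_mult[symmetric] by (rule le_imp_power_dvd) simp
  also have "\<dots> dvd (u\<^sup>2 + 1)\<^sup>2" using u(1) by (rule dvd_power_same)
  finally have "?q ^ Suc (Suc k) dvd Polynomial.smult 4 (u'\<^sup>2 + 1)"
    unfolding e4 by (rule dvd_mult2)
  then have 1: "?q ^ Suc (Suc k) dvd u'\<^sup>2 + 1" by (rule dvd_smult_cancel) simp
  have "?q dvd u\<^sup>2 + 1" using u(1) unfolding power_Suc by (rule dvd_mult_left)
  moreover have "[:- a, 1:] - Polynomial.smult b u'
      = ([:- a, 1:] - Polynomial.smult b u) - Polynomial.smult (b / 2) (u * (u\<^sup>2 + 1))"
  proof -
    have "u * (u\<^sup>2 + 3) = u * (u\<^sup>2 + 1) + 2 * u" by (simp add: algebra_simps)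
    moreover have "2 * u = Polynomial.smult 2 u" by (simp add: numeral_poly)
    ultimately have "u * (u\<^sup>2 + 3) = u * (u\<^sup>2 + 1) + Polynomial.smult 2 u" by metis
    then show ?thesis unfolding u'_def by (simp only: smult_add_right smult_smult) simp
  qed
  ultimately have 2: "?q dvd [:- a, 1:] - Polynomial.smult b u'"
    using u(2) by (simp only: dvd_diff dvd_smult dvd_mult)
  have 3: "block_band m (Suc (Suc k)) (mat_poly m (real_jordan_block m (a, b)) u' - rotation_part m)"
    if m: "even m" for m
  proof -
    let ?C = "real_jordan_block m (a, b)" and ?J = "rotation_part m"
    define E where "E = mat_poly m ?C u"
    have E: "E \<in> carrier_mat m m" by (simp add: E_def)
    have J: "?J \<in> carrier_mat m m" by simp
    have EJ: "E * ?J = ?J * E" unfolding E_def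
      by (rule mat_poly_commute[OF real_jordan_closed(1) J rotation_commutes[OF m]])
    have dE: "block_band m (Suc k) (E - ?J)" using u(3)[OF m] by (simp add: E_def)
    have "E = ?J + (E - ?J)" using E carrier_matD[OF J] by (intro eq_matI) auto
    moreover have "block_band m 0 (E - ?J)" using dE by (rule block_band_mono) simp
    ultimately have "block_band m 0 E" using block_band_add[OF block_band_parts(1)] by metis
    then have "block_band m 0 (E + 2 \<cdot>\<^sub>m ?J)"
      by (intro block_band_add block_band_smult block_band_parts)
    then have "block_band m (Suc k + Suc k + 0) ((E - ?J) * (E - ?J) * (E + 2 \<cdot>\<^sub>m ?J))"
      by (intro block_band_mult dE)
    then have "block_band m (Suc (Suc k)) ((E - ?J) * (E - ?J) * (E + 2 \<cdot>\<^sub>m ?J))"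
      by (rule block_band_mono) simp
    then have "block_band m (Suc (Suc k)) ((1/2) \<cdot>\<^sub>m (E * E * E + 3 \<cdot>\<^sub>m E - 2 \<cdot>\<^sub>m ?J))"
      unfolding newton_error[OF E J EJ rotation_square[OF m]] by (rule block_band_smult)
    moreover have "mat_poly m ?C u' - ?J = (1/2) \<cdot>\<^sub>m (E * E * E + 3 \<cdot>\<^sub>m E - 2 \<cdot>\<^sub>m ?J)"
    proof -
      have "u' = Polynomial.smult (1/2) (u * u * u + Polynomial.smult 3 u)"
        by (simp add: u'_def power2_eq_square numeral_poly algebra_simps)
      then have "mat_poly m ?C u' = (1/2) \<cdot>\<^sub>m (E * E * E + 3 \<cdot>\<^sub>m E)"
        by (simp only: mat_poly_smult[OF real_jordan_closed(1)] mat_poly_add[OF real_jordan_closed(1)]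
            mat_poly_mult[OF real_jordan_closed(1)] E_def)
      moreover have "(1/2) \<cdot>\<^sub>m (U + 3 \<cdot>\<^sub>m E) - ?J = (1/2) \<cdot>\<^sub>m (U + 3 \<cdot>\<^sub>m E - 2 \<cdot>\<^sub>m ?J)"
        if "U \<in> carrier_mat m m" for U
        using that E carrier_matD[OF J] by (intro eq_matI) (auto simp: field_simps)
      ultimately show ?thesis using E by simp
    qed
    ultimately show ?thesis by simp
  qed
  show ?case using 1 2 3 by blast
qed

lemma rotation_polynomial:
  assumes "b \<noteq> 0" "even m"
  obtains u where "pair_poly (a, b) ^ (m div 2) dvd u\<^sup>2 + 1"
    "pair_poly (a, b) dvd [:- a, 1:] - Polynomial.smult b u"
    "mat_poly m (real_jordan_block m (a, b)) u = rotation_part m"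
proof -
  obtain u where u: "pair_poly (a, b) ^ Suc (m div 2) dvd u\<^sup>2 + 1"
    "pair_poly (a, b) dvd [:- a, 1:] - Polynomial.smult b u"
    "block_band m (Suc (m div 2)) (mat_poly m (real_jordan_block m (a, b)) u - rotation_part m)"
    using rotation_polynomial_step[OF assms(1), of a "m div 2"] assms(2) by blast
  let ?E = "mat_poly m (real_jordan_block m (a, b)) u"
  have E: "?E \<in> carrier_mat m m" by simp
  have "?E - rotation_part m = 0\<^sub>m m m" by (rule block_band_zero[OF u(3)]) simp
  moreover have "V = W" if "V - W = 0\<^sub>m m m" "V \<in> carrier_mat m m" "W \<in> carrier_mat m m" for V W :: "real mat"
  proof (rule eq_matI)
    fix i j assume "i < dim_row W" "j < dim_col W"
    then have "(V - W) $$ (i, j) = V $$ (i, j) - W $$ (i, j)" "i < m" "j < m"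
      using that(3) by auto
    then show "V $$ (i, j) = W $$ (i, j)" unfolding that(1) by simp
  qed (use that in auto)
  ultimately have "?E = rotation_part m" using E by simp
  moreover have "pair_poly (a, b) ^ (m div 2) dvd u\<^sup>2 + 1" using u(1) unfolding power_Suc by (rule dvd_mult_right)
  ultimately show ?thesis using that u(2) by blast
qed

text \<open>
  With \<open>u(C)\<close> the rotation part and \<open>t = x - a - bu\<close>, the matrix \<open>t(C)\<close> is the block shift, so the
  unit vectors are \<open>t(C)\<^sup>j\<close> and \<open>u(C) t(C)\<^sup>j\<close> applied to the last one.
\<close>
lemma cyclic_block_real_jordan:
  assumes b: "b \<noteq> 0" and m: "even m" "0 < m"
  shows "cyclic_block (real_jordan_block m (a, b)) (pair_poly (a, b) ^ (m div 2))"
proof -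
  let ?C = "real_jordan_block m (a, b)" and ?J = "rotation_part m" and ?N = "double_shift m"
    and ?q = "pair_poly (a, b)"
  have C: "?C \<in> carrier_mat m m" by simp
  obtain u where u: "?q ^ (m div 2) dvd u\<^sup>2 + 1" "?q dvd [:- a, 1:] - Polynomial.smult b u"
    "mat_poly m ?C u = ?J"
    using rotation_polynomial[OF b m(1)] by blast
  define t where "t = [:- a, 1:] - Polynomial.smult b u"
  have y: "pCons 0 p = Polynomial.smult a p + t * p + Polynomial.smult b (u * p)" for p
    unfolding t_def by (subst pCons_0_linear[of p a]) (simp add: algebra_simps)
  have "(- a \<cdot>\<^sub>m 1\<^sub>m m + 1 \<cdot>\<^sub>m (a \<cdot>\<^sub>m 1\<^sub>m m + b \<cdot>\<^sub>m J + N)) - b \<cdot>\<^sub>m J = N"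
    if "J \<in> carrier_mat m m" "N \<in> carrier_mat m m" for J N :: "real mat"
    using that by (intro eq_matI) auto
  then have tC: "mat_poly m ?C t = ?N"
    unfolding t_def mat_poly_minus[OF C] mat_poly_smult[OF C] u(3) mat_poly_linear[OF C]
    unfolding real_jordan_decompose by simp
  have tj: "mat_poly m ?C (t ^ j) \<in> carrier_mat m m" for j by simp
  have col_t: "mat_poly m ?C (t ^ j) $$ (r, m - 1) = (if r + 2 * j = m - 1 then 1 else 0)" if "r < m" for r j
    using that
  proof (induction j arbitrary: r)
    case 0
    then show ?case by auto
  next
    case (Suc j)
    have "mat_poly m ?C (t ^ Suc j) = ?N * mat_poly m ?C (t ^ j)"
      by (simp only: power_Suc mat_poly_mult[OF C] tC)
    then show ?case
      using double_shift_mult_index[OF tj Suc.prems, of "m - 1"] Suc.IH[of "r + 2"] Suc.prems m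
      by (auto simp del: index_mult_mat(1))
  qed
  have row_t: "mat_poly m ?C (t ^ j) $$ (0, r) = (if r = 2 * j then 1 else 0)" if "r < m" for r j
    using that
  proof (induction j arbitrary: r)
    case 0
    then show ?case by auto
  next
    case (Suc j)
    have "mat_poly m ?C (t ^ Suc j) = mat_poly m ?C (t ^ j) * ?N"
      by (simp only: power_Suc2 mat_poly_mult[OF C] tC)
    then show ?case
      using mult_double_shift_index[OF tj m(2) Suc.prems] Suc.IH[of "r - 2"] Suc.prems
      by (auto simp del: index_mult_mat(1))
  qed
  have col_ut: "mat_poly m ?C (u * t ^ j) $$ (r, m - 1) = (if r + 1 + 2 * j = m - 1 then 1 else 0)"
    if r: "r < m" for r j
  proof -
    have "mat_poly m ?C (u * t ^ j) $$ (r, m - 1)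
        = (if even r then mat_poly m ?C (t ^ j) $$ (r + 1, m - 1) else - mat_poly m ?C (t ^ j) $$ (r - 1, m - 1))"
      unfolding mat_poly_mult[OF C] u(3) using m r
      by (intro rotation_mult_index[OF m(1) tj]) auto
    moreover have "even r \<Longrightarrow> r + 1 < m" "odd r \<Longrightarrow> r - 1 + 2 * j \<noteq> m - 1" using m r by presburger+
    moreover have "odd r \<Longrightarrow> r + 1 + 2 * j \<noteq> m - 1" using m by presburger
    ultimately show ?thesis using r col_t by auto
  qed
  have row_ut: "mat_poly m ?C (u * t ^ j) $$ (0, r) = (if r = 2 * j + 1 then 1 else 0)"
    if r: "r < m" for r j
  proof -
    have "mat_poly m ?C (u * t ^ j) $$ (0, r)
        = (if even r then - mat_poly m ?C (t ^ j) $$ (0, r + 1) else mat_poly m ?C (t ^ j) $$ (0, r - 1))"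
      unfolding mult.commute[of u] mat_poly_mult[OF C] u(3) using m r
      by (intro mult_rotation_index[OF m(1) tj]) auto
    moreover have "even r \<Longrightarrow> r + 1 < m" "even r \<Longrightarrow> r + 1 \<noteq> 2 * j" "odd r \<Longrightarrow> r - 1 = 2 * j \<longleftrightarrow> r = 2 * j + 1"
      using m r by presburger+
    moreover have "even r \<Longrightarrow> r \<noteq> 2 * j + 1" by presburger
    ultimately show ?thesis using r row_t by auto
  qed
  define p where "p i = (if even i then u else 1) * t ^ ((m - 1 - i) div 2)" for i
  define s where "s i = (if even i then 1 else u) * t ^ (i div 2)" for i
  have colsum: "(\<Sum>i<m. Polynomial.smult (?C $$ (i, k)) (f i)) = Polynomial.smult a (f k)
      + (if even k then - Polynomial.smult b (f (k + 1)) else Polynomial.smult b (f (k - 1)))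
      + (if 2 \<le> k then f (k - 2) else 0)" if k: "k < m" for f k
  proof -
    let ?k = "if even k then k + 1 else k - 1" and ?b = "if even k then - b else b"
    have k': "?k < m" using m k by (auto elim!: evenE)
    have "(\<Sum>i<m. Polynomial.smult (?C $$ (i, k)) (f i)) = (\<Sum>i<m. (if i = k then Polynomial.smult a (f k) else 0)
        + (if i = ?k then Polynomial.smult ?b (f ?k) else 0)
        + (if i = k - 2 then (if 2 \<le> k then f (k - 2) else 0) else 0))"
    proof (rule sum.cong)
      fix i assume i: "i \<in> {..<m}"
      have "?C $$ (i, k) = (if i = k then a else 0) + (if i = ?k then ?b else 0)
          + (if i = k - 2 then (if 2 \<le> k then 1 else 0) else 0)"
        using i k by (intro real_jordan_column) auto
      then show "Polynomial.smult (?C $$ (i, k)) (f i) = (if i = k then Polynomial.smult a (f k) else 0)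
        + (if i = ?k then Polynomial.smult ?b (f ?k) else 0)
        + (if i = k - 2 then (if 2 \<le> k then f (k - 2) else 0) else 0)"
        by (simp only: smult_add_left) (intro arg_cong2[of _ _ _ _ "(+)"], simp_all)
    qed simp
    also have "\<dots> = Polynomial.smult a (f k) + Polynomial.smult ?b (f ?k)
      + (if 2 \<le> k then f (k - 2) else 0)"
      using k k' less_imp_diff_less[OF k, of 2] by (simp add: sum.distrib)
    finally show ?thesis by (cases "even k") simp_all
  qed
  have rowsum: "(\<Sum>i<m. Polynomial.smult (?C $$ (k, i)) (f i)) = Polynomial.smult a (f k)
      + (if even k then Polynomial.smult b (f (k + 1)) else - Polynomial.smult b (f (k - 1)))
      + (if k + 2 < m then f (k + 2) else 0)" if k: "k < m" for f k
  proof -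
    let ?k = "if even k then k + 1 else k - 1" and ?b = "if even k then b else - b"
    have k': "?k < m" using m k by (auto elim!: evenE)
    have "(\<Sum>i<m. Polynomial.smult (?C $$ (k, i)) (f i)) = (\<Sum>i<m. (if i = k then Polynomial.smult a (f k) else 0)
        + (if i = ?k then Polynomial.smult ?b (f ?k) else 0)
        + (if i = k + 2 then f (k + 2) else 0))"
    proof (rule sum.cong)
      fix i assume i: "i \<in> {..<m}"
      have "?C $$ (k, i) = (if i = k then a else 0) + (if i = ?k then ?b else 0)
          + (if i = k + 2 then 1 else 0)"
        using i k by (intro real_jordan_row) auto
      then show "Polynomial.smult (?C $$ (k, i)) (f i) = (if i = k then Polynomial.smult a (f k) else 0)
        + (if i = ?k then Polynomial.smult ?b (f ?k) else 0)
        + (if i = k + 2 then f (k + 2) else 0)"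
        by (simp only: smult_add_left) (intro arg_cong2[of _ _ _ _ "(+)"], simp_all)
    qed simp
    also have "\<dots> = Polynomial.smult a (f k) + Polynomial.smult ?b (f ?k)
      + (if k + 2 < m then f (k + 2) else 0)"
      using k k' by (simp add: sum.distrib)
    finally show ?thesis by (cases "even k") simp_all
  qed
  \<comment> \<open>The relations hold up to multiples of \<open>u\<^sup>2 + 1\<close> and of \<open>t\<^bsup>m/2\<^esup>\<close>.\<close>
  have alg_odd: "Polynomial.smult b (u * X) + Y - (t * X + Polynomial.smult b (u * X)) = Y - t * X" for X Y
    by simp
  have alg_even: "- Polynomial.smult b X + Y - (t * (u * X) + Polynomial.smult b (u * (u * X)))
      = Y - u * (t * X) - Polynomial.smult b ((u\<^sup>2 + 1) * X)" for X Y
    by (simp add: algebra_simps power2_eq_square smult_add_right)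
  have half: "\<exists>d. m = 2 * (k div 2 + Suc d)" if k: "k < m" for k
  proof -
    obtain h where h: "m = 2 * h" using m(1) by (elim evenE)
    then have "k div 2 < h" using k by simp
    then obtain d where "h = Suc (k div 2 + d)" using less_imp_Suc_add by blast
    then show ?thesis using h by auto
  qed
  have colrel: "(\<Sum>i<m. Polynomial.smult (?C $$ (i, k)) (p i)) - pCons 0 (p k)
      = (if odd k then (if k = 1 then - (t ^ (m div 2)) else 0)
         else (if k = 0 then - (u * t ^ (m div 2)) else 0) - Polynomial.smult b ((u\<^sup>2 + 1) * t ^ ((m - 1 - k) div 2)))"
    if k: "k < m" for k
  proof (cases "even k")
    case True
    obtain c d where cd: "k = 2 * c" "m = 2 * (c + Suc d)" using half[OF k] True by (elim evenE) auto
    define j where "j = (m - 1 - k) div 2"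
    have d: "j = d" unfolding j_def cd by simp
    have j: "(m - 1 - (k + 1)) div 2 = j" unfolding d cd by simp
    have j2: "(m - 1 - (k - 2)) div 2 = Suc j" if "2 \<le> k"
    proof -
      have "m - 1 - (k - 2) = Suc (2 * Suc d)" using that unfolding cd by simp
      then show ?thesis unfolding d by simp
    qed
    have j0: "k = 0 \<Longrightarrow> m div 2 = Suc j" unfolding d cd by simp
    have pk: "p k = u * t ^ j" "p (k + 1) = t ^ j" "2 \<le> k \<Longrightarrow> p (k - 2) = u * (t * t ^ j)"
      using True j j2 j_def[symmetric] by (simp_all add: p_def)
    have "k = 0 \<or> 2 \<le> k" using cd(1) by auto
    moreover have "(\<Sum>i<m. Polynomial.smult (?C $$ (i, k)) (p i)) - pCons 0 (p k)
        = - Polynomial.smult b (t ^ j) + (if 2 \<le> k then u * (t * t ^ j) else 0)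
          - (t * (u * t ^ j) + Polynomial.smult b (u * (u * t ^ j)))"
      unfolding colsum[OF k] y[of "p k"] using True pk by simp
    ultimately show ?thesis unfolding alg_even using True j0 j_def[symmetric] by auto
  next
    case False
    obtain c d where cd: "k = 2 * c + 1" "m = 2 * (c + Suc d)" using half[OF k] False by (elim oddE) auto
    define j where "j = (m - 1 - k) div 2"
    have d: "j = d" unfolding j_def cd by simp
    have j: "(m - 1 - (k - 1)) div 2 = j" unfolding d cd by simp
    have j2: "(m - 1 - (k - 2)) div 2 = Suc j" if "2 \<le> k"
    proof -
      have "m - 1 - (k - 2) = 2 * Suc d" using that unfolding cd by simp
      then show ?thesis unfolding d by simp
    qed
    have j0: "k = 1 \<Longrightarrow> m div 2 = Suc j" unfolding d cd by simp
    have pk: "p k = t ^ j" "p (k - 1) = u * t ^ j" "2 \<le> k \<Longrightarrow> p (k - 2) = t * t ^ j"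
      using False j j2 j_def[symmetric] by (simp_all add: p_def)
    have "k = 1 \<or> 2 \<le> k" using cd(1) by auto
    moreover have "(\<Sum>i<m. Polynomial.smult (?C $$ (i, k)) (p i)) - pCons 0 (p k)
        = Polynomial.smult b (u * t ^ j) + (if 2 \<le> k then t * t ^ j else 0)
          - (t * t ^ j + Polynomial.smult b (u * t ^ j))"
      unfolding colsum[OF k] y[of "p k"] using False pk by simp
    ultimately show ?thesis unfolding alg_odd using False j0 by auto
  qed
  have rowrel: "(\<Sum>i<m. Polynomial.smult (?C $$ (k, i)) (s i)) - pCons 0 (s k)
      = (if even k then (if k + 2 = m then - (t ^ (m div 2)) else 0)
         else (if k + 1 = m then - (u * t ^ (m div 2)) else 0) - Polynomial.smult b ((u\<^sup>2 + 1) * t ^ (k div 2)))"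
    if k: "k < m" for k
  proof (cases "even k")
    case True
    define j where "j = k div 2"
    have j: "(k + 1) div 2 = j" "(k + 2) div 2 = Suc j" unfolding j_def using True by auto
    have j0: "k + 2 = m \<Longrightarrow> m div 2 = Suc j" using j(2) by simp
    have sk: "s k = t ^ j" "s (k + 1) = u * t ^ j" "s (k + 2) = t * t ^ j"
      using True j j_def[symmetric] by (simp_all add: s_def)
    obtain d where "m = 2 * (k div 2 + Suc d)" using half[OF k] by blast
    then have "k + 2 = m \<or> k + 2 < m" using True by (elim evenE) auto
    moreover have "(\<Sum>i<m. Polynomial.smult (?C $$ (k, i)) (s i)) - pCons 0 (s k)
        = Polynomial.smult b (u * t ^ j) + (if k + 2 < m then t * t ^ j else 0)
          - (t * t ^ j + Polynomial.smult b (u * t ^ j))"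
      unfolding rowsum[OF k] y[of "s k"] using True sk by simp
    ultimately show ?thesis unfolding alg_odd using True j0 by auto
  next
    case False
    define j where "j = k div 2"
    have j: "(k - 1) div 2 = j" "(k + 2) div 2 = Suc j" unfolding j_def using False by (auto elim: oddE)
    have j0: "k + 1 = m \<Longrightarrow> m div 2 = Suc j" unfolding j_def using False by (auto elim!: oddE)
    have sk: "s k = u * t ^ j" "s (k - 1) = t ^ j" "s (k + 2) = u * (t * t ^ j)"
      using False j j_def[symmetric] by (simp_all add: s_def)
    obtain d where "m = 2 * (k div 2 + Suc d)" using half[OF k] by blast
    then have "k + 1 = m \<or> k + 2 < m" using False by (elim oddE) auto
    moreover have "(\<Sum>i<m. Polynomial.smult (?C $$ (k, i)) (s i)) - pCons 0 (s k)
        = - Polynomial.smult b (t ^ j) + (if k + 2 < m then u * (t * t ^ j) else 0)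
          - (t * (u * t ^ j) + Polynomial.smult b (u * (u * t ^ j)))"
      unfolding rowsum[OF k] y[of "s k"] using False sk by simp
    ultimately show ?thesis unfolding alg_even using False j0 j_def[symmetric] by auto
  qed
  have col: "mat_poly m ?C (p i) $$ (r, m - 1) = (if r = i then 1 else 0)" if i: "i < m" and r: "r < m" for i r
  proof (cases "even i")
    case True
    obtain d where "m = 2 * (i div 2 + Suc d)" using half[OF i] by blast
    then have "r + 1 + 2 * ((m - 1 - i) div 2) = m - 1 \<longleftrightarrow> r = i"
      using True by (elim evenE) auto
    then show ?thesis using True col_ut[OF r] by (simp add: p_def)
  next
    case False
    obtain d where "m = 2 * (i div 2 + Suc d)" using half[OF i] by blast
    then have "r + 2 * ((m - 1 - i) div 2) = m - 1 \<longleftrightarrow> r = i"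
      using False by (elim oddE) auto
    then show ?thesis using False col_t[OF r] by (simp add: p_def)
  qed
  have row: "mat_poly m ?C (s i) $$ (0, r) = (if r = i then 1 else 0)" if "i < m" "r < m" for i r
  proof (cases "even i")
    case True
    then show ?thesis using row_t[OF that(2), of "i div 2"] by (simp add: s_def)
  next
    case False
    then have "2 * (i div 2) + 1 = i" by presburger
    then show ?thesis using False row_ut[OF that(2), of "i div 2"] by (simp add: s_def)
  qed
  have tdvd: "?q ^ (m div 2) dvd t ^ (m div 2)" using u(2) unfolding t_def by (rule dvd_power_same)
  have zero: "mat_poly m ?C (?q ^ (m div 2)) = 0\<^sub>m m m"
  proof -
    have m1: "1 < m" using m by presburger
    have "mat_poly m ?C ((\<Sum>i<m. Polynomial.smult (?C $$ (i, 1)) (p i)) - pCons 0 (p 1)) = 0\<^sub>m m m"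
      using m by (intro cyclic_relation_annihilates[OF C _ m1, of "m - 1"] col) auto
    then have "mat_poly m ?C (- (t ^ (m div 2))) = 0\<^sub>m m m"
      unfolding colrel[OF m1] by (simp only: odd_one if_True simp_thms)
    then have th: "mat_poly m ?C (t ^ (m div 2)) = 0\<^sub>m m m"
      using mat_poly_dvd_zero[OF C, of "- (t ^ (m div 2))"] by simp
    have JJ: "mat_poly m ?C (u\<^sup>2 + 1) = 0\<^sub>m m m"
      unfolding power2_eq_square mat_poly_add[OF C] mat_poly_mult[OF C] u(3) mat_poly_1[OF C]
        rotation_square[OF m(1)]
      by (intro eq_matI) auto
    let ?w = "t + Polynomial.smult (2 * b) u"
    have "?q = t * ?w + Polynomial.smult (b\<^sup>2) (u\<^sup>2 + 1)"
    proof -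
      have "(t + B * u)\<^sup>2 + B\<^sup>2 = t * (t + 2 * B * u) + B\<^sup>2 * (u\<^sup>2 + 1)" for B
        by (simp add: power2_eq_square algebra_simps)
      moreover have "?q = (t + [:b:] * u)\<^sup>2 + [:b:]\<^sup>2"
        by (simp add: pair_poly_def t_def power2_eq_square)
      moreover have "2 * [:b:] * u = Polynomial.smult (2 * b) u" by (simp add: numeral_poly mult.commute)
      moreover have "[:b:]\<^sup>2 * v = Polynomial.smult (b\<^sup>2) v" for v by (simp add: power2_eq_square)
      ultimately show ?thesis by metis
    qed
    moreover have "mat_poly m ?C (t * ?w) + b\<^sup>2 \<cdot>\<^sub>m 0\<^sub>m m m = mat_poly m ?C (t * ?w)"
    proof -
      have "mat_poly m ?C (t * ?w) \<in> carrier_mat m m" by simp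
      then show ?thesis by (intro eq_matI) auto
    qed
    ultimately have q: "mat_poly m ?C ?q = mat_poly m ?C (t * ?w)"
      using JJ by (simp only: mat_poly_add[OF C] mat_poly_smult[OF C])
    have "mat_poly m ?C (?q ^ h) = mat_poly m ?C ((t * ?w) ^ h)" for h
      by (induction h) (simp_all only: power_0 power_Suc mat_poly_mult[OF C, of ?q]
          mat_poly_mult[OF C, of "t * ?w"] q)
    moreover have "mat_poly m ?C ((t * ?w) ^ (m div 2)) = 0\<^sub>m m m"
      by (rule mat_poly_dvd_zero[OF C _ th]) (simp add: power_mult_distrib)
    ultimately show ?thesis by simp
  qed
  show ?thesis
  proof (rule cyclic_blockI[where p = p and q = s, OF C m(2) zero])
    show "p (m - 1) = 1" using m by (simp add: p_def)
    show "s 0 = 1" by (simp add: s_def)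
    show "?q ^ (m div 2) dvd (\<Sum>i<m. Polynomial.smult (?C $$ (i, k)) (p i)) - pCons 0 (p k)" if "k < m" for k
      unfolding colrel[OF that] using tdvd u(1) by (auto intro!: dvd_diff dvd_smult)
    show "?q ^ (m div 2) dvd (\<Sum>i<m. Polynomial.smult (?C $$ (k, i)) (s i)) - pCons 0 (s k)" if "k < m" for k
      unfolding rowrel[OF that] using tdvd u(1) by (auto intro!: dvd_diff dvd_smult)
  qed (use col row in auto)
qed

section \<open>The canonical forms\<close>

text \<open>The difference of the polynomials is constant or linear, and neither of them has a real root.\<close>
lemma pair_poly_bezout:
  assumes ne: "(a, b) \<noteq> (c, d)" and pos: "0 < b" "0 < d"
  shows "bezout (pair_poly (a, b)) (pair_poly (c, d))"
proof -
  let ?p = "pair_poly (a, b)" and ?q = "pair_poly (c, d)"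
  have diff: "?p - ?q = Polynomial.smult (2 * (c - a)) [:0, 1:] + [:a\<^sup>2 + b\<^sup>2 - c\<^sup>2 - d\<^sup>2:]"
    by (simp add: pair_poly_def power2_eq_square algebra_simps)
  show ?thesis
  proof (cases "a = c")
    case True
    then have "b\<^sup>2 - d\<^sup>2 \<noteq> 0" using ne pos by (simp add: power2_eq_iff)
    moreover have "?p - ?q = [:b\<^sup>2 - d\<^sup>2:]" using diff True by simp
    ultimately have "[:1 / (b\<^sup>2 - d\<^sup>2):] * (?p - ?q) = 1" by (simp add: one_pCons)
    moreover have "v * (x - y) = v * x + (- v) * y" for v x y :: "real poly"
      by (simp add: algebra_simps)
    ultimately have "[:1 / (b\<^sup>2 - d\<^sup>2):] * ?p + (- [:1 / (b\<^sup>2 - d\<^sup>2):]) * ?q = 1"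
      by metis
    then show ?thesis unfolding bezout_def by blast
  next
    case False
    define e where "e = (a\<^sup>2 + b\<^sup>2 - c\<^sup>2 - d\<^sup>2) / (2 * (a - c))"
    have pq: "?p - ?q = [:2 * (c - a):] * [:- e, 1:]"
      unfolding diff e_def using False by (simp add: field_simps)
    have "poly ?q e \<noteq> 0"
      using pos by (simp add: pair_poly_def add_nonneg_eq_0_iff)
    then have "bezout [:- e, 1:] ?q" by (rule bezout_linear)
    then obtain u v where uv: "u * [:- e, 1:] + v * ?q = 1" by (auto simp: bezout_def)
    let ?c = "[:1 / (2 * (c - a)):]"
    have "?c * (?p - ?q) = [:- e, 1:]" unfolding pq using False by simp
    then have "u * (?c * (?p - ?q)) + v * ?q = 1" using uv by simp
    then have "(u * ?c) * ?p + (v - u * ?c) * ?q = 1" by (simp only: algebra_simps)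
    then show ?thesis unfolding bezout_def by blast
  qed
qed

lemma linear_pair_poly_bezout:
  assumes "b \<noteq> 0"
  shows "bezout [:- l, 1:] (pair_poly (a, b))"
  using assms by (intro bezout_linear) (simp add: pair_poly_def add_nonneg_eq_0_iff)

lemma linear_bezout: "a \<noteq> b \<Longrightarrow> bezout [:- a, 1:] [:- b, 1 :: 'a::field:]"
  by (intro bezout_linear) simp

lemma cyclic_chain_powers:
  assumes "list_all2 (\<lambda>m B. cyclic_block B (p ^ e m)) ms Bs" "sorted_wrt (\<ge>) ms"
    and "\<And>i j. i \<le> j \<Longrightarrow> e i \<le> e j"
  shows "cyclic_chain Bs (map (\<lambda>m. p ^ e m) ms)"
proof -
  have "sorted_wrt (\<lambda>m m'. p ^ e m' dvd p ^ e m) ms"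
    using assms(2) by (rule sorted_wrt_mono_rel[rotated]) (auto intro: le_imp_power_dvd assms(3))
  then show ?thesis
    using assms(1) by (auto simp: cyclic_chain_def sorted_wrt_map list_all2_conv_all_nth)
qed

lemma sorted_wrt_distinct_map:
  assumes "distinct (map f xs)" "\<And>x y. x \<in> set xs \<Longrightarrow> y \<in> set xs \<Longrightarrow> f x \<noteq> f y \<Longrightarrow> R x y"
  shows "sorted_wrt R xs"
  using assms by (induction xs) (auto simp: image_iff)

theorem jordan_tangent_decomposition:
  fixes A :: "'a::field mat"
  assumes A: "A \<in> carrier_mat n n" and J: "jordan_canonical lms A"
  shows "tangent_decomposition n A (canonical_form (map snd lms))"
proof -
  define Gs where "Gs = map (\<lambda>(l, ms). (map (\<lambda>m. jordan_block m l) ms, map (\<lambda>m. [:- l, 1:] ^ m) ms)) lms"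
  have chain: "cyclic_chain Bs gs" if Bs: "(Bs, gs) \<in> set Gs" for Bs gs
  proof -
    obtain l ms where lms: "(l, ms) \<in> set lms" "Bs = map (\<lambda>m. jordan_block m l) ms"
      "gs = map (\<lambda>m. [:- l, 1:] ^ m) ms"
      using Bs by (auto simp: Gs_def)
    have bs: "block_sizes ms" using J lms(1) by (auto simp: jordan_canonical_def)
    then have "list_all2 (\<lambda>m B. cyclic_block B ([:- l, 1:] ^ m)) ms Bs"
      unfolding lms(2) by (auto simp: list_all2_conv_all_nth block_sizes_def intro!: cyclic_block_jordan)
    then show ?thesis unfolding lms(3) using bs
      by (intro cyclic_chain_powers[where e = "\<lambda>m. m"]) (auto simp: block_sizes_def)
  qed
  have "sorted_wrt (\<lambda>(l, ms) (l', ms'). bezout_lists (map (\<lambda>m. [:- l, 1:] ^ m) ms) (map (\<lambda>m. [:- l', 1:] ^ m) ms')) lms"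
    by (rule sorted_wrt_distinct_map[where f = fst])
      (use J in \<open>auto simp: jordan_canonical_def bezout_lists_def intro!: bezout_powers linear_bezout\<close>)
  then have sorted: "sorted_wrt (\<lambda>(_, gs) (_, hs). bezout_lists gs hs) Gs"
    by (simp add: Gs_def sorted_wrt_map case_prod_unfold)
  have "map fst Gs = map (\<lambda>(l, ms). map (\<lambda>m. jordan_block m l) ms) lms"
    by (auto simp: Gs_def)
  then have A': "A = diag_block_mat (concat (map fst Gs))"
    using J by (simp only: jordan_canonical_def)
  have sizes: "map (map dim_row \<circ> fst) Gs = map snd lms"
    by (auto simp: Gs_def comp_def)
  show ?thesis using direct_sum_tangent_decomposition[OF chain sorted A' A] unfolding sizes .
qed

theorem frobenius_tangent_decomposition:
  fixes A :: "'a::field mat"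
  assumes A: "A \<in> carrier_mat n n" and F: "frobenius_canonical pms A"
  shows "tangent_decomposition n A (canonical_form (map snd pms))"
proof -
  obtain Bss where Bss: "list_all2 (\<lambda>(p, ms) Bs. list_all2 (frobenius_block p) ms Bs) pms Bss"
    and AB: "A = diag_block_mat (concat Bss)"
    using F by (auto simp: frobenius_canonical_def)
  define Gs where "Gs = map (\<lambda>Bs. (Bs, map char_poly Bs)) Bss"
  have len: "length Bss = length pms" using Bss by (simp add: list_all2_lengthD)
  have blocks: "list_all2 (frobenius_block p) ms Bs" if "i < length pms" "pms ! i = (p, ms)" "Bss ! i = Bs" for i p ms Bs
    using list_all2_nthD[OF Bss that(1)] that by simp
  have dims: "map dim_row Bs = ms" if "list_all2 (frobenius_block p) ms Bs" for p :: "'a poly" and ms Bs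
    using that by (induction rule: list_all2_induct) (auto simp: frobenius_block_def companion_def)
  \<comment> \<open>Block sizes are the degrees of the powers of \<open>p\<close>, so their order is the order of divisibility.\<close>
  have chain': "cyclic_chain Bs (map char_poly Bs)"
    if fb: "list_all2 (frobenius_block p) ms Bs" and bs: "block_sizes ms" and irr: "irreducible p" for p :: "'a poly" and ms Bs
  proof -
    have p0: "degree p > 0" "p \<noteq> 0" using irr by (auto simp: irreducible_def is_unit_iff_degree)
    have nth: "cyclic_block (Bs ! i) (char_poly (Bs ! i)) \<and>
        (\<exists>s. char_poly (Bs ! i) = p ^ s \<and> ms ! i = degree p * s)" if i: "i < length ms" for i
    proof -
      obtain c s where c: "Bs ! i = companion (ms ! i) c" "char_poly (Bs ! i) = p ^ s"
        using list_all2_nthD[OF fb i] by (auto simp: frobenius_block_def)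
      have pos: "0 < ms ! i" using bs i by (simp add: block_sizes_def)
      have "degree (char_poly (Bs ! i)) = ms ! i"
        unfolding c(1) char_poly_companion[OF pos] by (rule companion_poly_degree)
      then have "ms ! i = degree p * s" unfolding c(2) using p0 by (simp add: degree_power_eq)
      moreover have "cyclic_block (Bs ! i) (char_poly (Bs ! i))"
        unfolding c(1) char_poly_companion[OF pos] by (rule cyclic_block_companion[OF pos])
      ultimately show ?thesis using c(2) by blast
    qed
    have l: "length Bs = length ms" using fb by (simp add: list_all2_lengthD)
    have "char_poly (Bs ! j) dvd char_poly (Bs ! i)" if ij: "i < j" "j < length Bs" for i j
    proof -
      have i: "i < length ms" and j: "j < length ms" using ij l by simp_all
      obtain s where s: "char_poly (Bs ! i) = p ^ s" "ms ! i = degree p * s" using nth[OF i] by blast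
      obtain r where r: "char_poly (Bs ! j) = p ^ r" "ms ! j = degree p * r" using nth[OF j] by blast
      have "ms ! j \<le> ms ! i" using bs ij l by (auto simp: block_sizes_def sorted_wrt_iff_nth_less)
      then have "r \<le> s" using p0 s r by simp
      then show ?thesis unfolding s r by (rule le_imp_power_dvd)
    qed
    then have "sorted_wrt (\<lambda>g g'. g' dvd g) (map char_poly Bs)"
      by (simp add: sorted_wrt_iff_nth_less)
    then show ?thesis using nth l by (auto simp: cyclic_chain_def list_all2_conv_all_nth)
  qed
  have pm: "distinct (map fst pms)" "\<And>p ms. (p, ms) \<in> set pms \<Longrightarrow> irreducible p \<and> monic p \<and> block_sizes ms"
    using F by (auto simp: frobenius_canonical_def)
  have chain: "cyclic_chain Bs gs" if Bs: "(Bs, gs) \<in> set Gs" for Bs gs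
  proof -
    obtain i where i: "i < length pms" "Bs = Bss ! i" "gs = map char_poly Bs"
      using Bs len by (auto simp: Gs_def in_set_conv_nth)
    obtain p ms where pi: "pms ! i = (p, ms)" by fastforce
    have "(p, ms) \<in> set pms" using i(1) pi by (metis nth_mem)
    then show ?thesis unfolding i(3)
      using chain'[OF blocks[OF i(1) pi i(2)[symmetric]]] pm(2) by blast
  qed
  have "bezout_lists (map char_poly (Bss ! i)) (map char_poly (Bss ! j))"
    if ij: "i < j" "j < length Bss" for i j
  proof -
    have i: "i < length pms" and j: "j < length pms" using ij len by simp_all
    obtain p ms where pi: "pms ! i = (p, ms)" by fastforce
    obtain q ls where qj: "pms ! j = (q, ls)" by fastforce
    have "p \<noteq> q" using pm(1) i j ij pi qj by (metis distinct_conv_nth fst_conv length_map nat_neq_iff nth_map)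
    moreover have "irreducible p \<and> monic p" "irreducible q \<and> monic q"
      using pm(2) i j pi qj by (metis nth_mem)+
    ultimately have pq: "bezout p q" by (blast intro: bezout_irreducible)
    have "\<exists>s. char_poly B = p ^ s" if "B \<in> set (Bss ! i)" for B
      using blocks[OF i pi refl] that
      by (auto simp: list_all2_conv_all_nth in_set_conv_nth frobenius_block_def)
    moreover have "\<exists>s. char_poly B = q ^ s" if "B \<in> set (Bss ! j)" for B
      using blocks[OF j qj refl] that
      by (auto simp: list_all2_conv_all_nth in_set_conv_nth frobenius_block_def)
    ultimately show ?thesis using bezout_powers[OF pq] by (fastforce simp: bezout_lists_def)
  qed
  then have sorted: "sorted_wrt (\<lambda>(_, gs) (_, hs). bezout_lists gs hs) Gs"
    by (simp add: Gs_def sorted_wrt_map sorted_wrt_iff_nth_less)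
  have A': "A = diag_block_mat (concat (map fst Gs))"
    by (simp add: AB Gs_def comp_def)
  have sizes: "map (map dim_row \<circ> fst) Gs = map snd pms"
  proof (rule nth_equalityI)
    fix i assume "i < length (map (map dim_row \<circ> fst) Gs)"
    then have i: "i < length pms" using len by (simp add: Gs_def)
    obtain p ms where pi: "pms ! i = (p, ms)" by fastforce
    show "map (map dim_row \<circ> fst) Gs ! i = map snd pms ! i"
      using dims[OF blocks[OF i pi refl]] i len pi by (simp add: Gs_def)
  qed (simp add: Gs_def len)
  show ?thesis using direct_sum_tangent_decomposition[OF chain sorted A' A] unfolding sizes .
qed

theorem real_jordan_tangent_decomposition:
  assumes A: "A \<in> carrier_mat n n" and J: "real_jordan_canonical lms cms A"
  shows "tangent_decomposition n A (canonical_form (map snd lms @ map snd cms))"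
proof -
  define Gs1 where "Gs1 = map (\<lambda>(l, ms). (map (\<lambda>m. jordan_block m l) ms, map (\<lambda>m. [:- l, 1:] ^ m) ms)) lms"
  define Gs2 where "Gs2 = map (\<lambda>(ab, ms). (map (\<lambda>m. real_jordan_block m ab) ms,
    map (\<lambda>m. pair_poly ab ^ (m div 2)) ms)) cms"
  have lms: "distinct (map fst lms)" "\<And>l ms. (l, ms) \<in> set lms \<Longrightarrow> block_sizes ms"
    and cms: "distinct (map fst cms)" "\<And>a b ms. ((a, b), ms) \<in> set cms \<Longrightarrow> 0 < b \<and> block_sizes ms \<and> (\<forall>m\<in>set ms. even m)"
    using J by (auto simp: real_jordan_canonical_def)
  have chain1: "cyclic_chain Bs gs" if Bs: "(Bs, gs) \<in> set Gs1" for Bs gs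
  proof -
    obtain l ms where l: "(l, ms) \<in> set lms" "Bs = map (\<lambda>m. jordan_block m l) ms"
      "gs = map (\<lambda>m. [:- l, 1:] ^ m) ms"
      using Bs by (auto simp: Gs1_def)
    have bs: "block_sizes ms" using lms(2) l(1) by blast
    then have "list_all2 (\<lambda>m B. cyclic_block B ([:- l, 1:] ^ m)) ms Bs"
      unfolding l(2) by (auto simp: list_all2_conv_all_nth block_sizes_def intro!: cyclic_block_jordan)
    then show ?thesis unfolding l(3) using bs
      by (intro cyclic_chain_powers[where e = "\<lambda>m. m"]) (auto simp: block_sizes_def)
  qed
  have chain2: "cyclic_chain Bs gs" if Bs: "(Bs, gs) \<in> set Gs2" for Bs gs
  proof -
    obtain a b ms where l: "((a, b), ms) \<in> set cms" "Bs = map (\<lambda>m. real_jordan_block m (a, b)) ms"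
      "gs = map (\<lambda>m. pair_poly (a, b) ^ (m div 2)) ms"
      using Bs by (auto simp: Gs2_def)
    have bs: "0 < b" "block_sizes ms" "\<forall>m\<in>set ms. even m" using cms(2) l(1) by blast+
    then have "list_all2 (\<lambda>m B. cyclic_block B (pair_poly (a, b) ^ (m div 2))) ms Bs"
      unfolding l(2) by (auto simp: list_all2_conv_all_nth block_sizes_def intro!: cyclic_block_real_jordan)
    then show ?thesis unfolding l(3) using bs
      by (intro cyclic_chain_powers[where e = "\<lambda>m. m div 2"]) (auto simp: block_sizes_def div_le_mono)
  qed
  have "sorted_wrt (\<lambda>(l, ms) (l', ms'). bezout_lists (map (\<lambda>m. [:- l, 1:] ^ m) ms) (map (\<lambda>m. [:- l', 1:] ^ m) ms')) lms"
    by (rule sorted_wrt_distinct_map[where f = fst])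
      (use lms in \<open>auto simp: bezout_lists_def intro!: bezout_powers linear_bezout\<close>)
  then have sorted1: "sorted_wrt (\<lambda>(_, gs) (_, hs). bezout_lists gs hs) Gs1"
    by (simp add: Gs1_def sorted_wrt_map case_prod_unfold)
  have "sorted_wrt (\<lambda>(ab, ms) (ab', ms'). bezout_lists (map (\<lambda>m. pair_poly ab ^ (m div 2)) ms)
      (map (\<lambda>m. pair_poly ab' ^ (m div 2)) ms')) cms"
  proof (rule sorted_wrt_distinct_map[where f = fst])
    fix x y assume xy: "x \<in> set cms" "y \<in> set cms" "fst x \<noteq> fst y"
    obtain a b ms c d ls where e: "x = ((a, b), ms)" "y = ((c, d), ls)" by (metis prod.exhaust)
    have "bezout (pair_poly (a, b)) (pair_poly (c, d))"
      using xy cms(2) unfolding e by (intro pair_poly_bezout) auto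
    then show "(case x of (ab, ms) \<Rightarrow> \<lambda>(ab', ms'). bezout_lists (map (\<lambda>m. pair_poly ab ^ (m div 2)) ms)
      (map (\<lambda>m. pair_poly ab' ^ (m div 2)) ms')) y"
      unfolding e by (auto simp: bezout_lists_def intro!: bezout_powers)
  qed (rule cms(1))
  then have sorted2: "sorted_wrt (\<lambda>(_, gs) (_, hs). bezout_lists gs hs) Gs2"
    by (simp add: Gs2_def sorted_wrt_map case_prod_unfold)
  have cross: "bezout_lists gs hs" if G: "(Bs, gs) \<in> set Gs1" "(Cs, hs) \<in> set Gs2" for Bs Cs gs hs
  proof -
    obtain l ms where l: "gs = map (\<lambda>m. [:- l, 1:] ^ m) ms" using G(1) by (auto simp: Gs1_def)
    obtain a b ls where ab: "((a, b), ls) \<in> set cms" "hs = map (\<lambda>m. pair_poly (a, b) ^ (m div 2)) ls"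
      using G(2) by (auto simp: Gs2_def)
    have "bezout [:- l, 1:] (pair_poly (a, b))"
      using cms(2)[OF ab(1)] by (intro linear_pair_poly_bezout) simp
    then show ?thesis unfolding l ab(2) by (auto simp: bezout_lists_def intro!: bezout_powers)
  qed
  have sorted: "sorted_wrt (\<lambda>(_, gs) (_, hs). bezout_lists gs hs) (Gs1 @ Gs2)"
    using sorted1 sorted2 cross by (auto simp: sorted_wrt_append)
  have chain: "cyclic_chain Bs gs" if "(Bs, gs) \<in> set (Gs1 @ Gs2)" for Bs gs
    using that chain1 chain2 by auto
  have "map fst Gs1 = map (\<lambda>(l, ms). map (\<lambda>m. jordan_block m l) ms) lms"
    "map fst Gs2 = map (\<lambda>(ab, ms). map (\<lambda>m. real_jordan_block m ab) ms) cms"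
    by (auto simp: Gs1_def Gs2_def)
  then have A': "A = diag_block_mat (concat (map fst (Gs1 @ Gs2)))"
    using J by (simp only: real_jordan_canonical_def map_append concat_append)
  have "map dim_row (map (\<lambda>m. real_jordan_block m ab) ms) = ms" for ab ms
    by (induction ms) (simp_all add: real_jordan_block_def)
  then have sizes: "map (map dim_row \<circ> fst) (Gs1 @ Gs2) = map snd lms @ map snd cms"
    by (auto simp: Gs1_def Gs2_def comp_def)
  show ?thesis using direct_sum_tangent_decomposition[OF chain sorted A' A] unfolding sizes .
qed

section \<open>The codimension of the similarity class\<close>

text \<open>
  The entries outside the stars are coordinates on the tangent space: they can be prescribed, since
  every matrix is congruent to a tangent vector modulo \<open>\<D>\<close>; and two tangent vectors that agree in
  them differ by a tangent vector of the form \<open>\<D>\<close>, which is \<open>0\<close>.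
\<close>
lemma star_count_codim:
  fixes A :: "'a::field mat"
  assumes A: "A \<in> carrier_mat n n" and dec: "tangent_decomposition n A D"
  shows "int (card (star_positions n D)) = similarity_class_codim n A"
proof -
  let ?T = "tangent_space n A" and ?V = "module_mat TYPE('a) n n"
  let ?W = "?V\<lparr>carrier := ?T\<rparr>" and ?K = "class_ring :: 'a ring"
  define S where "S = {..<n} \<times> {..<n} - star_positions n D"
  define N where "N = card S"
  have finS: "finite S" by (simp add: S_def)
  have S_iff: "(i, j) \<in> S \<longleftrightarrow> i < n \<and> j < n \<and> D $$ (i, j) = Nul" for i j
    by (cases "D $$ (i, j)") (auto simp: S_def star_positions_def)
  obtain pos where pos: "bij_betw pos {0..<N} S"
    using ex_bij_betw_nat_finite[OF finS] by (auto simp: N_def)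
  have T: "M \<in> carrier_mat n n" if "M \<in> ?T" for M
    using that sylvester_range_carrier[OF A A] by (simp add: tangent_space_sylvester)
  have T0: "0\<^sub>m n n \<in> ?T"
    unfolding tangent_space_sylvester by (rule sylvester_range_zero[OF A A])
  have Tadd: "M + N \<in> ?T" if "M \<in> ?T" "N \<in> ?T" for M N
    using that unfolding tangent_space_sylvester by (rule sylvester_range_add[OF A A])
  have Tsm: "c \<cdot>\<^sub>m M \<in> ?T" if "M \<in> ?T" for M c
    using that unfolding tangent_space_sylvester by (rule sylvester_range_smult[OF A A])
  have uniq: "P = Q" if P: "P \<in> ?T" and Q: "Q \<in> ?T" and eq: "\<And>k. k < N \<Longrightarrow> P $$ pos k = Q $$ pos k" for P Q
  proof -
    have PQ: "P - Q \<in> ?T"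
      using P Q unfolding tangent_space_sylvester by (rule sylvester_range_minus[OF A A])
    have eqS: "P $$ (i, j) = Q $$ (i, j)" if ij: "(i, j) \<in> S" for i j
    proof -
      obtain k where "k < N" "pos k = (i, j)"
        using pos ij by (auto simp: bij_betw_def)
      then show ?thesis using eq by metis
    qed
    have "P - Q \<in> form_space n D"
      using T[OF P] T[OF Q] eqS S_iff by (auto simp: form_space_def)
    then have "P - Q = 0\<^sub>m n n" using PQ dec by (auto simp: tangent_decomposition_def)
    show ?thesis
    proof (rule eq_matI)
      fix i j assume "i < dim_row Q" "j < dim_col Q"
      then have "(P - Q) $$ (i, j) = P $$ (i, j) - Q $$ (i, j)" "i < n" "j < n"
        using T[OF Q] by auto
      then show "P $$ (i, j) = Q $$ (i, j)" unfolding \<open>P - Q = 0\<^sub>m n n\<close> by simp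
    qed (use T[OF P] T[OF Q] in auto)
  qed
  have ex: "\<exists>P. P \<in> ?T \<and> (\<forall>k<N. P $$ pos k = v $ k)" for v :: "'a Matrix.vec"
  proof -
    define E where "E = mat n n (\<lambda>p. v $ (inv_into {0..<N} pos p))"
    have "E \<in> carrier_mat n n" by (simp add: E_def)
    then obtain P Q where PQ: "E = P + Q" "P \<in> ?T" "Q \<in> form_space n D"
      using dec unfolding tangent_decomposition_def by blast
    have "P $$ pos k = v $ k" if k: "k < N" for k
    proof -
      have kS: "pos k \<in> S" using pos k by (auto simp: bij_betw_def)
      obtain i j where ij: "pos k = (i, j)" by fastforce
      have inv: "inv_into {0..<N} pos (pos k) = k"
        using pos k by (intro inv_into_f_f) (auto simp: bij_betw_def)
      have "i < n" "j < n" "Q $$ (i, j) = 0"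
        using kS PQ(3) unfolding ij S_iff by (auto simp: form_space_def)
      moreover have "E $$ (i, j) = v $ k"
        using \<open>i < n\<close> \<open>j < n\<close> inv by (simp add: E_def ij)
      moreover have "E $$ (i, j) = P $$ (i, j) + Q $$ (i, j)"
        using \<open>i < n\<close> \<open>j < n\<close> T[OF PQ(2)] PQ(3) unfolding PQ(1) by (auto simp: form_space_def)
      ultimately show ?thesis by (simp add: ij)
    qed
    then show ?thesis using PQ(2) by blast
  qed
  define \<psi> where "\<psi> v = (SOME P. P \<in> ?T \<and> (\<forall>k<N. P $$ pos k = v $ k))" for v
  have psi: "\<psi> v \<in> ?T" "\<And>k. k < N \<Longrightarrow> \<psi> v $$ pos k = v $ k" for v
    using someI_ex[OF ex[of v]] by (auto simp: \<psi>_def)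
  have posb: "\<exists>i j. pos k = (i, j) \<and> i < n \<and> j < n" if k: "k < N" for k
  proof -
    have "pos k \<in> S" using pos k by (auto simp: bij_betw_def)
    then show ?thesis by (cases "pos k") (simp add: S_iff)
  qed
  interpret V: vectorspace ?K ?V by (rule matrix_vs)
  have "submodule ?K ?T ?V"
    using T T0 Tadd Tsm V.module_axioms
    by (auto simp: submodule_def module_mat_simps)
  then have "subspace ?K ?T ?V" unfolding subspace_def using matrix_vs by blast
  then have vsW: "vectorspace ?K ?W" by (rule V.subspace_is_vs)
  interpret vn: vec_space "TYPE('a)" N .
  have hom: "\<psi> \<in> module_hom ?K (module_vec TYPE('a) N) ?W"
  proof -
    have add: "\<psi> (v + w) = \<psi> v + \<psi> w" if "v \<in> carrier_vec N" "w \<in> carrier_vec N" for v w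
    proof (rule uniq)
      fix k assume k: "k < N"
      obtain i j where ij: "pos k = (i, j)" "i < n" "j < n" using posb[OF k] by blast
      have "(\<psi> v + \<psi> w) $$ (i, j) = \<psi> v $$ (i, j) + \<psi> w $$ (i, j)"
        using ij T[OF psi(1)[of w]] by simp
      then show "\<psi> (v + w) $$ pos k = (\<psi> v + \<psi> w) $$ pos k"
        using that k ij psi(2)[OF k] by auto
    qed (intro psi Tadd)+
    have sm: "\<psi> (c \<cdot>\<^sub>v v) = c \<cdot>\<^sub>m \<psi> v" if "v \<in> carrier_vec N" for c v
    proof (rule uniq)
      fix k assume k: "k < N"
      obtain i j where ij: "pos k = (i, j)" "i < n" "j < n" using posb[OF k] by blast
      have "(c \<cdot>\<^sub>m \<psi> v) $$ (i, j) = c * \<psi> v $$ (i, j)"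
        using ij T[OF psi(1)[of v]] by simp
      then show "\<psi> (c \<cdot>\<^sub>v v) $$ pos k = (c \<cdot>\<^sub>m \<psi> v) $$ pos k"
        using that k ij psi(2)[OF k] by auto
    qed (intro psi Tsm)+
    show ?thesis unfolding module_hom_def
      using psi(1) add sm by (auto simp: module_vec_simps module_mat_simps)
  qed
  have lin: "linear_map ?K (module_vec TYPE('a) N) ?W \<psi>"
    using vec_vs vsW hom unfolding linear_map_def mod_hom_def mod_hom_axioms_def vectorspace_def by blast
  have inj: "inj_on \<psi> (carrier (module_vec TYPE('a) N))"
  proof (rule inj_onI)
    fix v w assume vw: "v \<in> carrier (module_vec TYPE('a) N)" "w \<in> carrier (module_vec TYPE('a) N)" "\<psi> v = \<psi> w"
    show "v = w"
    proof (rule eq_vecI)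
      fix k assume "k < dim_vec w"
      then have k: "k < N" using vw by (simp add: module_vec_simps)
      show "v $ k = w $ k" using psi(2)[OF k, of v] psi(2)[OF k, of w] vw(3) by simp
    qed (use vw in \<open>simp add: module_vec_simps\<close>)
  qed
  have "M \<in> \<psi> ` carrier (module_vec TYPE('a) N)" if M: "M \<in> ?T" for M
  proof (rule image_eqI)
    let ?v = "vec N (\<lambda>k. M $$ pos k)"
    show "M = \<psi> ?v" by (rule uniq[OF M psi(1)]) (simp add: psi(2))
    show "?v \<in> carrier (module_vec TYPE('a) N)" by (simp add: module_vec_simps)
  qed
  then have surj: "\<psi> ` carrier (module_vec TYPE('a) N) = carrier ?W"
    using psi(1) by auto
  have "vectorspace.dim ?K ?W = N"
    using linear_map.dim_eq[OF lin vn.fin_dim inj surj] vn.dim_is_n by simp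
  moreover have "star_positions n D \<subseteq> {..<n} \<times> {..<n}" by (auto simp: star_positions_def)
  then have "card (star_positions n D) + N = n\<^sup>2"
    unfolding N_def S_def
    by (subst card_Diff_subset) (auto simp: power2_eq_square finite_subset card_mono
        dest: card_mono[rotated])
  then have "int (card (star_positions n D)) + int N = int (n\<^sup>2)"
    by (simp only: of_nat_add[symmetric])
  ultimately show ?thesis unfolding similarity_class_codim_def by linarith
qed

section \<open>The Frobenius norm over a field with absolute value\<close>

locale valued_field =
  fixes av :: "'a::field \<Rightarrow> real"
  assumes absolute_value: "absolute_value av"
begin

lemma av_nonneg [simp]: "0 \<le> av x"
  and av_eq_0 [simp]: "av x = 0 \<longleftrightarrow> x = 0"
  and av_mult: "av (x * y) = av x * av y"
  and av_add: "av (x + y) \<le> av x + av y"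
  using absolute_value by (auto simp: absolute_value_def)

lemma av_0 [simp]: "av 0 = 0" by simp

lemma av_1 [simp]: "av 1 = 1"
  using av_mult[of 1 1] av_eq_0[of 1] by simp

lemma av_minus [simp]: "av (- x) = av x"
proof -
  have "(av (- 1))\<^sup>2 = 1" using av_mult[of "- 1" "- 1"] by (simp add: power2_eq_square)
  then have "av (- 1) = 1" using av_nonneg[of "- 1"] by (simp add: power2_eq_1_iff)
  then show ?thesis using av_mult[of "- 1" x] by simp
qed

lemma av_diff: "av (x - y) \<le> av x + av y"
  using av_add[of x "- y"] by simp

lemma av_sum: "av (\<Sum>i\<in>I. f i) \<le> (\<Sum>i\<in>I. av (f i))"
proof (induction I rule: infinite_finite_induct)
  case (insert i I)
  then show ?case using av_add[of "f i" "sum f I"] by simp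
qed auto

abbreviation nrm :: "'a mat \<Rightarrow> real" where "nrm \<equiv> mat_norm av"

lemma mat_norm_L2: "M \<in> carrier_mat r c \<Longrightarrow> nrm M = L2_set (\<lambda>p. av (M $$ p)) ({..<r} \<times> {..<c})"
  by (auto simp: mat_norm_def L2_set_def sum.cartesian_product)

lemma nrm_nonneg [simp]: "0 \<le> nrm M"
  by (simp add: mat_norm_def sum_nonneg)

lemma av_le_nrm:
  assumes "M \<in> carrier_mat r c" "i < r" "j < c"
  shows "av (M $$ (i, j)) \<le> nrm M"
  unfolding mat_norm_L2[OF assms(1)]
  by (rule member_le_L2_set[of _ "(i, j)" "\<lambda>p. av (M $$ p)"]) (use assms in auto)

lemma nrm_le_sum:
  assumes "M \<in> carrier_mat r c"
  shows "nrm M \<le> (\<Sum>p\<in>{..<r} \<times> {..<c}. av (M $$ p))"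
  unfolding mat_norm_L2[OF assms] by (rule L2_set_le_sum) simp

lemma nrm_mono:
  assumes "M \<in> carrier_mat r c" "N \<in> carrier_mat r c"
    and "\<And>i j. i < r \<Longrightarrow> j < c \<Longrightarrow> av (M $$ (i, j)) \<le> av (N $$ (i, j))"
  shows "nrm M \<le> nrm N"
  unfolding mat_norm_L2[OF assms(1)] mat_norm_L2[OF assms(2)]
  by (rule L2_set_mono) (use assms(3) in auto)

lemma nrm_add:
  assumes "M \<in> carrier_mat r c" "N \<in> carrier_mat r c"
  shows "nrm (M + N) \<le> nrm M + nrm N"
proof -
  have MN: "M + N \<in> carrier_mat r c" using assms by simp
  have "nrm (M + N) \<le> L2_set (\<lambda>p. av (M $$ p) + av (N $$ p)) ({..<r} \<times> {..<c})"
    unfolding mat_norm_L2[OF MN] by (rule L2_set_mono) (use assms av_add in auto)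
  also have "\<dots> \<le> nrm M + nrm N"
    unfolding mat_norm_L2[OF assms(1)] mat_norm_L2[OF assms(2)] by (rule L2_set_triangle_ineq)
  finally show ?thesis .
qed

lemma nrm_uminus:
  assumes "M \<in> carrier_mat r c"
  shows "nrm (- M) = nrm M"
proof -
  have "- M \<in> carrier_mat r c" using assms by simp
  then show ?thesis using assms unfolding mat_norm_L2[OF assms] 
    by (simp add: mat_norm_L2, intro L2_set_cong) auto
qed

lemma nrm_minus:
  assumes "M \<in> carrier_mat r c" "N \<in> carrier_mat r c"
  shows "nrm (M - N) \<le> nrm M + nrm N"
proof -
  have "M - N = M + (- N)" using assms by (intro eq_matI) auto
  then show ?thesis using nrm_add[of M r c "- N"] nrm_uminus[of N] assms by auto
qed

lemma nrm_minus_commute: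
  assumes "M \<in> carrier_mat r c" "N \<in> carrier_mat r c"
  shows "nrm (M - N) = nrm (N - M)"
proof -
  have "M - N = - (N - M)" using assms by (intro eq_matI) auto
  moreover have "N - M \<in> carrier_mat r c" by (rule minus_carrier_mat[OF assms(1)])
  ultimately show ?thesis using nrm_uminus by metis
qed

lemma nrm_triangle:
  assumes "M \<in> carrier_mat r c" "N \<in> carrier_mat r c" "P \<in> carrier_mat r c"
  shows "nrm (M - P) \<le> nrm (M - N) + nrm (N - P)"
proof -
  have "M - P = (M - N) + (N - P)" using assms by (intro eq_matI) auto
  then show ?thesis using nrm_add[OF minus_carrier_mat[OF assms(2)] minus_carrier_mat[OF assms(3)]] by metis
qed

lemma nrm_zero [simp]: "nrm (0\<^sub>m r c) = 0"
  by (simp add: mat_norm_def)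

lemma nrm_eq_0:
  assumes "M \<in> carrier_mat r c" "nrm M = 0"
  shows "M = 0\<^sub>m r c"
proof (rule eq_matI)
  fix i j assume "i < dim_row (0\<^sub>m r c :: 'a mat)" "j < dim_col (0\<^sub>m r c :: 'a mat)"
  then have ij: "i < r" "j < c" by auto
  then have "av (M $$ (i, j)) \<le> 0" using av_le_nrm[OF assms(1) ij] assms(2) by simp
  then have "av (M $$ (i, j)) = 0" using av_nonneg by (rule antisym)
  then show "M $$ (i, j) = 0\<^sub>m r c $$ (i, j)" using ij by simp
qed (use assms in auto)

lemma nrm_one: "nrm (1\<^sub>m n) = sqrt (real n)"
proof -
  have "(\<Sum>i<n. \<Sum>j<n. (av (1\<^sub>m n $$ (i, j)))\<^sup>2) = (\<Sum>i<n. \<Sum>j<n. if j = i then 1 else 0)"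
    by (intro sum.cong) auto
  then show ?thesis by (simp add: mat_norm_def)
qed

lemma nrm_mult:
  assumes A: "A \<in> carrier_mat r k" and B: "B \<in> carrier_mat k c"
  shows "nrm (A * B) \<le> nrm A * nrm B"
proof -
  have AB: "A * B \<in> carrier_mat r c" using A B by simp
  have entry: "(av ((A * B) $$ (i, j)))\<^sup>2 \<le> (\<Sum>s<k. (av (A $$ (i, s)))\<^sup>2) * (\<Sum>s<k. (av (B $$ (s, j)))\<^sup>2)"
    if ij: "i < r" "j < c" for i j
  proof -
    have "av ((A * B) $$ (i, j)) \<le> (\<Sum>s<k. \<bar>av (A $$ (i, s))\<bar> * \<bar>av (B $$ (s, j))\<bar>)"
      unfolding index_mult_mat_sum[OF A B ij]
      using av_sum[of "\<lambda>s. A $$ (i, s) * B $$ (s, j)" "{..<k}"] by (simp add: av_mult)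
    also have "\<dots> \<le> L2_set (\<lambda>s. av (A $$ (i, s))) {..<k} * L2_set (\<lambda>s. av (B $$ (s, j))) {..<k}"
      by (rule L2_set_mult_ineq)
    finally have "(av ((A * B) $$ (i, j)))\<^sup>2
        \<le> (L2_set (\<lambda>s. av (A $$ (i, s))) {..<k} * L2_set (\<lambda>s. av (B $$ (s, j))) {..<k})\<^sup>2"
      by (intro power_mono) simp_all
    then show ?thesis by (simp add: power_mult_distrib L2_set_def sum_nonneg)
  qed
  have "(\<Sum>i<r. \<Sum>j<c. (av ((A * B) $$ (i, j)))\<^sup>2)
      \<le> (\<Sum>i<r. \<Sum>j<c. (\<Sum>s<k. (av (A $$ (i, s)))\<^sup>2) * (\<Sum>s<k. (av (B $$ (s, j)))\<^sup>2))"
    by (intro sum_mono entry) auto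
  also have "\<dots> = (\<Sum>i<r. \<Sum>s<k. (av (A $$ (i, s)))\<^sup>2) * (\<Sum>j<c. \<Sum>s<k. (av (B $$ (s, j)))\<^sup>2)"
    by (simp only: sum_product)
  also have "(\<Sum>j<c. \<Sum>s<k. (av (B $$ (s, j)))\<^sup>2) = (\<Sum>s<k. \<Sum>j<c. (av (B $$ (s, j)))\<^sup>2)"
    by (rule sum.swap)
  finally have "sqrt (\<Sum>i<r. \<Sum>j<c. (av ((A * B) $$ (i, j)))\<^sup>2)
      \<le> sqrt (\<Sum>i<r. \<Sum>s<k. (av (A $$ (i, s)))\<^sup>2) * sqrt (\<Sum>s<k. \<Sum>j<c. (av (B $$ (s, j)))\<^sup>2)"
    by (simp add: real_sqrt_mult[symmetric])
  then show ?thesis using A B AB unfolding mat_norm_def by simp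
qed

lemma nrm_combination:
  assumes "finite Q" "\<And>q. q \<in> Q \<Longrightarrow> G q \<in> carrier_mat r c"
  shows "nrm (mat r c (\<lambda>p. \<Sum>q\<in>Q. x q * G q $$ p)) \<le> (\<Sum>q\<in>Q. av (x q) * nrm (G q))"
  using assms
proof (induction Q)
  case empty
  have "mat r c (\<lambda>p. \<Sum>q\<in>{}. x q * G q $$ p) = 0\<^sub>m r c" by (intro eq_matI) auto
  then show ?case by simp
next
  case (insert q Q)
  let ?R = "mat r c (\<lambda>p. \<Sum>q\<in>Q. x q * G q $$ p)"
  have G: "G q \<in> carrier_mat r c" using insert by simp
  have "mat r c (\<lambda>p. \<Sum>q\<in>insert q Q. x q * G q $$ p) = x q \<cdot>\<^sub>m G q + ?R"
    using insert.hyps carrier_matD[OF G] by (intro eq_matI) auto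
  then have "nrm (mat r c (\<lambda>p. \<Sum>q\<in>insert q Q. x q * G q $$ p)) \<le> nrm (x q \<cdot>\<^sub>m G q) + nrm ?R"
    using nrm_add[of "x q \<cdot>\<^sub>m G q" r c ?R] G by simp
  also have "nrm (x q \<cdot>\<^sub>m G q) = av (x q) * nrm (G q)"
  proof -
    have "x q \<cdot>\<^sub>m G q \<in> carrier_mat r c" using G by simp
    moreover have "L2_set (\<lambda>p. av ((x q \<cdot>\<^sub>m G q) $$ p)) ({..<r} \<times> {..<c})
        = L2_set (\<lambda>p. av (x q) * av (G q $$ p)) ({..<r} \<times> {..<c})"
      using G by (intro L2_set_cong) (auto simp: av_mult)
    ultimately show ?thesis
      by (simp add: mat_norm_L2 mat_norm_L2[OF G] L2_set_right_distrib)
  qed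
  finally show ?case using insert by simp
qed

subsection \<open>Invertibility near the identity\<close>

text \<open>If \<open>\<parallel>C\<parallel> < 1\<close>, then \<open>CX = X\<close> forces \<open>X = 0\<close>, so \<open>I - C\<close> has no kernel.\<close>
lemma mat_inv_near_one:
  assumes C: "C \<in> carrier_mat n n" and small: "nrm C < 1"
  shows "mat_inv (1\<^sub>m n - C) \<in> carrier_mat n n" "(1\<^sub>m n - C) * mat_inv (1\<^sub>m n - C) = 1\<^sub>m n"
    "mat_inv (1\<^sub>m n - C) * (1\<^sub>m n - C) = 1\<^sub>m n" "invertible_mat (1\<^sub>m n - C)"
proof -
  let ?B = "1\<^sub>m n - C"
  have B: "?B \<in> carrier_mat n n" using C by (intro minus_carrier_mat)
  have "det ?B \<noteq> 0"
  proof
    assume "det ?B = 0"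
    then obtain v where v: "v \<in> carrier_vec n" "v \<noteq> 0\<^sub>v n" "?B *\<^sub>v v = 0\<^sub>v n"
      using det_0_iff_vec_prod_zero_field[OF B] by blast
    define V where "V = mat n 1 (\<lambda>(i, j). v $ i)"
    have V: "V \<in> carrier_mat n 1" by (simp add: V_def)
    have "C * V = V"
    proof (rule eq_matI)
      fix i j assume "i < dim_row V" "j < dim_col V"
      then have ij: "i < n" "j < 1" by (auto simp: V_def)
      have "(E *\<^sub>v v) $ i = (\<Sum>k<n. E $$ (i, k) * v $ k)" if "E \<in> carrier_mat n n" for E
        using that ij v(1) by (simp add: scalar_prod_def lessThan_atLeast0)
      from this[OF B, symmetric] have "(\<Sum>k<n. ?B $$ (i, k) * v $ k) = 0"
        unfolding v(3) using ij by simp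
      moreover have "(\<Sum>k<n. ?B $$ (i, k) * v $ k) = (\<Sum>k<n. (if k = i then v $ i else 0) - C $$ (i, k) * v $ k)"
        using ij C by (intro sum.cong) (auto simp: left_diff_distrib)
      ultimately have "(\<Sum>k<n. C $$ (i, k) * v $ k) = v $ i"
        using ij by (simp add: sum_subtractf)
      moreover have "(\<Sum>k<n. C $$ (i, k) * V $$ (k, j)) = (\<Sum>k<n. C $$ (i, k) * v $ k)"
        using ij by (intro sum.cong) (auto simp: V_def)
      ultimately show "(C * V) $$ (i, j) = V $$ (i, j)"
        unfolding index_mult_mat_sum[OF C V ij] using ij by (simp add: V_def)
    qed (use C in \<open>auto simp: V_def\<close>)
    then have "nrm V \<le> nrm C * nrm V" using nrm_mult[OF C V] by simp
    then have "(1 - nrm C) * nrm V \<le> 0" by (simp add: algebra_simps)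
    then have "nrm V \<le> 0" using small by (simp add: mult_le_0_iff)
    then have "V = 0\<^sub>m n 1" using nrm_eq_0[OF V] nrm_nonneg[of V] by linarith
    have "v $ i = 0" if "i < n" for i
    proof -
      have "V $$ (i, 0) = 0" using \<open>V = 0\<^sub>m n 1\<close> that by simp
      then show ?thesis using that by (simp add: V_def)
    qed
    then have "v = 0\<^sub>v n" using v(1) by (intro eq_vecI) auto
    then show False using v(2) by simp
  qed
  then have "?B \<in> Units (ring_mat TYPE('a) n ())" by (rule det_non_zero_imp_unit[OF B])
  then obtain R where R: "mat_inverse ?B = Some R"
    using mat_inverse(1)[OF B, where b = "()"] by (cases "mat_inverse ?B") auto
  show "mat_inv ?B \<in> carrier_mat n n" "?B * mat_inv ?B = 1\<^sub>m n" "mat_inv ?B * ?B = 1\<^sub>m n"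
    using mat_inverse(2)[OF B R] R by auto
  note inv = this
  have "dim_row ?B = n" "dim_col ?B = n" using carrier_matD[OF B] .
  moreover have "dim_row (mat_inv ?B) = n" using carrier_matD(1)[OF inv(1)] .
  ultimately show "invertible_mat ?B"
    unfolding invertible_mat_def inverts_mat_def square_mat.simps
    by (intro conjI exI[of _ "mat_inv ?B"]) (simp_all only: inv)
qed

subsection \<open>Limits\<close>

lemma mat_tendsto_entry:
  assumes "\<And>k. P k \<in> carrier_mat r c" "L \<in> carrier_mat r c" "mat_tendsto av P L" "i < r" "j < c"
  shows "(\<lambda>k. av (P k $$ (i, j) - L $$ (i, j))) \<longlonglongrightarrow> 0"
proof (rule Lim_null_comparison)
  show "(\<lambda>k. nrm (P k - L)) \<longlonglongrightarrow> 0" using assms(3) by (simp add: mat_tendsto_def)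
  have "av (P k $$ (i, j) - L $$ (i, j)) \<le> nrm (P k - L)" for k
    using av_le_nrm[OF minus_carrier_mat[OF assms(2)] assms(4,5)] assms(1)[of k] assms(2,4,5) by simp
  then show "\<forall>\<^sub>F k in sequentially. norm (av (P k $$ (i, j) - L $$ (i, j))) \<le> nrm (P k - L)"
    by simp
qed

lemma mat_tendsto_unique:
  assumes P: "\<And>k. P k \<in> carrier_mat r c" and L: "L \<in> carrier_mat r c" "mat_tendsto av P L"
    and L': "L' \<in> carrier_mat r c" "mat_tendsto av P L'"
  shows "L = L'"
proof -
  have "(\<lambda>k. nrm (P k - L) + nrm (P k - L')) \<longlonglongrightarrow> 0 + 0"
    using L L' unfolding mat_tendsto_def by (intro tendsto_add)
  moreover have "nrm (L - L') \<le> nrm (P k - L) + nrm (P k - L')" for k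
    using nrm_triangle[OF L(1) P[of k] L'(1)] nrm_minus_commute[OF L(1) P[of k]] by simp
  ultimately have "nrm (L - L') \<le> 0"
    by (intro LIMSEQ_le_const[where X = "\<lambda>k. nrm (P k - L) + nrm (P k - L')"]) auto
  then have "nrm (L - L') = 0" using nrm_nonneg[of "L - L'"] by linarith
  then have z: "L - L' = 0\<^sub>m r c" using nrm_eq_0[of "L - L'" r c] L'(1) by (simp add: minus_carrier_mat)
  show ?thesis
  proof (rule eq_matI)
    fix i j assume ij: "i < dim_row L'" "j < dim_col L'"
    then have "(L - L') $$ (i, j) = L $$ (i, j) - L' $$ (i, j)" by simp
    then show "L $$ (i, j) = L' $$ (i, j)" unfolding z using ij L'(1) by simp
  qed (use L L' in auto)
qed

lemma mat_tendsto_mult: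
  assumes P: "\<And>k. P k \<in> carrier_mat r n" "L \<in> carrier_mat r n" "mat_tendsto av P L"
    and Q: "\<And>k. Q k \<in> carrier_mat n c" "R \<in> carrier_mat n c" "mat_tendsto av Q R"
  shows "mat_tendsto av (\<lambda>k. P k * Q k) (L * R)"
proof -
  have lim: "(\<lambda>k. nrm (P k - L) * nrm (Q k - R) + nrm (P k - L) * nrm R + nrm L * nrm (Q k - R)) \<longlonglongrightarrow> 0 * 0 + 0 * nrm R + nrm L * 0"
    using P(3) Q(3) unfolding mat_tendsto_def by (intro tendsto_intros)
  have bd: "nrm (P k * Q k - L * R)
      \<le> nrm (P k - L) * nrm (Q k - R) + nrm (P k - L) * nrm R + nrm L * nrm (Q k - R)" for k
  proof -
    have d: "P k - L \<in> carrier_mat r n" "Q k - R \<in> carrier_mat n c"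
      by (rule minus_carrier_mat[OF P(2)], rule minus_carrier_mat[OF Q(2)])
    have "(P k - L) * (Q k - R) = (P k * Q k - L * Q k) - (P k * R - L * R)"
      using mult_minus_distrib_mat[OF d(1) Q(1)[of k] Q(2)] minus_mult_distrib_mat[OF P(1)[of k] P(2) Q(1)[of k]]
        minus_mult_distrib_mat[OF P(1)[of k] P(2) Q(2)] by simp
    moreover have "(P k - L) * R = P k * R - L * R" "L * (Q k - R) = L * Q k - L * R"
      using minus_mult_distrib_mat[OF P(1)[of k] P(2) Q(2)] mult_minus_distrib_mat[OF P(2) Q(1)[of k] Q(2)] by auto
    moreover have "U - Z = ((U - V) - (W - Z)) + (W - Z) + (V - Z)"
      if "U \<in> carrier_mat r c" "V \<in> carrier_mat r c" "W \<in> carrier_mat r c" "Z \<in> carrier_mat r c" for U V W Z :: "'a mat"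
      using that by (intro eq_matI) auto
    ultimately have e: "P k * Q k - L * R = (P k - L) * (Q k - R) + (P k - L) * R + L * (Q k - R)"
      using P(1)[of k] P(2) Q(1)[of k] Q(2) by simp
    have c: "(P k - L) * (Q k - R) \<in> carrier_mat r c" "(P k - L) * R \<in> carrier_mat r c"
      "L * (Q k - R) \<in> carrier_mat r c" "(P k - L) * (Q k - R) + (P k - L) * R \<in> carrier_mat r c"
      using d P(2) Q(2) by auto
    show ?thesis unfolding e
      using nrm_add[OF c(4) c(3)] nrm_add[OF c(1) c(2)] nrm_mult[OF d] nrm_mult[OF d(1) Q(2)] nrm_mult[OF P(2) d(2)]
      by linarith
  qed
  show ?thesis unfolding mat_tendsto_def
    by (rule Lim_null_comparison[OF _ lim[simplified]]) (use bd in simp)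
qed

lemma mat_tendsto_const_add:
  assumes "\<And>k. P k \<in> carrier_mat r c" "L \<in> carrier_mat r c" "mat_tendsto av P L" "A \<in> carrier_mat r c"
  shows "mat_tendsto av (\<lambda>k. A + P k) (A + L)"
proof -
  have "A + P k - (A + L) = P k - L" for k using assms(1)[of k] assms(2,4) by (intro eq_matI) auto
  then show ?thesis using assms(3) by (simp add: mat_tendsto_def)
qed

lemma mat_tendsto_const: "M \<in> carrier_mat r c \<Longrightarrow> mat_tendsto av (\<lambda>k. M) M"
proof -
  assume "M \<in> carrier_mat r c"
  then have "M - M = 0\<^sub>m r c" by (intro eq_matI) auto
  then show ?thesis by (simp add: mat_tendsto_def)
qed

lemma geometric_tail:
  assumes P: "\<And>k. P k \<in> carrier_mat r c" and q: "0 \<le> q" "q < 1"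
    and step: "\<And>k. nrm (P (Suc k) - P k) \<le> K * q ^ k"
  shows "nrm (P (k + d) - P k) \<le> K * q ^ k / (1 - q)"
proof -
  have K: "0 \<le> K" using order_trans[OF nrm_nonneg step[of 0]] by simp
  have "nrm (P (k + d) - P k) \<le> (\<Sum>i<d. K * q ^ (k + i))"
  proof (induction d)
    case 0
    have "P k - P k = 0\<^sub>m r c" using P[of k] by (intro eq_matI) auto
    then show ?case by simp
  next
    case (Suc d)
    have "nrm (P (k + Suc d) - P k) \<le> nrm (P (Suc (k + d)) - P (k + d)) + nrm (P (k + d) - P k)"
      using nrm_triangle[OF P[of "Suc (k + d)"] P[of "k + d"] P[of k]] by simp
    then show ?case using Suc step[of "k + d"] by simp
  qed
  also have "\<dots> = K * q ^ k * (\<Sum>i<d. q ^ i)" by (simp add: sum_distrib_left power_add mult_ac)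
  also have "\<dots> \<le> K * q ^ k * (1 / (1 - q))"
  proof (rule mult_left_mono)
    have "(\<Sum>i<d. q ^ i) = (1 - q ^ d) / (1 - q)" using q by (simp add: sum_gp_strict)
    also have "\<dots> \<le> 1 / (1 - q)" using q by (intro divide_right_mono) auto
    finally show "(\<Sum>i<d. q ^ i) \<le> 1 / (1 - q)" .
  qed (use K q in simp)
  finally show ?thesis by simp
qed

end

locale complete_valued_field = valued_field +
  assumes complete: "complete_wrt av"
begin

lemma geometric_limit:
  assumes P: "\<And>k. P k \<in> carrier_mat r c" and q: "0 \<le> q" "q < 1"
    and step: "\<And>k. nrm (P (Suc k) - P k) \<le> K * q ^ k"
  obtains L where "L \<in> carrier_mat r c" "mat_tendsto av P L" "\<And>k. nrm (L - P k) \<le> K * q ^ k / (1 - q)"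
proof -
  note tail = geometric_tail[OF P q step]
  have lim0: "(\<lambda>k. K * q ^ k / (1 - q)) \<longlonglongrightarrow> 0"
    using q by (intro tendsto_eq_intros LIMSEQ_realpow_zero | simp)+
  have entry: "\<exists>x. (\<lambda>k. av (P k $$ (i, j) - x)) \<longlonglongrightarrow> 0" if ij: "i < r" "j < c" for i j
  proof -
    have diff: "av (P (k + d) $$ (i, j) - P k $$ (i, j)) \<le> K * q ^ k / (1 - q)" for k d
    proof -
      have "av ((P (k + d) - P k) $$ (i, j)) \<le> nrm (P (k + d) - P k)"
        by (rule av_le_nrm[OF _ ij]) (use P[of k] in \<open>rule minus_carrier_mat\<close>)
      then show ?thesis using tail[of k d] ij P[of k] by simp
    qed
    have "\<exists>N. \<forall>k\<ge>N. \<forall>l\<ge>N. av (P k $$ (i, j) - P l $$ (i, j)) < e" if e: "e > 0" for e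
    proof -
      obtain N where N: "K * q ^ N / (1 - q) < e / 2"
        using order_tendstoD(2)[OF lim0, of "e / 2"] e by (auto simp: eventually_sequentially)
      have near: "av (P k $$ (i, j) - P N $$ (i, j)) < e / 2" if "k \<ge> N" for k
        using order.strict_trans1[OF diff[of N "k - N"] N] that by simp
      have "av (P k $$ (i, j) - P l $$ (i, j)) < e" if "k \<ge> N" "l \<ge> N" for k l
      proof -
        have "P k $$ (i, j) - P l $$ (i, j) = (P k $$ (i, j) - P N $$ (i, j)) - (P l $$ (i, j) - P N $$ (i, j))"
          by simp
        then show ?thesis
          using av_diff[of "P k $$ (i, j) - P N $$ (i, j)" "P l $$ (i, j) - P N $$ (i, j)"]
            near[OF that(1)] near[OF that(2)] by (simp only:)
      qed
      then show ?thesis by blast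
    qed
    then show ?thesis
      using complete[unfolded complete_wrt_def, THEN spec[of _ "\<lambda>k. P k $$ (i, j)"]] by blast
  qed
  define L where "L = mat r c (\<lambda>(i, j). SOME x. (\<lambda>k. av (P k $$ (i, j) - x)) \<longlonglongrightarrow> 0)"
  have L: "L \<in> carrier_mat r c" by (simp add: L_def)
  have Lij: "(\<lambda>k. av (P k $$ (i, j) - L $$ (i, j))) \<longlonglongrightarrow> 0" if "i < r" "j < c" for i j
    using someI_ex[OF entry[OF that]] that by (simp add: L_def)
  have tend: "mat_tendsto av P L"
    unfolding mat_tendsto_def
  proof (rule Lim_null_comparison)
    show "(\<lambda>k. \<Sum>p\<in>{..<r} \<times> {..<c}. av ((P k - L) $$ p)) \<longlonglongrightarrow> 0"
      using L Lij by (intro tendsto_null_sum) auto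
    show "\<forall>\<^sub>F k in sequentially. norm (nrm (P k - L)) \<le> (\<Sum>p\<in>{..<r} \<times> {..<c}. av ((P k - L) $$ p))"
      using nrm_le_sum[OF minus_carrier_mat[OF L]] by simp
  qed
  have "nrm (L - P k) \<le> K * q ^ k / (1 - q)" for k
  proof (rule LIMSEQ_le_const)
    show "(\<lambda>d. nrm (P (d + k) - L) + K * q ^ k / (1 - q)) \<longlonglongrightarrow> K * q ^ k / (1 - q)"
      using tendsto_add[OF LIMSEQ_ignore_initial_segment[OF tend[unfolded mat_tendsto_def], of k] tendsto_const]
      by simp
    have "nrm (L - P k) \<le> nrm (P (d + k) - L) + K * q ^ k / (1 - q)" for d
      using nrm_triangle[OF L P[of "d + k"] P[of k]] nrm_minus_commute[OF L P[of "d + k"]] tail[of k d]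
      by (simp add: add.commute)
    then show "\<exists>N. \<forall>d\<ge>N. nrm (L - P k) \<le> nrm (P (d + k) - L) + K * q ^ k / (1 - q)" by blast
  qed
  then show ?thesis using that L tend by blast
qed

end

lemma (in valued_field) uniform_limit_continuous:
  assumes G: "\<And>X. X \<in> V \<Longrightarrow> G X \<in> carrier_mat r c"
    and H: "\<And>X k. X \<in> V \<Longrightarrow> H k X \<in> carrier_mat r c"
    and close: "\<And>X k. X \<in> V \<Longrightarrow> nrm (G X - H k X) \<le> B k" and B: "B \<longlonglongrightarrow> 0"
    and lip: "\<And>k. \<exists>K. \<forall>X\<in>V. \<forall>Y\<in>V. nrm (H k Y - H k X) \<le> K * nrm (Y - X)"
  shows "mat_continuous_on av V G"
  unfolding mat_continuous_on_def
proof (intro ballI allI impI)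
  fix X :: "'a mat" and e :: real assume X: "X \<in> V" and e: "0 < e"
  obtain k where k: "B k < e / 3"
    using order_tendstoD(2)[OF B, of "e / 3"] e by (auto simp: eventually_sequentially)
  obtain K where K: "\<And>X Y. X \<in> V \<Longrightarrow> Y \<in> V \<Longrightarrow> nrm (H k Y - H k X) \<le> K * nrm (Y - X)"
    using lip by blast
  define d where "d = e / (3 * (\<bar>K\<bar> + 1))"
  have "nrm (G Y - G X) < e" if Y: "Y \<in> V" "nrm (Y - X) < d" for Y
  proof -
    have "K * nrm (Y - X) \<le> (\<bar>K\<bar> + 1) * nrm (Y - X)" by (intro mult_right_mono) auto
    also have "\<dots> \<le> (\<bar>K\<bar> + 1) * d" using Y(2) by (intro mult_left_mono) auto
    also have "\<dots> = e / 3"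
    proof -
      have "m * (e / (3 * m)) = e / 3" if "m \<noteq> 0" for m using that by simp
      moreover have "\<bar>K\<bar> + 1 \<noteq> 0" by linarith
      ultimately show ?thesis unfolding d_def by blast
    qed
    finally have "nrm (H k Y - H k X) \<le> e / 3" using K[OF X Y(1)] by linarith
    moreover have "nrm (H k X - G X) < e / 3"
      using close[OF X, of k] k nrm_minus_commute[OF G[OF X] H[OF X, of k]] by linarith
    moreover have "nrm (G Y - H k Y) < e / 3" using close[OF Y(1), of k] k by linarith
    ultimately show ?thesis
      using nrm_triangle[OF G[OF Y(1)] H[OF Y(1), of k] G[OF X]]
        nrm_triangle[OF H[OF Y(1), of k] H[OF X, of k] G[OF X]] by linarith
  qed
  moreover have "0 < d" using e by (simp add: d_def add_nonneg_pos)
  ultimately show "\<exists>d>0. \<forall>Y\<in>V. nrm (Y - X) < d \<longrightarrow> nrm (G Y - G X) < e" by blast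
qed

section \<open>The reducing iteration\<close>

subsection \<open>The scalar estimate\<close>

text \<open>
  Here \<open>m\<close> bounds \<open>\<parallel>M\<^sub>k\<parallel>\<close> and \<open>c\<close> bounds \<open>\<parallel>C\<^sub>k\<parallel>\<close>. The weighted sum \<open>m + 8/3 (a + b) c\<close> does not
  increase, which keeps \<open>m\<close> below \<open>b = \<epsilon>/(4f)\<close>; and then \<open>c\<close> shrinks at least by the factor
  \<open>2fb = \<epsilon>/2 \<le> 1/4\<close>. As \<open>m\<close> grows by at most \<open>2 (a + b) c\<close>, the weight has to satisfy
  \<open>2 + 8/3 \<cdot> 1/4 \<le> 8/3\<close>, and it is the smallest number that does.
\<close>
lemma reduction_step_bound:
  fixes a b c c' f m m' \<epsilon> :: real
  assumes a: "0 \<le> a" and f: "0 < f" and eps: "0 < \<epsilon>" "\<epsilon> \<le> 1/2" and b: "b = \<epsilon> / (4 * f)"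
    and m: "0 \<le> m" and c: "0 \<le> c" "c \<le> \<epsilon> / 8" and inv: "m + 8/3 * (a + b) * c \<le> b"
    and m': "(1 - c) * m' \<le> m * (1 + c) + 2 * a * c" and c': "c' \<le> f * (c * (m + m'))"
  shows "m' + 8/3 * (a + b) * c' \<le> b" "c' \<le> c * (\<epsilon> / 2)" "m \<le> b" "m' \<le> b"
proof -
  have b0: "0 < b" using eps f by (simp add: b)
  have fb: "f * b = \<epsilon> / 4" using f by (simp add: b)
  have ac: "0 \<le> a * c" "0 \<le> b * c" using a b0 c by auto
  have inv': "m + (8/3 * (a * c) + 8/3 * (b * c)) \<le> b"
    using inv by (simp only: distrib_left distrib_right mult.assoc)
  have m'': "m' - m' * c \<le> m + m * c + 2 * (a * c)"
    using m' by (simp add: algebra_simps)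
  show mb: "m \<le> b" using inv' ac by linarith
  show m'b: "m' \<le> b"
  proof (rule ccontr)
    assume "\<not> m' \<le> b"
    then have "b * (1 - c) < m' * (1 - c)" using c eps by (intro mult_strict_right_mono) auto
    then have "b - b * c < m' - m' * c" by (simp add: right_diff_distrib)
    moreover have "m * c \<le> b * c" using mb c by (intro mult_right_mono) auto
    ultimately show False using m'' inv' ac by linarith
  qed
  have "f * (c * (m + m')) \<le> f * (c * (b + b))"
    using mb m'b f c by (intro mult_left_mono add_mono) auto
  also have "\<dots> = 2 * c * (f * b)" by (simp add: algebra_simps)
  also have "\<dots> = c * (\<epsilon> / 2)" unfolding fb by simp
  finally show c'c: "c' \<le> c * (\<epsilon> / 2)" using c' by linarith
  have "c * (\<epsilon> / 2) \<le> c * (1 / 4)" using c eps by (intro mult_left_mono) auto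
  then have "c' \<le> c / 4" using c'c by linarith
  then have "8/3 * (a + b) * c' \<le> 8/3 * (a + b) * (c / 4)"
    using a b0 by (intro mult_left_mono) auto
  also have "\<dots> = 2/3 * (a * c) + 2/3 * (b * c)" by (simp add: algebra_simps)
  finally have "8/3 * (a + b) * c' \<le> 2/3 * (a * c) + 2/3 * (b * c)" .
  moreover have "m * c \<le> b * c" "m' * c \<le> b * c" using mb m'b c by (auto intro: mult_right_mono)
  ultimately show "m' + 8/3 * (a + b) * c' \<le> b"
    using m'' inv' ac by linarith
qed

text \<open>The radius of the ball is such that its elements satisfy the inequality that all steps preserve.\<close>
lemma reduction_start_bound:
  fixes a b f m s \<epsilon> :: real
  assumes a: "0 \<le> a" and f: "1/3 \<le> f" and eps: "0 < \<epsilon>" "\<epsilon> \<le> 1/2" and b: "b = \<epsilon> / (4 * f)"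
    and s: "1 \<le> s" and m: "m \<le> 2 * \<epsilon> / (48 * s * (a + 1) * f\<^sup>2)" "0 \<le> m"
  shows "m + 8/3 * (a + b) * (f * m) \<le> b" "f * m \<le> \<epsilon> / 8"
proof -
  have f0: "0 < f" using f by simp
  define \<mu> where "\<mu> = \<epsilon> / (24 * (a + 1) * f\<^sup>2)"
  have "2 * \<epsilon> / (48 * s * p * q) = \<epsilon> / (24 * p * q) / s" if "p \<noteq> 0" "q \<noteq> 0" "s \<noteq> 0" for p q
    using that by (simp add: field_simps)
  then have "2 * \<epsilon> / (48 * s * (a + 1) * f\<^sup>2) = \<mu> / s" using a f0 s by (simp add: \<mu>_def)
  also have "\<dots> \<le> \<mu>" using s a f0 eps by (simp add: \<mu>_def divide_le_eq mult_left_le)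
  finally have m\<mu>: "m \<le> \<mu>" using m by linarith
  have \<mu>0: "0 \<le> \<mu>" using a f0 eps by (simp add: \<mu>_def)
  have cancel: "f * (\<epsilon> / (24 * p * f\<^sup>2)) * (6 * p) = \<epsilon> / (4 * f)" if "p \<noteq> 0" for p
    using that f0 by (simp add: power2_eq_square field_simps)
  have "a + 1 \<noteq> 0" using a by simp
  from cancel[OF this] have f\<mu>: "f * \<mu> * (6 * (a + 1)) = b" unfolding \<mu>_def b .
  have fb: "f * b = \<epsilon> / 4" using f0 by (simp add: b)
  have "m + 8/3 * (a + b) * (f * m) = m * (1 + 8/3 * (a * f + f * b))" by (simp add: algebra_simps)
  also have "\<dots> \<le> \<mu> * (1 + 8/3 * (a * f + f * b))"
    using m\<mu> a f0 fb eps by (intro mult_right_mono) auto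
  also have "\<dots> \<le> \<mu> * (f * (6 * (a + 1)))"
  proof (rule mult_left_mono)
    have "0 \<le> a * f" using a f0 by simp
    then show "1 + 8/3 * (a * f + f * b) \<le> f * (6 * (a + 1))"
      unfolding fb using f eps by (simp add: algebra_simps)
  qed (rule \<mu>0)
  also have "\<dots> = b" using f\<mu> by (simp add: mult_ac)
  finally show "m + 8/3 * (a + b) * (f * m) \<le> b" .
  have "f * m \<le> f * \<mu>" using m\<mu> f0 by simp
  also have "f * \<mu> \<le> f * \<mu> * (a + 1)" using a f0 \<mu>0 mult_left_mono[of 1 "a + 1" "f * \<mu>"] by simp
  also have "\<dots> = b / 6" using f\<mu> by (simp add: algebra_simps)
  also have "\<dots> \<le> \<epsilon> / 8"
  proof -
    have "1/3 * b \<le> f * b" using f f0 eps by (intro mult_right_mono) (auto simp: b)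
    then show ?thesis unfolding fb by simp
  qed
  finally show "f * m \<le> \<epsilon> / 8" .
qed

subsection \<open>One step\<close>

locale reduction = complete_valued_field av for av :: "'a::field \<Rightarrow> real" +
  fixes n :: nat and A :: "'a mat" and D :: "sym mat" and F :: "nat \<Rightarrow> nat \<Rightarrow> 'a mat"
  assumes data: "reduction_data n A D F"
begin

abbreviation a where "a \<equiv> nrm A"
abbreviation f where "f \<equiv> F_const av n F"
abbreviation C where "C \<equiv> C_of n F"
abbreviation Ms where "Ms \<equiv> M_seq n A F"
abbreviation Cs where "Cs \<equiv> C_seq n A F"
abbreviation Ps where "Ps \<equiv> partial_prod n A F"

lemma n_pos: "0 < n" and A [simp]: "A \<in> carrier_mat n n" and dec: "tangent_decomposition n A D"
  and F [simp]: "i < n \<Longrightarrow> j < n \<Longrightarrow> F i j \<in> carrier_mat n n"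
  and F_form: "i < n \<Longrightarrow> j < n \<Longrightarrow> mat_unit n i j + F i j * A - A * F i j \<in> form_space n D"
  using data by (auto simp: reduction_data_def)

lemma F_star:
  assumes "i < n" "j < n" "D $$ (i, j) \<noteq> Nul"
  shows "F i j = 0\<^sub>m n n"
proof -
  have "(mat_unit n i j :: 'a mat) \<in> form_space n D"
    using assms by (auto simp: form_space_def mat_unit_def)
  then show ?thesis using data assms by (auto simp: reduction_data_def)
qed

lemma f_pos: "0 < f" "1/3 \<le> f"
  by (auto simp: F_const_def max_def)

lemma C_closed [simp]: "C M \<in> carrier_mat n n"
  by (simp add: C_of_def)

definition nonstar :: "'a mat \<Rightarrow> 'a mat" where
  "nonstar M = mat n n (\<lambda>p. if D $$ p = Nul then M $$ p else 0)"

lemma nonstar_closed [simp]: "nonstar M \<in> carrier_mat n n"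
  by (simp add: nonstar_def)

lemma nrm_nonstar: "M \<in> carrier_mat n n \<Longrightarrow> nrm (nonstar M) \<le> nrm M"
  by (rule nrm_mono[of _ n n]) (auto simp: nonstar_def)

text \<open>\<open>C\<close> sees only the entries of \<open>M\<close> off the stars, as \<open>F\<^sub>i\<^sub>j = 0\<close> at a star.\<close>
lemma nrm_C:
  assumes M: "M \<in> carrier_mat n n"
  shows "nrm (C M) \<le> f * nrm (nonstar M)"
proof -
  have "C M = mat n n (\<lambda>p. \<Sum>q\<in>{..<n} \<times> {..<n}. M $$ q * (case q of (i, j) \<Rightarrow> F i j) $$ p)"
    by (simp add: C_of_def sum.cartesian_product case_prod_unfold)
  then have "nrm (C M) \<le> (\<Sum>q\<in>{..<n} \<times> {..<n}. av (M $$ q) * nrm (case q of (i, j) \<Rightarrow> F i j))"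
    by (simp only:) (rule nrm_combination, auto)
  also have "\<dots> \<le> (\<Sum>q\<in>{..<n} \<times> {..<n}. nrm (nonstar M) * nrm (case q of (i, j) \<Rightarrow> F i j))"
  proof (rule sum_mono)
    fix q assume "q \<in> {..<n} \<times> {..<n}"
    then obtain i j where q: "q = (i, j)" "i < n" "j < n" by auto
    show "av (M $$ q) * nrm (case q of (i, j) \<Rightarrow> F i j) \<le> nrm (nonstar M) * nrm (case q of (i, j) \<Rightarrow> F i j)"
    proof (cases "D $$ (i, j) = Nul")
      case True
      then have "av (M $$ (i, j)) \<le> nrm (nonstar M)"
        using av_le_nrm[OF nonstar_closed q(2,3), of M] q by (simp add: nonstar_def)
      then show ?thesis unfolding q by (intro mult_right_mono) auto
    next
      case False
      then show ?thesis using F_star q by simp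
    qed
  qed
  also have "\<dots> = nrm (nonstar M) * (\<Sum>i<n. \<Sum>j<n. nrm (F i j))"
    by (simp add: sum_distrib_left[symmetric] sum.cartesian_product case_prod_unfold)
  also have "\<dots> \<le> nrm (nonstar M) * f"
    by (intro mult_left_mono) (auto simp: F_const_def)
  finally show ?thesis by (simp add: mult.commute)
qed

lemma nrm_C_le: "M \<in> carrier_mat n n \<Longrightarrow> nrm (C M) \<le> f * nrm M"
  using order_trans[OF nrm_C mult_left_mono[OF nrm_nonstar less_imp_le[OF f_pos(1)]]] .

lemma C_diff: 
  assumes "M \<in> carrier_mat n n" "N \<in> carrier_mat n n"
  shows "C (M - N) = C M - C N"
  using assms by (intro eq_matI) (auto simp: C_of_def sum_subtractf[symmetric] left_diff_distrib)

definition step :: "'a mat \<Rightarrow> 'a mat" where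
  "step M = mat_inv (1\<^sub>m n - C M) * (A + M) * (1\<^sub>m n - C M) - A"

text \<open>
  The linear part \<open>M + CA - AC = \<Sum> m\<^sub>i\<^sub>j (E\<^sub>i\<^sub>j + F\<^sub>i\<^sub>j A - A F\<^sub>i\<^sub>j)\<close> of a step has the form \<open>\<D>\<close>, so that
  off the stars only the quadratic remainder survives.
\<close>
lemma linear_part_nonstar:
  assumes M: "M \<in> carrier_mat n n" and ij: "i < n" "j < n" "D $$ (i, j) = Nul"
  shows "M $$ (i, j) + (C M * A) $$ (i, j) - (A * C M) $$ (i, j) = 0"
proof -
  let ?S = "\<lambda>g. \<Sum>r<n. \<Sum>s<n. M $$ (r, s) * g r s"
  have 1: "M $$ (i, j) = ?S (\<lambda>r s. mat_unit n r s $$ (i, j))"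
  proof -
    have "?S (\<lambda>r s. mat_unit n r s $$ (i, j)) = (\<Sum>r<n. \<Sum>s<n. if s = j then (if r = i then M $$ (i, j) else 0) else 0)"
      using ij by (intro sum.cong) (auto simp: mat_unit_def)
    then show ?thesis using ij by simp
  qed
  have 2: "(C M * A) $$ (i, j) = ?S (\<lambda>r s. (F r s * A) $$ (i, j))"
  proof -
    have "(C M * A) $$ (i, j) = (\<Sum>k<n. \<Sum>r<n. \<Sum>s<n. M $$ (r, s) * (F r s $$ (i, k) * A $$ (k, j)))"
      unfolding index_mult_mat_sum[OF C_closed A ij(1,2)] using ij
      by (intro sum.cong) (auto simp: C_of_def sum_distrib_right mult.assoc)
    also have "\<dots> = (\<Sum>r<n. \<Sum>k<n. \<Sum>s<n. M $$ (r, s) * (F r s $$ (i, k) * A $$ (k, j)))"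
      by (rule sum.swap)
    also have "\<dots> = (\<Sum>r<n. \<Sum>s<n. \<Sum>k<n. M $$ (r, s) * (F r s $$ (i, k) * A $$ (k, j)))"
      by (intro sum.cong refl sum.swap)
    also have "\<dots> = ?S (\<lambda>r s. (F r s * A) $$ (i, j))"
      using ij by (intro sum.cong refl)
        (simp add: index_mult_mat_sum[OF F A] sum_distrib_left del: index_mult_mat(1))
    finally show ?thesis .
  qed
  have 3: "(A * C M) $$ (i, j) = ?S (\<lambda>r s. (A * F r s) $$ (i, j))"
  proof -
    have "(A * C M) $$ (i, j) = (\<Sum>k<n. \<Sum>r<n. \<Sum>s<n. M $$ (r, s) * (A $$ (i, k) * F r s $$ (k, j)))"
      unfolding index_mult_mat_sum[OF A C_closed ij(1,2)] using ij
      by (intro sum.cong) (auto simp: C_of_def sum_distrib_left mult_ac)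
    also have "\<dots> = (\<Sum>r<n. \<Sum>k<n. \<Sum>s<n. M $$ (r, s) * (A $$ (i, k) * F r s $$ (k, j)))"
      by (rule sum.swap)
    also have "\<dots> = (\<Sum>r<n. \<Sum>s<n. \<Sum>k<n. M $$ (r, s) * (A $$ (i, k) * F r s $$ (k, j)))"
      by (intro sum.cong refl sum.swap)
    also have "\<dots> = ?S (\<lambda>r s. (A * F r s) $$ (i, j))"
      using ij by (intro sum.cong refl)
        (simp add: index_mult_mat_sum[OF A F] sum_distrib_left del: index_mult_mat(1))
    finally show ?thesis .
  qed
  have "mat_unit n r s $$ (i, j) + (F r s * A) $$ (i, j) - (A * F r s) $$ (i, j) = 0" if "r < n" "s < n" for r s
  proof -
    have c: "F r s * A \<in> carrier_mat n n" "A * F r s \<in> carrier_mat n n"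
      by (rule mult_carrier_mat[OF F[OF that] A], rule mult_carrier_mat[OF A F[OF that]])
    have "(U + V - W) $$ (i, j) = U $$ (i, j) + V $$ (i, j) - W $$ (i, j)"
      if "V \<in> carrier_mat n n" "W \<in> carrier_mat n n" for U V W :: "'a mat"
      using that ij by simp
    from this[OF c, of "mat_unit n r s"] show ?thesis
      using F_form[OF that] ij by (auto simp: form_space_def)
  qed
  then have "0 = ?S (\<lambda>r s. mat_unit n r s $$ (i, j) + (F r s * A) $$ (i, j) - (A * F r s) $$ (i, j))"
    by simp
  also have "\<dots> = M $$ (i, j) + (C M * A) $$ (i, j) - (A * C M) $$ (i, j)"
    unfolding 1 2 3 by (simp add: sum.distrib sum_subtractf distrib_left right_diff_distrib
        del: index_mult_mat(1))
  finally show ?thesis by simp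
qed

text \<open>
  Multiplying out \<open>(I - C)(A + M') = (A + M)(I - C)\<close> eliminates the inverse matrix, at the price that
  \<open>M'\<close> also occurs on the right.
\<close>
lemma step_identity:
  assumes M: "M \<in> carrier_mat n n" and small: "nrm (C M) < 1"
  shows "step M \<in> carrier_mat n n"
    and "step M = M + (C M * A - A * C M) + (C M * step M - M * C M)"
    and "(1\<^sub>m n - C M) * (A + step M) = (A + M) * (1\<^sub>m n - C M)"
proof -
  note inv = mat_inv_near_one[OF C_closed small]
  let ?B = "1\<^sub>m n - C M"
  have B: "?B \<in> carrier_mat n n" by (rule minus_carrier_mat[OF C_closed])
  have AM: "A + M \<in> carrier_mat n n" using M by simp
  have Z: "mat_inv ?B * (A + M) * ?B \<in> carrier_mat n n" using inv(1) AM B by auto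
  show s: "step M \<in> carrier_mat n n" unfolding step_def by (rule minus_carrier_mat[OF A])
  have "A + step M = mat_inv ?B * (A + M) * ?B"
    unfolding step_def using Z carrier_matD[OF A] carrier_matD[OF Z] by (intro eq_matI) auto
  then have "?B * (A + step M) = ?B * (mat_inv ?B * ((A + M) * ?B))"
    using assoc_mult_mat[OF inv(1) AM B] by simp
  also have "\<dots> = ?B * mat_inv ?B * ((A + M) * ?B)"
    by (rule assoc_mult_mat[symmetric, OF B inv(1) mult_carrier_mat[OF AM B]])
  also have "\<dots> = (A + M) * ?B"
    unfolding inv(2) by (rule left_mult_one_mat[OF mult_carrier_mat[OF AM B]])
  finally show conj: "?B * (A + step M) = (A + M) * ?B" .
  have As: "A + step M \<in> carrier_mat n n" using s by simp
  have "?B * (A + step M) = 1\<^sub>m n * (A + step M) - C M * (A + step M)"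
    by (rule minus_mult_distrib_mat[OF one_carrier_mat C_closed As])
  also have "1\<^sub>m n * (A + step M) = A + step M" by (rule left_mult_one_mat[OF As])
  also have "C M * (A + step M) = C M * A + C M * step M"
    by (rule mult_add_distrib_mat[OF C_closed A s])
  finally have L: "?B * (A + step M) = (A + step M) - (C M * A + C M * step M)" .
  have "(A + M) * ?B = (A + M) * 1\<^sub>m n - (A + M) * C M"
    by (rule mult_minus_distrib_mat[OF AM one_carrier_mat C_closed])
  also have "(A + M) * 1\<^sub>m n = A + M" by (rule right_mult_one_mat[OF AM])
  also have "(A + M) * C M = A * C M + M * C M"
    by (rule add_mult_distrib_mat[OF A M C_closed])
  finally have R: "(A + M) * ?B = (A + M) - (A * C M + M * C M)" .
  have alg: "X = M + (U - V) + (W - Y)"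
    if "(A + X) - (U + W) = (A + M) - (V + Y)" "X \<in> carrier_mat n n" "U \<in> carrier_mat n n"
      "V \<in> carrier_mat n n" "W \<in> carrier_mat n n" "Y \<in> carrier_mat n n" for X U V W Y :: "'a mat"
  proof (rule eq_matI)
    fix i j assume "i < dim_row (M + (U - V) + (W - Y))" "j < dim_col (M + (U - V) + (W - Y))"
    then have ij: "i < n" "j < n" using that by auto
    have "((A + X) - (U + W)) $$ (i, j) = ((A + M) - (V + Y)) $$ (i, j)" using that(1) by simp
    then have "A $$ (i, j) + X $$ (i, j) - (U $$ (i, j) + W $$ (i, j)) = A $$ (i, j) + M $$ (i, j) - (V $$ (i, j) + Y $$ (i, j))"
      using that(2-) M ij by simp
    then show "X $$ (i, j) = (M + (U - V) + (W - Y)) $$ (i, j)"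
      using that(2-) M ij by (simp add: algebra_simps)
  qed (use that M in auto)
  show "step M = M + (C M * A - A * C M) + (C M * step M - M * C M)"
    by (rule alg[OF conj[unfolded L R] s mult_carrier_mat[OF C_closed A] mult_carrier_mat[OF A C_closed]
          mult_carrier_mat[OF C_closed s] mult_carrier_mat[OF M C_closed]])
qed

lemma nonstar_step:
  assumes M: "M \<in> carrier_mat n n" and small: "nrm (C M) < 1"
  shows "nonstar (step M) = nonstar (C M * step M - M * C M)"
proof (rule eq_matI)
  note id = step_identity[OF M small]
  have cm: "C M * A \<in> carrier_mat n n" "A * C M \<in> carrier_mat n n" "C M * step M - M * C M \<in> carrier_mat n n"
    using mult_carrier_mat[OF C_closed A] mult_carrier_mat[OF A C_closed] mult_carrier_mat[OF M C_closed]
    by (blast intro: minus_carrier_mat)+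
  fix i j assume "i < dim_row (nonstar (C M * step M - M * C M))" "j < dim_col (nonstar (C M * step M - M * C M))"
  then have ij: "i < n" "j < n" by (auto simp: nonstar_def)
  have "(M + (X - Y) + Z) $$ (i, j) = (M $$ (i, j) + X $$ (i, j) - Y $$ (i, j)) + Z $$ (i, j)"
    if "X \<in> carrier_mat n n" "Y \<in> carrier_mat n n" "Z \<in> carrier_mat n n" for X Y Z
    using that M ij by simp
  from this[OF cm] have "D $$ (i, j) = Nul \<Longrightarrow> step M $$ (i, j) = (C M * step M - M * C M) $$ (i, j)"
    using linear_part_nonstar[OF M ij] by (subst id(2)) simp
  then show "nonstar (step M) $$ (i, j) = nonstar (C M * step M - M * C M) $$ (i, j)"
    using ij by (simp add: nonstar_def)
qed (auto simp: nonstar_def)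

lemma step_bounds:
  assumes M: "M \<in> carrier_mat n n" and c: "nrm (C M) \<le> c" "c < 1"
  shows "(1 - c) * nrm (step M) \<le> nrm M * (1 + c) + 2 * a * c"
    and "nrm (nonstar (step M)) \<le> c * (nrm M + nrm (step M))"
    and "nrm (step M - M) \<le> 2 * a * c + c * (nrm M + nrm (step M))"
proof -
  have small: "nrm (C M) < 1" using c by simp
  note id = step_identity[OF M small]
  have cm: "C M * A \<in> carrier_mat n n" "A * C M \<in> carrier_mat n n" "C M * step M \<in> carrier_mat n n"
    "M * C M \<in> carrier_mat n n" "C M * A - A * C M \<in> carrier_mat n n" "C M * step M - M * C M \<in> carrier_mat n n"
    using mult_carrier_mat[OF C_closed A] mult_carrier_mat[OF A C_closed]
      mult_carrier_mat[OF C_closed id(1)] mult_carrier_mat[OF M C_closed]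
    by (blast intro: minus_carrier_mat)+
  have mono: "nrm (C M) * x \<le> c * x" if "0 \<le> x" for x using c that by (intro mult_right_mono)
  have lin: "nrm (C M * A - A * C M) \<le> 2 * a * c"
    using nrm_minus[OF cm(1,2)] nrm_mult[OF C_closed A, of M] nrm_mult[OF A C_closed, of M] mono[of a]
    by (simp add: mult_ac)
  have quad: "nrm (C M * step M - M * C M) \<le> c * (nrm M + nrm (step M))"
    using nrm_minus[OF cm(3,4)] nrm_mult[OF C_closed id(1), of M] nrm_mult[OF M C_closed, of M]
      mono[of "nrm M"] mono[of "nrm (step M)"]
    by (simp add: algebra_simps)
  have "step M - M = (C M * A - A * C M) + (C M * step M - M * C M)"
  proof -
    have "(M + X + Y) - M = X + Y" if "X \<in> carrier_mat n n" "Y \<in> carrier_mat n n" for X Y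
      using that M by (intro eq_matI) auto
    then show ?thesis using cm(5,6) by (subst id(2)) simp
  qed
  then show diff: "nrm (step M - M) \<le> 2 * a * c + c * (nrm M + nrm (step M))"
    using nrm_add[OF cm(5,6)] lin quad by simp
  have "nrm (step M) \<le> nrm (step M - M) + nrm M"
  proof -
    have "step M = (step M - M) + M" using M id(1) by (intro eq_matI) auto
    then show ?thesis using nrm_add[OF minus_carrier_mat[OF M] M] by metis
  qed
  then show "(1 - c) * nrm (step M) \<le> nrm M * (1 + c) + 2 * a * c"
    using diff by (simp add: algebra_simps)
  show "nrm (nonstar (step M)) \<le> c * (nrm M + nrm (step M))"
    using nrm_nonstar[OF cm(6)] quad nonstar_step[OF M small] by simp
qed

lemma Ms_Suc: "Ms X (Suc k) = step (Ms X k)"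
  by (simp add: step_def)

lemma Cs_closed [simp]: "Cs X k \<in> carrier_mat n n"
  by (simp add: C_seq_def)

lemma Ps_closed [simp]: "Ps X k \<in> carrier_mat n n"
  by (induction k) (auto intro!: mult_carrier_mat minus_carrier_mat)

subsection \<open>Convergence\<close>

context
  fixes \<epsilon> :: real
  assumes eps: "0 < \<epsilon>" "\<epsilon> \<le> 1/2"
begin

abbreviation b where "b \<equiv> \<epsilon> / (4 * f)"

lemma b_pos: "0 < b" using eps f_pos by simp

lemma iteration_bounds:
  assumes X: "X \<in> nbhd av n A F (2 * \<epsilon>)"
  shows "Ms X k \<in> carrier_mat n n" "nrm (Ms X k) \<le> b"
    "f * nrm (nonstar (Ms X k)) \<le> \<epsilon> / 8 * (\<epsilon> / 2) ^ k"
    "nrm (Cs X k) \<le> \<epsilon> / 8 * (\<epsilon> / 2) ^ k"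
proof -
  have "Ms X k \<in> carrier_mat n n \<and> nrm (Ms X k) + 8/3 * (a + b) * (f * nrm (nonstar (Ms X k))) \<le> b
    \<and> f * nrm (nonstar (Ms X k)) \<le> \<epsilon> / 8 * (\<epsilon> / 2) ^ k"
  proof (induction k)
    case 0
    have Xc: "X \<in> carrier_mat n n" and Xn: "nrm X \<le> 2 * \<epsilon> / (48 * sqrt (real n) * (a + 1) * f\<^sup>2)"
      using X by (auto simp: nbhd_def)
    have s: "1 \<le> sqrt (real n)" using n_pos by simp
    note start = reduction_start_bound[OF nrm_nonneg f_pos(2) eps refl s Xn nrm_nonneg]
    have fm: "f * nrm (nonstar X) \<le> f * nrm X"
      by (rule mult_left_mono[OF nrm_nonstar[OF Xc] less_imp_le[OF f_pos(1)]])
    have "8/3 * (a + b) * (f * nrm (nonstar X)) \<le> 8/3 * (a + b) * (f * nrm X)"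
      by (rule mult_left_mono[OF fm]) (use b_pos nrm_nonneg[of A] in auto)
    then have "nrm X + 8/3 * (a + b) * (f * nrm (nonstar X)) \<le> b" using start(1) by linarith
    moreover have "f * nrm (nonstar X) \<le> \<epsilon> / 8" using start(2) fm by linarith
    ultimately show ?case using Xc by simp
  next
    case (Suc k)
    let ?M = "Ms X k"
    define c where "c = f * nrm (nonstar ?M)"
    have M: "?M \<in> carrier_mat n n" and inv: "nrm ?M + 8/3 * (a + b) * c \<le> b"
      and ck: "c \<le> \<epsilon> / 8 * (\<epsilon> / 2) ^ k"
      using Suc by (auto simp: c_def)
    have c0: "0 \<le> c" using f_pos by (simp add: c_def)
    have "(\<epsilon> / 2) ^ k \<le> 1" using eps by (intro power_le_one) auto
    then have c8: "c \<le> \<epsilon> / 8" using ck eps mult_left_le[of "(\<epsilon> / 2) ^ k" "\<epsilon> / 8"] by linarith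
    then have c1: "c < 1" using eps by simp
    have Cc: "nrm (C ?M) \<le> c" using nrm_C[OF M] by (simp add: c_def)
    note sb = step_bounds[OF M Cc c1]
    have "f * nrm (nonstar (step ?M)) \<le> f * (c * (nrm ?M + nrm (step ?M)))"
      using sb(2) f_pos by (intro mult_left_mono) auto
    note bound = reduction_step_bound[OF nrm_nonneg f_pos(1) eps refl nrm_nonneg c0 c8 inv sb(1) this]
    have "c * (\<epsilon> / 2) \<le> \<epsilon> / 8 * (\<epsilon> / 2) ^ Suc k"
    proof -
      have "\<epsilon> / 8 * (\<epsilon> / 2) ^ Suc k = \<epsilon> / 8 * (\<epsilon> / 2) ^ k * (\<epsilon> / 2)" by simp
      then show ?thesis using mult_right_mono[OF ck, of "\<epsilon> / 2"] eps by linarith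
    qed
    then have "f * nrm (nonstar (step ?M)) \<le> \<epsilon> / 8 * (\<epsilon> / 2) ^ Suc k" using bound(2) by linarith
    moreover have "step ?M \<in> carrier_mat n n" using step_identity(1)[OF M] Cc c1 by linarith
    ultimately show ?case unfolding Ms_Suc using bound(1) by blast
  qed
  then have all: "Ms X k \<in> carrier_mat n n" "nrm (Ms X k) + 8/3 * (a + b) * (f * nrm (nonstar (Ms X k))) \<le> b"
    "f * nrm (nonstar (Ms X k)) \<le> \<epsilon> / 8 * (\<epsilon> / 2) ^ k" by blast+
  then show "Ms X k \<in> carrier_mat n n" "f * nrm (nonstar (Ms X k)) \<le> \<epsilon> / 8 * (\<epsilon> / 2) ^ k" by blast+
  have "0 \<le> 8/3 * (a + b) * (f * nrm (nonstar (Ms X k)))"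
    using b_pos f_pos nrm_nonneg[of A] by (intro mult_nonneg_nonneg) auto
  then show "nrm (Ms X k) \<le> b" using all(2) by linarith
  show "nrm (Cs X k) \<le> \<epsilon> / 8 * (\<epsilon> / 2) ^ k"
    using nrm_C[OF all(1)] all(3) by (simp add: C_seq_def)
qed

lemma Cs_small:
  assumes X: "X \<in> nbhd av n A F (2 * \<epsilon>)"
  shows "nrm (Cs X k) < 1" "nrm (Cs X k) \<le> 1/16 * (1/4) ^ k" "nrm (Cs X k) \<le> \<epsilon> ^ Suc k / 2"
proof -
  note C = iteration_bounds(4)[OF X, of k]
  have "\<epsilon> / 8 * (\<epsilon> / 2) ^ k \<le> 1/16 * (1/4) ^ k"
    using eps by (intro mult_mono power_mono) auto
  then show le: "nrm (Cs X k) \<le> 1/16 * (1/4) ^ k" using C by linarith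
  have "(1/4 :: real) ^ k \<le> 1" by (intro power_le_one) auto
  then show "nrm (Cs X k) < 1" using le by linarith
  have "(\<epsilon> / 2) ^ k \<le> \<epsilon> ^ k" using eps by (intro power_mono) auto
  then have "\<epsilon> / 8 * (\<epsilon> / 2) ^ k \<le> \<epsilon> / 8 * \<epsilon> ^ k" using eps by (intro mult_left_mono) auto
  also have "\<dots> \<le> \<epsilon> / 2 * \<epsilon> ^ k" using eps by (intro mult_right_mono) auto
  also have "\<dots> = \<epsilon> ^ Suc k / 2" by simp
  finally show "nrm (Cs X k) \<le> \<epsilon> ^ Suc k / 2" using C by linarith
qed

lemma Ms_step_bound:
  assumes X: "X \<in> nbhd av n A F (2 * \<epsilon>)"
  shows "nrm (Ms X (Suc k) - Ms X k) \<le> (2 * a + 2 * b) / 16 * (1/4) ^ k"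
proof -
  have c: "nrm (C (Ms X k)) \<le> 1/16 * (1/4) ^ k" using Cs_small(2)[OF X, of k] by (simp add: C_seq_def)
  have "(1/4 :: real) ^ k \<le> 1" by (intro power_le_one) auto
  then have c1: "1/16 * (1/4 :: real) ^ k < 1" by linarith
  let ?c = "1/16 * (1/4 :: real) ^ k"
  have "nrm (step (Ms X k) - Ms X k) \<le> 2 * a * ?c + ?c * (nrm (Ms X k) + nrm (step (Ms X k)))"
    by (rule step_bounds(3)[OF iteration_bounds(1)[OF X] c c1])
  also have "\<dots> \<le> 2 * a * ?c + ?c * (b + b)"
    using iteration_bounds(2)[OF X, of k] iteration_bounds(2)[OF X, of "Suc k"]
    unfolding Ms_Suc by (intro add_left_mono mult_left_mono add_mono) auto
  also have "\<dots> = (2 * a + 2 * b) / 16 * (1/4) ^ k" by (simp add: algebra_simps)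
  finally show ?thesis unfolding Ms_Suc .
qed

lemma Ps_Suc_diff: "Ps X (Suc k) - Ps X k = - (Ps X k * Cs X k)"
proof -
  have "Ps X k * (1\<^sub>m n - Cs X k) = Ps X k - Ps X k * Cs X k"
    using mult_minus_distrib_mat[OF Ps_closed one_carrier_mat Cs_closed, of X k X k]
      right_mult_one_mat[OF Ps_closed] by simp
  moreover have "(U - V) - U = - V" if "U \<in> carrier_mat n n" "V \<in> carrier_mat n n" for U V :: "'a mat"
    using that by (intro eq_matI) auto
  ultimately show ?thesis using mult_carrier_mat[OF Ps_closed Cs_closed] by simp
qed

lemma Ps_diff_one:
  assumes c: "nrm (Cs X k) \<le> c"
  shows "nrm (Ps X (Suc k) - 1\<^sub>m n) \<le> nrm (Ps X k - 1\<^sub>m n) * (1 + c) + c"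
proof -
  let ?P = "Ps X k - 1\<^sub>m n"
  have P: "?P \<in> carrier_mat n n" by (rule minus_carrier_mat) simp
  have PC: "?P * Cs X k \<in> carrier_mat n n" by (rule mult_carrier_mat[OF P Cs_closed])
  have "Ps X k * Cs X k = ?P * Cs X k + Cs X k"
  proof -
    have "Ps X k = ?P + 1\<^sub>m n" using carrier_matD[OF Ps_closed[of X k]] by (intro eq_matI) auto
    then have "Ps X k * Cs X k = (?P + 1\<^sub>m n) * Cs X k" by simp
    also have "\<dots> = ?P * Cs X k + 1\<^sub>m n * Cs X k"
      by (rule add_mult_distrib_mat[OF P one_carrier_mat Cs_closed])
    also have "1\<^sub>m n * Cs X k = Cs X k" by (rule left_mult_one_mat[OF Cs_closed])
    finally show ?thesis .
  qed
  moreover have "Ps X (Suc k) = Ps X k - Ps X k * Cs X k"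
    using mult_minus_distrib_mat[OF Ps_closed one_carrier_mat Cs_closed, of X k X k]
      right_mult_one_mat[OF Ps_closed] by simp
  moreover have "U - (V + W) - 1\<^sub>m n = ((U - 1\<^sub>m n) - V) - W"
    if "U \<in> carrier_mat n n" "V \<in> carrier_mat n n" "W \<in> carrier_mat n n" for U V W :: "'a mat"
    using that by (intro eq_matI) auto
  ultimately have e: "Ps X (Suc k) - 1\<^sub>m n = (?P - ?P * Cs X k) - Cs X k"
    using PC by simp
  have "nrm (Ps X (Suc k) - 1\<^sub>m n) \<le> nrm ?P + nrm ?P * nrm (Cs X k) + nrm (Cs X k)"
    unfolding e using nrm_minus[OF minus_carrier_mat[OF PC] Cs_closed] nrm_minus[OF P PC] nrm_mult[OF P Cs_closed]
    by (smt (verit))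
  also have "\<dots> \<le> nrm ?P + nrm ?P * c + c" using c by (intro add_mono mult_left_mono) auto
  finally show ?thesis by (simp add: algebra_simps)
qed

text \<open>
  From \<open>\<parallel>C\<^sub>j\<parallel> \<le> \<epsilon>\<^sup>j\<close> one would get the bound \<open>\<Prod>(1 + \<epsilon>\<^sup>j) - 1\<close>. As \<open>\<parallel>C\<^sub>j\<parallel>\<close> is even at most \<open>\<epsilon>\<^sup>j/2\<close>, half of
  it suffices, which leaves room for a strict inequality in the limit.
\<close>
lemma Ps_near_one:
  assumes X: "X \<in> nbhd av n A F (2 * \<epsilon>)"
  shows "nrm (Ps X k - 1\<^sub>m n) \<le> 1/2" "nrm (Ps X k - 1\<^sub>m n) \<le> ((\<Prod>j<k. 1 + \<epsilon> ^ Suc j) - 1) / 2"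
proof -
  have z: "Ps X 0 - 1\<^sub>m n = 0\<^sub>m n n" by (intro eq_matI) auto
  have "nrm (Ps X k - 1\<^sub>m n) \<le> 1/2 * (1 - (1/2) ^ k)"
  proof (induction k)
    case 0
    show ?case unfolding z by simp
  next
    case (Suc k)
    let ?c = "1/16 * (1/4 :: real) ^ k" and ?x = "nrm (Ps X k - 1\<^sub>m n)"
    have x: "?x \<le> 1/2" using Suc by (rule order_trans) simp
    have "nrm (Ps X (Suc k) - 1\<^sub>m n) \<le> ?x * (1 + ?c) + ?c"
      by (rule Ps_diff_one[OF Cs_small(2)[OF X]])
    also have "\<dots> = ?x + ?x * ?c + ?c" by (simp add: algebra_simps)
    also have "\<dots> \<le> ?x + 1/2 * ?c + ?c" using x by (intro add_mono mult_right_mono) auto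
    also have "\<dots> \<le> 1/2 * (1 - (1/2) ^ k) + 3/32 * (1/4) ^ k" using Suc by simp
    also have "\<dots> \<le> 1/2 * (1 - (1/2 :: real) ^ Suc k)"
    proof -
      have "(1/4 :: real) ^ k \<le> (1/2) ^ k" "0 \<le> (1/2 :: real) ^ k" by (auto intro: power_mono)
      moreover have "3/32 * y \<le> 1/4 * x" if "y \<le> x" "0 \<le> x" for x y :: real using that by simp
      ultimately have "3/32 * (1/4) ^ k \<le> 1/4 * (1/2 :: real) ^ k" by blast
      then show ?thesis by (simp add: algebra_simps)
    qed
    finally show ?case .
  qed
  also have "\<dots> \<le> 1/2" by simp
  finally show "nrm (Ps X k - 1\<^sub>m n) \<le> 1/2" .
  show "nrm (Ps X k - 1\<^sub>m n) \<le> ((\<Prod>j<k. 1 + \<epsilon> ^ Suc j) - 1) / 2"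
  proof (induction k)
    case 0
    show ?case unfolding z by simp
  next
    case (Suc k)
    let ?h = "(\<Prod>j<k. 1 + \<epsilon> ^ Suc j) - 1" and ?e = "\<epsilon> ^ Suc k"
    have e: "0 \<le> ?e" using eps by simp
    have "nrm (Ps X (Suc k) - 1\<^sub>m n) \<le> nrm (Ps X k - 1\<^sub>m n) * (1 + ?e / 2) + ?e / 2"
      by (rule Ps_diff_one[OF Cs_small(3)[OF X]])
    also have "\<dots> \<le> nrm (Ps X k - 1\<^sub>m n) * (1 + ?e) + ?e / 2"
      using e by (intro add_right_mono mult_left_mono) auto
    also have "\<dots> \<le> ?h / 2 * (1 + ?e) + ?e / 2"
      using Suc e by (intro add_right_mono mult_right_mono) auto
    also have "\<dots> = ((\<Prod>j<Suc k. 1 + \<epsilon> ^ Suc j) - 1) / 2"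
      by (simp add: field_simps)
    finally show ?case .
  qed
qed

lemma Ps_bounded:
  assumes X: "X \<in> nbhd av n A F (2 * \<epsilon>)"
  shows "nrm (Ps X k) \<le> sqrt (real n) + 1"
proof -
  have "Ps X k = (Ps X k - 1\<^sub>m n) + 1\<^sub>m n" using carrier_matD[OF Ps_closed[of X k]] by (intro eq_matI) auto
  then have "nrm (Ps X k) \<le> nrm (Ps X k - 1\<^sub>m n) + nrm (1\<^sub>m n)"
    using nrm_add[OF minus_carrier_mat[OF one_carrier_mat] one_carrier_mat] by metis
  then show ?thesis using Ps_near_one(1)[OF X, of k] by (simp add: nrm_one)
qed

lemma Ps_step_bound:
  assumes X: "X \<in> nbhd av n A F (2 * \<epsilon>)"
  shows "nrm (Ps X (Suc k) - Ps X k) \<le> (sqrt (real n) + 1) / 16 * (1/4) ^ k"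
proof -
  have "nrm (Ps X (Suc k) - Ps X k) = nrm (Ps X k * Cs X k)"
    unfolding Ps_Suc_diff by (rule nrm_uminus[OF mult_carrier_mat[OF Ps_closed Cs_closed]])
  also have "\<dots> \<le> nrm (Ps X k) * nrm (Cs X k)" by (rule nrm_mult[OF Ps_closed Cs_closed])
  also have "\<dots> \<le> (sqrt (real n) + 1) * (1/16 * (1/4) ^ k)"
    using Ps_bounded[OF X] Cs_small(2)[OF X] by (intro mult_mono) auto
  finally show ?thesis by simp
qed

lemma conjugation:
  assumes X: "X \<in> nbhd av n A F (2 * \<epsilon>)"
  shows "(A + X) * Ps X k = Ps X k * (A + Ms X k)"
proof (induction k)
  case 0
  have AX: "A + X \<in> carrier_mat n n" using iteration_bounds(1)[OF X, of 0] by simp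
  show ?case using left_mult_one_mat[OF AX] right_mult_one_mat[OF AX] by simp
next
  case (Suc k)
  let ?B = "1\<^sub>m n - C (Ms X k)"
  have M: "Ms X k \<in> carrier_mat n n" "Ms X (Suc k) \<in> carrier_mat n n" by (rule iteration_bounds(1)[OF X])+
  have c: "A + X \<in> carrier_mat n n" "?B \<in> carrier_mat n n" "A + Ms X k \<in> carrier_mat n n"
    "A + Ms X (Suc k) \<in> carrier_mat n n"
    using iteration_bounds(1)[OF X, of 0] M minus_carrier_mat[OF C_closed] by (simp_all del: M_seq.simps(2))
  have "?B * (A + Ms X (Suc k)) = (A + Ms X k) * ?B"
    unfolding Ms_Suc using step_identity(3)[OF M(1)] Cs_small(1)[OF X, of k] by (simp add: C_seq_def)
  moreover have "Ps X (Suc k) = Ps X k * ?B" by (simp add: C_seq_def)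
  ultimately show ?case
    using Suc assoc_mult_mat[OF c(1) Ps_closed c(2)] assoc_mult_mat[OF Ps_closed c(3) c(2)]
      assoc_mult_mat[OF Ps_closed c(2) c(4)] by metis
qed

lemma S_map_limit:
  assumes X: "X \<in> nbhd av n A F (2 * \<epsilon>)"
  shows "S_map av n A F X \<in> carrier_mat n n" "mat_tendsto av (Ps X) (S_map av n A F X)"
    "nrm (S_map av n A F X - Ps X k) \<le> (sqrt (real n) + 1) / 16 * (1/4) ^ k / (1 - 1/4)"
proof -
  obtain L where L: "L \<in> carrier_mat n n" "mat_tendsto av (Ps X) L"
    "\<And>k. nrm (L - Ps X k) \<le> (sqrt (real n) + 1) / 16 * (1/4) ^ k / (1 - 1/4)"
    by (rule geometric_limit[OF Ps_closed _ _ Ps_step_bound[OF X]]) auto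
  have "S_map av n A F X = L"
    unfolding S_map_def using L mat_tendsto_unique[OF Ps_closed] by (intro the_equality) auto
  then show "S_map av n A F X \<in> carrier_mat n n" "mat_tendsto av (Ps X) (S_map av n A F X)"
    "nrm (S_map av n A F X - Ps X k) \<le> (sqrt (real n) + 1) / 16 * (1/4) ^ k / (1 - 1/4)"
    using L by auto
qed

lemma limit_norm_le:
  assumes P: "\<And>k. P k \<in> carrier_mat r c" "L \<in> carrier_mat r c" "mat_tendsto av P L"
    and N: "N \<in> carrier_mat r c" and bd: "\<And>k. nrm (P k - N) \<le> K"
  shows "nrm (L - N) \<le> K"
proof (rule LIMSEQ_le_const)
  show "(\<lambda>k. nrm (P k - L) + K) \<longlonglongrightarrow> K"
    using tendsto_add[OF P(3)[unfolded mat_tendsto_def] tendsto_const, of K] by simp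
  have "nrm (L - N) \<le> nrm (P k - L) + K" for k
    using nrm_triangle[OF P(2) P(1)[of k] N] nrm_minus_commute[OF P(2) P(1)[of k]] bd[of k] by linarith
  then show "\<exists>N'. \<forall>k\<ge>N'. nrm (L - N) \<le> nrm (P k - L) + K" by blast
qed

lemma S_map_bounds:
  assumes X: "X \<in> nbhd av n A F (2 * \<epsilon>)"
  shows "nrm (S_map av n A F X - 1\<^sub>m n) \<le> 1/2"
    "nrm (S_map av n A F X - 1\<^sub>m n) < - 1 + prodinf (\<lambda>k. 1 + \<epsilon> ^ Suc k)"
proof -
  note S = S_map_limit[OF X]
  show "nrm (S_map av n A F X - 1\<^sub>m n) \<le> 1/2"
    by (rule limit_norm_le[OF Ps_closed S(1,2) one_carrier_mat Ps_near_one(1)[OF X]])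
  let ?g = "\<lambda>k. 1 + \<epsilon> ^ Suc k" and ?H = "prodinf (\<lambda>k. 1 + \<epsilon> ^ Suc k)"
  have "summable (\<lambda>k. \<epsilon> ^ Suc k)" using eps by (subst summable_Suc_iff) (simp add: summable_geometric)
  then have conv: "convergent_prod ?g"
    using eps by (intro abs_convergent_prod_imp_convergent_prod summable_imp_abs_convergent_prod) simp
  have g1: "1 \<le> ?g k" for k using eps by simp
  have le: "(\<Prod>j<k. ?g j) \<le> ?H" for k
    using conv g1 by (intro prod_le_prodinf) (auto simp: convergent_prod_has_prod add_nonneg_nonneg eps)
  have "nrm (Ps X k - 1\<^sub>m n) \<le> (?H - 1) / 2" for k
  proof -
    have "((\<Prod>j<k. ?g j) - 1) / 2 \<le> (?H - 1) / 2"
      by (intro divide_right_mono diff_right_mono le) simp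
    then show ?thesis by (rule order_trans[OF Ps_near_one(2)[OF X]])
  qed
  then have "nrm (S_map av n A F X - 1\<^sub>m n) \<le> (?H - 1) / 2"
    by (rule limit_norm_le[OF Ps_closed S(1,2) one_carrier_mat])
  also have "(?H - 1) / 2 < - 1 + ?H"
  proof -
    have "1 < ?H" using le[of 1] eps by simp
    then show ?thesis by (simp add: field_simps)
  qed
  finally show "nrm (S_map av n A F X - 1\<^sub>m n) < - 1 + ?H" .
qed

lemma S_map_invertible:
  assumes X: "X \<in> nbhd av n A F (2 * \<epsilon>)"
  defines "S \<equiv> S_map av n A F X"
  shows "invertible_mat S" "mat_inv S \<in> carrier_mat n n" "mat_inv S * S = 1\<^sub>m n"
proof -
  have S: "S \<in> carrier_mat n n" unfolding S_def by (rule S_map_limit(1)[OF X])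
  have c: "1\<^sub>m n - S \<in> carrier_mat n n" by (rule minus_carrier_mat[OF S])
  have e: "1\<^sub>m n - (1\<^sub>m n - S) = S" using S by (intro eq_matI) auto
  have "nrm (1\<^sub>m n - S) < 1"
    using S_map_bounds(1)[OF X] nrm_minus_commute[OF S one_carrier_mat] unfolding S_def by simp
  from mat_inv_near_one[OF c this] show "invertible_mat S" "mat_inv S \<in> carrier_mat n n" "mat_inv S * S = 1\<^sub>m n"
    unfolding e by auto
qed

text \<open>Passing to the limit in \<open>(A + X) P\<^sub>k = P\<^sub>k (A + M\<^sub>k)\<close> identifies \<open>D(X)\<close> as the limit of the \<open>M\<^sub>k\<close>.\<close>
lemma D_map_limit:
  assumes X: "X \<in> nbhd av n A F (2 * \<epsilon>)"
  shows "D_map av n A F X \<in> carrier_mat n n" "mat_tendsto av (Ms X) (D_map av n A F X)"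
    "nrm (D_map av n A F X - Ms X k) \<le> (2 * a + 2 * b) / 16 * (1/4) ^ k / (1 - 1/4)"
proof -
  let ?S = "S_map av n A F X"
  have M: "Ms X k \<in> carrier_mat n n" for k by (rule iteration_bounds(1)[OF X])
  obtain L where L: "L \<in> carrier_mat n n" "mat_tendsto av (Ms X) L"
    "\<And>k. nrm (L - Ms X k) \<le> (2 * a + 2 * b) / 16 * (1/4) ^ k / (1 - 1/4)"
    by (rule geometric_limit[OF M _ _ Ms_step_bound[OF X]]) auto
  note S = S_map_limit(1,2)[OF X] and inv = S_map_invertible[OF X]
  have AX: "A + X \<in> carrier_mat n n" using M[of 0] by simp
  have AL: "A + L \<in> carrier_mat n n" using L by simp
  have "mat_tendsto av (\<lambda>k. (A + X) * Ps X k) ((A + X) * ?S)"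
    by (rule mat_tendsto_mult[OF AX AX mat_tendsto_const[OF AX] Ps_closed S])
  moreover have "mat_tendsto av (\<lambda>k. Ps X k * (A + Ms X k)) (?S * (A + L))"
    by (rule mat_tendsto_mult[OF Ps_closed S _ AL mat_tendsto_const_add[OF M L(1,2) A]]) (simp add: M)
  ultimately have "(A + X) * ?S = ?S * (A + L)"
    unfolding conjugation[OF X]
    by (intro mat_tendsto_unique[OF mult_carrier_mat[OF Ps_closed add_carrier_mat[OF M]]
          mult_carrier_mat[OF AX S(1)] _ mult_carrier_mat[OF S(1) AL]])
  then have "mat_inv ?S * (A + X) * ?S = A + L"
    using assoc_mult_mat[OF inv(2) AX S(1)] assoc_mult_mat[OF inv(2) S(1) AL] inv(3)
      left_mult_one_mat[OF AL] by simp
  moreover have "A + L - A = L" using L(1) carrier_matD[OF A] by (intro eq_matI) auto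
  ultimately have "D_map av n A F X = L" by (simp add: D_map_def)
  then show "D_map av n A F X \<in> carrier_mat n n" "mat_tendsto av (Ms X) (D_map av n A F X)"
    "nrm (D_map av n A F X - Ms X k) \<le> (2 * a + 2 * b) / 16 * (1/4) ^ k / (1 - 1/4)"
    using L by auto
qed

lemma D_map_form:
  assumes X: "X \<in> nbhd av n A F (2 * \<epsilon>)"
  shows "D_map av n A F X \<in> form_space n D"
proof -
  let ?L = "D_map av n A F X"
  note L = D_map_limit(1,2)[OF X]
  have M: "Ms X k \<in> carrier_mat n n" for k by (rule iteration_bounds(1)[OF X])
  have "?L $$ (i, j) = 0" if ij: "i < n" "j < n" "D $$ (i, j) = Nul" for i j
  proof -
    have "av (?L $$ (i, j)) \<le> av (Ms X k $$ (i, j) - ?L $$ (i, j)) + 1 / f * (\<epsilon> / 8 * (\<epsilon> / 2) ^ k)" for k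
    proof -
      have "av (Ms X k $$ (i, j)) \<le> nrm (nonstar (Ms X k))"
        using av_le_nrm[OF nonstar_closed ij(1,2), of "Ms X k"] ij by (simp add: nonstar_def)
      also have "\<dots> = 1 / f * (f * nrm (nonstar (Ms X k)))" using f_pos by simp
      also have "\<dots> \<le> 1 / f * (\<epsilon> / 8 * (\<epsilon> / 2) ^ k)"
        using iteration_bounds(3)[OF X, of k] f_pos by (intro mult_left_mono) auto
      finally show ?thesis
        using av_diff[of "Ms X k $$ (i, j)" "Ms X k $$ (i, j) - ?L $$ (i, j)"] by simp
    qed
    moreover have "(\<lambda>k. av (Ms X k $$ (i, j) - ?L $$ (i, j)) + 1 / f * (\<epsilon> / 8 * (\<epsilon> / 2) ^ k)) \<longlonglongrightarrow> 0 + 1 / f * (\<epsilon> / 8 * 0)"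
      using eps by (intro tendsto_add tendsto_mult tendsto_const LIMSEQ_realpow_zero
          mat_tendsto_entry[OF M L ij(1,2)]) auto
    ultimately have "av (?L $$ (i, j)) \<le> 0 + 1 / f * (\<epsilon> / 8 * 0)"
      by (intro LIMSEQ_le_const) blast+
    then have "av (?L $$ (i, j)) = 0" using av_nonneg[of "?L $$ (i, j)"] by simp
    then show ?thesis by simp
  qed
  then show ?thesis using L by (auto simp: form_space_def)
qed

lemma D_map_bound:
  assumes X: "X \<in> nbhd av n A F (2 * \<epsilon>)"
  shows "nrm (D_map av n A F X) \<le> \<epsilon> / (2 * f)"
proof -
  have M: "Ms X k \<in> carrier_mat n n" for k by (rule iteration_bounds(1)[OF X])
  have z: "N - 0\<^sub>m n n = N" if "N \<in> carrier_mat n n" for N :: "'a mat" using that by (intro eq_matI) auto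
  have "nrm (Ms X k - 0\<^sub>m n n) \<le> b" for k unfolding z[OF M] by (rule iteration_bounds(2)[OF X])
  then have "nrm (D_map av n A F X - 0\<^sub>m n n) \<le> b"
    by (rule limit_norm_le[OF M D_map_limit(1,2)[OF X] zero_carrier_mat])
  then have "nrm (D_map av n A F X) \<le> b" unfolding z[OF D_map_limit(1)[OF X]] .
  also have "\<dots> \<le> \<epsilon> / (2 * f)" using eps f_pos by (simp add: field_simps)
  finally show ?thesis .
qed

end

subsection \<open>Continuity\<close>

abbreviation U where "U \<equiv> nbhd av n A F 1"

lemma U_bounds:
  assumes "X \<in> U"
  shows "Ms X k \<in> carrier_mat n n" "nrm (Ms X k) \<le> 1 / (8 * f)" "nrm (Cs X k) \<le> 1/16"
    "nrm (Ps X k) \<le> sqrt (real n) + 1"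
proof -
  have X: "X \<in> nbhd av n A F (2 * (1/2))" using assms by simp
  show "Ms X k \<in> carrier_mat n n" "nrm (Ms X k) \<le> 1 / (8 * f)" "nrm (Ps X k) \<le> sqrt (real n) + 1"
    using iteration_bounds(1,2)[OF _ _ X, of k] Ps_bounded[OF _ _ X, of k] by auto
  have "(1/4 :: real) ^ k \<le> 1" by (intro power_le_one) auto
  then show "nrm (Cs X k) \<le> 1/16" using Cs_small(2)[OF _ _ X, of k] by linarith
qed

text \<open>
  Let \<open>G = C M\<close>, \<open>H = C N\<close> and \<open>E = G - H\<close>. The difference of the step identities for \<open>M\<close> and \<open>N\<close> has
  the term \<open>G (M' - N')\<close> on the right, which \<open>\<parallel>G\<parallel> \<le> 1/16\<close> absorbs; all other terms contain \<open>M - N\<close>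
  or \<open>E\<close>, and \<open>\<parallel>E\<parallel> \<le> f \<parallel>M - N\<parallel>\<close>.
\<close>
lemma Ms_Lipschitz: "\<exists>K. \<forall>X\<in>U. \<forall>Y\<in>U. nrm (Ms Y k - Ms X k) \<le> K * nrm (Y - X)"
proof (induction k)
  case 0
  show ?case by (rule exI[of _ 1]) simp
next
  case (Suc k)
  then obtain K where K: "\<And>X Y. X \<in> U \<Longrightarrow> Y \<in> U \<Longrightarrow> nrm (Ms Y k - Ms X k) \<le> K * nrm (Y - X)"
    by blast
  let ?K = "2 * (1 + 2 * a * f + 2 * f * (1 / (8 * f)) + 1)"
  have "nrm (Ms Y (Suc k) - Ms X (Suc k)) \<le> ?K * K * nrm (Y - X)" if XY: "X \<in> U" "Y \<in> U" for X Y
  proof -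
    define M N M' N' where "M = Ms Y k" and "N = Ms X k" and "M' = step M" and "N' = step N"
    define G H E where "G = C M" and "H = C N" and "E = C M - C N"
    have c: "M \<in> carrier_mat n n" "N \<in> carrier_mat n n" "M' \<in> carrier_mat n n" "N' \<in> carrier_mat n n"
      using U_bounds(1)[OF XY(1), of k] U_bounds(1)[OF XY(2), of k]
        U_bounds(1)[OF XY(1), of "Suc k"] U_bounds(1)[OF XY(2), of "Suc k"]
      unfolding M_def N_def M'_def N'_def Ms_Suc by auto
    have small: "nrm G \<le> 1/16" "nrm H \<le> 1/16"
      using U_bounds(3)[OF XY(2), of k] U_bounds(3)[OF XY(1), of k]
      by (auto simp: G_def H_def M_def N_def C_seq_def)
    have bd: "nrm M \<le> 1 / (8 * f)" "nrm N' \<le> 1 / (8 * f)"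
      using U_bounds(2)[OF XY(2), of k] U_bounds(2)[OF XY(1), of "Suc k"]
      unfolding M_def N_def N'_def Ms_Suc by auto
    have cc: "G \<in> carrier_mat n n" "H \<in> carrier_mat n n" "E \<in> carrier_mat n n"
      by (auto simp: G_def H_def E_def intro: minus_carrier_mat)
    define d where "d = nrm (M - N)"
    have d0: "0 \<le> d" by (simp add: d_def)
    have Ed: "nrm E \<le> f * d"
      using nrm_C_le[OF minus_carrier_mat[OF c(2)], of M] C_diff[OF c(1,2)] by (simp add: E_def d_def)
    have G1: "nrm (C M) < 1" and H1: "nrm (C N) < 1" using small by (auto simp: G_def H_def)
    have MN: "M - N \<in> carrier_mat n n" by (rule minus_carrier_mat[OF c(2)])
    have MN': "M' - N' \<in> carrier_mat n n" by (rule minus_carrier_mat[OF c(4)])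
    have prods: "G * A \<in> carrier_mat n n" "A * G \<in> carrier_mat n n" "H * A \<in> carrier_mat n n" "A * H \<in> carrier_mat n n"
      "G * M' \<in> carrier_mat n n" "M * G \<in> carrier_mat n n" "H * N' \<in> carrier_mat n n" "N * H \<in> carrier_mat n n"
      "G * N' \<in> carrier_mat n n" "M * H \<in> carrier_mat n n"
      using mult_carrier_mat[OF cc(1) A] mult_carrier_mat[OF A cc(1)] mult_carrier_mat[OF cc(2) A]
        mult_carrier_mat[OF A cc(2)] mult_carrier_mat[OF cc(1) c(3)] mult_carrier_mat[OF c(1) cc(1)]
        mult_carrier_mat[OF cc(2) c(4)] mult_carrier_mat[OF c(2) cc(2)] mult_carrier_mat[OF cc(1) c(4)]
        mult_carrier_mat[OF c(1) cc(2)] by blast+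
    have prods2: "E * A \<in> carrier_mat n n" "A * E \<in> carrier_mat n n" "G * (M' - N') \<in> carrier_mat n n"
      "E * N' \<in> carrier_mat n n" "M * E \<in> carrier_mat n n" "(M - N) * H \<in> carrier_mat n n"
      using mult_carrier_mat[OF cc(3) A] mult_carrier_mat[OF A cc(3)] mult_carrier_mat[OF cc(1) MN']
        mult_carrier_mat[OF cc(3) c(4)] mult_carrier_mat[OF c(1) cc(3)] mult_carrier_mat[OF MN cc(2)]
      by blast+
    have dist: "E * A = G * A - H * A" "A * E = A * G - A * H" "G * (M' - N') = G * M' - G * N'"
      "E * N' = G * N' - H * N'" "M * E = M * G - M * H" "(M - N) * H = M * H - N * H"
      unfolding E_def G_def[symmetric] H_def[symmetric]
      using minus_mult_distrib_mat[OF cc(1,2) A] mult_minus_distrib_mat[OF A cc(1,2)]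
        mult_minus_distrib_mat[OF cc(1) c(3,4)] minus_mult_distrib_mat[OF cc(1,2) c(4)]
        mult_minus_distrib_mat[OF c(1) cc(1,2)] minus_mult_distrib_mat[OF c(1,2) cc(2)]
      by blast+
    have "M' = M + (G * A - A * G) + (G * M' - M * G)"
      unfolding M'_def G_def by (rule step_identity(2)[OF c(1) G1])
    moreover have "N' = N + (H * A - A * H) + (H * N' - N * H)"
      unfolding N'_def H_def by (rule step_identity(2)[OF c(2) H1])
    ultimately have "M' - N' = (M + (G * A - A * G) + (G * M' - M * G)) - (N + (H * A - A * H) + (H * N' - N * H))"
      by simp
    also have "\<dots> = (M - N) + ((G * A - H * A) - (A * G - A * H)) + ((G * M' - G * N') + (G * N' - H * N'))
        - ((M * G - M * H) + (M * H - N * H))"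
      using c prods carrier_matD[OF prods(1)] by (intro eq_matI) (simp_all del: index_mult_mat)
    finally have id: "M' - N' = (M - N) + (E * A - A * E) + (G * (M' - N') + E * N') - (M * E + (M - N) * H)"
      unfolding dist .
    define x where "x = nrm (M' - N')"
    have "x \<le> nrm ((M - N) + (E * A - A * E) + (G * (M' - N') + E * N')) + nrm (M * E + (M - N) * H)"
      unfolding x_def by (subst id) (rule nrm_minus[of _ n n], use MN prods2 in \<open>auto intro!: add_carrier_mat\<close>)
    also have "nrm (M * E + (M - N) * H) \<le> nrm M * nrm E + d * nrm H"
      using nrm_add[OF prods2(5,6)] nrm_mult[OF c(1) cc(3)] nrm_mult[OF MN cc(2)] by (simp add: d_def)
    also have "nrm ((M - N) + (E * A - A * E) + (G * (M' - N') + E * N'))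
        \<le> d + (nrm E * a + a * nrm E) + (nrm G * x + nrm E * nrm N')"
      using nrm_add[OF add_carrier_mat[OF minus_carrier_mat[OF prods2(2)]] add_carrier_mat[OF prods2(4)]]
        nrm_add[OF MN minus_carrier_mat[OF prods2(2)]] nrm_minus[OF prods2(1,2)] nrm_add[OF prods2(3,4)]
        nrm_mult[OF cc(3) A] nrm_mult[OF A cc(3)] nrm_mult[OF cc(1) MN'] nrm_mult[OF cc(3) c(4)]
      unfolding x_def d_def by (smt (verit))
    finally have "x \<le> d + (nrm E * a + a * nrm E) + (nrm G * x + nrm E * nrm N') + (nrm M * nrm E + d * nrm H)"
      by simp
    moreover have "nrm E * a \<le> f * d * a" by (rule mult_right_mono[OF Ed nrm_nonneg])
    moreover have "nrm E * nrm N' \<le> f * d * (1 / (8 * f))"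
      by (rule mult_mono[OF Ed bd(2)]) (use d0 f_pos in simp_all)
    moreover have "nrm M * nrm E \<le> 1 / (8 * f) * (f * d)"
      by (rule mult_mono[OF bd(1) Ed]) (use f_pos in simp_all)
    moreover have "nrm G * x \<le> 1/2 * x"
      by (rule mult_right_mono) (use small(1) in \<open>simp_all add: x_def\<close>)
    moreover have "d * nrm H \<le> d * 1"
      by (rule mult_left_mono) (use small(2) d0 in simp_all)
    ultimately have "x \<le> ?K * d" using f_pos by (simp add: algebra_simps)
    also have "\<dots> \<le> ?K * (K * nrm (Y - X))"
      using K[OF XY] f_pos nrm_nonneg[of A] unfolding d_def M_def N_def by (intro mult_left_mono) auto
    finally show ?thesis unfolding x_def M'_def N'_def M_def N_def Ms_Suc by (simp add: mult.assoc)
  qed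
  then show ?case by blast
qed

lemma Ps_Lipschitz: "\<exists>K. \<forall>X\<in>U. \<forall>Y\<in>U. nrm (Ps Y k - Ps X k) \<le> K * nrm (Y - X)"
proof (induction k)
  case 0
  have "1\<^sub>m n - 1\<^sub>m n = (0\<^sub>m n n :: 'a mat)" by (intro eq_matI) auto
  then have "nrm (1\<^sub>m n - 1\<^sub>m n) = 0" using nrm_zero by metis
  then show ?case by (intro exI[of _ 0]) simp
next
  case (Suc k)
  then obtain K where K: "\<And>X Y. X \<in> U \<Longrightarrow> Y \<in> U \<Longrightarrow> nrm (Ps Y k - Ps X k) \<le> K * nrm (Y - X)"
    by blast
  obtain K' where K': "\<And>X Y. X \<in> U \<Longrightarrow> Y \<in> U \<Longrightarrow> nrm (Ms Y k - Ms X k) \<le> K' * nrm (Y - X)"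
    using Ms_Lipschitz[of k] by blast
  let ?s = "sqrt (real n) + 1"
  have "nrm (Ps Y (Suc k) - Ps X (Suc k)) \<le> (K * ?s + ?s * (f * K')) * nrm (Y - X)"
    if XY: "X \<in> U" "Y \<in> U" for X Y
  proof -
    define B B' where "B = 1\<^sub>m n - Cs Y k" and "B' = 1\<^sub>m n - Cs X k"
    have B: "B \<in> carrier_mat n n" "B' \<in> carrier_mat n n"
      by (auto simp: B_def B'_def intro: minus_carrier_mat)
    have PP: "Ps Y k - Ps X k \<in> carrier_mat n n" and BB: "B - B' \<in> carrier_mat n n"
      using B by (auto intro: minus_carrier_mat)
    have prods: "Ps Y k * B \<in> carrier_mat n n" "Ps X k * B \<in> carrier_mat n n" "Ps X k * B' \<in> carrier_mat n n"
      using mult_carrier_mat[OF Ps_closed B(1)] mult_carrier_mat[OF Ps_closed B(2)] by blast+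
    have "Ps Y k * B - Ps X k * B' = (Ps Y k * B - Ps X k * B) + (Ps X k * B - Ps X k * B')"
      using prods carrier_matD[OF prods(3)] by (intro eq_matI) (simp_all del: index_mult_mat)
    also have "\<dots> = (Ps Y k - Ps X k) * B + Ps X k * (B - B')"
      using minus_mult_distrib_mat[OF Ps_closed Ps_closed B(1)] mult_minus_distrib_mat[OF Ps_closed B] by simp
    finally have e: "Ps Y (Suc k) - Ps X (Suc k) = (Ps Y k - Ps X k) * B + Ps X k * (B - B')"
      by (simp add: B_def B'_def)
    have "nrm B \<le> nrm (1\<^sub>m n) + nrm (Cs Y k)" unfolding B_def by (rule nrm_minus[OF one_carrier_mat Cs_closed])
    then have nB: "nrm B \<le> ?s" using U_bounds(3)[OF XY(2), of k] by (simp add: nrm_one)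
    have "B - B' = C (Ms X k - Ms Y k)"
      unfolding C_diff[OF U_bounds(1)[OF XY(1)] U_bounds(1)[OF XY(2)]] B_def B'_def C_seq_def
      using carrier_matD[OF C_closed] by (intro eq_matI) auto
    then have "nrm (B - B') \<le> f * nrm (Ms X k - Ms Y k)"
      using nrm_C_le[OF minus_carrier_mat[OF U_bounds(1)[OF XY(2)]]] by simp
    also have "\<dots> \<le> f * (K' * nrm (Y - X))"
      using K'[OF XY] nrm_minus_commute[OF U_bounds(1)[OF XY(1)] U_bounds(1)[OF XY(2)]] f_pos by simp
    finally have nBB: "nrm (B - B') \<le> f * (K' * nrm (Y - X))" .
    have "nrm (Ps Y (Suc k) - Ps X (Suc k)) \<le> nrm (Ps Y k - Ps X k) * nrm B + nrm (Ps X k) * nrm (B - B')"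
      unfolding e using nrm_add[OF mult_carrier_mat[OF PP B(1)] mult_carrier_mat[OF Ps_closed BB]]
        nrm_mult[OF PP B(1)] nrm_mult[OF Ps_closed BB] by (smt (verit))
    also have "\<dots> \<le> (K * nrm (Y - X)) * ?s + ?s * (f * (K' * nrm (Y - X)))"
    proof (intro add_mono mult_mono)
      show "nrm (Ps Y k - Ps X k) \<le> K * nrm (Y - X)" by (rule K[OF XY])
      then show "0 \<le> K * nrm (Y - X)" using nrm_nonneg order_trans by blast
      show "nrm (Ps X k) \<le> ?s" by (rule U_bounds(4)[OF XY(1)])
    qed (use nB nBB in auto)
    finally show ?thesis by (simp add: algebra_simps)
  qed
  then show ?case by blast
qed

lemma geometric_null: "(\<lambda>k. K * (1/4 :: real) ^ k / (1 - 1/4)) \<longlonglongrightarrow> 0"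
proof -
  have "(\<lambda>k. K * (1/4 :: real) ^ k / (1 - 1/4)) \<longlonglongrightarrow> K * 0 / (1 - 1/4)"
    by (intro tendsto_mult tendsto_divide tendsto_const LIMSEQ_realpow_zero) auto
  then show ?thesis by simp
qed

lemma S_map_continuous: "mat_continuous_on av U (S_map av n A F)"
proof (rule uniform_limit_continuous[where H = "\<lambda>k X. Ps X k"])
  show "nrm (S_map av n A F X - Ps X k) \<le> (sqrt (real n) + 1) / 16 * (1/4) ^ k / (1 - 1/4)" if "X \<in> U" for X k
    using S_map_limit(3)[of "1/2" X k] that by simp
  show "S_map av n A F X \<in> carrier_mat n n" if "X \<in> U" for X
    using S_map_limit(1)[of "1/2" X] that by simp
  show "(\<lambda>k. (sqrt (real n) + 1) / 16 * (1/4) ^ k / (1 - 1/4)) \<longlonglongrightarrow> 0" by (rule geometric_null)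
qed (use Ps_Lipschitz in auto)

lemma D_map_continuous: "mat_continuous_on av U (D_map av n A F)"
proof (rule uniform_limit_continuous[where H = "\<lambda>k X. Ms X k"])
  show "nrm (D_map av n A F X - Ms X k) \<le> (2 * a + 2 * (1/2 / (4 * f))) / 16 * (1/4) ^ k / (1 - 1/4)" if "X \<in> U" for X k
    using D_map_limit(3)[of "1/2" X k] that by simp
  show "D_map av n A F X \<in> carrier_mat n n" if "X \<in> U" for X
    using D_map_limit(1)[of "1/2" X] that by simp
  show "Ms X k \<in> carrier_mat n n" if "X \<in> U" for X k by (rule U_bounds(1)[OF that])
  show "(\<lambda>k. (2 * a + 2 * (1/2 / (4 * f))) / 16 * (1/4) ^ k / (1 - 1/4)) \<longlonglongrightarrow> 0" by (rule geometric_null)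
qed (use Ms_Lipschitz in auto)

lemma zero_in_nbhd:
  assumes "0 < \<delta>"
  shows "0\<^sub>m n n \<in> nbhd av n A F \<delta>"
proof -
  have "0 < 48 * sqrt (real n) * (a + 1) * f\<^sup>2"
    using n_pos f_pos nrm_nonneg[of A] by (intro mult_pos_pos) (auto simp: add_nonneg_pos)
  then show ?thesis using assms by (simp add: nbhd_def)
qed

lemma S_map_zero: "S_map av n A F (0\<^sub>m n n) = 1\<^sub>m n"
proof -
  have C0: "C (0\<^sub>m n n) = 0\<^sub>m n n" by (intro eq_matI) (auto simp: C_of_def)
  have "Ms (0\<^sub>m n n) k = 0\<^sub>m n n" for k
  proof (induction k)
    case (Suc k)
    have z: "(0\<^sub>m n n :: 'a mat) \<in> carrier_mat n n" by simp
    have small: "nrm (C (0\<^sub>m n n)) < 1" unfolding C0 by simp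
    have s: "step (0\<^sub>m n n) \<in> carrier_mat n n" by (rule step_identity(1)[OF z small])
    have "step (0\<^sub>m n n) = 0\<^sub>m n n + (0\<^sub>m n n - 0\<^sub>m n n) + (0\<^sub>m n n - 0\<^sub>m n n)"
      using step_identity(2)[OF z small] s A unfolding C0 by simp
    also have "\<dots> = 0\<^sub>m n n" by (intro eq_matI) auto
    finally show ?case unfolding Ms_Suc Suc .
  qed simp
  then have "Ps (0\<^sub>m n n) k = 1\<^sub>m n" for k
  proof (induction k)
    case (Suc k)
    have "1\<^sub>m n - 0\<^sub>m n n = (1\<^sub>m n :: 'a mat)" by (intro eq_matI) auto
    then show ?case using Suc by (simp add: C_seq_def C0 del: M_seq.simps)
  qed simp
  then have "mat_tendsto av (Ps (0\<^sub>m n n)) (1\<^sub>m n)" 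
    using mat_tendsto_const[OF one_carrier_mat[of n]] by (simp add: mat_tendsto_def)
  moreover have X: "0\<^sub>m n n \<in> nbhd av n A F (2 * (1/2))" by (rule zero_in_nbhd) simp
  ultimately show ?thesis
    using mat_tendsto_unique[OF Ps_closed S_map_limit(1,2)[OF _ _ X] one_carrier_mat] by simp
qed

end

section \<open>Power series in the entries of a matrix\<close>

definition multi_indices :: "nat \<Rightarrow> (nat \<times> nat \<Rightarrow> nat) set" where
  "multi_indices n = {\<alpha>. \<forall>p. p \<notin> {..<n} \<times> {..<n} \<longrightarrow> \<alpha> p = 0}"

definition monomial :: "nat \<Rightarrow> (nat \<times> nat \<Rightarrow> 'a::comm_monoid_mult) \<Rightarrow> (nat \<times> nat \<Rightarrow> nat) \<Rightarrow> 'a" where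
  "monomial n z \<alpha> = (\<Prod>p\<in>{..<n} \<times> {..<n}. z p ^ \<alpha> p)"

lemma monomial_zero [simp]: "monomial n z (\<lambda>p. 0) = 1"
  by (simp add: monomial_def)

lemma monomial_add: "monomial n z (\<lambda>p. \<alpha> p + \<beta> p) = monomial n z \<alpha> * monomial n z \<beta>"
  by (simp add: monomial_def power_add prod.distrib)

lemma monomial_single:
  assumes "p \<in> {..<n} \<times> {..<n}"
  shows "monomial n z (\<lambda>q. if q = p then 1 else 0) = z p"
proof -
  have "monomial n z (\<lambda>q. if q = p then 1 else 0) = (\<Prod>q\<in>{..<n} \<times> {..<n}. if q = p then z p else 1)"
    unfolding monomial_def by (intro prod.cong) auto
  then show ?thesis using assms by simp
qed

text \<open>
  Functions on \<open>W\<close>, a subset of the polydisc of radius \<open>r\<close> about \<open>X\<^sub>0\<close>. The bound \<open>K\<close> of a power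
  series is on \<open>\<Sum> \<bar>c\<^sub>\<alpha>\<bar> r\<^bsup>\<bar>\<alpha>\<bar>\<^esup>\<close>; this norm is submultiplicative and complete, so that estimates by
  sums, products and series carry over from matrices of numbers to matrices of functions.
\<close>
locale polydisc =
  fixes n :: nat and X0 :: "complex mat" and r :: real and W :: "complex mat set"
  assumes r: "0 < r" and W_carrier: "X \<in> W \<Longrightarrow> X \<in> carrier_mat n n"
    and W_disc: "X \<in> W \<Longrightarrow> p \<in> {..<n} \<times> {..<n} \<Longrightarrow> cmod ((X - X0) $$ p) \<le> r"
begin

abbreviation rad where "rad \<equiv> monomial n (\<lambda>p. r)"
abbreviation pow where "pow X \<equiv> monomial n (\<lambda>p. (X - X0) $$ p)"

text \<open>
  A power series whose terms may be indexed by any set, where \<open>d t\<close> is the multi-index of the term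
  \<open>t\<close>. Products and infinite sums of power series first appear in this shape, indexed by pairs.
\<close>
definition family_sum :: "'t set \<Rightarrow> ('t \<Rightarrow> complex) \<Rightarrow> ('t \<Rightarrow> nat \<times> nat \<Rightarrow> nat) \<Rightarrow> (complex mat \<Rightarrow> complex) \<Rightarrow> real \<Rightarrow> bool" where
  "family_sum T w d g K \<longleftrightarrow> d ` T \<subseteq> multi_indices n \<and>
     (\<lambda>t. cmod (w t) * rad (d t)) summable_on T \<and> (\<Sum>\<^sub>\<infinity>t\<in>T. cmod (w t) * rad (d t)) \<le> K \<and>
     (\<forall>X\<in>W. ((\<lambda>t. w t * pow X (d t)) has_sum g X) T)"

definition series_bound :: "(complex mat \<Rightarrow> complex) \<Rightarrow> real \<Rightarrow> bool" where
  "series_bound g K \<longleftrightarrow> (\<exists>c. family_sum (multi_indices n) c (\<lambda>\<alpha>. \<alpha>) g K)"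

lemma rad_pos: "0 < rad \<alpha>"
  using r by (simp add: monomial_def prod_pos)

lemma pow_le: "X \<in> W \<Longrightarrow> cmod (pow X \<alpha>) \<le> rad \<alpha>"
  unfolding monomial_def prod_norm[symmetric] norm_power using W_disc
  by (intro prod_mono) (auto intro!: power_mono)

text \<open>Collecting the terms of equal degree turns any absolutely summable family into a power series.\<close>
lemma collect_degrees:
  assumes "family_sum T w d g K"
  shows "series_bound g K"
proof -
  define fib where "fib \<gamma> = {t \<in> T. d t = \<gamma>}" for \<gamma>
  define c where "c \<gamma> = infsum w (fib \<gamma>)" for \<gamma>
  let ?I = "multi_indices n" and ?S = "Sigma (multi_indices n) fib"
  have d: "d t \<in> ?I" if "t \<in> T" for t using assms that by (auto simp: family_sum_def)
  have sm: "(\<lambda>t. cmod (w t) * rad (d t)) summable_on T" and le: "(\<Sum>\<^sub>\<infinity>t\<in>T. cmod (w t) * rad (d t)) \<le> K"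
    and hs: "\<And>X. X \<in> W \<Longrightarrow> ((\<lambda>t. w t * pow X (d t)) has_sum g X) T"
    using assms by (auto simp: family_sum_def)
  have bij: "bij_betw snd ?S T"
    by (rule bij_betwI[where g = "\<lambda>t. (d t, t)"]) (auto simp: fib_def d)
  have wabs: "w abs_summable_on fib \<gamma>" for \<gamma>
  proof -
    have "(\<lambda>t. cmod (w t) * rad (d t)) summable_on fib \<gamma>"
      by (rule summable_on_subset_banach[OF sm]) (auto simp: fib_def)
    moreover have "(\<lambda>t. cmod (w t) * rad (d t)) summable_on fib \<gamma> \<longleftrightarrow> (\<lambda>t. cmod (w t) * rad \<gamma>) summable_on fib \<gamma>"
      by (rule summable_on_cong) (simp add: fib_def)
    ultimately show ?thesis
      using summable_on_cmult_left'[of "rad \<gamma>" "\<lambda>t. cmod (w t)" "fib \<gamma>"] rad_pos[of \<gamma>] by auto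
  qed
  have ws: "w summable_on fib \<gamma>" for \<gamma> by (rule abs_summable_summable[OF wabs])
  have "((\<lambda>t. cmod (w t) * rad (d t)) has_sum (\<Sum>\<^sub>\<infinity>t\<in>T. cmod (w t) * rad (d t))) T"
    using sm by (rule has_sum_infsum)
  then have "((\<lambda>q. cmod (w (snd q)) * rad (d (snd q))) has_sum (\<Sum>\<^sub>\<infinity>t\<in>T. cmod (w t) * rad (d t))) ?S"
    using has_sum_reindex_bij_betw[OF bij, of "\<lambda>t. cmod (w t) * rad (d t)"] by simp
  then have nrm: "((\<lambda>\<gamma>. (\<Sum>\<^sub>\<infinity>t\<in>fib \<gamma>. cmod (w t)) * rad \<gamma>) has_sum (\<Sum>\<^sub>\<infinity>t\<in>T. cmod (w t) * rad (d t))) ?I"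
  proof (rule has_sum_SigmaD)
    fix \<gamma>
    have "((\<lambda>t. cmod (w t) * rad \<gamma>) has_sum (\<Sum>\<^sub>\<infinity>t\<in>fib \<gamma>. cmod (w t)) * rad \<gamma>) (fib \<gamma>)"
      using wabs by (intro has_sum_cmult_left has_sum_infsum)
    then show "((\<lambda>t. cmod (w (snd (\<gamma>, t))) * rad (d (snd (\<gamma>, t)))) has_sum
        (\<Sum>\<^sub>\<infinity>t\<in>fib \<gamma>. cmod (w t)) * rad \<gamma>) (fib \<gamma>)"
      by (rule has_sum_cong[THEN iffD1, rotated]) (simp add: fib_def)
  qed
  have cle: "cmod (c \<gamma>) * rad \<gamma> \<le> (\<Sum>\<^sub>\<infinity>t\<in>fib \<gamma>. cmod (w t)) * rad \<gamma>" for \<gamma>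
    unfolding c_def using rad_pos[of \<gamma>] by (intro mult_right_mono norm_infsum_bound wabs) auto
  have csm: "(\<lambda>\<gamma>. cmod (c \<gamma>) * rad \<gamma>) summable_on ?I"
    by (rule summable_on_comparison_test[OF has_sum_imp_summable[OF nrm] cle])
      (simp add: rad_pos less_imp_le)
  have "(\<Sum>\<^sub>\<infinity>\<gamma>\<in>?I. cmod (c \<gamma>) * rad \<gamma>) \<le> (\<Sum>\<^sub>\<infinity>t\<in>T. cmod (w t) * rad (d t))"
    using has_sum_mono[OF has_sum_infsum[OF csm] nrm] cle by simp
  then have cK: "(\<Sum>\<^sub>\<infinity>\<gamma>\<in>?I. cmod (c \<gamma>) * rad \<gamma>) \<le> K" using le by linarith
  have "((\<lambda>\<gamma>. c \<gamma> * pow X \<gamma>) has_sum g X) ?I" if X: "X \<in> W" for X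
  proof -
    have "((\<lambda>q. w (snd q) * pow X (d (snd q))) has_sum g X) ?S"
      using has_sum_reindex_bij_betw[OF bij, of "\<lambda>t. w t * pow X (d t)"] hs[OF X] by simp
    then show ?thesis
    proof (rule has_sum_SigmaD)
      fix \<gamma>
      have "((\<lambda>t. w t * pow X \<gamma>) has_sum c \<gamma> * pow X \<gamma>) (fib \<gamma>)"
        unfolding c_def using ws by (intro has_sum_cmult_left has_sum_infsum)
      then show "((\<lambda>t. w (snd (\<gamma>, t)) * pow X (d (snd (\<gamma>, t)))) has_sum c \<gamma> * pow X \<gamma>) (fib \<gamma>)"
        by (rule has_sum_cong[THEN iffD1, rotated]) (simp add: fib_def)
    qed
  qed
  then have "family_sum ?I c (\<lambda>\<alpha>. \<alpha>) g K"
    using csm cK by (auto simp: family_sum_def)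
  then show ?thesis by (auto simp: series_bound_def)
qed

lemma series_bound_nonneg:
  assumes "series_bound g K"
  shows "0 \<le> K"
proof -
  obtain c where c: "family_sum (multi_indices n) c (\<lambda>\<alpha>. \<alpha>) g K"
    using assms by (auto simp: series_bound_def)
  have "0 \<le> (\<Sum>\<^sub>\<infinity>\<alpha>\<in>multi_indices n. cmod (c \<alpha>) * rad \<alpha>)"
    using rad_pos by (intro infsum_nonneg) (simp add: less_imp_le)
  then show ?thesis using c by (auto simp: family_sum_def)
qed

lemma series_bound_cong: "series_bound g K \<Longrightarrow> (\<And>X. X \<in> W \<Longrightarrow> g X = h X) \<Longrightarrow> series_bound h K"
  unfolding series_bound_def family_sum_def by auto

lemma series_bound_const: "series_bound (\<lambda>X. k) (cmod k)"
  by (rule collect_degrees[of "{()}" "\<lambda>_. k" "\<lambda>_ p. 0"])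
    (auto simp: family_sum_def multi_indices_def has_sum_finite_iff)

lemma series_bound_coordinate:
  assumes "i < n" "j < n"
  shows "series_bound (\<lambda>X. (X - X0) $$ (i, j)) r"
  by (rule collect_degrees[of "{()}" "\<lambda>_. 1" "\<lambda>_ q. if q = (i, j) then 1 else 0"])
    (use assms in \<open>auto simp: family_sum_def multi_indices_def has_sum_finite_iff monomial_single
      simp del: One_nat_def\<close>)

lemma series_bound_add:
  assumes "series_bound g K" "series_bound h L"
  shows "series_bound (\<lambda>X. g X + h X) (K + L)"
proof -
  obtain c e where c: "family_sum (multi_indices n) c (\<lambda>\<alpha>. \<alpha>) g K"
    and e: "family_sum (multi_indices n) e (\<lambda>\<alpha>. \<alpha>) h L"
    using assms by (auto simp: series_bound_def)
  note cs = c[unfolded family_sum_def] and es = e[unfolded family_sum_def]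
  have sum: "((\<lambda>\<alpha>. cmod (c \<alpha>) * rad \<alpha> + cmod (e \<alpha>) * rad \<alpha>) has_sum
      ((\<Sum>\<^sub>\<infinity>\<alpha>\<in>multi_indices n. cmod (c \<alpha>) * rad \<alpha>) + (\<Sum>\<^sub>\<infinity>\<alpha>\<in>multi_indices n. cmod (e \<alpha>) * rad \<alpha>))) (multi_indices n)"
    using cs es by (intro has_sum_add has_sum_infsum) auto
  have le: "cmod (c \<alpha> + e \<alpha>) * rad \<alpha> \<le> cmod (c \<alpha>) * rad \<alpha> + cmod (e \<alpha>) * rad \<alpha>" for \<alpha>
    using rad_pos[of \<alpha>] by (simp add: distrib_right[symmetric] norm_triangle_ineq)
  have sm: "(\<lambda>\<alpha>. cmod (c \<alpha> + e \<alpha>) * rad \<alpha>) summable_on multi_indices n"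
    by (rule summable_on_comparison_test[OF has_sum_imp_summable[OF sum] le])
      (simp add: rad_pos less_imp_le)
  have "(\<Sum>\<^sub>\<infinity>\<alpha>\<in>multi_indices n. cmod (c \<alpha> + e \<alpha>) * rad \<alpha>) \<le> K + L"
  proof -
    have "(\<Sum>\<^sub>\<infinity>\<alpha>\<in>multi_indices n. cmod (c \<alpha> + e \<alpha>) * rad \<alpha>) \<le>
        (\<Sum>\<^sub>\<infinity>\<alpha>\<in>multi_indices n. cmod (c \<alpha>) * rad \<alpha>) + (\<Sum>\<^sub>\<infinity>\<alpha>\<in>multi_indices n. cmod (e \<alpha>) * rad \<alpha>)"
      by (rule has_sum_mono[OF has_sum_infsum[OF sm] sum le])
    then show ?thesis using cs es by linarith
  qed
  moreover have "((\<lambda>\<alpha>. (c \<alpha> + e \<alpha>) * pow X \<alpha>) has_sum (g X + h X)) (multi_indices n)" if "X \<in> W" for X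
    using that cs es by (auto simp: distrib_right intro!: has_sum_add)
  ultimately have "family_sum (multi_indices n) (\<lambda>\<alpha>. c \<alpha> + e \<alpha>) (\<lambda>\<alpha>. \<alpha>) (\<lambda>X. g X + h X) (K + L)"
    using sm by (auto simp: family_sum_def)
  then show ?thesis by (auto simp: series_bound_def)
qed

lemma series_bound_finite_sum:
  assumes "finite Q" "\<And>q. q \<in> Q \<Longrightarrow> series_bound (g q) (B q)"
  shows "series_bound (\<lambda>X. \<Sum>q\<in>Q. g q X) (\<Sum>q\<in>Q. B q)"
  using assms
proof (induction Q)
  case empty
  show ?case using series_bound_const[of 0] by simp
next
  case (insert q Q)
  then show ?case by (simp add: series_bound_add)
qed

lemma series_bound_mult:
  assumes "series_bound g K" "series_bound h L"
  shows "series_bound (\<lambda>X. g X * h X) (K * L)"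
proof -
  obtain c e where c: "family_sum (multi_indices n) c (\<lambda>\<alpha>. \<alpha>) g K"
    and e: "family_sum (multi_indices n) e (\<lambda>\<alpha>. \<alpha>) h L"
    using assms by (auto simp: series_bound_def)
  note cs = c[unfolded family_sum_def] and es = e[unfolded family_sum_def]
  let ?I = "multi_indices n"
  let ?a = "\<lambda>\<alpha>. cmod (c \<alpha>) * rad \<alpha>" and ?b = "\<lambda>\<alpha>. cmod (e \<alpha>) * rad \<alpha>"
  let ?w = "\<lambda>q. c (fst q) * e (snd q)" and ?d = "\<lambda>q p. fst q p + snd q p"
  have nn: "0 \<le> ?a \<alpha>" "0 \<le> ?b \<alpha>" for \<alpha> using rad_pos[of \<alpha>] by auto
  have a: "(?a has_sum infsum ?a ?I) ?I" and b: "(?b has_sum infsum ?b ?I) ?I"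
    using cs es by (auto intro: has_sum_infsum)
  have inner: "((\<lambda>\<beta>. ?a \<alpha> * ?b \<beta>) has_sum ?a \<alpha> * infsum ?b ?I) ?I" for \<alpha>
    by (rule has_sum_cmult_right[OF b])
  have outer: "((\<lambda>\<alpha>. ?a \<alpha> * infsum ?b ?I) has_sum infsum ?a ?I * infsum ?b ?I) ?I"
    by (rule has_sum_cmult_left[OF a])
  have sm: "(\<lambda>q. ?a (fst q) * ?b (snd q)) summable_on ?I \<times> ?I"
    by (rule summable_on_SigmaI[where g = "\<lambda>\<alpha>. ?a \<alpha> * infsum ?b ?I"])
      (use inner has_sum_imp_summable[OF outer] nn in \<open>auto intro: mult_nonneg_nonneg\<close>)
  have tot: "((\<lambda>q. ?a (fst q) * ?b (snd q)) has_sum infsum ?a ?I * infsum ?b ?I) (?I \<times> ?I)"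
    by (rule has_sum_SigmaI[where g = "\<lambda>\<alpha>. ?a \<alpha> * infsum ?b ?I"]) (use inner outer sm in auto)
  have eq: "cmod (?w q) * rad (?d q) = ?a (fst q) * ?b (snd q)" for q
    by (simp add: monomial_add norm_mult mult_ac)
  have "infsum ?a ?I * infsum ?b ?I \<le> K * L"
    using cs es nn by (intro mult_mono infsum_nonneg series_bound_nonneg[OF assms(1)]) auto
  then have 1: "(\<Sum>\<^sub>\<infinity>q\<in>?I \<times> ?I. cmod (?w q) * rad (?d q)) \<le> K * L"
    unfolding eq using infsumI[OF tot] by simp
  have "((\<lambda>q. ?w q * pow X (?d q)) has_sum g X * h X) (?I \<times> ?I)" if X: "X \<in> W" for X
  proof -
    have f: "((\<lambda>\<alpha>. c \<alpha> * pow X \<alpha>) has_sum g X) ?I" and k: "((\<lambda>\<alpha>. e \<alpha> * pow X \<alpha>) has_sum h X) ?I"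
      using cs es X by auto
    have "(\<lambda>q. (c (fst q) * pow X (fst q)) * (e (snd q) * pow X (snd q))) abs_summable_on ?I \<times> ?I"
    proof (rule abs_summable_on_comparison_test'[OF sm])
      fix q
      have "cmod (c (fst q) * pow X (fst q)) * cmod (e (snd q) * pow X (snd q)) \<le> ?a (fst q) * ?b (snd q)"
        unfolding norm_mult using pow_le[OF X] nn by (intro mult_mono mult_left_mono) auto
      then show "cmod ((c (fst q) * pow X (fst q)) * (e (snd q) * pow X (snd q))) \<le> ?a (fst q) * ?b (snd q)"
        by (simp only: norm_mult)
    qed
    then have s: "(\<lambda>q. (c (fst q) * pow X (fst q)) * (e (snd q) * pow X (snd q))) summable_on ?I \<times> ?I"
      by (rule abs_summable_summable)
    have "((\<lambda>q. (c (fst q) * pow X (fst q)) * (e (snd q) * pow X (snd q))) has_sum g X * h X) (?I \<times> ?I)"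
      by (rule has_sum_SigmaI[where g = "\<lambda>\<alpha>. (c \<alpha> * pow X \<alpha>) * h X"])
        (use s has_sum_cmult_right[OF k] has_sum_cmult_left[OF f] in auto)
    then show ?thesis by (simp add: monomial_add mult_ac)
  qed
  then have "family_sum (?I \<times> ?I) ?w ?d (\<lambda>X. g X * h X) (K * L)"
    using sm 1 unfolding family_sum_def eq by (auto simp: multi_indices_def)
  then show ?thesis by (rule collect_degrees)
qed

lemma series_bound_sums:
  assumes g: "\<And>k. series_bound (g k) (K k)" and K: "summable K"
    and G: "\<And>X. X \<in> W \<Longrightarrow> (\<lambda>k. g k X) sums G X"
  shows "series_bound G (suminf K)"
proof -
  let ?I = "multi_indices n"
  obtain c where c: "\<And>k. family_sum ?I (c k) (\<lambda>\<alpha>. \<alpha>) (g k) (K k)"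
    using g unfolding series_bound_def by metis
  note cs = c[unfolded family_sum_def]
  let ?s = "\<lambda>k. \<Sum>\<^sub>\<infinity>\<alpha>\<in>?I. cmod (c k \<alpha>) * rad \<alpha>"
  let ?T = "(UNIV :: nat set) \<times> ?I" and ?w = "\<lambda>q. c (fst q) (snd q)"
  have nn: "0 \<le> cmod (c k \<alpha>) * rad \<alpha>" for k \<alpha> using rad_pos[of \<alpha>] by auto
  have s0: "0 \<le> ?s k" "?s k \<le> K k" for k using cs nn by (auto intro: infsum_nonneg)
  have ssum: "summable ?s" using s0 by (intro summable_comparison_test'[OF K]) auto
  have inner: "((\<lambda>\<alpha>. cmod (c k \<alpha>) * rad \<alpha>) has_sum ?s k) ?I" for k
    using cs by (auto intro: has_sum_infsum)
  have outer: "(?s has_sum suminf ?s) UNIV"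
    using ssum s0 by (intro norm_summable_imp_has_sum) (auto simp: summable_sums)
  have sm: "(\<lambda>q. cmod (?w q) * rad (snd q)) summable_on ?T"
    by (rule summable_on_SigmaI[where g = ?s]) (use inner has_sum_imp_summable[OF outer] nn in auto)
  have "((\<lambda>q. cmod (?w q) * rad (snd q)) has_sum suminf ?s) ?T"
    by (rule has_sum_SigmaI[where g = ?s]) (use inner outer sm in auto)
  then have "(\<Sum>\<^sub>\<infinity>q\<in>?T. cmod (?w q) * rad (snd q)) = suminf ?s" by (rule infsumI)
  also have "\<dots> \<le> suminf K" using s0 ssum K by (intro suminf_le) auto
  finally have 1: "(\<Sum>\<^sub>\<infinity>q\<in>?T. cmod (?w q) * rad (snd q)) \<le> suminf K" .
  have "((\<lambda>q. ?w q * pow X (snd q)) has_sum G X) ?T" if X: "X \<in> W" for X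
  proof -
    have "(\<lambda>q. ?w q * pow X (snd q)) abs_summable_on ?T"
    proof (rule abs_summable_on_comparison_test'[OF sm])
      fix q show "cmod (?w q * pow X (snd q)) \<le> cmod (?w q) * rad (snd q)"
        unfolding norm_mult using pow_le[OF X] by (intro mult_left_mono) auto
    qed
    from abs_summable_summable[OF this]
    have hs: "((\<lambda>q. ?w q * pow X (snd q)) has_sum (\<Sum>\<^sub>\<infinity>q\<in>?T. ?w q * pow X (snd q))) ?T"
      by (rule has_sum_infsum)
    then have "((\<lambda>k. g k X) has_sum (\<Sum>\<^sub>\<infinity>q\<in>?T. ?w q * pow X (snd q))) UNIV"
    proof (rule has_sum_SigmaD)
      show "((\<lambda>\<alpha>. ?w (k, \<alpha>) * pow X (snd (k, \<alpha>))) has_sum g k X) ?I" for k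
        using cs[of k] X by simp
    qed
    then have "(\<Sum>\<^sub>\<infinity>q\<in>?T. ?w q * pow X (snd q)) = G X"
      using G[OF X] has_sum_imp_sums sums_unique2 by blast
    then show ?thesis using hs by simp
  qed
  then have "family_sum ?T ?w snd G (suminf K)"
    using sm 1 unfolding family_sum_def by auto
  then show ?thesis by (rule collect_degrees)
qed

lemma series_bound_le:
  assumes "series_bound g K" "X \<in> W"
  shows "cmod (g X) \<le> K"
proof -
  obtain c where c: "family_sum (multi_indices n) c (\<lambda>\<alpha>. \<alpha>) g K"
    using assms(1) by (auto simp: series_bound_def)
  note cs = c[unfolded family_sum_def]
  have "cmod (g X) \<le> (\<Sum>\<^sub>\<infinity>\<alpha>\<in>multi_indices n. cmod (c \<alpha>) * rad \<alpha>)"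
  proof (rule norm_infsum_le)
    show "((\<lambda>\<alpha>. c \<alpha> * pow X \<alpha>) has_sum g X) (multi_indices n)" using cs assms(2) by auto
    show "((\<lambda>\<alpha>. cmod (c \<alpha>) * rad \<alpha>) has_sum (\<Sum>\<^sub>\<infinity>\<alpha>\<in>multi_indices n. cmod (c \<alpha>) * rad \<alpha>)) (multi_indices n)"
      using cs by (auto intro: has_sum_infsum)
    show "cmod (c \<alpha> * pow X \<alpha>) \<le> cmod (c \<alpha>) * rad \<alpha>" for \<alpha>
      unfolding norm_mult using pow_le[OF assms(2)] by (intro mult_left_mono) auto
  qed
  then show ?thesis using cs by linarith
qed

end

lemma absolute_value_abs: "absolute_value (abs :: real \<Rightarrow> real)"
  by (auto simp: absolute_value_def abs_mult)

lemma absolute_value_cmod: "absolute_value cmod"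
  by (auto simp: absolute_value_def norm_mult norm_triangle_ineq)

lemma complete_wrt_cmod: "complete_wrt cmod"
  unfolding complete_wrt_def
proof (intro allI impI)
  fix s :: "nat \<Rightarrow> complex" assume "\<forall>e>0. \<exists>N. \<forall>k\<ge>N. \<forall>l\<ge>N. cmod (s k - s l) < e"
  then have "Cauchy s" by (simp add: Cauchy_def dist_norm)
  then obtain x where "s \<longlonglongrightarrow> x" using Cauchy_convergent convergent_def by blast
  then have "(\<lambda>k. cmod (s k - x)) \<longlonglongrightarrow> 0" by (simp add: LIM_zero_iff tendsto_norm_zero_iff)
  then show "\<exists>x. (\<lambda>k. cmod (s k - x)) \<longlonglongrightarrow> 0" by blast
qed

global_interpretation rn: valued_field "abs :: real \<Rightarrow> real"
  by standard (rule absolute_value_abs)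

global_interpretation cn: complete_valued_field cmod
  by standard (rule absolute_value_cmod, rule complete_wrt_cmod)

subsection \<open>Matrices of power series\<close>

context polydisc
begin

text \<open>
  Bounding the entries separately first, and taking the Frobenius norm of the bounds afterwards, makes
  \<open>mat_series_bound\<close> submultiplicative with the factor 1.
\<close>
definition majorant :: "(complex mat \<Rightarrow> complex mat) \<Rightarrow> real mat \<Rightarrow> bool" where
  "majorant G K \<longleftrightarrow> K \<in> carrier_mat n n \<and> (\<forall>i<n. \<forall>j<n. series_bound (\<lambda>X. G X $$ (i, j)) (K $$ (i, j))) \<and>
     (\<forall>X\<in>W. G X \<in> carrier_mat n n)"

definition mat_series_bound :: "(complex mat \<Rightarrow> complex mat) \<Rightarrow> real \<Rightarrow> bool" where
  "mat_series_bound G \<kappa> \<longleftrightarrow> (\<exists>K. majorant G K \<and> mat_norm abs K \<le> \<kappa>)"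

lemma majorantD:
  assumes "majorant G K"
  shows "K \<in> carrier_mat n n"
    and "i < n \<Longrightarrow> j < n \<Longrightarrow> series_bound (\<lambda>X. G X $$ (i, j)) (K $$ (i, j))"
    and "X \<in> W \<Longrightarrow> G X \<in> carrier_mat n n"
  using assms by (auto simp: majorant_def)

lemma mat_series_bound_carrier: "mat_series_bound G \<kappa> \<Longrightarrow> X \<in> W \<Longrightarrow> G X \<in> carrier_mat n n"
  by (auto simp: mat_series_bound_def majorant_def)

lemma mat_series_boundI:
  assumes "K \<in> carrier_mat n n" "mat_norm abs K \<le> \<kappa>"
    "\<And>i j. i < n \<Longrightarrow> j < n \<Longrightarrow> series_bound (\<lambda>X. G X $$ (i, j)) (K $$ (i, j))"
    "\<And>X. X \<in> W \<Longrightarrow> G X \<in> carrier_mat n n"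
  shows "mat_series_bound G \<kappa>"
proof -
  have "majorant G K" using assms by (auto simp: majorant_def)
  then show ?thesis using assms(2) by (auto simp: mat_series_bound_def)
qed

lemma mat_series_bound_cong:
  assumes "mat_series_bound G \<kappa>" "\<And>X. X \<in> W \<Longrightarrow> G X = H X"
  shows "mat_series_bound H \<kappa>"
proof -
  obtain K where majK: "majorant G K" and bdK: "mat_norm abs K \<le> \<kappa>"
    using assms(1) by (auto simp: mat_series_bound_def)
  note K = majorantD(1)[OF majK] bdK majorantD(2,3)[OF majK]
  show ?thesis
  proof (rule mat_series_boundI[OF K(1,2)])
    show "series_bound (\<lambda>X. H X $$ (i, j)) (K $$ (i, j))" if "i < n" "j < n" for i j
      using K(3)[OF that] by (rule series_bound_cong) (simp add: assms(2))
    show "H X \<in> carrier_mat n n" if "X \<in> W" for X using K(4)[OF that] assms(2)[OF that] by simp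
  qed
qed

lemma mat_series_bound_mono: "mat_series_bound G \<kappa> \<Longrightarrow> \<kappa> \<le> \<mu> \<Longrightarrow> mat_series_bound G \<mu>"
  unfolding mat_series_bound_def by (meson order_trans)

lemma mat_norm_map_cmod: "mat_norm abs (map_mat cmod M) = mat_norm cmod M"
  by (simp add: mat_norm_def)

lemma mat_series_bound_const:
  assumes "M \<in> carrier_mat n n"
  shows "mat_series_bound (\<lambda>X. M) (mat_norm cmod M)"
  by (rule mat_series_boundI[of "map_mat cmod M"])
    (use assms in \<open>auto simp: mat_norm_map_cmod series_bound_const\<close>)

lemma mat_series_bound_add:
  assumes "mat_series_bound G \<kappa>" "mat_series_bound H \<mu>"
  shows "mat_series_bound (\<lambda>X. G X + H X) (\<kappa> + \<mu>)"
proof -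
  obtain K where majK: "majorant G K" and bdK: "mat_norm abs K \<le> \<kappa>"
    using assms(1) by (auto simp: mat_series_bound_def)
  note K = majorantD(1)[OF majK] bdK majorantD(2,3)[OF majK]
  obtain L where majL: "majorant H L" and bdL: "mat_norm abs L \<le> \<mu>"
    using assms(2) by (auto simp: mat_series_bound_def)
  note L = majorantD(1)[OF majL] bdL majorantD(2,3)[OF majL]
  show ?thesis
  proof (rule mat_series_boundI[of "K + L"])
    show "mat_norm abs (K + L) \<le> \<kappa> + \<mu>" using rn.nrm_add[OF K(1) L(1)] K(2) L(2) by linarith
    show "series_bound (\<lambda>X. (G X + H X) $$ (i, j)) ((K + L) $$ (i, j))" if ij: "i < n" "j < n" for i j
    proof -
      have "series_bound (\<lambda>X. G X $$ (i, j) + H X $$ (i, j)) (K $$ (i, j) + L $$ (i, j))"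
        by (rule series_bound_add[OF K(3)[OF ij] L(3)[OF ij]])
      then have "series_bound (\<lambda>X. (G X + H X) $$ (i, j)) (K $$ (i, j) + L $$ (i, j))"
      proof (rule series_bound_cong)
        fix X assume "X \<in> W"
        from L(4)[OF this] show "G X $$ (i, j) + H X $$ (i, j) = (G X + H X) $$ (i, j)" using ij by simp
      qed
      then show ?thesis using L(1) ij by simp
    qed
  qed (use K L in auto)
qed

lemma mat_series_bound_mult:
  assumes "mat_series_bound G \<kappa>" "mat_series_bound H \<mu>"
  shows "mat_series_bound (\<lambda>X. G X * H X) (\<kappa> * \<mu>)"
proof -
  obtain K where majK: "majorant G K" and bdK: "mat_norm abs K \<le> \<kappa>"
    using assms(1) by (auto simp: mat_series_bound_def)
  note K = majorantD(1)[OF majK] bdK majorantD(2,3)[OF majK]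
  obtain L where majL: "majorant H L" and bdL: "mat_norm abs L \<le> \<mu>"
    using assms(2) by (auto simp: mat_series_bound_def)
  note L = majorantD(1)[OF majL] bdL majorantD(2,3)[OF majL]
  show ?thesis
  proof (rule mat_series_boundI[of "K * L"])
    have "mat_norm abs K * mat_norm abs L \<le> \<kappa> * \<mu>"
      using K(2) L(2) order_trans[OF rn.nrm_nonneg K(2)] by (intro mult_mono) auto
    then show "mat_norm abs (K * L) \<le> \<kappa> * \<mu>" using rn.nrm_mult[OF K(1) L(1)] by linarith
    show "series_bound (\<lambda>X. (G X * H X) $$ (i, j)) ((K * L) $$ (i, j))" if ij: "i < n" "j < n" for i j
      unfolding index_mult_mat_sum[OF K(1) L(1) ij]
    proof (rule series_bound_cong)
      show "series_bound (\<lambda>X. \<Sum>k<n. G X $$ (i, k) * H X $$ (k, j)) (\<Sum>k<n. K $$ (i, k) * L $$ (k, j))"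
        using ij by (intro series_bound_finite_sum series_bound_mult K(3) L(3)) auto
      show "(\<Sum>k<n. G X $$ (i, k) * H X $$ (k, j)) = (G X * H X) $$ (i, j)" if "X \<in> W" for X
        using index_mult_mat_sum[OF K(4)[OF that] L(4)[OF that] ij] by simp
    qed
  qed (use K(1,4) L(1,4) in \<open>auto intro: mult_carrier_mat\<close>)
qed

lemma mat_series_bound_uminus:
  assumes "mat_series_bound G \<kappa>"
  shows "mat_series_bound (\<lambda>X. - G X) \<kappa>"
proof -
  obtain K where majK: "majorant G K" and bdK: "mat_norm abs K \<le> \<kappa>"
    using assms(1) by (auto simp: mat_series_bound_def)
  note K = majorantD(1)[OF majK] bdK majorantD(2,3)[OF majK]
  show ?thesis
  proof (rule mat_series_boundI[OF K(1,2)])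
    show "series_bound (\<lambda>X. (- G X) $$ (i, j)) (K $$ (i, j))" if ij: "i < n" "j < n" for i j
    proof (rule series_bound_cong)
      show "series_bound (\<lambda>X. (- 1) * G X $$ (i, j)) (K $$ (i, j))"
        using series_bound_mult[OF series_bound_const[of "- 1"] K(3)[OF ij]] by simp
      show "(- 1) * G X $$ (i, j) = (- G X) $$ (i, j)" if "X \<in> W" for X
        using K(4)[OF that] ij by simp
    qed
    show "- G X \<in> carrier_mat n n" if "X \<in> W" for X using K(4)[OF that] by simp
  qed
qed

lemma mat_series_bound_minus:
  assumes "mat_series_bound G \<kappa>" "mat_series_bound H \<mu>"
  shows "mat_series_bound (\<lambda>X. G X - H X) (\<kappa> + \<mu>)"
proof (rule mat_series_bound_cong[OF mat_series_bound_add[OF assms(1) mat_series_bound_uminus[OF assms(2)]]])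
  fix X assume X: "X \<in> W"
  have "G X \<in> carrier_mat n n" "H X \<in> carrier_mat n n"
    using assms X by (auto intro: mat_series_bound_carrier)
  then show "G X + - H X = G X - H X" by (intro eq_matI) auto
qed

lemma mat_series_bound_identity:
  assumes X0: "X0 \<in> carrier_mat n n"
  shows "mat_series_bound (\<lambda>X. X) (mat_norm cmod X0 + real n * r)"
proof -
  define R where "R = mat n n (\<lambda>p. r)"
  have R: "R \<in> carrier_mat n n" by (simp add: R_def)
  have "mat_norm abs R = sqrt ((real n * r)\<^sup>2)"
    by (simp add: R_def mat_norm_def power2_eq_square mult_ac)
  then have Rn: "mat_norm abs R \<le> real n * r" using r by simp
  have "mat_series_bound (\<lambda>X. X - X0) (real n * r)"
  proof (rule mat_series_boundI[OF R Rn])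
    show "series_bound (\<lambda>X. (X - X0) $$ (i, j)) (R $$ (i, j))" if "i < n" "j < n" for i j
      using series_bound_coordinate[OF that] that by (simp add: R_def)
  qed (rule minus_carrier_mat[OF X0])
  from mat_series_bound_add[OF mat_series_bound_const[OF X0] this] show ?thesis
  proof (rule mat_series_bound_cong)
    fix X assume "X \<in> W"
    then have "X \<in> carrier_mat n n" by (rule W_carrier)
    then show "X0 + (X - X0) = X" using X0 by (intro eq_matI) auto
  qed
qed

lemma mat_series_bound_norm:
  assumes "mat_series_bound G \<kappa>" "X \<in> W"
  shows "mat_norm cmod (G X) \<le> \<kappa>"
proof -
  obtain K where majK: "majorant G K" and bdK: "mat_norm abs K \<le> \<kappa>"
    using assms(1) by (auto simp: mat_series_bound_def)
  note K = majorantD(1)[OF majK] bdK majorantD(2,3)[OF majK]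
  note GX = K(4)[OF assms(2)]
  have "mat_norm abs (map_mat cmod (G X)) \<le> mat_norm abs K"
  proof (rule rn.nrm_mono[OF _ K(1)])
    show "\<bar>map_mat cmod (G X) $$ (i, j)\<bar> \<le> \<bar>K $$ (i, j)\<bar>" if "i < n" "j < n" for i j
      using series_bound_le[OF K(3)[OF that] assms(2)] that GX by simp
  qed (use GX in simp)
  then show ?thesis using K(2) by (simp add: mat_norm_map_cmod)
qed

lemma mat_series_bound_sums:
  assumes G: "\<And>k. mat_series_bound (G k) (\<kappa> k)" and \<kappa>: "summable \<kappa>"
    and S: "\<And>X i j. X \<in> W \<Longrightarrow> i < n \<Longrightarrow> j < n \<Longrightarrow> (\<lambda>k. G k X $$ (i, j)) sums (S X $$ (i, j))"
    and Sc: "\<And>X. X \<in> W \<Longrightarrow> S X \<in> carrier_mat n n"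
  shows "mat_series_bound S (suminf \<kappa>)"
proof -
  obtain K where maj: "\<And>k. majorant (G k) (K k)" and bd: "\<And>k. mat_norm abs (K k) \<le> \<kappa> k"
    using G unfolding mat_series_bound_def by metis
  note K = majorantD(1)[OF maj] bd majorantD(2)[OF maj]
  have ent: "\<bar>K k $$ (i, j)\<bar> \<le> \<kappa> k" if "i < n" "j < n" for k i j
    using rn.av_le_nrm[OF K(1) that, of k] K(2)[of k] by linarith
  have sm: "summable (\<lambda>k. K k $$ (i, j))" if "i < n" "j < n" for i j
    using ent[OF that] by (intro summable_comparison_test'[OF \<kappa>]) auto
  have \<kappa>0: "0 \<le> \<kappa> k" for k using order_trans[OF rn.nrm_nonneg K(2)] .
  define L where "L = mat n n (\<lambda>(i, j). \<Sum>k. K k $$ (i, j))"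
  define P where "P N = mat n n (\<lambda>(i, j). \<Sum>k<N. K k $$ (i, j))" for N
  have P: "P N \<in> carrier_mat n n" for N by (simp add: P_def)
  have L: "L \<in> carrier_mat n n" by (simp add: L_def)
  have Pn: "mat_norm abs (P N) \<le> suminf \<kappa>" for N
  proof -
    have "mat_norm abs (P N) \<le> (\<Sum>k<N. \<kappa> k)"
    proof (induction N)
      case 0
      have "P 0 = 0\<^sub>m n n" by (intro eq_matI) (auto simp: P_def)
      then show ?case by simp
    next
      case (Suc N)
      have "P (Suc N) = P N + K N" using K(1)[of N] by (intro eq_matI) (auto simp: P_def)
      then show ?case using Suc rn.nrm_add[OF P K(1), of N N] K(2)[of N] by simp
    qed
    also have "\<dots> \<le> suminf \<kappa>" using \<kappa> \<kappa>0 by (intro sum_le_suminf) auto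
    finally show ?thesis .
  qed
  have "(\<lambda>N. mat_norm abs (P N)) \<longlonglongrightarrow> mat_norm abs L"
  proof -
    have "(\<lambda>N. P N $$ (i, j)) \<longlonglongrightarrow> L $$ (i, j)" if "i < n" "j < n" for i j
      using summable_LIMSEQ[OF sm[OF that]] that by (simp add: P_def L_def)
    then have "(\<lambda>N. sqrt (\<Sum>i<n. \<Sum>j<n. \<bar>P N $$ (i, j)\<bar>\<^sup>2)) \<longlonglongrightarrow> sqrt (\<Sum>i<n. \<Sum>j<n. \<bar>L $$ (i, j)\<bar>\<^sup>2)"
      by (intro tendsto_real_sqrt tendsto_sum tendsto_power tendsto_rabs) auto
    then show ?thesis unfolding mat_norm_def using carrier_matD[OF P] carrier_matD[OF L] by simp
  qed
  then have Ln: "mat_norm abs L \<le> suminf \<kappa>" using Pn by (intro LIMSEQ_le_const2) auto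
  show ?thesis
  proof (rule mat_series_boundI[OF L Ln])
    show "series_bound (\<lambda>X. S X $$ (i, j)) (L $$ (i, j))" if ij: "i < n" "j < n" for i j
      using series_bound_sums[OF K(3)[OF ij] sm[OF ij] S[OF _ ij]] ij by (simp add: L_def)
  qed (rule Sc)
qed

lemma mat_series_bound_nonneg: "mat_series_bound G \<kappa> \<Longrightarrow> 0 \<le> \<kappa>"
  unfolding mat_series_bound_def using order_trans[OF rn.nrm_nonneg] by blast

text \<open>The solution of \<open>H = B + GH\<close> is the Neumann series \<open>\<Sum> G\<^sup>k B\<close>; no inverse matrix has to be expanded.\<close>
lemma mat_series_bound_fixpoint:
  assumes G: "mat_series_bound G c" and c1: "c < 1" and B: "mat_series_bound B \<beta>"
    and H: "\<And>X. X \<in> W \<Longrightarrow> H X \<in> carrier_mat n n" "\<And>X. X \<in> W \<Longrightarrow> H X = B X + G X * H X"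
  shows "mat_series_bound H (\<beta> / (1 - c))"
proof -
  have c0: "0 \<le> c" by (rule mat_series_bound_nonneg[OF G])
  define T where "T k X = ((*) (G X) ^^ k) (B X)" for k X
  define R where "R k X = ((*) (G X) ^^ k) (H X)" for k X
  have T: "mat_series_bound (T k) (c ^ k * \<beta>)" for k
  proof (induction k)
    case 0
    have "T 0 = B" by (rule ext) (simp add: T_def)
    then show ?case using B by simp
  next
    case (Suc k)
    have "T (Suc k) = (\<lambda>X. G X * T k X)" by (rule ext) (simp add: T_def)
    then show ?case using mat_series_bound_mult[OF G Suc] by (simp add: mult.assoc)
  qed
  have entry: "(\<lambda>k. T k X $$ (i, j)) sums (H X $$ (i, j))" if X: "X \<in> W" and ij: "i < n" "j < n" for X i j
  proof -
    have GX: "G X \<in> carrier_mat n n" and TX: "T k X \<in> carrier_mat n n" for k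
      using mat_series_bound_carrier[OF G X] mat_series_bound_carrier[OF T X] .
    have RX: "R k X \<in> carrier_mat n n" for k
      by (induction k) (use H(1)[OF X] GX in \<open>simp_all add: R_def mult_carrier_mat\<close>)
    have split: "R k X = T k X + R (Suc k) X" for k
    proof (induction k)
      case 0
      show ?case using H(2)[OF X] by (simp add: R_def T_def)
    next
      case (Suc k)
      have "R (Suc k) X = G X * R k X" by (simp add: R_def)
      also have "\<dots> = G X * (T k X + R (Suc k) X)" using Suc by simp
      also have "\<dots> = G X * T k X + G X * R (Suc k) X"
        by (rule mult_add_distrib_mat[OF GX TX RX])
      finally show ?case by (simp add: R_def T_def)
    qed
    have partial: "(\<Sum>k<N. T k X $$ (i, j)) = H X $$ (i, j) - R N X $$ (i, j)" for N
    proof (induction N)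
      case 0
      show ?case by (simp add: R_def)
    next
      case (Suc N)
      have "R N X $$ (i, j) = T N X $$ (i, j) + R (Suc N) X $$ (i, j)"
        using arg_cong[OF split[of N], of "\<lambda>M. M $$ (i, j)"] ij carrier_matD[OF RX[of "Suc N"]] by simp
      then show ?case using Suc by simp
    qed
    have Rn: "mat_norm cmod (R N X) \<le> c ^ N * mat_norm cmod (H X)" for N
    proof (induction N)
      case 0
      show ?case by (simp add: R_def)
    next
      case (Suc N)
      have "mat_norm cmod (R (Suc N) X) \<le> mat_norm cmod (G X) * mat_norm cmod (R N X)"
        using cn.nrm_mult[OF GX RX[of N]] by (simp add: R_def)
      also have "\<dots> \<le> c * (c ^ N * mat_norm cmod (H X))"
        using Suc mat_series_bound_norm[OF G X] c0 by (intro mult_mono) auto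
      finally show ?case by (simp add: mult.assoc)
    qed
    have "(\<lambda>N. R N X $$ (i, j)) \<longlonglongrightarrow> 0"
    proof (rule Lim_null_comparison)
      show "\<forall>\<^sub>F N in sequentially. norm (R N X $$ (i, j)) \<le> c ^ N * mat_norm cmod (H X)"
        using order_trans[OF cn.av_le_nrm[OF RX ij] Rn] by simp
      show "(\<lambda>N. c ^ N * mat_norm cmod (H X)) \<longlonglongrightarrow> 0"
        using c0 c1 by (intro tendsto_mult_left_zero LIMSEQ_realpow_zero) auto
    qed
    from tendsto_diff[OF tendsto_const this, of "H X $$ (i, j)"] show ?thesis
      unfolding sums_def partial by simp
  qed
  have "(\<lambda>k. c ^ k * \<beta>) sums (1 / (1 - c) * \<beta>)"
    using c0 c1 by (intro sums_mult2 geometric_sums) auto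
  then have geo: "summable (\<lambda>k. c ^ k * \<beta>)" "(\<Sum>k. c ^ k * \<beta>) = \<beta> / (1 - c)"
    by (auto simp: sums_iff)
  show ?thesis using mat_series_bound_sums[OF T geo(1) entry H(1)] unfolding geo(2) .
qed

end

section \<open>Analyticity over the complex numbers\<close>

text \<open>
  \<open>r\<close> is so small that the function \<open>X \<mapsto> X\<close>, as a matrix of power series, lies in the closed ball
  with the radius of \<open>U\<close>: its norm is at most \<open>\<parallel>X\<^sub>0\<parallel> + nr\<close>.
\<close>
locale analytic_reduction = reduction cmod n A D F + polydisc n X0 r W
  for n A D F X0 r W +
  assumes X0: "X0 \<in> carrier_mat n n" and W_U: "X \<in> W \<Longrightarrow> X \<in> U"
    and room: "cn.nrm X0 + real n * r \<le> 1 / (48 * sqrt (real n) * (a + 1) * f\<^sup>2)"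
begin

lemma series_nonstar:
  assumes "mat_series_bound G \<kappa>"
  shows "mat_series_bound (\<lambda>X. nonstar (G X)) \<kappa>"
proof -
  obtain K where maj: "majorant G K" and bd: "mat_norm abs K \<le> \<kappa>"
    using assms by (auto simp: mat_series_bound_def)
  note K = majorantD(1)[OF maj] bd majorantD(2)[OF maj]
  define L where "L = mat n n (\<lambda>p. if D $$ p = Nul then K $$ p else 0)"
  have L: "L \<in> carrier_mat n n" by (simp add: L_def)
  show ?thesis
  proof (rule mat_series_boundI[OF L])
    have "mat_norm abs L \<le> mat_norm abs K"
      by (rule rn.nrm_mono[OF L K(1)]) (simp add: L_def)
    then show "mat_norm abs L \<le> \<kappa>" using K(2) by linarith
    show "series_bound (\<lambda>X. nonstar (G X) $$ (i, j)) (L $$ (i, j))" if "i < n" "j < n" for i j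
      using K(3)[OF that] series_bound_const[of 0] that by (auto simp: nonstar_def L_def)
  qed simp
qed

lemma C_nonstar: "C M = mat n n (\<lambda>p. \<Sum>q\<in>{..<n} \<times> {..<n}. nonstar M $$ q * (case q of (i, j) \<Rightarrow> F i j) $$ p)"
proof (rule eq_matI)
  fix i j assume "i < dim_row (mat n n (\<lambda>p. \<Sum>q\<in>{..<n} \<times> {..<n}. nonstar M $$ q * (case q of (i, j) \<Rightarrow> F i j) $$ p))"
    "j < dim_col (mat n n (\<lambda>p. \<Sum>q\<in>{..<n} \<times> {..<n}. nonstar M $$ q * (case q of (i, j) \<Rightarrow> F i j) $$ p))"
  then have ij: "i < n" "j < n" by auto
  have "M $$ (r, s) * F r s $$ (i, j) = nonstar M $$ (r, s) * F r s $$ (i, j)" if "r < n" "s < n" for r s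
    using that ij F_star[OF that] by (cases "D $$ (r, s) = Nul") (auto simp: nonstar_def)
  then have "(\<Sum>r<n. \<Sum>s<n. M $$ (r, s) * F r s $$ (i, j)) = (\<Sum>r<n. \<Sum>s<n. nonstar M $$ (r, s) * F r s $$ (i, j))"
    by (intro sum.cong refl) (simp del: mult_cancel_right)
  then show "C M $$ (i, j) = mat n n (\<lambda>p. \<Sum>q\<in>{..<n} \<times> {..<n}. nonstar M $$ q * (case q of (i, j) \<Rightarrow> F i j) $$ p) $$ (i, j)"
    using ij by (simp add: C_of_def sum.cartesian_product case_prod_unfold)
qed (auto simp: C_of_def)

lemma series_C:
  assumes "mat_series_bound (\<lambda>X. nonstar (G X)) p"
  shows "mat_series_bound (\<lambda>X. C (G X)) (f * p)"
proof -
  obtain K where maj: "majorant (\<lambda>X. nonstar (G X)) K" and bd: "mat_norm abs K \<le> p"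
    using assms by (auto simp: mat_series_bound_def)
  note K = majorantD(1)[OF maj] majorantD(2)[OF maj]
  let ?Q = "{..<n} \<times> {..<n}" and ?F = "\<lambda>q. case q of (i, j) \<Rightarrow> F i j"
  define L where "L = mat n n (\<lambda>p. \<Sum>q\<in>?Q. K $$ q * map_mat cmod (?F q) $$ p)"
  have L: "L \<in> carrier_mat n n" by (simp add: L_def)
  have Fq: "?F q \<in> carrier_mat n n" if "q \<in> ?Q" for q using that by auto
  have p0: "0 \<le> p" by (rule mat_series_bound_nonneg[OF assms])
  show ?thesis
  proof (rule mat_series_boundI[OF L])
    have "mat_norm abs L \<le> (\<Sum>q\<in>?Q. \<bar>K $$ q\<bar> * mat_norm abs (map_mat cmod (?F q)))"
      unfolding L_def by (rule rn.nrm_combination) (use Fq in auto)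
    also have "\<dots> \<le> (\<Sum>q\<in>?Q. p * cn.nrm (?F q))"
    proof (rule sum_mono)
      fix q assume "q \<in> ?Q"
      then obtain i j where q: "q = (i, j)" "i < n" "j < n" by auto
      have "\<bar>K $$ (i, j)\<bar> \<le> p" using rn.av_le_nrm[OF K(1) q(2,3)] bd by linarith
      then show "\<bar>K $$ q\<bar> * mat_norm abs (map_mat cmod (?F q)) \<le> p * cn.nrm (?F q)"
        unfolding q mat_norm_map_cmod by (intro mult_right_mono) auto
    qed
    also have "\<dots> = p * (\<Sum>i<n. \<Sum>j<n. cn.nrm (F i j))"
      by (simp add: sum_distrib_left[symmetric] sum.cartesian_product case_prod_unfold)
    also have "\<dots> \<le> p * f" by (intro mult_left_mono p0) (auto simp: F_const_def)
    finally show "mat_norm abs L \<le> f * p" by (simp add: mult.commute)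
    show "series_bound (\<lambda>X. C (G X) $$ (i, j)) (L $$ (i, j))" if ij: "i < n" "j < n" for i j
    proof -
      have "series_bound (\<lambda>X. \<Sum>q\<in>?Q. nonstar (G X) $$ q * ?F q $$ (i, j)) (\<Sum>q\<in>?Q. K $$ q * cmod (?F q $$ (i, j)))"
        by (intro series_bound_finite_sum series_bound_mult series_bound_const) (use K(2) in auto)
      moreover have "(\<Sum>q\<in>?Q. K $$ q * cmod (?F q $$ (i, j))) = L $$ (i, j)"
      proof -
        have "cmod (?F q $$ (i, j)) = map_mat cmod (?F q) $$ (i, j)" if "q \<in> ?Q" for q
          using carrier_matD[OF Fq[OF that]] ij by (intro index_map_mat(1)[symmetric]) auto
        then have "(\<Sum>q\<in>?Q. K $$ q * cmod (?F q $$ (i, j))) = (\<Sum>q\<in>?Q. K $$ q * map_mat cmod (?F q) $$ (i, j))"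
          by (intro sum.cong refl) (simp only:)
        then show ?thesis unfolding L_def using ij by simp
      qed
      moreover have "C (G X) $$ (i, j) = (\<Sum>q\<in>?Q. nonstar (G X) $$ q * ?F q $$ (i, j))" for X
        unfolding C_nonstar using ij by simp
      ultimately show ?thesis by simp
    qed
  qed simp
qed

lemma series_step:
  assumes G: "mat_series_bound G m" and C: "mat_series_bound (\<lambda>X. C (G X)) c" and c1: "c < 1"
  shows "mat_series_bound (\<lambda>X. step (G X)) ((m * (1 + c) + 2 * a * c) / (1 - c))" (is "mat_series_bound _ ?m'")
    and "mat_series_bound (\<lambda>X. nonstar (step (G X))) (c * (m + (m * (1 + c) + 2 * a * c) / (1 - c)))"
proof -
  have GX: "G X \<in> carrier_mat n n" if "X \<in> W" for X by (rule mat_series_bound_carrier[OF G that])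
  have small: "cn.nrm (C (G X)) < 1" if "X \<in> W" for X
    using mat_series_bound_norm[OF C that] c1 by linarith
  note id = step_identity[OF GX small]
  have constA: "mat_series_bound (\<lambda>X. A) a" by (rule mat_series_bound_const[OF A])
  let ?B = "\<lambda>X. (G X + (C (G X) * A - A * C (G X))) - G X * C (G X)"
  have B: "mat_series_bound ?B ((m + (c * a + a * c)) + m * c)"
    by (intro mat_series_bound_minus mat_series_bound_add mat_series_bound_mult G C constA)
  have eqn: "step (G X) = ?B X + C (G X) * step (G X)" if X: "X \<in> W" for X
  proof -
    have "M + U + (V - Y) = ((M + U) - Y) + V"
      if "M \<in> carrier_mat n n" "U \<in> carrier_mat n n" "V \<in> carrier_mat n n" "Y \<in> carrier_mat n n"
      for M U V Y :: "complex mat"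
      using that by (intro eq_matI) auto
    from this[OF GX[OF X] minus_carrier_mat[OF mult_carrier_mat[OF A C_closed]]
        mult_carrier_mat[OF C_closed id(1)[OF X X]] mult_carrier_mat[OF GX[OF X] C_closed]]
    show ?thesis using id(2)[OF X X] by metis
  qed
  have "mat_series_bound (\<lambda>X. step (G X)) (((m + (c * a + a * c)) + m * c) / (1 - c))"
    by (rule mat_series_bound_fixpoint[OF C c1 B id(1) eqn])
  moreover have "(m + (c * a + a * c)) + m * c = m * (1 + c) + 2 * a * c" by (simp add: algebra_simps)
  ultimately show S: "mat_series_bound (\<lambda>X. step (G X)) ?m'" by (simp only:)
  have "mat_series_bound (\<lambda>X. C (G X) * step (G X) - G X * C (G X)) (c * ?m' + m * c)"
    by (intro mat_series_bound_minus mat_series_bound_mult G C S)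
  then have "mat_series_bound (\<lambda>X. nonstar (C (G X) * step (G X) - G X * C (G X))) (c * ?m' + m * c)"
    by (rule series_nonstar)
  then have "mat_series_bound (\<lambda>X. nonstar (step (G X))) (c * ?m' + m * c)"
  proof (rule mat_series_bound_cong)
    fix X assume X: "X \<in> W"
    show "nonstar (C (G X) * step (G X) - G X * C (G X)) = nonstar (step (G X))"
      by (rule nonstar_step[OF GX[OF X] small[OF X], symmetric])
  qed
  moreover have "c * ?m' + m * c = c * (m + ?m')" by (simp only: distrib_left mult.commute[of m c] add.commute)
  ultimately show "mat_series_bound (\<lambda>X. nonstar (step (G X))) (c * (m + ?m'))" by simp
qed

text \<open>
  The numerical estimates for the iteration, with \<open>\<epsilon> = 1/2\<close>, and with \<open>m\<close> and \<open>p\<close> bounding matrices of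
  power series in place of single matrices.
\<close>
lemma series_Ms:
  "\<exists>m p. mat_series_bound (\<lambda>X. Ms X k) m \<and> mat_series_bound (\<lambda>X. nonstar (Ms X k)) p \<and>
     m + 8/3 * (a + 1/2 / (4 * f)) * (f * p) \<le> 1/2 / (4 * f) \<and> f * p \<le> 1/2 / 8 * (1/2 / 2) ^ k"
proof (induction k)
  case 0
  let ?m = "cn.nrm X0 + real n * r"
  have m: "?m \<le> 2 * (1/2) / (48 * sqrt (real n) * (a + 1) * f\<^sup>2)" "0 \<le> ?m"
    using room r cn.nrm_nonneg[of X0] by (auto intro!: add_nonneg_nonneg)
  have "1 \<le> sqrt (real n)" using n_pos by simp
  from reduction_start_bound[OF nrm_nonneg f_pos(2) _ _ refl this m]
  have "?m + 8/3 * (a + 1/2 / (4 * f)) * (f * ?m) \<le> 1/2 / (4 * f)" "f * ?m \<le> 1/2 / 8" by auto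
  moreover have X: "mat_series_bound (\<lambda>X. X) ?m" by (rule mat_series_bound_identity[OF X0])
  ultimately show ?case using series_nonstar[OF X] by (intro exI[of _ ?m]) simp
next
  case (Suc k)
  then obtain m p where M: "mat_series_bound (\<lambda>X. Ms X k) m"
    and N: "mat_series_bound (\<lambda>X. nonstar (Ms X k)) p"
    and inv: "m + 8/3 * (a + 1/2 / (4 * f)) * (f * p) \<le> 1/2 / (4 * f)"
    and p: "f * p \<le> 1/2 / 8 * (1/2 / 2) ^ k" by blast
  define c where "c = f * p"
  define m' where "m' = (m * (1 + c) + 2 * a * c) / (1 - c)"
  have c0: "0 \<le> c" using mat_series_bound_nonneg[OF N] f_pos by (simp add: c_def)
  have "(1/2 / 2 :: real) ^ k \<le> 1" by (intro power_le_one) auto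
  then have c8: "c \<le> 1/2 / 8" using p unfolding c_def by linarith
  then have c1: "c < 1" by simp
  have "mat_series_bound (\<lambda>X. C (Ms X k)) c" unfolding c_def by (rule series_C[OF N])
  note S = series_step[OF M this c1, folded m'_def]
  have "(1 - c) * m' \<le> m * (1 + c) + 2 * a * c" using c1 by (simp add: m'_def)
  from reduction_step_bound[OF nrm_nonneg f_pos(1) _ _ refl mat_series_bound_nonneg[OF M] c0 c8 inv[folded c_def] this order_refl]
  have new: "m' + 8/3 * (a + 1/2 / (4 * f)) * (f * (c * (m + m'))) \<le> 1/2 / (4 * f)"
    "f * (c * (m + m')) \<le> c * (1/2 / 2)" by auto
  have "c * (1/2 / 2) \<le> 1/2 / 8 * (1/2 / 2) ^ k * (1/2 / 2)"
    using p unfolding c_def by (rule mult_right_mono) simp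
  also have "\<dots> = 1/2 / 8 * (1/2 / 2) ^ Suc k" by simp
  finally have "f * (c * (m + m')) \<le> 1/2 / 8 * (1/2 / 2) ^ Suc k" using new(2) by linarith
  then show ?case unfolding Ms_Suc using S new(1) by blast
qed

lemma series_Cs: "mat_series_bound (\<lambda>X. Cs X k) (1/16 * (1/4) ^ k)"
proof -
  obtain p where "mat_series_bound (\<lambda>X. nonstar (Ms X k)) p" "f * p \<le> 1/2 / 8 * (1/2 / 2) ^ k"
    using series_Ms by blast
  then show ?thesis using mat_series_bound_mono[OF series_C] by (simp add: C_seq_def)
qed

lemma series_Ps: "mat_series_bound (\<lambda>X. Ps X k) (sqrt (real n) * (2 - (1/2) ^ k))"
proof (induction k)
  case 0
  show ?case using mat_series_bound_const[OF one_carrier_mat] by (simp add: cn.nrm_one)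
next
  case (Suc k)
  let ?s = "sqrt (real n)" and ?h = "(1/2 :: real) ^ k"
  have "mat_series_bound (\<lambda>X. Ps X k - Ps X k * Cs X k) (?s * (2 - ?h) + ?s * (2 - ?h) * (1/16 * (1/4) ^ k))"
    by (intro mat_series_bound_minus mat_series_bound_mult Suc series_Cs)
  moreover have "Ps X k - Ps X k * Cs X k = Ps X (Suc k)" for X
    using mult_minus_distrib_mat[OF Ps_closed one_carrier_mat Cs_closed, of X k X k]
      right_mult_one_mat[OF Ps_closed] by simp
  moreover have "?s * (2 - ?h) + ?s * (2 - ?h) * (1/16 * (1/4) ^ k) \<le> ?s * (2 - (1/2) ^ Suc k)"
  proof -
    have q: "(1/4 :: real) ^ k \<le> ?h" "0 \<le> (1/4 :: real) ^ k" by (auto intro: power_mono)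
    have "(2 - ?h) * (1/16 * (1/4) ^ k) \<le> 2 * (1/16 * (1/4) ^ k)" by (intro mult_right_mono) auto
    also have "\<dots> \<le> ?h / 2" using q by linarith
    finally have "(2 - ?h) + (2 - ?h) * (1/16 * (1/4) ^ k) \<le> 2 - (1/2) ^ Suc k"
      unfolding power_Suc by linarith
    from mult_left_mono[OF this, of ?s] show ?thesis by (simp only: distrib_left mult.assoc) simp
  qed
  ultimately show ?case using mat_series_bound_mono by simp
qed

lemma series_S: "\<exists>\<kappa>. mat_series_bound (S_map cmod n A F) \<kappa>"
proof -
  let ?S = "S_map cmod n A F" and ?s = "sqrt (real n)"
  define T where "T X = S_map cmod n A F X - 1\<^sub>m n" for X
  have S: "?S X \<in> carrier_mat n n" "mat_tendsto cmod (Ps X) (?S X)" if "X \<in> W" for X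
    using S_map_limit(1,2)[of "1/2" X] W_U[OF that] by auto
  have "mat_series_bound (\<lambda>X. - (Ps X k * Cs X k)) (?s * 2 * (1/16 * (1/4) ^ k))" for k
  proof -
    have "mat_series_bound (\<lambda>X. Ps X k) (?s * 2)"
      by (rule mat_series_bound_mono[OF series_Ps[of k]]) (intro mult_left_mono, auto)
    then show ?thesis by (intro mat_series_bound_uminus mat_series_bound_mult series_Cs)
  qed
  moreover have "summable (\<lambda>k. ?s * 2 * (1/16 * (1/4) ^ k))"
    by (intro summable_mult summable_geometric) simp
  moreover have "(\<lambda>k. (- (Ps X k * Cs X k)) $$ (i, j)) sums (T X $$ (i, j))"
    if X: "X \<in> W" and ij: "i < n" "j < n" for X i j
  proof -
    have "(\<lambda>k. Ps X k $$ (i, j) - ?S X $$ (i, j)) \<longlonglongrightarrow> 0"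
      using mat_tendsto_entry[OF Ps_closed S[OF X] ij] by (simp only: tendsto_norm_zero_iff)
    then have "(\<lambda>k. Ps X k $$ (i, j)) \<longlonglongrightarrow> ?S X $$ (i, j)" by (simp only: LIM_zero_iff)
    from telescope_sums[OF this]
    have "(\<lambda>k. Ps X (Suc k) $$ (i, j) - Ps X k $$ (i, j)) sums (?S X $$ (i, j) - 1\<^sub>m n $$ (i, j))"
      by (simp del: partial_prod.simps(2))
    moreover have "Ps X (Suc k) $$ (i, j) - Ps X k $$ (i, j) = (- (Ps X k * Cs X k)) $$ (i, j)" for k
      using Ps_Suc_diff[of "1/2" X k, symmetric] ij carrier_matD[OF Ps_closed[of X k]]
      by (simp del: partial_prod.simps(2))
    moreover have "T X $$ (i, j) = ?S X $$ (i, j) - 1\<^sub>m n $$ (i, j)" using ij by (simp add: T_def)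
    ultimately show ?thesis by simp
  qed
  moreover have "T X \<in> carrier_mat n n" for X
    unfolding T_def by (rule minus_carrier_mat[OF one_carrier_mat])
  ultimately have "mat_series_bound T (\<Sum>k. ?s * 2 * (1/16 * (1/4) ^ k))"
    by (rule mat_series_bound_sums)
  from mat_series_bound_add[OF mat_series_bound_const[OF one_carrier_mat] this]
  have "mat_series_bound ?S (cn.nrm (1\<^sub>m n) + (\<Sum>k. ?s * 2 * (1/16 * (1/4) ^ k)))"
  proof (rule mat_series_bound_cong)
    fix X assume "X \<in> W"
    from S(1)[OF this] show "1\<^sub>m n + T X = ?S X" unfolding T_def by (intro eq_matI) auto
  qed
  then show ?thesis by blast
qed

end

lemma S_map_analytic:
  assumes data: "reduction_data n A D F"
  shows "mat_analytic_on n (nbhd cmod n A F 1) (S_map cmod n A F)"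
proof -
  interpret reduction cmod n A D F by unfold_locales (rule data)
  show ?thesis
    unfolding mat_analytic_on_def
  proof (intro ballI allI impI)
    fix X0 i j assume X0: "X0 \<in> U" and ij: "i < n" "j < n"
    define t where "t = 1 / (48 * sqrt (real n) * (a + 1) * f\<^sup>2)"
    define r where "r = (t - cn.nrm X0) / real n"
    define W where "W = {X \<in> U. cn.nrm (X - X0) < r}"
    have X0c: "X0 \<in> carrier_mat n n" and X0t: "cn.nrm X0 < t" using X0 by (auto simp: nbhd_def t_def)
    have r0: "0 < r" using X0t n_pos by (simp add: r_def)
    interpret analytic_reduction n A D F X0 r W
    proof
      show "0 < r" by (rule r0)
      show "X \<in> carrier_mat n n" if "X \<in> W" for X using that by (auto simp: W_def nbhd_def)
      show "cmod ((X - X0) $$ p) \<le> r" if "X \<in> W" "p \<in> {..<n} \<times> {..<n}" for X p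
      proof -
        have p: "p = (fst p, snd p)" "fst p < n" "snd p < n" using that(2) by auto
        have "cmod ((X - X0) $$ (fst p, snd p)) \<le> cn.nrm (X - X0)"
          by (rule cn.av_le_nrm[OF minus_carrier_mat[OF X0c] p(2,3)])
        then show ?thesis using that(1) p(1) by (simp add: W_def)
      qed
      show "X0 \<in> carrier_mat n n" by (rule X0c)
      show "X \<in> U" if "X \<in> W" for X using that by (simp add: W_def)
      show "cn.nrm X0 + real n * r \<le> 1 / (48 * sqrt (real n) * (a + 1) * f\<^sup>2)"
        using n_pos by (simp add: r_def t_def)
    qed
    obtain \<kappa> where "mat_series_bound (S_map cmod n A F) \<kappa>" using series_S by blast
    then obtain K where "majorant (S_map cmod n A F) K" by (auto simp: mat_series_bound_def)
    from majorantD(2)[OF this ij] obtain c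
      where c: "family_sum (multi_indices n) c (\<lambda>\<alpha>. \<alpha>) (\<lambda>X. S_map cmod n A F X $$ (i, j)) (K $$ (i, j))"
      by (auto simp: series_bound_def)
    have "((\<lambda>\<alpha>. c \<alpha> * (\<Prod>p\<in>{..<n} \<times> {..<n}. ((X - X0) $$ p) ^ \<alpha> p)) has_sum (S_map cmod n A F X $$ (i, j)))
        {\<alpha>. \<forall>p. p \<notin> {..<n} \<times> {..<n} \<longrightarrow> \<alpha> p = 0}" if "X \<in> U" "cn.nrm (X - X0) < r" for X
    proof -
      have "X \<in> W" using that by (simp add: W_def)
      then show ?thesis using c unfolding family_sum_def multi_indices_def monomial_def by blast
    qed
    then show "\<exists>r>0. \<exists>c. \<forall>X\<in>U. cn.nrm (X - X0) < r \<longrightarrow>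
        ((\<lambda>\<alpha>. c \<alpha> * (\<Prod>p\<in>{..<n} \<times> {..<n}. ((X - X0) $$ p) ^ \<alpha> p)) has_sum (S_map cmod n A F X $$ (i, j)))
        {\<alpha>. \<forall>p. p \<notin> {..<n} \<times> {..<n} \<longrightarrow> \<alpha> p = 0}"
      using r0 by blast
  qed
qed

theorem theorem7:
  fixes av :: "'a::field \<Rightarrow> real"
  assumes "nontrivial_absolute_value av" and "complete_wrt av"
  shows
    "(\<forall>n (A :: 'a mat) D F. reduction_data n A D F \<longrightarrow>
       (let U = nbhd av n A F 1; S = S_map av n A F; DX = D_map av n A F; f = F_const av n F in
         (\<forall>X\<in>U. (\<forall>k. invertible_mat (1\<^sub>m n - C_seq n A F X k)) \<and>
             S X \<in> carrier_mat n n \<and> mat_tendsto av (partial_prod n A F X) (S X) \<and>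
             invertible_mat (S X)) \<and>
         mat_continuous_on av U S \<and> S (0\<^sub>m n n) = 1\<^sub>m n \<and>
         (\<forall>X\<in>U. DX X \<in> form_space n D) \<and> mat_continuous_on av U DX \<and>
         int (card (star_positions n D)) = similarity_class_codim n A \<and>
         (\<forall>\<epsilon>. 0 < \<epsilon> \<and> \<epsilon> \<le> 1/2 \<longrightarrow>
            (\<forall>X\<in>nbhd av n A F (2 * \<epsilon>).
               mat_norm av (S X - 1\<^sub>m n) < - 1 + prodinf (\<lambda>k. 1 + \<epsilon> ^ Suc k) \<and>
               mat_norm av (DX X) \<le> \<epsilon> / (2 * f))))) \<and>
     (\<forall>n (A :: complex mat) D F. reduction_data n A D F \<longrightarrow>
        mat_analytic_on n (nbhd cmod n A F 1) (S_map cmod n A F)) \<and>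
     (\<forall>n (A :: 'a mat) pms. 0 < n \<and> A \<in> carrier_mat n n \<and> frobenius_canonical pms A \<longrightarrow>
        tangent_decomposition n A (canonical_form (map snd pms))) \<and>
     (\<forall>n (A :: complex mat) lms. 0 < n \<and> A \<in> carrier_mat n n \<and> jordan_canonical lms A \<longrightarrow>
        tangent_decomposition n A (canonical_form (map snd lms))) \<and>
     (\<forall>n (A :: real mat) lms cms.
        0 < n \<and> A \<in> carrier_mat n n \<and> real_jordan_canonical lms cms A \<longrightarrow>
        tangent_decomposition n A (canonical_form (map snd lms @ map snd cms)))"
proof (intro conjI allI impI)
  fix n and A :: "'a mat" and D F
  assume data: "reduction_data n A D F"
  have "absolute_value av" using assms(1) by (simp add: nontrivial_absolute_value_def)
  then interpret reduction av n A D F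
    by unfold_locales (simp_all add: assms(2) data)
  have U: "X \<in> nbhd av n A F (2 * (1/2))" if "X \<in> nbhd av n A F 1" for X using that by simp
  have inv: "invertible_mat (1\<^sub>m n - C_seq n A F X k)" if "X \<in> nbhd av n A F 1" for X k
    using mat_inv_near_one(4)[OF Cs_closed Cs_small(1)[OF _ _ U[OF that]]] by simp
  have "S_map av n A F X \<in> carrier_mat n n" "mat_tendsto av (partial_prod n A F X) (S_map av n A F X)"
    "invertible_mat (S_map av n A F X)" "D_map av n A F X \<in> form_space n D" if "X \<in> nbhd av n A F 1" for X
    using S_map_limit(1,2)[OF _ _ U[OF that]] S_map_invertible(1)[OF _ _ U[OF that]]
      D_map_form[OF _ _ U[OF that]] by auto
  then show "let U = nbhd av n A F 1; S = S_map av n A F; DX = D_map av n A F; f = F_const av n F in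
         (\<forall>X\<in>U. (\<forall>k. invertible_mat (1\<^sub>m n - C_seq n A F X k)) \<and>
             S X \<in> carrier_mat n n \<and> mat_tendsto av (partial_prod n A F X) (S X) \<and>
             invertible_mat (S X)) \<and>
         mat_continuous_on av U S \<and> S (0\<^sub>m n n) = 1\<^sub>m n \<and>
         (\<forall>X\<in>U. DX X \<in> form_space n D) \<and> mat_continuous_on av U DX \<and>
         int (card (star_positions n D)) = similarity_class_codim n A \<and>
         (\<forall>\<epsilon>. 0 < \<epsilon> \<and> \<epsilon> \<le> 1/2 \<longrightarrow>
            (\<forall>X\<in>nbhd av n A F (2 * \<epsilon>).
               mat_norm av (S X - 1\<^sub>m n) < - 1 + prodinf (\<lambda>k. 1 + \<epsilon> ^ Suc k) \<and>
               mat_norm av (DX X) \<le> \<epsilon> / (2 * f)))"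
    unfolding Let_def
    using inv S_map_continuous S_map_zero D_map_continuous star_count_codim[OF A dec]
      S_map_bounds(2) D_map_bound by blast
next
  show "mat_analytic_on n (nbhd cmod n A F 1) (S_map cmod n A F)" if "reduction_data n A D F" for n A D F
    by (rule S_map_analytic[OF that])
next
  show "tangent_decomposition n A (canonical_form (map snd pms))"
    if "0 < n \<and> A \<in> carrier_mat n n \<and> frobenius_canonical pms A" for n and A :: "'a mat" and pms
    using that by (intro frobenius_tangent_decomposition) auto
next
  show "tangent_decomposition n A (canonical_form (map snd lms))"
    if "0 < n \<and> A \<in> carrier_mat n n \<and> jordan_canonical lms A" for n and A :: "complex mat" and lms
    using that by (intro jordan_tangent_decomposition) auto
next
  show "tangent_decomposition n A (canonical_form (map snd lms @ map snd cms))"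
    if "0 < n \<and> A \<in> carrier_mat n n \<and> real_jordan_canonical lms cms A" for n and A :: "real mat" and lms cms
    using that by (intro real_jordan_tangent_decomposition) auto
qed

end
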